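(* Consider the stochastic differential equation in $\mathbb{R}^d$ $$dX_t = b(X_t)\,dt + \sigma(X_t)\,dW_t + \int_U g(X_{t-},u)\,\widetilde{N}(dt,du), \qquad X_0=x\in\mathbb{R}^d,$$ with coefficients $b:\mathbb{R}^d\to\mathbb{R}^d$, $\sigma:\mathbb{R}^d\to\mathbb{R}^{d\times d}$, $g:\mathbb{R}^d\times U\to\mathbb{R}^d$. Assume that $b$ is continuous, that there exists $K>0$ such that for all $x,y\in\mathbb{R}^d$, $$\langle b(x)-b(y),x-y\rangle + \|\sigma(x)-\sigma(y)\|_{HS}^2 + \int_U |g(x,u)-g(y,u)|^2\,\nu(du) \le K|x-y|^2,$$ and that there exists $M>0$ such that for all $x\in\mathbb{R}^d$, $$|b(x)|^2+\|\sigma(x)\|_{HS}^2+\int_U|g(x,u)|^2\,\nu(du)\le M.$$ Then for every initial condition $x\in\mathbb{R}^d$ there exists a unique strong solution $(X_t(x))_{t\ge0}$ of the equation.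
   Context: On a filtered probability space, $(W_t)_{t\ge0}$ is a $d$-dimensional Wiener process; $(U,\mathcal{U},\nu)$ is a $\sigma$-finite measure space; $N(dt,du)$ is a Poisson random measure on $\mathbb{R}^+\times U$ with intensity measure $dt\,\nu(du)$ (with $W$ and $N$ independent); $\widetilde N(dt,du)=N(dt,du)-dt\,\nu(du)$ is the compensated Poisson random measure. The coefficients $b$, $\sigma$ are Borel measurable and $g$ is jointly measurable. $\|\cdot\|_{HS}$ is the Hilbert-Schmidt norm of a matrix. A strong solution is an adapted càdlàg process defined for all $t\ge0$ (for the given $W$ and $N$) satisfying the equation in integral form almost surely; uniqueness is pathwise, up to indistinguishability. *)

theory Defs
  imports "HOL-Probability.Probability"
begin

section \<open>Filtered probability spaces and paths\<close>

text \<open>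
  Time is modelled by the type \<^typ>\<open>real\<close>, and only times \<open>t \<ge> 0\<close> are ever referred to. A filtration
  indexed by \<open>[0, \<infinity>)\<close> becomes one in the sense of the library by setting \<open>F t = F 0\<close> for
  \<open>t < 0\<close>. Neither completeness nor right-continuity of the filtration is assumed.
\<close>

definition filtered_prob_space :: "'w measure \<Rightarrow> (real \<Rightarrow> 'w measure) \<Rightarrow> bool" where
  "filtered_prob_space M F \<longleftrightarrow>
     prob_space M \<and> filtration (space M) F \<and> (\<forall>t. subalgebra M (F t))"

definition adapted_process ::
    "(real \<Rightarrow> 'w measure) \<Rightarrow> (real \<Rightarrow> 'w \<Rightarrow> 'b::topological_space) \<Rightarrow> bool" where
  "adapted_process F X \<longleftrightarrow> (\<forall>t\<ge>0. X t \<in> borel_measurable (F t))"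

definition cadlag :: "(real \<Rightarrow> 'b::topological_space) \<Rightarrow> bool" where
  "cadlag f \<longleftrightarrow> (\<forall>t\<ge>0. (f \<longlongrightarrow> f t) (at_right t)) \<and> (\<forall>t>0. \<exists>l. (f \<longlongrightarrow> l) (at_left t))"

definition left_limit :: "(real \<Rightarrow> 'b::t2_space) \<Rightarrow> real \<Rightarrow> 'b" where
  "left_limit f t = Lim (at_left t) f"

definition hs_norm :: "real^'n^'m \<Rightarrow> real" where
  "hs_norm A = sqrt (\<Sum>i\<in>UNIV. \<Sum>j\<in>UNIV. (A $ i $ j)\<^sup>2)"

lemma hs_norm_eq_norm: "hs_norm A = norm A"
  by (simp add: hs_norm_def norm_vec_def L2_set_def sum_nonneg)


section \<open>Wiener processes and Poisson random measures\<close>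

definition wiener_process ::
    "'w measure \<Rightarrow> (real \<Rightarrow> 'w measure) \<Rightarrow> (real \<Rightarrow> 'w \<Rightarrow> real^'d) \<Rightarrow> bool" where
  "wiener_process M F W \<longleftrightarrow>
     adapted_process F W \<and>
     (AE \<omega> in M. W 0 \<omega> = 0) \<and>
     (AE \<omega> in M. continuous_on {0..} (\<lambda>t. W t \<omega>)) \<and>
     (\<forall>s t. 0 \<le> s \<and> s < t \<longrightarrow>
        distributed M lborel (\<lambda>\<omega>. W t \<omega> - W s \<omega>)
          (\<lambda>x. ennreal (\<Prod>i\<in>UNIV. normal_density 0 (sqrt (t - s)) (x $ i))) \<and>
        prob_space.indep_set M (sets (F s))
          {(\<lambda>\<omega>. W t \<omega> - W s \<omega>) -` B \<inter> space M | B. B \<in> sets borel})"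

definition wiener_events :: "'w measure \<Rightarrow> (real \<Rightarrow> 'w \<Rightarrow> real^'d) \<Rightarrow> 'w set set" where
  "wiener_events M W =
     sigma_sets (space M) {W t -` B \<inter> space M | t B. 0 \<le> t \<and> B \<in> sets borel}"

text \<open>The intensity measure \<open>dt \<nu>(du)\<close> on \<open>[0, \<infinity>) \<times> U\<close>.\<close>

definition jump_intensity :: "'u measure \<Rightarrow> (real \<times> 'u) measure" where
  "jump_intensity \<nu> = restrict_space lborel {0..} \<Otimes>\<^sub>M \<nu>"

text \<open>
  The Poisson law of parameter \<open>\<mu>(A)\<close> is written out because \<^const>\<open>poisson_pmf\<close> requires a strictly
  positive rate; by \<open>0 ^ 0 = 1\<close> the formula gives the point mass at \<open>0\<close> when \<open>\<mu>(A) = 0\<close>.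
\<close>

definition poisson_random_measure ::
    "'w measure \<Rightarrow> 'e measure \<Rightarrow> ('w \<Rightarrow> 'e measure) \<Rightarrow> bool" where
  "poisson_random_measure M \<mu> N \<longleftrightarrow>
     (\<forall>\<omega>\<in>space M. sets (N \<omega>) = sets \<mu>) \<and>
     (\<forall>A\<in>sets \<mu>. (\<lambda>\<omega>. emeasure (N \<omega>) A) \<in> borel_measurable M) \<and>
     (\<forall>A\<in>sets \<mu>. emeasure \<mu> A < \<infinity> \<longrightarrow>
        (\<forall>k::nat. measure M {\<omega> \<in> space M. emeasure (N \<omega>) A = of_nat k} =
           measure \<mu> A ^ k / fact k * exp (- measure \<mu> A))) \<and>
     (\<forall>A\<in>sets \<mu>. emeasure \<mu> A = \<infinity> \<longrightarrow> (AE \<omega> in M. emeasure (N \<omega>) A = \<infinity>)) \<and>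
     (\<forall>(n::nat) A. A ` {..<n} \<subseteq> sets \<mu> \<and> disjoint_family_on A {..<n} \<longrightarrow>
        prob_space.indep_vars M (\<lambda>_. borel) (\<lambda>i \<omega>. emeasure (N \<omega>) (A i)) {..<n})"

text \<open>The \<open>\<sigma>\<close>-algebra generated by the restriction of the random measure \<open>N\<close> to the set \<open>E\<close>.\<close>

definition random_measure_events ::
    "'w measure \<Rightarrow> 'e measure \<Rightarrow> ('w \<Rightarrow> 'e measure) \<Rightarrow> 'e set \<Rightarrow> 'w set set" where
  "random_measure_events M \<mu> N E =
     sigma_sets (space M)
       {(\<lambda>\<omega>. emeasure (N \<omega>) A) -` B \<inter> space M | A B. A \<in> sets \<mu> \<and> A \<subseteq> E \<and> B \<in> sets borel}"

definition adapted_poisson_random_measure ::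
    "'w measure \<Rightarrow> (real \<Rightarrow> 'w measure) \<Rightarrow> 'u measure \<Rightarrow> ('w \<Rightarrow> (real \<times> 'u) measure) \<Rightarrow> bool" where
  "adapted_poisson_random_measure M F \<nu> N \<longleftrightarrow>
     poisson_random_measure M (jump_intensity \<nu>) N \<and>
     (\<forall>t\<ge>0.
        random_measure_events M (jump_intensity \<nu>) N ({0..t} \<times> space \<nu>) \<subseteq> sets (F t) \<and>
        prob_space.indep_set M (sets (F t))
          (random_measure_events M (jump_intensity \<nu>) N ({t<..} \<times> space \<nu>)))"

definition wiener_poisson_independent ::
    "'w measure \<Rightarrow> 'u measure \<Rightarrow> (real \<Rightarrow> 'w \<Rightarrow> real^'d) \<Rightarrow> ('w \<Rightarrow> (real \<times> 'u) measure) \<Rightarrow> bool" where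
  "wiener_poisson_independent M \<nu> W N \<longleftrightarrow>
     prob_space.indep_set M (wiener_events M W)
       (random_measure_events M (jump_intensity \<nu>) N (space (jump_intensity \<nu>)))"

text \<open>\<open>N(A) - \<integral>\<^sub>A dt \<nu>(du)\<close>, meaningful for sets \<open>A\<close> of finite intensity.\<close>

definition compensated ::
    "'u measure \<Rightarrow> ('w \<Rightarrow> (real \<times> 'u) measure) \<Rightarrow> 'w \<Rightarrow> (real \<times> 'u) set \<Rightarrow> real" where
  "compensated \<nu> N \<omega> A = measure (N \<omega>) A - measure (jump_intensity \<nu>) A"


section \<open>Stochastic integrals\<close>

text \<open>
  Both integrals are the \<open>L\<^sup>2\<close> extensions of the elementary integral of simple predictable
  integrands. An integrand is identified with its class in \<open>L\<^sup>2\<close> of \<open>dt dP\<close>, respectively of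
  \<open>dt \<nu>(du) dP\<close>, on every bounded time interval, and a continuous, respectively cadlag, version of
  the integral process is taken. Measurability of the integrands refers to the completed product
  measure, because a process with almost surely cadlag paths need only agree almost everywhere with
  a jointly measurable one when the filtration is not complete.

  The list entry \<open>(a, b, \<xi>)\<close> stands for the integrand \<open>\<xi> \<cdot> 1\<^bsub>(a, b]\<^esub>(s)\<close>, and \<open>(a, b, A, \<xi>)\<close> for
  \<open>\<xi> \<cdot> 1\<^bsub>(a, b]\<^esub>(s) \<cdot> 1\<^bsub>A\<^esub>(u)\<close>.
\<close>

abbreviation time_interval :: "real \<Rightarrow> real measure" where
  "time_interval T \<equiv> restrict_space lborel {0..T}"

type_synonym ('w, 'd) simple_integrand = "(real \<times> real \<times> ('w \<Rightarrow> real^'d^'d)) list"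

definition simple_integrand ::
    "'w measure \<Rightarrow> (real \<Rightarrow> 'w measure) \<Rightarrow> ('w, 'd::finite) simple_integrand \<Rightarrow> bool" where
  "simple_integrand M F hs \<longleftrightarrow>
     (\<forall>(a, b, \<xi>)\<in>set hs. 0 \<le> a \<and> a \<le> b \<and> \<xi> \<in> borel_measurable (F a) \<and> bounded (\<xi> ` space M))"

definition simple_value ::
    "('w, 'd::finite) simple_integrand \<Rightarrow> real \<Rightarrow> 'w \<Rightarrow> real^'d^'d" where
  "simple_value hs s \<omega> = (\<Sum>(a, b, \<xi>)\<leftarrow>hs. indicator {a<..b} s *\<^sub>R \<xi> \<omega>)"

definition simple_ito_integral ::
    "(real \<Rightarrow> 'w \<Rightarrow> real^'d) \<Rightarrow> ('w, 'd::finite) simple_integrand \<Rightarrow> real \<Rightarrow> 'w \<Rightarrow> real^'d" where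
  "simple_ito_integral W hs t \<omega> = (\<Sum>(a, b, \<xi>)\<leftarrow>hs. \<xi> \<omega> *v (W (min b t) \<omega> - W (min a t) \<omega>))"

definition is_ito_integral ::
    "'w measure \<Rightarrow> (real \<Rightarrow> 'w measure) \<Rightarrow> (real \<Rightarrow> 'w \<Rightarrow> real^'d) \<Rightarrow>
     (real \<Rightarrow> 'w \<Rightarrow> real^'d^'d) \<Rightarrow> (real \<Rightarrow> 'w \<Rightarrow> real^'d) \<Rightarrow> bool" where
  "is_ito_integral M F W H I \<longleftrightarrow>
     adapted_process F I \<and>
     (AE \<omega> in M. continuous_on {0..} (\<lambda>t. I t \<omega>)) \<and>
     (\<forall>T\<ge>0. (\<lambda>(s, \<omega>). H s \<omega>) \<in> borel_measurable (completion (time_interval T \<Otimes>\<^sub>M M))) \<and>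
     (\<exists>hs. (\<forall>n::nat. simple_integrand M F (hs n)) \<and>
        (\<forall>T\<ge>0.
           (\<lambda>n. \<integral>\<^sup>+(s, \<omega>). ennreal ((hs_norm (simple_value (hs n) s \<omega> - H s \<omega>))\<^sup>2)
                  \<partial>completion (time_interval T \<Otimes>\<^sub>M M)) \<longlonglongrightarrow> 0 \<and>
           (\<lambda>n. \<integral>\<^sup>+\<omega>. ennreal ((norm (simple_ito_integral W (hs n) T \<omega> - I T \<omega>))\<^sup>2) \<partial>M) \<longlonglongrightarrow> 0))"

type_synonym ('w, 'u, 'd) simple_jump_integrand =
  "(real \<times> real \<times> 'u set \<times> ('w \<Rightarrow> real^'d)) list"

definition simple_jump_integrand ::
    "'w measure \<Rightarrow> (real \<Rightarrow> 'w measure) \<Rightarrow> 'u measure \<Rightarrow>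
     ('w, 'u, 'd::finite) simple_jump_integrand \<Rightarrow> bool" where
  "simple_jump_integrand M F \<nu> hs \<longleftrightarrow>
     (\<forall>(a, b, A, \<xi>)\<in>set hs. 0 \<le> a \<and> a \<le> b \<and> A \<in> sets \<nu> \<and> emeasure \<nu> A < \<infinity> \<and>
        \<xi> \<in> borel_measurable (F a) \<and> bounded (\<xi> ` space M))"

definition simple_jump_value ::
    "('w, 'u, 'd::finite) simple_jump_integrand \<Rightarrow> real \<Rightarrow> 'u \<Rightarrow> 'w \<Rightarrow> real^'d" where
  "simple_jump_value hs s u \<omega> =
     (\<Sum>(a, b, A, \<xi>)\<leftarrow>hs. (indicator {a<..b} s * indicator A u) *\<^sub>R \<xi> \<omega>)"

definition simple_jump_integral ::
    "'u measure \<Rightarrow> ('w \<Rightarrow> (real \<times> 'u) measure) \<Rightarrow>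
     ('w, 'u, 'd::finite) simple_jump_integrand \<Rightarrow> real \<Rightarrow> 'w \<Rightarrow> real^'d" where
  "simple_jump_integral \<nu> N hs t \<omega> =
     (\<Sum>(a, b, A, \<xi>)\<leftarrow>hs. compensated \<nu> N \<omega> ({min a t<..min b t} \<times> A) *\<^sub>R \<xi> \<omega>)"

definition is_compensated_poisson_integral ::
    "'w measure \<Rightarrow> (real \<Rightarrow> 'w measure) \<Rightarrow> 'u measure \<Rightarrow> ('w \<Rightarrow> (real \<times> 'u) measure) \<Rightarrow>
     (real \<Rightarrow> 'u \<Rightarrow> 'w \<Rightarrow> real^'d) \<Rightarrow> (real \<Rightarrow> 'w \<Rightarrow> real^'d) \<Rightarrow> bool" where
  "is_compensated_poisson_integral M F \<nu> N G J \<longleftrightarrow>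
     adapted_process F J \<and>
     (AE \<omega> in M. cadlag (\<lambda>t. J t \<omega>)) \<and>
     (\<forall>T\<ge>0. (\<lambda>(s, u, \<omega>). G s u \<omega>)
        \<in> borel_measurable (completion (time_interval T \<Otimes>\<^sub>M \<nu> \<Otimes>\<^sub>M M))) \<and>
     (\<exists>hs. (\<forall>n::nat. simple_jump_integrand M F \<nu> (hs n)) \<and>
        (\<forall>T\<ge>0.
           (\<lambda>n. \<integral>\<^sup>+(s, u, \<omega>). ennreal ((norm (simple_jump_value (hs n) s u \<omega> - G s u \<omega>))\<^sup>2)
                  \<partial>completion (time_interval T \<Otimes>\<^sub>M \<nu> \<Otimes>\<^sub>M M)) \<longlonglongrightarrow> 0 \<and>
           (\<lambda>n. \<integral>\<^sup>+\<omega>. ennreal ((norm (simple_jump_integral \<nu> N (hs n) T \<omega> - J T \<omega>))\<^sup>2) \<partial>M) \<longlonglongrightarrow> 0))"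


section \<open>Strong solutions\<close>

text \<open>
  Paths are required to be cadlag almost surely, as the filtration need not contain the null sets of
  \<open>M\<close>; over a complete filtration every such process is indistinguishable from an adapted process
  all of whose paths are cadlag.
\<close>

definition strong_solution ::
    "'w measure \<Rightarrow> (real \<Rightarrow> 'w measure) \<Rightarrow> 'u measure \<Rightarrow> (real \<Rightarrow> 'w \<Rightarrow> real^'d) \<Rightarrow>
     ('w \<Rightarrow> (real \<times> 'u) measure) \<Rightarrow> (real^'d \<Rightarrow> real^'d) \<Rightarrow> (real^'d \<Rightarrow> real^'d^'d) \<Rightarrow>
     (real^'d \<Rightarrow> 'u \<Rightarrow> real^'d) \<Rightarrow> real^'d \<Rightarrow> (real \<Rightarrow> 'w \<Rightarrow> real^'d) \<Rightarrow> bool" where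
  "strong_solution M F \<nu> W N b \<sigma> g x X \<longleftrightarrow>
     adapted_process F X \<and>
     (AE \<omega> in M. cadlag (\<lambda>t. X t \<omega>)) \<and>
     (\<exists>I J.
        is_ito_integral M F W (\<lambda>s \<omega>. \<sigma> (X s \<omega>)) I \<and>
        is_compensated_poisson_integral M F \<nu> N
          (\<lambda>s u \<omega>. g (left_limit (\<lambda>r. X r \<omega>) s) u) J \<and>
        (AE \<omega> in M. \<forall>t\<ge>0.
           set_integrable lborel {0..t} (\<lambda>s. b (X s \<omega>)) \<and>
           X t \<omega> = x + (LINT s:{0..t}|lborel. b (X s \<omega>)) + I t \<omega> + J t \<omega>))"

definition indistinguishable ::
    "'w measure \<Rightarrow> (real \<Rightarrow> 'w \<Rightarrow> 'b) \<Rightarrow> (real \<Rightarrow> 'w \<Rightarrow> 'b) \<Rightarrow> bool" where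
  "indistinguishable M X Y \<longleftrightarrow> (AE \<omega> in M. \<forall>t\<ge>0. X t \<omega> = Y t \<omega>)"

end

theory Submission
  imports Defs
begin

text \<open>
  Both drivers are treated as orthogonal noises: square-integrable random set functions of a mark whose
  increments have conditional mean \<open>0\<close> and conditional covariance \<open>(t - s) \<nu>(A \<inter> B)\<close>. For the Wiener process
  the marks are the coordinates with counting measure. Everything rests on one energy estimate, proved by
  summing increments over a grid and letting the mesh tend to \<open>0\<close>: if
  \<open>Z\<^sub>t = \<integral> \<beta> dr + I\<^sub>t + J\<^sub>t\<close> and \<open>E (2 (Z\<^sub>r, \<beta>\<^sub>r) + \<alpha>\<^sub>r) \<le> k E |Z\<^sub>r|\<^sup>2 + \<epsilon>\<close>, where \<open>E |\<Delta>(I + J)|\<^sup>2 \<le> \<integral> E \<alpha> dr\<close>,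
  then \<open>E |Z\<^sub>T|\<^sup>2 \<le> \<epsilon> T exp (k T)\<close>. The drift enters the monotonicity condition with coefficient \<open>1\<close> and the
  energy with coefficient \<open>2\<close>, so one may take \<open>\<alpha> = 2 |\<Delta>\<sigma>|\<^sup>2 + 2 \<integral> |\<Delta>g|\<^sup>2 d\<nu>\<close>, and the cross term of the two
  martingale parts need not be computed. Applied to the difference of two solutions this gives uniqueness.

  For existence, the Euler schemes with mesh \<open>16^-n\<close> form a Cauchy sequence by the same estimate, because
  monotonicity and the bound on \<open>b\<close> give the modulus
  \<open>|\<sigma>(x) - \<sigma>(y)|\<^sup>2 + \<integral> |g(x,u) - g(y,u)|\<^sup>2 \<nu>(du) \<le> K |x - y|\<^sup>2 + 2 sqrt L |x - y|\<close>. The stochastic integrals then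
  converge locally uniformly by the maximal inequality, the drift parts are uniformly Lipschitz in time and
  converge along the schemes, and the continuity of \<open>b\<close> identifies their limit.
\<close>

section \<open>Moments, cadlag paths and jointly measurable versions\<close>

text \<open>The drift has no modulus of continuity, so only the monotonicity inequality at frozen
  states can compare two Euler schemes, and it leaves no slack. Hence bounds on stochastic integrals
  must carry the constant 1, and triangle inequalities are used in the weighted form
  \<open>(1 + \<delta>) |a|^2 + (1 + 1/\<delta>) |b|^2\<close>. The mesh pays for two square roots:
  frozen and running states differ by \<open>16^-n\<close> in mean square, hence by
  \<open>4^-n\<close> in mean, and since the drift is merely bounded this first moment decides the
  mean-square distance of two schemes; the modulus of the coefficients is linear near 0, so another
  root gives \<open>2^-n\<close> for the stochastic integrals, which a threshold
  \<open>(3/4)^n\<close> in the maximal inequality turns into almost sure convergence. The kernels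
  of the scheme are finite sums of indicators of mark sets, so the scheme itself supplies the simple
  integrands that define its integrals. As the filtration need not be complete, limits are taken
  with the total function \<open>lim\<close>, which preserves adaptedness.\<close>

abbreviation sq_norm :: "'a measure \<Rightarrow> ('a \<Rightarrow> 'b::real_normed_vector) \<Rightarrow> ennreal" where
  "sq_norm M f \<equiv> \<integral>\<^sup>+x. ennreal ((norm (f x))\<^sup>2) \<partial>M"

lemma two_inner_le:
  fixes a b :: "'a::real_inner"
  assumes "\<delta> > 0"
  shows "2 * \<bar>a \<bullet> b\<bar> \<le> \<delta> * (norm a)\<^sup>2 + (norm b)\<^sup>2 / \<delta>"
proof -
  have "0 \<le> (\<delta> * norm a - norm b)\<^sup>2 / \<delta>" using assms by simp
  also have "\<dots> = \<delta> * (norm a)\<^sup>2 + (norm b)\<^sup>2 / \<delta> - 2 * (norm a * norm b)"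
    using assms by (simp add: power2_diff field_simps power2_eq_square)
  finally show ?thesis using Cauchy_Schwarz_ineq2[of a b] by linarith
qed

lemma norm_add_sq_le:
  fixes a b :: "'a::real_inner"
  assumes "\<delta> > 0"
  shows "(norm (a + b))\<^sup>2 \<le> (1 + \<delta>) * (norm a)\<^sup>2 + (1 + 1 / \<delta>) * (norm b)\<^sup>2"
  using two_inner_le[OF assms, of a b] by (simp add: dot_norm algebra_simps)

lemma norm_add_sq_le2:
  fixes a b :: "'a::real_inner"
  shows "(norm (a + b))\<^sup>2 \<le> 2 * (norm a)\<^sup>2 + 2 * (norm b)\<^sup>2"
  using norm_add_sq_le[of 1 a b] by simp

lemma norm_diff_sq_le2:
  fixes a b :: "'a::real_inner"
  shows "(norm (a - b))\<^sup>2 \<le> 2 * (norm a)\<^sup>2 + 2 * (norm b)\<^sup>2"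
  using norm_add_sq_le2[of a "- b"] by simp

lemma sq_integrable_inner:
  fixes X Y :: "'a \<Rightarrow> 'b::euclidean_space"
  assumes [measurable]: "X \<in> borel_measurable M" "Y \<in> borel_measurable M"
    and "integrable M (\<lambda>w. (norm (X w))\<^sup>2)" "integrable M (\<lambda>w. (norm (Y w))\<^sup>2)"
  shows "integrable M (\<lambda>w. X w \<bullet> Y w)"
proof (rule Bochner_Integration.integrable_bound)
  show "integrable M (\<lambda>w. (norm (X w))\<^sup>2 + (norm (Y w))\<^sup>2)" using assms by simp
  have "norm (a \<bullet> b) \<le> norm ((norm a)\<^sup>2 + (norm b)\<^sup>2)" for a b :: 'b
    using two_inner_le[of 1 a b] by (auto simp: abs_if)
  then show "AE w in M. norm (X w \<bullet> Y w) \<le> norm ((norm (X w))\<^sup>2 + (norm (Y w))\<^sup>2)"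
    by simp
qed simp

lemma sq_integrable_add:
  fixes X Y :: "'a \<Rightarrow> 'b::euclidean_space"
  assumes [measurable]: "X \<in> borel_measurable M" "Y \<in> borel_measurable M"
    and "integrable M (\<lambda>w. (norm (X w))\<^sup>2)" "integrable M (\<lambda>w. (norm (Y w))\<^sup>2)"
  shows "integrable M (\<lambda>w. (norm (X w + Y w))\<^sup>2)"
proof (rule Bochner_Integration.integrable_bound)
  show "integrable M (\<lambda>w. 2 * (norm (X w))\<^sup>2 + 2 * (norm (Y w))\<^sup>2)" using assms by simp
  show "AE w in M. norm ((norm (X w + Y w))\<^sup>2) \<le> norm (2 * (norm (X w))\<^sup>2 + 2 * (norm (Y w))\<^sup>2)"
    using norm_add_sq_le2 by (auto intro!: AE_I2)
qed simp

lemma sq_integrable_diff: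
  fixes X Y :: "'a \<Rightarrow> 'b::euclidean_space"
  assumes "X \<in> borel_measurable M" "Y \<in> borel_measurable M"
    and "integrable M (\<lambda>w. (norm (X w))\<^sup>2)" "integrable M (\<lambda>w. (norm (Y w))\<^sup>2)"
  shows "integrable M (\<lambda>w. (norm (X w - Y w))\<^sup>2)"
  using sq_integrable_add[of X M "\<lambda>w. - Y w"] assms by simp

lemma (in finite_measure) sq_integrable_norm:
  fixes X :: "'a \<Rightarrow> 'b::euclidean_space"
  assumes [measurable]: "X \<in> borel_measurable M" and "integrable M (\<lambda>w. (norm (X w))\<^sup>2)"
  shows "integrable M (\<lambda>w. norm (X w))"
proof (rule Bochner_Integration.integrable_bound)
  show "integrable M (\<lambda>w. 1 + (norm (X w))\<^sup>2)" using assms by simp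
  have "norm (norm a) \<le> norm (1 + (norm a)\<^sup>2)" for a :: 'b
    using two_inner_le[of 1 "norm a" 1] by (auto simp: abs_if)
  then show "AE w in M. norm (norm (X w)) \<le> norm (1 + (norm (X w))\<^sup>2)"
    by (auto intro!: AE_I2)
qed simp

lemma (in finite_measure) integrable_sq_bounded:
  fixes X :: "'a \<Rightarrow> 'b::euclidean_space"
  assumes [measurable]: "X \<in> borel_measurable M" and "\<And>w. w \<in> space M \<Longrightarrow> norm (X w) \<le> C"
  shows "integrable M (\<lambda>w. (norm (X w))\<^sup>2)"
  by (rule integrable_const_bound[where B="C\<^sup>2"]) (auto intro!: AE_I2 power_mono assms)

text \<open>The inequality \<open>norm a <= (\<theta> + (norm a)^2 / \<theta>) / 2\<close> is
  integrated. With \<open>\<theta>\<close> chosen as the square root of a known rate, a mean-square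
  bound of order \<open>\<theta>^2\<close> becomes a mean bound of order \<open>\<theta>\<close>;
  the later passages from second to first moments rest on this.\<close>

lemma (in prob_space) expectation_norm_le:
  fixes X :: "'a \<Rightarrow> 'b::euclidean_space"
  assumes [measurable]: "X \<in> borel_measurable M" and "integrable M (\<lambda>w. (norm (X w))\<^sup>2)"
    and le: "expectation (\<lambda>w. (norm (X w))\<^sup>2) \<le> D * \<theta>\<^sup>2" and \<theta>: "\<theta> > 0"
  shows "expectation (\<lambda>w. norm (X w)) \<le> (1 + D) * \<theta> / 2"
proof -
  have *: "norm a \<le> (\<theta> + (norm a)\<^sup>2 / \<theta>) / 2" for a :: 'b
    using two_inner_le[of "1/\<theta>" "norm a" 1] \<theta> by (simp add: divide_simps power2_eq_square)
  have "expectation (\<lambda>w. norm (X w)) \<le> expectation (\<lambda>w. (\<theta> + (norm (X w))\<^sup>2 / \<theta>) / 2)"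
  proof (rule integral_mono)
    show "integrable M (\<lambda>w. norm (X w))" using assms by (intro sq_integrable_norm)
    show "integrable M (\<lambda>w. (\<theta> + (norm (X w))\<^sup>2 / \<theta>) / 2)" using assms by simp
  qed (rule *)
  also have "\<dots> = (\<theta> + expectation (\<lambda>w. (norm (X w))\<^sup>2) / \<theta>) / 2"
    using assms by (simp add: prob_space)
  also have "\<dots> \<le> (\<theta> + D * \<theta>\<^sup>2 / \<theta>) / 2" using le \<theta> by (intro divide_right_mono add_left_mono) auto
  also have "\<dots> = (1 + D) * \<theta> / 2" using \<theta> by (simp add: power2_eq_square algebra_simps)
  finally show ?thesis .
qed

text \<open>Independence is given for whole sub-sigma-algebras, while the product rule is about
  random variables; the sigma-algebras generated by \<open>X\<close> and \<open>Y\<close> lie inside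
  \<open>A\<close> and \<open>B\<close>. In this way independence of increments from the past
  becomes the mean and covariance conditions of a noise.\<close>

lemma (in prob_space) indep_set_integral_mult:
  fixes X Y :: "'a \<Rightarrow> real"
  assumes ind: "indep_set (sets A) (sets B)" and A: "subalgebra M A" and B: "subalgebra M B"
    and X: "X \<in> borel_measurable A" and Y: "Y \<in> borel_measurable B"
    and iX: "integrable M X" and iY: "integrable M Y"
  shows "integrable M (\<lambda>w. X w * Y w)"
    and "expectation (\<lambda>w. X w * Y w) = expectation X * expectation Y"
proof -
  have sub: "sigma_sets (space M) {Z -` S \<inter> space M |S. S \<in> sets borel} \<subseteq> sets C"
    if C: "subalgebra M C" and Z: "Z \<in> borel_measurable C" for C and Z :: "'a \<Rightarrow> real"
  proof -
    have sp: "space C = space M" using C by (simp add: subalgebra_def)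
    have "{Z -` S \<inter> space M |S. S \<in> sets borel} \<subseteq> sets C"
      using measurable_sets[OF Z] by (auto simp: sp)
    then show ?thesis using sets.sigma_sets_subset[of _ C] by (simp add: sp)
  qed
  have "indep_var borel X borel Y"
    unfolding indep_var_eq
  proof (intro conjI)
    show "random_variable borel X" "random_variable borel Y" using iX iY by auto
    show "indep_set (sigma_sets (space M) {X -` S \<inter> space M |S. S \<in> sets borel})
        (sigma_sets (space M) {Y -` S \<inter> space M |S. S \<in> sets borel})"
      unfolding indep_set_def
      by (rule indep_sets_mono_sets[OF ind[unfolded indep_set_def]])
        (auto split: bool.split simp: sub[OF A X] sub[OF B Y, THEN subsetD]  sub[OF A X, THEN subsetD])
  qed
  then show "integrable M (\<lambda>w. X w * Y w)"
    "expectation (\<lambda>w. X w * Y w) = expectation X * expectation Y"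
    using indep_var_integrable indep_var_lebesgue_integral iX iY by blast+
qed

section \<open>Countability of the jumps of cadlag paths\<close>

lemma countable_right_isolated:
  fixes S :: "real set"
  assumes "\<And>x. x \<in> S \<Longrightarrow> \<exists>d>0. \<forall>y. x < y \<and> y < x + d \<longrightarrow> y \<notin> S"
  shows "countable S"
proof -
  obtain d where d: "\<And>x. x \<in> S \<Longrightarrow> d x > 0 \<and> (\<forall>y. x < y \<and> y < x + d x \<longrightarrow> y \<notin> S)"
    using assms by metis
  \<comment> \<open>A rational in the gap to the right of each point; the gaps of different points
    are disjoint, so the choice is injective.\<close>
  have "\<exists>q\<in>\<rat>. x < q \<and> q < x + d x" if "x \<in> S" for x
    using Rats_dense_in_real[of x "x + d x"] d[OF that] by auto
  then obtain q where q: "\<And>x. x \<in> S \<Longrightarrow> q x \<in> \<rat> \<and> x < q x \<and> q x < x + d x" by metis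
  have "inj_on q S"
  proof (rule linorder_inj_onI')
    fix x y assume "x \<in> S" "y \<in> S" "x < y"
    then have "\<not> y < x + d x" using d[of x] by blast
    then show "q x \<noteq> q y" using q[OF \<open>x \<in> S\<close>] q[OF \<open>y \<in> S\<close>] by linarith
  qed
  moreover have "countable (q ` S)" by (rule countable_subset[OF _ countable_rat]) (use q in blast)
  ultimately show ?thesis using countable_image_inj_on by blast
qed

lemma cadlag_right: "cadlag f \<Longrightarrow> 0 \<le> t \<Longrightarrow> (f \<longlongrightarrow> f t) (at_right t)"
  by (simp add: cadlag_def)

lemma cadlag_left:
  fixes f :: "real \<Rightarrow> 'a::t2_space"
  assumes "cadlag f" "0 < t" shows "(f \<longlongrightarrow> left_limit f t) (at_left t)"
proof -
  obtain l where l: "(f \<longlongrightarrow> l) (at_left t)" using assms unfolding cadlag_def by blast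
  then have "left_limit f t = l" unfolding left_limit_def by (intro tendsto_Lim) auto
  then show ?thesis using l by simp
qed

text \<open>A jump exceeding \<open>2 / Suc k\<close> cannot occur shortly after any
  \<open>x\<close>: right-continuity keeps the path within \<open>1 / Suc k\<close> of
  \<open>f x\<close> there, and its left limits as well. Hence the jumps above each such size are
  right-isolated, and countably many sizes exhaust all jumps.\<close>

lemma cadlag_countable_jumps:
  fixes f :: "real \<Rightarrow> 'a::metric_space"
  assumes f: "cadlag f"
  shows "countable {s. 0 < s \<and> left_limit f s \<noteq> f s}"
proof -
  define S where "S k = {s. 0 < s \<and> dist (left_limit f s) (f s) > 2 / real (Suc k)}" for k
  have "countable (S k)" for k
  proof (rule countable_right_isolated)
    fix x assume "x \<in> S k"
    then have x: "0 \<le> x" by (simp add: S_def)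
    define e where "e = 1 / real (Suc k)"
    have e: "e > 0" by (simp add: e_def)
    have "eventually (\<lambda>y. dist (f y) (f x) < e) (at_right x)"
      using cadlag_right[OF f x] e by (rule tendstoD)
    then obtain c where c: "x < c" "\<And>y. x < y \<Longrightarrow> y < c \<Longrightarrow> dist (f y) (f x) < e"
      unfolding eventually_at_right_field by auto
    have "y \<notin> S k" if y: "x < y" "y < c" for y
    proof -
      have "eventually (\<lambda>z. z \<in> {x<..<y}) (at_left y)" by (rule eventually_at_leftI[OF _ y(1)])
      then have "eventually (\<lambda>z. dist (f z) (f x) \<le> e) (at_left y)"
        by eventually_elim (use c(2) y in force)
      moreover have "((\<lambda>z. dist (f z) (f x)) \<longlongrightarrow> dist (left_limit f y) (f x)) (at_left y)"
        using y x by (intro tendsto_intros cadlag_left[OF f]) auto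
      ultimately have "dist (left_limit f y) (f x) \<le> e"
        using tendsto_upperbound[of "\<lambda>z. dist (f z) (f x)" _ "at_left y" e] by auto
      moreover have "dist (f y) (f x) < e" using c(2) y by auto
      ultimately have "dist (left_limit f y) (f y) \<le> 2 * e"
        using dist_triangle2[of "left_limit f y" "f y" "f x"] by linarith
      then show ?thesis by (simp add: S_def e_def)
    qed
    then show "\<exists>d>0. \<forall>y. x < y \<and> y < x + d \<longrightarrow> y \<notin> S k" using c(1)
      by (intro exI[of _ "c - x"]) auto
  qed
  moreover have "{s. 0 < s \<and> left_limit f s \<noteq> f s} \<subseteq> (\<Union>k. S k)"
  proof
    fix s assume "s \<in> {s. 0 < s \<and> left_limit f s \<noteq> f s}"
    then have s: "0 < s" "dist (left_limit f s) (f s) / 2 > 0" by auto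
    then obtain k where "1 / real (Suc k) < dist (left_limit f s) (f s) / 2"
      using nat_approx_posE by blast
    then show "s \<in> (\<Union>k. S k)" using s by (auto simp: S_def intro!: exI[of _ k])
  qed
  ultimately show ?thesis using countable_subset[OF _ countable_UN[of UNIV S]] by simp
qed

lemma cadlag_AE_left_limit:
  fixes f :: "real \<Rightarrow> 'a::metric_space"
  assumes "cadlag f"
  shows "AE s in lborel. 0 < s \<longrightarrow> left_limit f s = f s"
proof -
  have "AE s in lborel. s \<notin> {s. 0 < s \<and> left_limit f s \<noteq> f s}"
    using cadlag_countable_jumps[OF assms] by (intro AE_not_in countable_imp_null_set_lborel)
  then show ?thesis by eventually_elim auto
qed

section \<open>Dyadic approximation of time and jointly measurable versions\<close>

definition dyadic_above :: "nat \<Rightarrow> real \<Rightarrow> real" where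
  "dyadic_above n s = (real_of_int \<lfloor>s * 2 ^ n\<rfloor> + 1) / 2 ^ n"

text \<open>Floor plus one and ceiling minus one give the dyadic neighbours strictly above and
  strictly below \<open>s\<close>, even when \<open>s\<close> is itself dyadic; strictness is what
  makes the two sequences converge along \<open>at_right s\<close> and
  \<open>at_left s\<close>.\<close>

definition dyadic_below :: "nat \<Rightarrow> real \<Rightarrow> real" where
  "dyadic_below n s = (real_of_int \<lceil>s * 2 ^ n\<rceil> - 1) / 2 ^ n"

lemma LIMSEQ_add_inverse_power2: "(\<lambda>n. s + c / 2 ^ n) \<longlonglongrightarrow> (s::real)"
proof -
  have "(\<lambda>n. s + c * (1 / 2) ^ n) \<longlonglongrightarrow> s + c * 0"
    by (intro tendsto_intros LIMSEQ_realpow_zero) auto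
  then show ?thesis by (simp add: power_one_over field_simps)
qed

lemma dyadic_above: "s < dyadic_above n s" "dyadic_above n s \<le> s + 1 / 2 ^ n"
    "filterlim (\<lambda>n. dyadic_above n s) (at_right s) sequentially"
proof -
  show 1: "s < dyadic_above n s" "dyadic_above n s \<le> s + 1 / 2 ^ n" for n
    using floor_correct[of "s * 2 ^ n"] by (auto simp: dyadic_above_def field_simps)
  have "(\<lambda>n. dyadic_above n s) \<longlonglongrightarrow> s"
    by (rule tendsto_sandwich[OF _ _ tendsto_const LIMSEQ_add_inverse_power2[of s 1]])
      (auto intro!: always_eventually less_imp_le 1)
  then show "filterlim (\<lambda>n. dyadic_above n s) (at_right s) sequentially"
    by (simp add: filterlim_at 1 less_imp_neq[OF 1(1), symmetric])
qed

lemma dyadic_below: "dyadic_below n s < s" "s - 1 / 2 ^ n \<le> dyadic_below n s"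
    "filterlim (\<lambda>n. dyadic_below n s) (at_left s) sequentially"
    "0 < s \<Longrightarrow> 0 \<le> dyadic_below n s"
proof -
  show 1: "dyadic_below n s < s" "s - 1 / 2 ^ n \<le> dyadic_below n s" for n
    using ceiling_correct[of "s * 2 ^ n"] by (auto simp: dyadic_below_def field_simps)
  have "(\<lambda>n. dyadic_below n s) \<longlonglongrightarrow> s"
    by (rule tendsto_sandwich[OF _ _ LIMSEQ_add_inverse_power2[of s "-1"] tendsto_const])
      (use 1 in \<open>auto intro!: always_eventually less_imp_le\<close>)
  then show "filterlim (\<lambda>n. dyadic_below n s) (at_left s) sequentially"
    by (simp add: filterlim_at 1 less_imp_neq[OF 1(1)])
  show "0 < s \<Longrightarrow> 0 \<le> dyadic_below n s"
  proof -
    assume "0 < s"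
    then have "0 < s * 2 ^ n" by simp
    then have "1 \<le> \<lceil>s * 2 ^ n\<rceil>" by linarith
    then show "0 \<le> dyadic_below n s" by (simp add: dyadic_below_def)
  qed
qed

text \<open>For fixed \<open>n\<close> the time argument takes countably many values, one for each
  value of the floor, so measurability at fixed times yields joint measurability.\<close>

lemma borel_measurable_dyadic_above:
  fixes X :: "real \<Rightarrow> 'w \<Rightarrow> 'b::{banach, second_countable_topology}"
  assumes X[measurable]: "\<And>t. 0 \<le> t \<Longrightarrow> X t \<in> borel_measurable M"
  shows "(\<lambda>(s, w). X (max 0 (dyadic_above n s)) w) \<in> borel_measurable (borel \<Otimes>\<^sub>M M)"
proof -
  have "(\<lambda>p::real \<times> 'w. (\<lambda>i p. X (max 0 ((real_of_int i + 1) / 2 ^ n)) (snd p)) \<lfloor>fst p * 2 ^ n\<rfloor> p)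
      \<in> borel_measurable (borel \<Otimes>\<^sub>M M)"
    by (rule measurable_compose_countable, rule measurable_compose[OF measurable_snd]) (simp_all add: X)
  then show ?thesis by (simp add: dyadic_above_def case_prod_beta)
qed

lemma borel_measurable_dyadic_below:
  fixes X :: "real \<Rightarrow> 'w \<Rightarrow> 'b::{banach, second_countable_topology}"
  assumes X[measurable]: "\<And>t. 0 \<le> t \<Longrightarrow> X t \<in> borel_measurable M"
  shows "(\<lambda>(s, w). X (max 0 (dyadic_below n s)) w) \<in> borel_measurable (borel \<Otimes>\<^sub>M M)"
proof -
  have "(\<lambda>p::real \<times> 'w. (\<lambda>i p. X (max 0 ((real_of_int i - 1) / 2 ^ n)) (snd p)) \<lceil>fst p * 2 ^ n\<rceil> p)
      \<in> borel_measurable (borel \<Otimes>\<^sub>M M)"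
    by (rule measurable_compose_countable, rule measurable_compose[OF measurable_snd]) (simp_all add: X)
  then show ?thesis by (simp add: dyadic_below_def case_prod_beta)
qed

text \<open>
  Jointly measurable processes which agree with \<open>X\<close> and with its left limits along cadlag paths; \<open>lim\<close> is
  an arbitrary value where the sequence diverges, and \<open>max 0\<close> keeps the time arguments nonnegative.
\<close>

definition right_version :: "(real \<Rightarrow> 'w \<Rightarrow> 'b::{banach, second_countable_topology}) \<Rightarrow> real \<Rightarrow> 'w \<Rightarrow> 'b" where
  "right_version X s w = lim (\<lambda>n. X (max 0 (dyadic_above n s)) w)"

definition left_version :: "(real \<Rightarrow> 'w \<Rightarrow> 'b::{banach, second_countable_topology}) \<Rightarrow> real \<Rightarrow> 'w \<Rightarrow> 'b" where
  "left_version X s w = lim (\<lambda>n. X (max 0 (dyadic_below n s)) w)"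

lemma borel_measurable_versions:
  fixes X :: "real \<Rightarrow> 'w \<Rightarrow> 'b::{banach, second_countable_topology}"
  assumes "\<And>t. 0 \<le> t \<Longrightarrow> X t \<in> borel_measurable M"
  shows "(\<lambda>(s, w). right_version X s w) \<in> borel_measurable (borel \<Otimes>\<^sub>M M)"
    "(\<lambda>(s, w). left_version X s w) \<in> borel_measurable (borel \<Otimes>\<^sub>M M)"
  using borel_measurable_lim_metric[OF borel_measurable_dyadic_above[where X=X and M=M, OF assms]]
    borel_measurable_lim_metric[OF borel_measurable_dyadic_below[where X=X and M=M, OF assms]]
  by (simp_all add: right_version_def left_version_def case_prod_beta)

lemma right_version_eq:
  assumes "cadlag (\<lambda>t. X t w)" "0 \<le> s"
  shows "right_version X s w = X s w"
proof -
  have "(\<lambda>n. X (dyadic_above n s) w) \<longlonglongrightarrow> X s w"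
    by (rule filterlim_compose[OF cadlag_right[OF assms] dyadic_above(3)])
  moreover have "max 0 (dyadic_above n s) = dyadic_above n s" for n
    using dyadic_above(1)[of s n] assms(2) by simp
  ultimately show ?thesis unfolding right_version_def by (simp add: limI)
qed

lemma left_version_eq:
  assumes "cadlag (\<lambda>t. X t w)" "0 < s"
  shows "left_version X s w = left_limit (\<lambda>t. X t w) s"
proof -
  have "(\<lambda>n. X (dyadic_below n s) w) \<longlonglongrightarrow> left_limit (\<lambda>t. X t w) s"
    by (rule filterlim_compose[OF cadlag_left[OF assms] dyadic_below(3)])
  moreover have "max 0 (dyadic_below n s) = dyadic_below n s" for n
    using dyadic_below(4)[of s n] assms(2) by simp
  ultimately show ?thesis unfolding left_version_def by (simp add: limI)
qed

lemma integrable_indicator_Ioc [simp]: "integrable lborel (indicat_real {s<..t::real})"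
  by (cases "s \<le> t") (auto intro!: integrable_real_indicator simp: emeasure_lborel_Ioc)

section \<open>The energy estimate\<close>

text \<open>Fubini for an integrand dominated by \<open>Y w\<close> uniformly in time. The majorant
  has to depend on \<open>w\<close>, since the pairing of a square-integrable state with the bounded
  drift is integrated later.\<close>

lemma (in prob_space) expectation_time_integral_le:
  fixes \<psi> :: "real \<Rightarrow> 'a \<Rightarrow> real"
  assumes \<psi>[measurable]: "(\<lambda>(r, w). \<psi> r w) \<in> borel_measurable (borel \<Otimes>\<^sub>M M)"
    and Y: "integrable M Y" and bd: "\<And>r w. w \<in> space M \<Longrightarrow> \<bar>\<psi> r w\<bar> \<le> Y w"
    and st: "s \<le> t" and le: "\<And>r. s < r \<Longrightarrow> r \<le> t \<Longrightarrow> expectation (\<psi> r) \<le> c"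
  shows "integrable M (\<lambda>w. LINT r:{s<..t}|lborel. \<psi> r w)"
    and "expectation (\<lambda>w. LINT r:{s<..t}|lborel. \<psi> r w) = (LINT r:{s<..t}|lborel. expectation (\<psi> r))"
    and "set_integrable lborel {s<..t} (\<lambda>r. expectation (\<psi> r))"
    and "expectation (\<lambda>w. LINT r:{s<..t}|lborel. \<psi> r w) \<le> (t - s) * c"
proof -
  interpret P: pair_sigma_finite lborel M ..
  have m[measurable]: "(\<lambda>(r, w). \<psi> r w) \<in> borel_measurable (lborel \<Otimes>\<^sub>M M)"
    using \<psi> by (simp cong: measurable_cong_sets sets_pair_measure_cong)
  have mr[measurable]: "\<psi> r \<in> borel_measurable M" for r by measurable
  have ir: "integrable M (\<psi> r)" for r
  proof (rule Bochner_Integration.integrable_bound[OF Y mr], rule AE_I2)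
    fix w assume "w \<in> space M" then show "norm (\<psi> r w) \<le> norm (Y w)" using bd[of w r] by simp
  qed
  have Y0: "0 \<le> Y w" if "w \<in> space M" for w using bd[OF that, of 0] by linarith
  have int: "integrable (lborel \<Otimes>\<^sub>M M) (\<lambda>(r, w). indicator {s<..t} r * \<psi> r w)"
  proof (rule P.Fubini_integrable)
    show "(\<lambda>(r, w). indicator {s<..t} r * \<psi> r w) \<in> borel_measurable (lborel \<Otimes>\<^sub>M M)" by measurable
    have i0: "integrable lborel (\<lambda>r. indicator {s<..t} r * expectation Y :: real)" by simp
    show "integrable lborel (\<lambda>r. \<integral>w. norm (case (r, w) of (r, w) \<Rightarrow> indicator {s<..t} r * \<psi> r w) \<partial>M)"
    proof (rule Bochner_Integration.integrable_bound[OF i0])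
      show "AE r in lborel. norm (\<integral>w. norm (case (r, w) of (r, w) \<Rightarrow> indicator {s<..t} r * \<psi> r w) \<partial>M)
          \<le> norm (indicator {s<..t} r * expectation Y)"
      proof (rule AE_I2)
        fix r
        have "expectation (\<lambda>w. \<bar>\<psi> r w\<bar>) \<le> expectation Y" using ir Y bd by (intro integral_mono) auto
        moreover have "0 \<le> expectation (\<lambda>w. \<bar>\<psi> r w\<bar>)" by simp
        ultimately show "norm (\<integral>w. norm (case (r, w) of (r, w) \<Rightarrow> indicator {s<..t} r * \<psi> r w) \<partial>M)
          \<le> norm (indicator {s<..t} r * expectation Y)"
          by (auto simp: indicator_def abs_mult)
      qed
    qed measurable
    show "AE r in lborel. integrable M (\<lambda>w. case (r, w) of (r, w) \<Rightarrow> indicator {s<..t} r * \<psi> r w)"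
      using ir by simp
  qed
  have swap: "integrable (M \<Otimes>\<^sub>M lborel) (\<lambda>(w, r). indicator {s<..t} r * \<psi> r w)"
    using P.integrable_product_swap[OF int] by (simp add: case_prod_beta split_beta')
  interpret Q: pair_sigma_finite M lborel ..
  show 1: "integrable M (\<lambda>w. LINT r:{s<..t}|lborel. \<psi> r w)"
    using Q.integrable_fst[OF swap] by (simp add: set_lebesgue_integral_def)
  show 2: "expectation (\<lambda>w. LINT r:{s<..t}|lborel. \<psi> r w) = (LINT r:{s<..t}|lborel. expectation (\<psi> r))"
    using P.Fubini_integral[OF int] by (simp add: set_lebesgue_integral_def)
  show 3: "set_integrable lborel {s<..t} (\<lambda>r. expectation (\<psi> r))"
    using P.integrable_fst[OF int] by (simp add: set_integrable_def)
  have "(LINT r:{s<..t}|lborel. expectation (\<psi> r)) \<le> (LINT r:{s<..t}|lborel. c)"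
    by (rule set_integral_mono[OF 3]) (use le in \<open>auto simp: set_integrable_def\<close>)
  also have "\<dots> = (t - s) * c" using st by (simp add: set_lebesgue_integral_def)
  finally show "expectation (\<lambda>w. LINT r:{s<..t}|lborel. \<psi> r w) \<le> (t - s) * c" using 2 by simp
qed

text \<open>Unrolling the recursion gives at most \<open>i\<close> terms
  \<open>e * (1 + k) ^ j\<close> with \<open>j < i\<close>, each bounded by
  \<open>e * (1 + k) ^ i\<close>. The crude factor \<open>i\<close> is harmless: the estimate is
  applied with \<open>e\<close> proportional to the mesh.\<close>

lemma discrete_gronwall:
  fixes x :: "nat \<Rightarrow> real"
  assumes "x 0 \<le> 0" "k \<ge> 0" "e \<ge> 0" and "\<And>i. i < n \<Longrightarrow> x (Suc i) \<le> (1 + k) * x i + e"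
  shows "i \<le> n \<Longrightarrow> x i \<le> real i * e * (1 + k) ^ i"
proof (induction i)
  case 0 then show ?case using assms by simp
next
  case (Suc i)
  have "x (Suc i) \<le> (1 + k) * x i + e" using assms Suc by simp
  also have "\<dots> \<le> (1 + k) * (real i * e * (1 + k) ^ i) + e"
    using Suc assms by (intro add_right_mono mult_left_mono) auto
  also have "\<dots> \<le> (1 + k) * (real i * e * (1 + k) ^ i) + e * (1 + k) ^ Suc i"
    using assms by (intro add_left_mono) (simp add: mult_left_le[of _ "e"] one_le_power mult_ge1_I mult_le_cancel_left1 del: power_Suc)
  also have "\<dots> = real (Suc i) * e * (1 + k) ^ Suc i" by (simp add: algebra_simps)
  finally show ?case .
qed

text \<open>In the square of the sum, the cross term of the state with \<open>m\<close> has mean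
  zero by \<open>orth\<close>. The remaining \<open>|m + B|^2\<close> is split with weight
  \<open>\<theta>\<close>: when \<open>\<theta>\<close> is the root of the step length and
  \<open>c\<close> proportional to the step length, both \<open>\<theta> * E |m|^2\<close> and
  \<open>c^2 / \<theta>\<close> are of higher order than the step, and the coefficient of
  \<open>E |m|^2\<close> tends to 1.\<close>

lemma (in prob_space) energy_step:
  fixes Z\<^sub>s Z\<^sub>t m B :: "'a \<Rightarrow> 'v::euclidean_space"
  assumes [measurable]: "Z\<^sub>s \<in> borel_measurable M" "m \<in> borel_measurable M" "B \<in> borel_measurable M"
    "Z\<^sub>t \<in> borel_measurable M"
    and Z: "integrable M (\<lambda>w. (norm (Z\<^sub>s w))\<^sup>2)" and m: "integrable M (\<lambda>w. (norm (m w))\<^sup>2)"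
    and B: "\<And>w. w \<in> space M \<Longrightarrow> norm (B w) \<le> c"
    and inc: "AE w in M. Z\<^sub>t w = Z\<^sub>s w + B w + m w"
    and orth: "expectation (\<lambda>w. Z\<^sub>s w \<bullet> m w) = 0" and \<theta>: "\<theta> > 0"
  shows "expectation (\<lambda>w. (norm (Z\<^sub>t w))\<^sup>2) \<le> expectation (\<lambda>w. (norm (Z\<^sub>s w))\<^sup>2)
      + 2 * expectation (\<lambda>w. Z\<^sub>s w \<bullet> B w) + (1 + \<theta>) * expectation (\<lambda>w. (norm (m w))\<^sup>2) + (1 + 1 / \<theta>) * c\<^sup>2"
proof -
  have iB: "integrable M (\<lambda>w. (norm (B w))\<^sup>2)" by (rule integrable_sq_bounded) (use B in auto)
  have i1: "integrable M (\<lambda>w. Z\<^sub>s w \<bullet> B w)" by (rule sq_integrable_inner) (use Z iB in auto)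
  have i2: "integrable M (\<lambda>w. Z\<^sub>s w \<bullet> m w)" by (rule sq_integrable_inner) (use Z m in auto)
  have i3: "integrable M (\<lambda>w. (norm (m w + B w))\<^sup>2)" by (rule sq_integrable_add) (use m iB in auto)
  have "expectation (\<lambda>w. (norm (Z\<^sub>t w))\<^sup>2) =
      expectation (\<lambda>w. (norm (Z\<^sub>s w))\<^sup>2 + 2 * (Z\<^sub>s w \<bullet> B w) + 2 * (Z\<^sub>s w \<bullet> m w) + (norm (m w + B w))\<^sup>2)"
  proof (rule integral_cong_AE)
    show "AE w in M. (norm (Z\<^sub>t w))\<^sup>2 =
        (norm (Z\<^sub>s w))\<^sup>2 + 2 * (Z\<^sub>s w \<bullet> B w) + 2 * (Z\<^sub>s w \<bullet> m w) + (norm (m w + B w))\<^sup>2"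
      using inc by eventually_elim (simp add: power2_norm_eq_inner inner_add_left inner_add_right inner_commute algebra_simps)
  qed simp_all
  also have "\<dots> = expectation (\<lambda>w. (norm (Z\<^sub>s w))\<^sup>2) + 2 * expectation (\<lambda>w. Z\<^sub>s w \<bullet> B w)
      + expectation (\<lambda>w. (norm (m w + B w))\<^sup>2)"
    using Z i1 i2 i3 orth by simp
  also have "expectation (\<lambda>w. (norm (m w + B w))\<^sup>2)
      \<le> expectation (\<lambda>w. (1 + \<theta>) * (norm (m w))\<^sup>2 + (1 + 1 / \<theta>) * c\<^sup>2)"
  proof (rule integral_mono[OF i3])
    show "integrable M (\<lambda>w. (1 + \<theta>) * (norm (m w))\<^sup>2 + (1 + 1 / \<theta>) * c\<^sup>2)" using m by simp
    fix w assume "w \<in> space M"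
    then have "(1 + 1 / \<theta>) * (norm (B w))\<^sup>2 \<le> (1 + 1 / \<theta>) * c\<^sup>2"
      using B \<theta> by (intro mult_left_mono power_mono) auto
    then show "(norm (m w + B w))\<^sup>2 \<le> (1 + \<theta>) * (norm (m w))\<^sup>2 + (1 + 1 / \<theta>) * c\<^sup>2"
      using norm_add_sq_le[OF \<theta>, of "m w" "B w"] by linarith
  qed
  also have "\<dots> = (1 + \<theta>) * expectation (\<lambda>w. (norm (m w))\<^sup>2) + (1 + 1 / \<theta>) * c\<^sup>2"
    using m by (simp add: prob_space)
  finally show ?thesis by simp
qed

lemma set_integrable_bounded_interval:
  fixes f :: "real \<Rightarrow> 'v::euclidean_space"
  assumes [measurable]: "f \<in> borel_measurable borel" and bd: "\<And>r. s < r \<Longrightarrow> r \<le> t \<Longrightarrow> norm (f r) \<le> C" and st: "s \<le> t"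
  shows "set_integrable lborel {s<..t} f" and "norm (LINT r:{s<..t}|lborel. f r) \<le> C * (t - s)"
proof -
  have i0: "integrable lborel (\<lambda>r. indicator {s<..t} r * C :: real)" by simp
  have le: "norm (indicator {s<..t} r *\<^sub>R f r) \<le> indicator {s<..t} r * C" for r
    using bd[of r] by (auto simp: indicator_def)
  show 1: "set_integrable lborel {s<..t} f" unfolding set_integrable_def
    by (rule Bochner_Integration.integrable_bound[OF i0]) (use le in \<open>auto intro!: AE_I2 intro: order_trans[OF _ abs_ge_self]\<close>)
  have "norm (LINT r:{s<..t}|lborel. f r) \<le> (\<integral>r. indicator {s<..t} r * C \<partial>lborel)"
    unfolding set_lebesgue_integral_def
    by (rule Bochner_Integration.integral_norm_bound_integral[OF 1[unfolded set_integrable_def] i0 le])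
  also have "\<dots> = C * (t - s)" using st by simp
  finally show "norm (LINT r:{s<..t}|lborel. f r) \<le> C * (t - s)" .
qed

text \<open>No Ito formula is used: one grid step is controlled up to an error of order
  \<open>(t - s) * sqrt (t - s)\<close>, and these errors sum to the order of the root of the mesh.
  A step produces the pairing of the drift with the state \<open>Z s\<close> at its left end,
  whereas \<open>main\<close> concerns the state \<open>Z r\<close> at the time of the drift;
  exchanging them costs a multiple of \<open>C * E |Z r - Z s|\<close>, which is of order
  \<open>sqrt (t - s)\<close>.\<close>

lemma (in prob_space) energy_estimate:
  fixes Z :: "real \<Rightarrow> 'a \<Rightarrow> 'v::euclidean_space" and \<beta> :: "real \<Rightarrow> 'a \<Rightarrow> 'v" and \<alpha> :: "real \<Rightarrow> 'a \<Rightarrow> real"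
    and m :: "real \<Rightarrow> real \<Rightarrow> 'a \<Rightarrow> 'v"
  assumes pos: "0 \<le> T" "0 \<le> C" "0 \<le> A" "0 \<le> k" "0 \<le> \<epsilon>"
    and Zm: "\<And>r. 0 \<le> r \<Longrightarrow> r \<le> T \<Longrightarrow> Z r \<in> borel_measurable M"
    and Zi: "\<And>r. 0 \<le> r \<Longrightarrow> r \<le> T \<Longrightarrow> integrable M (\<lambda>w. (norm (Z r w))\<^sup>2)"
    and ZQ: "\<And>r. 0 \<le> r \<Longrightarrow> r \<le> T \<Longrightarrow> expectation (\<lambda>w. (norm (Z r w))\<^sup>2) \<le> Q"
    and \<beta>m[measurable]: "(\<lambda>(r, w). \<beta> r w) \<in> borel_measurable (borel \<Otimes>\<^sub>M M)"
    and \<beta>b: "\<And>r w. w \<in> space M \<Longrightarrow> norm (\<beta> r w) \<le> C"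
    and \<alpha>m[measurable]: "(\<lambda>(r, w). \<alpha> r w) \<in> borel_measurable (borel \<Otimes>\<^sub>M M)"
    and \<alpha>b: "\<And>r w. w \<in> space M \<Longrightarrow> 0 \<le> \<alpha> r w \<and> \<alpha> r w \<le> A"
    and mm: "\<And>s t. 0 \<le> s \<Longrightarrow> s \<le> t \<Longrightarrow> t \<le> T \<Longrightarrow> m s t \<in> borel_measurable M"
    and mi: "\<And>s t. 0 \<le> s \<Longrightarrow> s \<le> t \<Longrightarrow> t \<le> T \<Longrightarrow> integrable M (\<lambda>w. (norm (m s t w))\<^sup>2)"
    and mle: "\<And>s t. 0 \<le> s \<Longrightarrow> s \<le> t \<Longrightarrow> t \<le> T \<Longrightarrow>
      expectation (\<lambda>w. (norm (m s t w))\<^sup>2) \<le> (LINT r:{s<..t}|lborel. expectation (\<alpha> r))"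
    and inc: "\<And>s t. 0 \<le> s \<Longrightarrow> s \<le> t \<Longrightarrow> t \<le> T \<Longrightarrow>
      AE w in M. Z t w = Z s w + (LINT r:{s<..t}|lborel. \<beta> r w) + m s t w"
    and orth: "\<And>s t. 0 \<le> s \<Longrightarrow> s \<le> t \<Longrightarrow> t \<le> T \<Longrightarrow> expectation (\<lambda>w. Z s w \<bullet> m s t w) = 0"
    and main: "\<And>r. 0 < r \<Longrightarrow> r \<le> T \<Longrightarrow> expectation (\<lambda>w. 2 * (Z r w \<bullet> \<beta> r w) + \<alpha> r w)
      \<le> k * expectation (\<lambda>w. (norm (Z r w))\<^sup>2) + \<epsilon>"
    and Z0: "expectation (\<lambda>w. (norm (Z 0 w))\<^sup>2) = 0"
  shows "expectation (\<lambda>w. (norm (Z T w))\<^sup>2) \<le> \<epsilon> * T * exp (k * T)"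
proof -
  define \<phi> where "\<phi> r = expectation (\<lambda>w. (norm (Z r w))\<^sup>2)" for r
  \<comment> \<open>Mean-square Lipschitz constant of \<open>Z\<close> in time: twice the squared
    drift, where \<open>(r - s)^2 <= (r - s) * T\<close>, plus twice the martingale part.\<close>
  define D where "D = 2 * C\<^sup>2 * T + 2 * A"
  \<comment> \<open>Collects the coefficients of \<open>(t - s) * sqrt (t - s)\<close> in
    \<open>step\<close>: \<open>A\<close> comes from the weight on the martingale square, the two
    terms with \<open>C^2\<close> from the squared drift, the term with \<open>k\<close> from
    replacing \<open>\<phi> r\<close> by \<open>\<phi> s\<close>, and the last one from replacing
    \<open>Z s\<close> by \<open>Z r\<close> in the pairing.\<close>
  define c0 where "c0 = A + C\<^sup>2 * sqrt T + C\<^sup>2 + k * (Q + D + D * sqrt T) + C * (1 + D)"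
  have \<phi>0: "0 \<le> \<phi> r" for r by (simp add: \<phi>_def)
  have Q0: "0 \<le> Q" using order_trans[OF \<phi>0[of 0] ZQ[of 0, folded \<phi>_def]] pos by simp
  have D0: "0 \<le> D" using pos by (simp add: D_def)
  have c00: "0 \<le> c0" using pos Q0 D0 by (simp add: c0_def)
  have mA: "expectation (\<lambda>w. (norm (m s t w))\<^sup>2) \<le> A * (t - s)" if "0 \<le> s" "s \<le> t" "t \<le> T" for s t
  proof -
    have e: "expectation (\<alpha> r) \<le> A" for r
    proof -
      have "expectation (\<alpha> r) \<le> expectation (\<lambda>_. A)"
        by (intro integral_mono integrable_const_bound[where B=A]) (use pos \<alpha>b in \<open>auto intro!: AE_I2\<close>)
      then show ?thesis by (simp add: prob_space)
    qed
    have "(LINT r:{s<..t}|lborel. expectation (\<alpha> r)) \<le> norm (LINT r:{s<..t}|lborel. expectation (\<alpha> r))" by simp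
    also have "\<dots> \<le> A * (t - s)"
      using that \<alpha>b e by (intro set_integrable_bounded_interval) (auto intro!: Bochner_Integration.integral_nonneg)
    finally show ?thesis using mle[OF that] by simp
  qed
  have Bm: "(\<lambda>w. LINT r:{s<..t}|lborel. \<beta> r w) \<in> borel_measurable M" for s t
    unfolding set_lebesgue_integral_def by measurable
  have Bb: "norm (LINT r:{s<..t}|lborel. \<beta> r w) \<le> C * (t - s)" if "s \<le> t" "w \<in> space M" for s t w
    using that \<beta>b by (intro set_integrable_bounded_interval) auto
  have incr: "expectation (\<lambda>w. (norm (Z r w - Z s w))\<^sup>2) \<le> D * (r - s)"
    if sr: "0 \<le> s" "s \<le> r" "r \<le> T" for s r
  proof -
    note [measurable] = Zm[of s] Zm[of r] mm[OF sr]
    have "expectation (\<lambda>w. (norm (Z r w - Z s w))\<^sup>2) \<le> expectation (\<lambda>w. 2 * (C * (r - s))\<^sup>2 + 2 * (norm (m s r w))\<^sup>2)"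
    proof (rule integral_mono_AE)
      show "integrable M (\<lambda>w. (norm (Z r w - Z s w))\<^sup>2)" using sr Zm Zi by (intro sq_integrable_diff) auto
      show "integrable M (\<lambda>w. 2 * (C * (r - s))\<^sup>2 + 2 * (norm (m s r w))\<^sup>2)" using mi sr by simp
      show "AE w in M. (norm (Z r w - Z s w))\<^sup>2 \<le> 2 * (C * (r - s))\<^sup>2 + 2 * (norm (m s r w))\<^sup>2"
        using inc[OF sr] AE_space
      proof eventually_elim
        case (elim w)
        have "(norm (LINT r:{s<..r}|lborel. \<beta> r w))\<^sup>2 \<le> (C * (r - s))\<^sup>2"
          using Bb[OF sr(2) elim(2)] by (intro power_mono) auto
        then show ?case using norm_add_sq_le2[of "LINT r:{s<..r}|lborel. \<beta> r w" "m s r w"] elim(1) by simp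
      qed
    qed
    also have "\<dots> = 2 * (C * (r - s))\<^sup>2 + 2 * expectation (\<lambda>w. (norm (m s r w))\<^sup>2)" using mi sr by (simp add: prob_space)
    also have "\<dots> \<le> 2 * C\<^sup>2 * ((r - s) * T) + 2 * (A * (r - s))"
    proof -
      have "(C * (r - s))\<^sup>2 = C\<^sup>2 * ((r - s) * (r - s))" by (simp add: power_mult_distrib power2_eq_square)
      also have "\<dots> \<le> C\<^sup>2 * ((r - s) * T)" using sr by (intro mult_left_mono) auto
      finally show ?thesis using mA[OF sr] by linarith
    qed
    finally show ?thesis by (simp add: D_def algebra_simps)
  qed
  have step: "\<phi> t \<le> \<phi> s + (t - s) * (k * \<phi> s + \<epsilon>) + c0 * (t - s) * sqrt (t - s)"
    if st: "0 \<le> s" "s < t" "t \<le> T" for s t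
  proof -
    define \<theta> where "\<theta> = sqrt (t - s)"
    have \<theta>: "\<theta> > 0" "\<theta>\<^sup>2 = t - s" "\<theta> \<le> sqrt T" using st by (auto simp: \<theta>_def)
    define B where "B w = (LINT r:{s<..t}|lborel. \<beta> r w)" for w
    define c where "c = k * \<phi> s + \<epsilon> + \<theta> * (k * (Q + D + D * sqrt T) + C * (1 + D))"
    have st': "s \<le> t" using st by simp
    note [measurable] = Zm[of s] Zm[of t] mm[OF st(1) st' st(3)] Bm
    have Zs[measurable]: "Z s \<in> borel_measurable M" and Zt[measurable]: "Z t \<in> borel_measurable M"
      using Zm st by auto
    have iZs: "integrable M (\<lambda>w. norm (Z s w))" using Zi[of s] st by (intro sq_integrable_norm) auto
    have pc: "expectation (\<lambda>w. 2 * (Z s w \<bullet> \<beta> r w) + \<alpha> r w) \<le> c" if r: "s < r" "r \<le> t" for r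
    proof -
      have r': "0 \<le> r" "r \<le> T" "s \<le> r" "0 < r" using r st by auto
      note Zr[measurable] = Zm[OF r'(1,2)]
      have rs: "r - s \<le> \<theta>\<^sup>2" using r \<theta> by simp
      have d2: "expectation (\<lambda>w. (norm (Z r w - Z s w))\<^sup>2) \<le> D * \<theta>\<^sup>2"
        using incr[OF st(1) r'(3,2)] mult_left_mono[OF rs D0] by linarith
      have id: "integrable M (\<lambda>w. (norm (Z r w - Z s w))\<^sup>2)" using Zi[of r] Zi[of s] st r' by (intro sq_integrable_diff) auto
      have d1: "expectation (\<lambda>w. norm (Z r w - Z s w)) \<le> (1 + D) * \<theta> / 2"
        using d2 \<theta> id by (intro expectation_norm_le) auto
      have idn: "integrable M (\<lambda>w. norm (Z r w - Z s w))" using id by (intro sq_integrable_norm) auto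
      have ib: "integrable M (\<lambda>w. (norm (\<beta> r w))\<^sup>2)" by (rule integrable_sq_bounded) (use \<beta>b in auto)
      have ia: "integrable M (\<alpha> r)" by (rule integrable_const_bound[where B=A]) (use \<alpha>b in \<open>auto intro!: AE_I2\<close>)
      have i1: "integrable M (\<lambda>w. Z s w \<bullet> \<beta> r w)" using Zi[of s] st ib by (intro sq_integrable_inner) auto
      have i2: "integrable M (\<lambda>w. Z r w \<bullet> \<beta> r w)" using Zi[of r] r' ib by (intro sq_integrable_inner) auto
      have "expectation (\<lambda>w. 2 * (Z s w \<bullet> \<beta> r w) + \<alpha> r w)
          \<le> expectation (\<lambda>w. (2 * (Z r w \<bullet> \<beta> r w) + \<alpha> r w) + 2 * C * norm (Z r w - Z s w))"
      proof (rule integral_mono)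
        fix w assume o: "w \<in> space M"
        have "Z s w \<bullet> \<beta> r w - Z r w \<bullet> \<beta> r w \<le> norm (Z r w - Z s w) * norm (\<beta> r w)"
          using norm_cauchy_schwarz[of "Z s w - Z r w" "\<beta> r w"] by (simp add: inner_diff_left norm_minus_commute)
        also have "\<dots> \<le> norm (Z r w - Z s w) * C" using \<beta>b[OF o] by (intro mult_left_mono) auto
        finally show "2 * (Z s w \<bullet> \<beta> r w) + \<alpha> r w
          \<le> (2 * (Z r w \<bullet> \<beta> r w) + \<alpha> r w) + 2 * C * norm (Z r w - Z s w)" by (simp add: algebra_simps)
      qed (use i1 i2 ia idn in auto)
      also have "\<dots> = expectation (\<lambda>w. 2 * (Z r w \<bullet> \<beta> r w) + \<alpha> r w) + 2 * C * expectation (\<lambda>w. norm (Z r w - Z s w))"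
        using i2 ia idn by simp
      also have "\<dots> \<le> (k * \<phi> r + \<epsilon>) + 2 * C * ((1 + D) * \<theta> / 2)"
        using main[OF r'(4,2)] d1 pos unfolding \<phi>_def by (intro add_mono mult_left_mono) auto
      finally have 1: "expectation (\<lambda>w. 2 * (Z s w \<bullet> \<beta> r w) + \<alpha> r w) \<le> k * \<phi> r + \<epsilon> + C * (1 + D) * \<theta>" by simp
      \<comment> \<open>With the weight \<open>\<theta>\<close> in the split, the loss is
        \<open>\<theta> * \<phi> s + (1 + 1/\<theta>) * D * \<theta>^2\<close>, which is of order
        \<open>\<theta>\<close>.\<close>
      have "\<phi> r \<le> \<phi> s + \<theta> * (Q + D + D * sqrt T)"
      proof -
        have "\<phi> r \<le> expectation (\<lambda>w. (1 + \<theta>) * (norm (Z s w))\<^sup>2 + (1 + 1 / \<theta>) * (norm (Z r w - Z s w))\<^sup>2)"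
          unfolding \<phi>_def
        proof (rule integral_mono)
          fix w
          show "(norm (Z r w))\<^sup>2 \<le> (1 + \<theta>) * (norm (Z s w))\<^sup>2 + (1 + 1 / \<theta>) * (norm (Z r w - Z s w))\<^sup>2"
            using norm_add_sq_le[OF \<theta>(1), of "Z s w" "Z r w - Z s w"] by simp
        qed (use Zi[of r] Zi[of s] st r' id in auto)
        also have "\<dots> = (1 + \<theta>) * \<phi> s + (1 + 1 / \<theta>) * expectation (\<lambda>w. (norm (Z r w - Z s w))\<^sup>2)"
          unfolding \<phi>_def using Zi[of s] st id by simp
        also have "\<dots> \<le> (1 + \<theta>) * \<phi> s + (1 + 1 / \<theta>) * (D * \<theta>\<^sup>2)"
          using d2 \<theta> by (intro add_left_mono mult_left_mono) auto
        also have "\<dots> = \<phi> s + \<theta> * (\<phi> s + D + D * \<theta>)" using \<theta> by (simp add: field_simps power2_eq_square)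
        also have "\<dots> \<le> \<phi> s + \<theta> * (Q + D + D * sqrt T)"
          using ZQ[of s] st \<theta> D0 by (intro add_left_mono mult_left_mono add_mono) (auto simp: \<phi>_def)
        finally show ?thesis .
      qed
      then have "k * \<phi> r \<le> k * (\<phi> s + \<theta> * (Q + D + D * sqrt T))" using pos by (intro mult_left_mono)
      with 1 show ?thesis by (simp add: c_def algebra_simps)
    qed
    have b\<psi>: "\<bar>2 * (Z s w \<bullet> \<beta> r w) + \<alpha> r w\<bar> \<le> 2 * C * norm (Z s w) + A" if o: "w \<in> space M" for r w
    proof -
      have "\<bar>Z s w \<bullet> \<beta> r w\<bar> \<le> norm (Z s w) * C"
        by (rule order_trans[OF Cauchy_Schwarz_ineq2]) (intro mult_left_mono \<beta>b[OF o] norm_ge_zero)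
      then show ?thesis using \<alpha>b[OF o, of r] by (simp add: abs_le_iff) (auto simp: algebra_simps)
    qed
    have iY: "integrable M (\<lambda>w. 2 * C * norm (Z s w) + A)" using iZs by simp
    have b\<psi>2: "\<bar>\<alpha> r w\<bar> \<le> A" if o: "w \<in> space M" for r w using \<alpha>b[OF o, of r] by simp
    have iA: "integrable M (\<lambda>_. A)" by simp
    have eA: "expectation (\<alpha> r) \<le> A" for r
      proof -
      have "expectation (\<alpha> r) \<le> expectation (\<lambda>_. A)"
        by (intro integral_mono integrable_const_bound[where B=A]) (use pos \<alpha>b in \<open>auto intro!: AE_I2\<close>)
      then show ?thesis by (simp add: prob_space)
    qed
    have m\<psi>: "(\<lambda>(r, w). 2 * (Z s w \<bullet> \<beta> r w) + \<alpha> r w) \<in> borel_measurable (borel \<Otimes>\<^sub>M M)" by measurable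
    note F = expectation_time_integral_le[OF m\<psi> iY b\<psi> st' pc, simplified]
    note G = expectation_time_integral_le[OF \<alpha>m iA b\<psi>2 st' eA, simplified]
    have sB: "set_integrable lborel {s<..t} (\<lambda>r. \<beta> r w)" if o: "w \<in> space M" for w
      by (rule set_integrable_bounded_interval[OF _ _ st']) (use \<beta>b[OF o] o in auto)
    have sA: "set_integrable lborel {s<..t} (\<lambda>r. \<alpha> r w)" if o: "w \<in> space M" for w
      by (rule set_integrable_bounded_interval[OF _ _ st']) (use b\<psi>2[OF o] o in auto)
    have split: "(LINT r:{s<..t}|lborel. 2 * (Z s w \<bullet> \<beta> r w) + \<alpha> r w) = 2 * (Z s w \<bullet> B w) + (LINT r:{s<..t}|lborel. \<alpha> r w)"
      if o: "w \<in> space M" for w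
    proof -
      have "Z s w \<bullet> B w = (LINT r:{s<..t}|lborel. Z s w \<bullet> \<beta> r w)"
        using integral_inner_right[OF sB[OF o, unfolded set_integrable_def], of "Z s w"]
        by (simp add: B_def set_lebesgue_integral_def)
      moreover have "set_integrable lborel {s<..t} (\<lambda>r. Z s w \<bullet> \<beta> r w)"
        using integrable_inner_right[OF sB[OF o, unfolded set_integrable_def], of "Z s w"]
        by (simp add: set_integrable_def)
      ultimately show ?thesis using sA[OF o] by (simp add: set_integral_add)
    qed
    have iB2: "integrable M (\<lambda>w. Z s w \<bullet> B w)"
    proof (rule sq_integrable_inner)
      show "integrable M (\<lambda>w. (norm (B w))\<^sup>2)"
        by (rule integrable_sq_bounded[where C="C * (t - s)"]) (use Bb[OF st'] Bm[of s t] in \<open>auto simp: B_def\<close>)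
    qed (use Zi[of s] st Bm[of s t] in \<open>auto simp: B_def\<close>)
    have "2 * expectation (\<lambda>w. Z s w \<bullet> B w) + expectation (\<lambda>w. (norm (m s t w))\<^sup>2)
       \<le> 2 * expectation (\<lambda>w. Z s w \<bullet> B w) + expectation (\<lambda>w. LINT r:{s<..t}|lborel. \<alpha> r w)"
      using mle[OF st(1) st' st(3)] G(2) by simp
    also have "\<dots> = expectation (\<lambda>w. 2 * (Z s w \<bullet> B w) + (LINT r:{s<..t}|lborel. \<alpha> r w))"
      using iB2 G(1) by simp
    also have "\<dots> = expectation (\<lambda>w. LINT r:{s<..t}|lborel. 2 * (Z s w \<bullet> \<beta> r w) + \<alpha> r w)"
      by (rule Bochner_Integration.integral_cong) (simp_all add: split)
    also have "\<dots> \<le> (t - s) * c" by (rule F(4))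
    finally have 1: "2 * expectation (\<lambda>w. Z s w \<bullet> B w) + expectation (\<lambda>w. (norm (m s t w))\<^sup>2) \<le> (t - s) * c" .
    have "\<phi> t \<le> \<phi> s + 2 * expectation (\<lambda>w. Z s w \<bullet> B w) + (1 + \<theta>) * expectation (\<lambda>w. (norm (m s t w))\<^sup>2)
        + (1 + 1 / \<theta>) * (C * (t - s))\<^sup>2"
      unfolding \<phi>_def
      using Bm[of s t] Bb[OF st'] inc[OF st(1) st' st(3)] orth[OF st(1) st' st(3)] \<theta>(1) mi[OF st(1) st' st(3)] Zi[of s] st
      by (intro energy_step) (auto simp: B_def)
    also have "\<dots> \<le> \<phi> s + (t - s) * c + \<theta> * (A * (t - s)) + (1 + 1 / \<theta>) * (C * (t - s))\<^sup>2"
      using 1 mult_left_mono[OF mA[OF st(1) st' st(3)], of \<theta>] \<theta> by (simp add: algebra_simps)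
    also have "(1 + 1 / \<theta>) * (C * (t - s))\<^sup>2 = C\<^sup>2 * ((t - s) * \<theta>) * \<theta> + C\<^sup>2 * ((t - s) * \<theta>)"
      using \<theta>(1) unfolding \<theta>(2)[symmetric] by (simp add: field_simps power2_eq_square)
    also have "C\<^sup>2 * ((t - s) * \<theta>) * \<theta> \<le> C\<^sup>2 * ((t - s) * \<theta>) * sqrt T"
      using \<theta> st by (intro mult_left_mono) auto
    finally show ?thesis unfolding c_def c0_def \<theta>_def[symmetric] by (simp add: algebra_simps)
  qed
  \<comment> \<open>With \<open>h = T / Suc n\<close>, the \<open>Suc n\<close> errors of size
    \<open>c0 * h * sqrt h\<close> add up to \<open>c0 * T * sqrt h\<close>, which vanishes as
    \<open>n\<close> grows, while \<open>(1 + k * h) ^ Suc n\<close> stays below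
    \<open>exp (k * T)\<close>.\<close>
  have grid: "\<phi> T \<le> T * (\<epsilon> + c0 * sqrt (T / real (Suc n))) * exp (k * T)" if T: "T > 0" for n
  proof -
    define h where "h = T / real (Suc n)"
    have h: "h > 0" "real (Suc n) * h = T" using T by (auto simp: h_def)
    have "\<phi> (real (Suc i) * h) \<le> (1 + k * h) * \<phi> (real i * h) + h * (\<epsilon> + c0 * sqrt h)" if "i < Suc n" for i
    proof -
      have "real (Suc i) * h \<le> T" using that h by (metis Suc_leI mult_right_mono less_imp_le of_nat_le_iff)
      then show ?thesis using step[of "real i * h" "real (Suc i) * h"] h by (simp add: algebra_simps)
    qed
    note st = this
    have "\<phi> (real (Suc n) * h) \<le> real (Suc n) * (h * (\<epsilon> + c0 * sqrt h)) * (1 + k * h) ^ Suc n"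
      by (rule discrete_gronwall[where x="\<lambda>i. \<phi> (real i * h)" and n="Suc n", OF _ _ _ st])
        (use pos h(1) c00 Z0 in \<open>simp_all add: \<phi>_def\<close>)
    also have "\<dots> \<le> real (Suc n) * (h * (\<epsilon> + c0 * sqrt h)) * exp (k * h) ^ Suc n"
      using pos h(1) c00 by (intro mult_left_mono power_mono exp_ge_add_one_self) auto
    also have "exp (k * h) ^ Suc n = exp (k * T)"
      unfolding exp_of_nat_mult[symmetric] using arg_cong[OF h(2), of "\<lambda>x. exp (k * x)"] by (simp add: algebra_simps)
    also have "real (Suc n) * (h * (\<epsilon> + c0 * sqrt h)) = T * (\<epsilon> + c0 * sqrt h)"
      unfolding h(2)[symmetric] by (simp only: mult.assoc)
    finally show ?thesis unfolding h(2) by (simp only: h_def)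
  qed
  show ?thesis
  proof (cases "T = 0")
    case True then show ?thesis using Z0 by simp
  next
    case False
    then have T: "T > 0" using pos by simp
    have "(\<lambda>n. sqrt (T / real (Suc n))) \<longlonglongrightarrow> sqrt 0"
      by (intro tendsto_real_sqrt LIMSEQ_Suc lim_const_over_n)
    then have "(\<lambda>n. T * (\<epsilon> + c0 * sqrt (T / real (Suc n))) * exp (k * T)) \<longlonglongrightarrow> T * (\<epsilon> + c0 * 0) * exp (k * T)"
      by (intro tendsto_intros) simp
    then have "\<phi> T \<le> T * (\<epsilon> + c0 * 0) * exp (k * T)"
      by (rule LIMSEQ_le_const) (use grid[OF T] in auto)
    then show ?thesis by (simp add: \<phi>_def mult.commute)
  qed
qed

section \<open>Integration against a noise\<close>

locale filtered_prob = prob_space M for M :: "'w measure" +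
  fixes F :: "real \<Rightarrow> 'w measure"
  assumes filt: "filtered_prob_space M F"
begin

lemma subalgebra_F: "subalgebra M (F t)"
  using filt by (simp add: filtered_prob_space_def)

lemma space_F [simp]: "space (F t) = space M"
  using subalgebra_F by (simp add: subalgebra_def)

lemma sets_F_mono: "s \<le> t \<Longrightarrow> sets (F s) \<subseteq> sets (F t)"
  using filt filtration.sets_F_mono[of "space M" F s t] by (simp add: filtered_prob_space_def)

lemma measurable_F_mono: "X \<in> measurable (F s) N \<Longrightarrow> s \<le> t \<Longrightarrow> X \<in> measurable (F t) N"
  using sets_F_mono[of s t] by (auto simp: measurable_def)

lemma measurable_F_M: "X \<in> measurable (F s) N \<Longrightarrow> X \<in> measurable M N"
  using measurable_from_subalg[OF subalgebra_F] .

end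

section \<open>Elementary integrals and their isometry\<close>

definition step_total :: "('u set \<Rightarrow> real \<Rightarrow> 'w \<Rightarrow> real) \<Rightarrow> ('w, 'u, 'd::finite) simple_jump_integrand \<Rightarrow> 'w \<Rightarrow> real^'d" where
  "step_total R hs w = (\<Sum>(a, b, A, \<xi>)\<leftarrow>hs. (R A b w - R A a w) *\<^sub>R \<xi> w)"

definition step_integral ::
    "('u set \<Rightarrow> real \<Rightarrow> 'w \<Rightarrow> real) \<Rightarrow> ('w, 'u, 'd::finite) simple_jump_integrand \<Rightarrow> real \<Rightarrow> 'w \<Rightarrow> real^'d" where
  "step_integral R hs t w = (\<Sum>(a, b, A, \<xi>)\<leftarrow>hs. (R A (min b t) w - R A (min a t) w) *\<^sub>R \<xi> w)"

text \<open>
  The part of an integrand which lives on the time interval \<open>(s, t]\<close>.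
\<close>

definition clip :: "real \<Rightarrow> real \<Rightarrow> ('w, 'u, 'd::finite) simple_jump_integrand \<Rightarrow> ('w, 'u, 'd) simple_jump_integrand" where
  "clip s t hs = map (\<lambda>(a, b, A, \<xi>). (max s (min a t), max s (min b t), A, \<xi>)) (filter (\<lambda>(a, b, A, \<xi>). a \<le> t) hs)"

definition step_diff :: "('w, 'u, 'd::finite) simple_jump_integrand \<Rightarrow> ('w, 'u, 'd) simple_jump_integrand \<Rightarrow>
    ('w, 'u, 'd) simple_jump_integrand" where
  "step_diff hs hs' = hs @ map (\<lambda>(a, b, A, \<xi>). (a, b, A, \<lambda>w. - \<xi> w)) hs'"

lemma step_integral_diff:
  "step_integral R (step_diff hs hs') t w = step_integral R hs t w - step_integral R hs' t w"
  by (induction hs') (auto simp: step_integral_def step_diff_def algebra_simps)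

lemma step_value_diff:
  "simple_jump_value (step_diff hs hs') r u w = simple_jump_value hs r u w - simple_jump_value hs' r u w"
  by (induction hs') (auto simp: simple_jump_value_def step_diff_def algebra_simps)

text \<open>Reduces increments over \<open>(s, t]\<close> to integrals over the whole time axis, for
  which isometry and orthogonality are computed. Entries starting after \<open>t\<close> contribute
  nothing to the increment; \<open>clip\<close> drops them because their coefficients would not be
  measurable at the clipped starting time.\<close>

lemma step_total_clip:
  assumes "s \<le> t" "\<forall>(a, b, A, \<xi>)\<in>set hs. a \<le> b"
  shows "step_total R (clip s t hs) w = step_integral R hs t w - step_integral R hs s w"
  using assms(2)
proof (induction hs)
  case Nil then show ?case by (simp add: step_total_def clip_def step_integral_def)
next
  case (Cons h hs)
  obtain a b A \<xi> where h: "h = (a, b, A, \<xi>)" by (cases h)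
  have ab: "a \<le> b" using Cons.prems h by simp
  have "(if a \<le> t then (R A (max s (min b t)) w - R A (max s (min a t)) w) *\<^sub>R \<xi> w else 0)
      = (R A (min b t) w - R A (min a t) w) *\<^sub>R \<xi> w - (R A (min b s) w - R A (min a s) w) *\<^sub>R \<xi> w"
    using ab assms(1) by (auto simp: min_def max_def algebra_simps)
  then show ?case using Cons h by (auto simp: step_total_def clip_def step_integral_def algebra_simps)
qed

lemma simple_value_clip:
  assumes "s \<le> t"
  shows "simple_jump_value (clip s t hs) r u w = indicator {s<..t} r *\<^sub>R simple_jump_value hs r u w"
proof (induction hs)
  case Nil then show ?case by (simp add: clip_def simple_jump_value_def)
next
  case (Cons h hs)
  obtain a b A \<xi> where h: "h = (a, b, A, \<xi>)" by (cases h)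
  have "(if a \<le> t then (indicator {max s (min a t)<..max s (min b t)} r :: real) else 0)
      = indicator {s<..t} r * indicator {a<..b} r"
    using assms by (auto simp: min_def max_def indicator_def)
  then show ?case using Cons h
    by (auto simp: clip_def simple_jump_value_def algebra_simps split: if_splits)
qed

text \<open>The squared norm in \<open>L^2\<close> of time, probability and marks over
  \<open>(s, t]\<close>, as an iterated integral with the marks innermost; this is the order in
  which the pointwise bounds on the coefficients apply.\<close>

definition energy :: "'w measure \<Rightarrow> 'u measure \<Rightarrow> real \<Rightarrow> real \<Rightarrow> (real \<Rightarrow> 'u \<Rightarrow> 'w \<Rightarrow> 'b::real_normed_vector) \<Rightarrow> ennreal" where
  "energy M \<nu> s t G = (\<integral>\<^sup>+r. (\<integral>\<^sup>+w. sq_norm \<nu> (\<lambda>u. G r u w) \<partial>M) * indicator {s<..t} r \<partial>lborel)"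

text \<open>An orthogonal martingale measure with intensity \<open>dt \<nu>\<close>, where
  \<open>R A t\<close> plays the role of the mass of \<open>(0, t] \<times> A\<close>. Conditioning
  on \<open>F s\<close> is expressed by testing against bounded \<open>F s\<close>-measurable
  \<open>\<eta>\<close>. The covariance is stated for two mark sets because the entries of a simple
  integrand may overlap in the marks.\<close>

locale noise = filtered_prob M F for M :: "'w measure" and F +
  fixes \<nu> :: "'u measure" and R :: "'u set \<Rightarrow> real \<Rightarrow> 'w \<Rightarrow> real"
  assumes sigma_finite_marks: "sigma_finite_measure \<nu>"
    and R_adapted: "A \<in> fmeasurable \<nu> \<Longrightarrow> 0 \<le> t \<Longrightarrow> R A t \<in> borel_measurable (F t)"
    and R_sq: "A \<in> fmeasurable \<nu> \<Longrightarrow> 0 \<le> s \<Longrightarrow> s \<le> t \<Longrightarrow> integrable M (\<lambda>w. (R A t w - R A s w)\<^sup>2)"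
    and R_mean: "A \<in> fmeasurable \<nu> \<Longrightarrow> 0 \<le> s \<Longrightarrow> s \<le> t \<Longrightarrow> \<eta> \<in> borel_measurable (F s) \<Longrightarrow>
      (\<And>w. w \<in> space M \<Longrightarrow> \<bar>\<eta> w\<bar> \<le> C) \<Longrightarrow> expectation (\<lambda>w. \<eta> w * (R A t w - R A s w)) = 0"
    and R_cov: "A \<in> fmeasurable \<nu> \<Longrightarrow> B \<in> fmeasurable \<nu> \<Longrightarrow> 0 \<le> s \<Longrightarrow> s \<le> t \<Longrightarrow> \<eta> \<in> borel_measurable (F s) \<Longrightarrow>
      (\<And>w. w \<in> space M \<Longrightarrow> \<bar>\<eta> w\<bar> \<le> C) \<Longrightarrow>
      expectation (\<lambda>w. \<eta> w * ((R A t w - R A s w) * (R B t w - R B s w)))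
        = expectation \<eta> * ((t - s) * measure \<nu> (A \<inter> B))"
    and R_cadlag: "A \<in> fmeasurable \<nu> \<Longrightarrow> AE w in M. cadlag (\<lambda>t. R A t w)"
begin

sublocale N: sigma_finite_measure \<nu> by (rule sigma_finite_marks)

lemma R_measurable: "A \<in> fmeasurable \<nu> \<Longrightarrow> 0 \<le> t \<Longrightarrow> R A t \<in> borel_measurable M"
  using R_adapted measurable_F_M by blast

lemma integrable_bounded_mult:
  fixes \<eta> X :: "'w \<Rightarrow> real"
  assumes [measurable]: "\<eta> \<in> borel_measurable M" and b: "\<And>w. w \<in> space M \<Longrightarrow> \<bar>\<eta> w\<bar> \<le> C"
    and X: "integrable M X"
  shows "integrable M (\<lambda>w. \<eta> w * X w)"
proof (rule Bochner_Integration.integrable_bound)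
  show "integrable M (\<lambda>w. C * \<bar>X w\<bar>)" using X by simp
  have [measurable]: "X \<in> borel_measurable M" using X by simp
  show "(\<lambda>w. \<eta> w * X w) \<in> borel_measurable M" by simp
  show "AE w in M. norm (\<eta> w * X w) \<le> norm (C * \<bar>X w\<bar>)"
  proof (rule AE_I2)
    fix w assume "w \<in> space M"
    then have "\<bar>\<eta> w\<bar> \<le> \<bar>C\<bar>" using b by force
    then show "norm (\<eta> w * X w) \<le> norm (C * \<bar>X w\<bar>)" by (simp add: abs_mult mult_right_mono)
  qed
qed

lemma sq_integrable_mult:
  fixes X Y :: "'w \<Rightarrow> real"
  assumes "X \<in> borel_measurable M" "Y \<in> borel_measurable M"
    and "integrable M (\<lambda>w. (X w)\<^sup>2)" "integrable M (\<lambda>w. (Y w)\<^sup>2)"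
  shows "integrable M (\<lambda>w. X w * Y w)"
  using sq_integrable_inner[of X M Y] assms by simp

text \<open>The bounded test variables of \<open>R_mean\<close> are extended to square-integrable
  ones by truncation at level \<open>k\<close> and dominated convergence. A coefficient times an
  earlier increment, in general unbounded, is a test variable of this kind.\<close>

lemma R_mean_L2:
  assumes A: "A \<in> fmeasurable \<nu>" and st: "0 \<le> s" "s \<le> t" and \<eta>: "\<eta> \<in> borel_measurable (F s)"
    and sq: "integrable M (\<lambda>w. (\<eta> w)\<^sup>2)"
  shows "expectation (\<lambda>w. \<eta> w * (R A t w - R A s w)) = 0"
proof -
  have [measurable]: "\<eta> \<in> borel_measurable M" "R A t \<in> borel_measurable M" "R A s \<in> borel_measurable M"
    using \<eta> st by (auto intro: measurable_F_M R_measurable[OF A])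
  define \<eta>' where "\<eta>' k w = (if \<bar>\<eta> w\<bar> \<le> real k then \<eta> w else 0)" for k w
  have m: "\<eta>' k \<in> borel_measurable (F s)" for k unfolding \<eta>'_def using \<eta> by measurable
  have [measurable]: "\<eta>' k \<in> borel_measurable M" for k using measurable_F_M[OF m] .
  have "(\<lambda>k. expectation (\<lambda>w. \<eta>' k w * (R A t w - R A s w))) \<longlonglongrightarrow> expectation (\<lambda>w. \<eta> w * (R A t w - R A s w))"
  proof (rule integral_dominated_convergence)
    show "integrable M (\<lambda>w. \<bar>\<eta> w * (R A t w - R A s w)\<bar>)"
      using sq R_sq[OF A st] by (intro integrable_abs sq_integrable_mult) auto
    have "eventually (\<lambda>k. \<eta>' k w = \<eta> w) sequentially" for w
      using eventually_ge_at_top[of "nat \<lceil>\<bar>\<eta> w\<bar>\<rceil>"]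
      proof eventually_elim
        case (elim k)
        then have "\<bar>\<eta> w\<bar> \<le> real k" by linarith
        then show ?case by (simp add: \<eta>'_def)
      qed
    then show "AE w in M. (\<lambda>k. \<eta>' k w * (R A t w - R A s w)) \<longlonglongrightarrow> \<eta> w * (R A t w - R A s w)"
      by (intro AE_I2 tendsto_intros tendsto_eventually)
    show "AE w in M. norm (\<eta>' k w * (R A t w - R A s w)) \<le> \<bar>\<eta> w * (R A t w - R A s w)\<bar>" for k
      by (intro AE_I2) (auto simp: \<eta>'_def)
  qed simp_all
  moreover have "expectation (\<lambda>w. \<eta>' k w * (R A t w - R A s w)) = 0" for k
    by (rule R_mean[OF A st m, of _ "real k"]) (simp add: \<eta>'_def)
  ultimately show ?thesis by (simp add: LIMSEQ_const_iff)
qed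

text \<open>The intervals are cut at \<open>c\<close> and at the earlier of the two ends, giving
  \<open>X1\<close>, \<open>X2\<close>, \<open>X3\<close> and \<open>Y1\<close>, \<open>Y2\<close>.
  Increments over disjoint intervals have a product of mean zero against \<open>\<eta>\<close>, the
  earlier factor being measurable when the later interval begins; only \<open>X2 * Y1\<close>, over
  the common interval, survives.\<close>

lemma R_cov_ordered:
  assumes A: "A \<in> fmeasurable \<nu>" and B: "B \<in> fmeasurable \<nu>" and o: "0 \<le> a" "a \<le> b" "a \<le> c" "c \<le> d"
    and \<eta>: "\<eta> \<in> borel_measurable (F c)" and bd: "\<And>w. w \<in> space M \<Longrightarrow> \<bar>\<eta> w\<bar> \<le> C"
  shows "integrable M (\<lambda>w. \<eta> w * ((R A b w - R A a w) * (R B d w - R B c w)))"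
    "expectation (\<lambda>w. \<eta> w * ((R A b w - R A a w) * (R B d w - R B c w)))
      = expectation \<eta> * (max 0 (min b d - c) * measure \<nu> (A \<inter> B))"
proof -
  define b1 where "b1 = min b c"
  \<comment> \<open>The outer \<open>max c\<close> covers intervals that do not overlap: then
    \<open>e = c\<close> and the common interval is empty.\<close>
  define e where "e = max c (min b d)"
  define b2 where "b2 = max b c"
  have o': "a \<le> b1" "b1 \<le> c" "c \<le> e" "e \<le> b2" "e \<le> d" "0 \<le> c" "0 \<le> e" "0 \<le> b1" "0 \<le> d" "0 \<le> b2"
    using o by (auto simp: b1_def e_def b2_def)
  have RM[measurable]: "R A' r \<in> borel_measurable M" if "0 \<le> r" "A' \<in> {A, B}" for A' r
    using R_measurable that A B by auto
  have \<eta>M[measurable]: "\<eta> \<in> borel_measurable M" using \<eta> measurable_F_M by blast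
  define X1 X2 X3 Y1 Y2 where "X1 w = R A b1 w - R A a w" and "X2 w = R A e w - R A c w"
    and "X3 w = R A b2 w - R A e w" and "Y1 w = R B e w - R B c w" and "Y2 w = R B d w - R B e w" for w
  have M[measurable]: "X1 \<in> borel_measurable M" "X2 \<in> borel_measurable M" "X3 \<in> borel_measurable M"
     "Y1 \<in> borel_measurable M" "Y2 \<in> borel_measurable M"
    unfolding X1_def X2_def X3_def Y1_def Y2_def using RM o o' by (auto intro!: borel_measurable_diff)
  have sq: "integrable M (\<lambda>w. (X1 w)\<^sup>2)" "integrable M (\<lambda>w. (X2 w)\<^sup>2)" "integrable M (\<lambda>w. (X3 w)\<^sup>2)"
     "integrable M (\<lambda>w. (Y1 w)\<^sup>2)" "integrable M (\<lambda>w. (Y2 w)\<^sup>2)"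
    unfolding X1_def X2_def X3_def Y1_def Y2_def using o o' by (auto intro!: R_sq A B)
  have RA: "R A b w - R A a w = X1 w + X2 w + X3 w" for w
    by (auto simp: X1_def X2_def X3_def b1_def b2_def e_def min_def max_def)
  have RB: "R B d w - R B c w = Y1 w + Y2 w" for w by (simp add: Y1_def Y2_def)
  \<comment> \<open>One of the intervals \<open>(e, b2]\<close> and \<open>(e, d]\<close> is empty,
    depending on which of \<open>b\<close> and \<open>d\<close> comes first.\<close>
  have X3Y2: "X3 w * Y2 w = 0" for w
    using o by (auto simp: X3_def Y2_def b2_def e_def min_def max_def)
  have sqm: "integrable M (\<lambda>w. (\<eta> w * X w)\<^sup>2)" if "X \<in> borel_measurable M" "integrable M (\<lambda>w. (X w)\<^sup>2)" for X
    unfolding power_mult_distrib using that bd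
    by (intro integrable_bounded_mult[where C="C\<^sup>2"]) (auto simp: abs_le_square_iff[symmetric] intro!: order_trans[OF bd] )
  have i: "integrable M (\<lambda>w. \<eta> w * (X w * Y w))"
    if "X \<in> borel_measurable M" "integrable M (\<lambda>w. (X w)\<^sup>2)" "Y \<in> borel_measurable M" "integrable M (\<lambda>w. (Y w)\<^sup>2)" for X Y
    using that bd by (intro integrable_bounded_mult[where C=C] sq_integrable_mult) auto
  have fe: "f \<in> borel_measurable (F e)" if "f \<in> borel_measurable (F c)" for f :: "'w \<Rightarrow> real"
    using measurable_F_mono[OF that o'(3)] .
  have RF: "R A' r \<in> borel_measurable (F r')" if "A' \<in> {A,B}" "0 \<le> r" "r \<le> r'" for A' r r'
    using measurable_F_mono[OF R_adapted that(3)] that A B by blast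
  have X1c: "X1 \<in> borel_measurable (F c)" unfolding X1_def using o o' by (intro borel_measurable_diff RF) auto
  have X2e: "X2 \<in> borel_measurable (F e)" unfolding X2_def using o o' by (intro borel_measurable_diff RF) auto
  have Y1e: "Y1 \<in> borel_measurable (F e)" unfolding Y1_def using o o' by (intro borel_measurable_diff RF) auto
  have "expectation (\<lambda>w. (\<eta> w * X1 w) * (R B d w - R B c w)) = 0"
    using o o' \<eta> X1c sqm[OF M(1) sq(1)] by (intro R_mean_L2 B) auto
  then have 1: "expectation (\<lambda>w. \<eta> w * (X1 w * (Y1 w + Y2 w))) = 0" by (simp add: RB mult.assoc)
  have "expectation (\<lambda>w. (\<eta> w * X2 w) * (R B d w - R B e w)) = 0"
    using o o' fe[OF \<eta>] X2e sqm[OF M(2) sq(2)] by (intro R_mean_L2 B) auto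
  then have 2: "expectation (\<lambda>w. \<eta> w * (X2 w * Y2 w)) = 0" by (simp add: Y2_def mult.assoc)
  have "expectation (\<lambda>w. (\<eta> w * Y1 w) * (R A b2 w - R A e w)) = 0"
    using o o' fe[OF \<eta>] Y1e sqm[OF M(4) sq(4)] by (intro R_mean_L2 A) auto
  then have 3: "expectation (\<lambda>w. \<eta> w * (X3 w * Y1 w)) = 0" by (simp add: X3_def mult_ac)
  have 4: "expectation (\<lambda>w. \<eta> w * (X2 w * Y1 w)) = expectation \<eta> * ((e - c) * measure \<nu> (A \<inter> B))"
    unfolding X2_def Y1_def using o' by (intro R_cov[OF A B _ _ \<eta> bd]) auto
  have sqY: "integrable M (\<lambda>w. (Y1 w + Y2 w)\<^sup>2)" using sq_integrable_add[of Y1 M Y2] M sq by simp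
  have eq: "\<eta> w * ((R A b w - R A a w) * (R B d w - R B c w)) =
      \<eta> w * (X1 w * (Y1 w + Y2 w)) + \<eta> w * (X2 w * Y2 w) + \<eta> w * (X3 w * Y1 w) + \<eta> w * (X2 w * Y1 w)" for w
  proof -
    have "\<eta> w * ((R A b w - R A a w) * (R B d w - R B c w)) = \<eta> w * (X1 w * (Y1 w + Y2 w))
      + \<eta> w * (X2 w * Y2 w) + \<eta> w * (X3 w * Y1 w) + \<eta> w * (X2 w * Y1 w) + \<eta> w * (X3 w * Y2 w)"
      by (simp add: RA RB algebra_simps)
    then show ?thesis unfolding X3Y2 by simp
  qed
  have iis: "integrable M (\<lambda>w. \<eta> w * (X1 w * (Y1 w + Y2 w)))" "integrable M (\<lambda>w. \<eta> w * (X2 w * Y2 w))"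
     "integrable M (\<lambda>w. \<eta> w * (X3 w * Y1 w))" "integrable M (\<lambda>w. \<eta> w * (X2 w * Y1 w))"
    using i[of X1 "\<lambda>w. Y1 w + Y2 w"] i[of X2 Y2] i[of X3 Y1] i[of X2 Y1] M sq sqY by auto
  show "integrable M (\<lambda>w. \<eta> w * ((R A b w - R A a w) * (R B d w - R B c w)))"
    unfolding eq using iis by simp
  have "e - c = max 0 (min b d - c)" by (simp add: e_def)
  then show "expectation (\<lambda>w. \<eta> w * ((R A b w - R A a w) * (R B d w - R B c w)))
      = expectation \<eta> * (max 0 (min b d - c) * measure \<nu> (A \<inter> B))"
    unfolding eq using iis 1 2 3 4 by simp
qed

lemma R_cov_intervals:
  assumes A: "A \<in> fmeasurable \<nu>" and B: "B \<in> fmeasurable \<nu>" and o: "0 \<le> a" "a \<le> b" "0 \<le> c" "c \<le> d"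
    and \<eta>: "\<eta> \<in> borel_measurable (F (max a c))" and bd: "\<And>w. w \<in> space M \<Longrightarrow> \<bar>\<eta> w\<bar> \<le> C"
  shows "integrable M (\<lambda>w. \<eta> w * ((R A b w - R A a w) * (R B d w - R B c w)))"
    "expectation (\<lambda>w. \<eta> w * ((R A b w - R A a w) * (R B d w - R B c w)))
      = expectation \<eta> * (measure lborel ({a<..b} \<inter> {c<..d}) * measure \<nu> (A \<inter> B))"
proof -
  have l: "measure lborel ({a<..b} \<inter> {c<..d}) = max 0 (min b d - max a c)"
  proof -
    have "{a<..b} \<inter> {c<..d} = {max a c<..min b d}" by auto
    then show ?thesis by (cases "max a c \<le> min b d") (auto simp: max_def)
  qed
  have "integrable M (\<lambda>w. \<eta> w * ((R A b w - R A a w) * (R B d w - R B c w))) \<and>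
    expectation (\<lambda>w. \<eta> w * ((R A b w - R A a w) * (R B d w - R B c w)))
      = expectation \<eta> * (measure lborel ({a<..b} \<inter> {c<..d}) * measure \<nu> (A \<inter> B))"
  proof (cases "a \<le> c")
    case True
    then have m: "max a c = c" by simp
    show ?thesis using R_cov_ordered[OF A B o(1,2) True o(4) \<eta>[unfolded m] bd] unfolding l m by simp
  next
    case False
    then have m: "max a c = a" and le: "c \<le> a" by auto
    show ?thesis using R_cov_ordered[OF B A o(3,4) le o(2) \<eta>[unfolded m] bd]
      unfolding l m by (simp add: mult.commute min.commute Int_commute)
  qed
  then show "integrable M (\<lambda>w. \<eta> w * ((R A b w - R A a w) * (R B d w - R B c w)))"
    "expectation (\<lambda>w. \<eta> w * ((R A b w - R A a w) * (R B d w - R B c w)))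
      = expectation \<eta> * (measure lborel ({a<..b} \<inter> {c<..d}) * measure \<nu> (A \<inter> B))" by auto
qed

end

lemma norm_sum_scaleR_sq:
  fixes \<xi> :: "'i \<Rightarrow> 'b::real_inner"
  shows "(norm (\<Sum>i\<in>I. c i *\<^sub>R \<xi> i))\<^sup>2 = (\<Sum>i\<in>I. \<Sum>j\<in>I. c i * c j * (\<xi> i \<bullet> \<xi> j))"
  by (simp add: power2_norm_eq_inner inner_sum_left inner_sum_right sum_distrib_left inner_commute mult_ac)

lemma borel_measurable_sum_list:
  fixes f :: "'i \<Rightarrow> 'a \<Rightarrow> 'b::euclidean_space"
  assumes "\<And>h. h \<in> set hs \<Longrightarrow> f h \<in> borel_measurable M"
  shows "(\<lambda>x. \<Sum>h\<leftarrow>hs. f h x) \<in> borel_measurable M"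
  using assms by (induction hs) auto

lemma sq_integrable_of_nn:
  fixes X :: "'a \<Rightarrow> 'b::euclidean_space"
  assumes [measurable]: "X \<in> borel_measurable M" and "sq_norm M X \<le> ennreal c"
  shows "integrable M (\<lambda>w. (norm (X w))\<^sup>2)" and "0 \<le> c \<Longrightarrow> (\<integral>w. (norm (X w))\<^sup>2 \<partial>M) \<le> c"
proof -
  show "integrable M (\<lambda>w. (norm (X w))\<^sup>2)"
    using assms(2) by (intro integrableI_nonneg) (auto simp: le_less_trans)
  assume "0 \<le> c"
  have "(\<integral>w. (norm (X w))\<^sup>2 \<partial>M) = enn2real (sq_norm M X)"
    by (intro integral_eq_nn_integral) auto
  also have "\<dots> \<le> c" using assms(2) \<open>0 \<le> c\<close> by (intro enn2real_leI)
  finally show "(\<integral>w. (norm (X w))\<^sup>2 \<partial>M) \<le> c" .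
qed

lemma nn_of_sq_integrable:
  fixes X :: "'a \<Rightarrow> 'b::euclidean_space"
  assumes "integrable M (\<lambda>w. (norm (X w))\<^sup>2)"
  shows "sq_norm M X = ennreal (\<integral>w. (norm (X w))\<^sup>2 \<partial>M)"
  using assms by (intro nn_integral_eq_integral) auto

lemma ennreal_norm_add_sq_le:
  fixes a b :: "'b::real_inner"
  assumes "\<delta> > 0"
  shows "ennreal ((norm (a + b))\<^sup>2) \<le> ennreal (1 + \<delta>) * ennreal ((norm a)\<^sup>2) + ennreal (1 + 1 / \<delta>) * ennreal ((norm b)\<^sup>2)"
  using norm_add_sq_le[OF assms, of a b] assms
  by (simp flip: ennreal_mult' ennreal_plus add: ennreal_leI)

lemma nn_norm_add_sq_le:
  fixes X Y :: "'a \<Rightarrow> 'b::euclidean_space"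
  assumes [measurable]: "X \<in> borel_measurable M" "Y \<in> borel_measurable M" and "\<delta> > 0"
  shows "sq_norm M (\<lambda>w. X w + Y w) \<le>
    ennreal (1 + \<delta>) * sq_norm M X + ennreal (1 + 1 / \<delta>) * sq_norm M Y"
proof -
  have "sq_norm M (\<lambda>w. X w + Y w) \<le>
    (\<integral>\<^sup>+w. ennreal (1 + \<delta>) * ennreal ((norm (X w))\<^sup>2) + ennreal (1 + 1 / \<delta>) * ennreal ((norm (Y w))\<^sup>2) \<partial>M)"
    by (intro nn_integral_mono ennreal_norm_add_sq_le assms)
  then show ?thesis by (simp add: nn_integral_add nn_integral_cmult)
qed

context noise
begin

lemma simple_jump_integrandD:
  assumes "simple_jump_integrand M F \<nu> hs" "(a, b, A, \<xi>) \<in> set hs"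
  shows "0 \<le> a" "a \<le> b" "A \<in> fmeasurable \<nu>" "\<xi> \<in> borel_measurable (F a)" "bounded (\<xi> ` space M)"
  using assms by (auto simp: simple_jump_integrand_def fmeasurable_def split: prod.splits)

lemma simple_clip:
  assumes "simple_jump_integrand M F \<nu> hs" "0 \<le> s" "s \<le> t"
  shows "simple_jump_integrand M F \<nu> (clip s t hs)"
  unfolding simple_jump_integrand_def
proof (intro ballI, clarify)
  fix a' b' A \<xi> assume "(a', b', A, \<xi>) \<in> set (clip s t hs)"
  then obtain a b where h: "(a, b, A, \<xi>) \<in> set hs" and ab: "a \<le> t" "a' = max s (min a t)" "b' = max s (min b t)"
    by (auto simp: clip_def)
  note D = simple_jump_integrandD[OF assms(1) h]
  have "a \<le> a'" using ab by simp
  then have "\<xi> \<in> borel_measurable (F a')" by (rule measurable_F_mono[OF D(4)])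
  moreover have "0 \<le> a'" "a' \<le> b'" using ab D(2) assms(2,3) by auto
  ultimately show "0 \<le> a' \<and> a' \<le> b' \<and> A \<in> sets \<nu> \<and> emeasure \<nu> A < \<infinity> \<and> \<xi> \<in> borel_measurable (F a') \<and> bounded (\<xi> ` space M)"
    using D(3,5) by (auto simp: fmeasurable_def)
qed

lemma simple_step_diff:
  assumes "simple_jump_integrand M F \<nu> hs" "simple_jump_integrand M F \<nu> hs'"
  shows "simple_jump_integrand M F \<nu> (step_diff hs hs')"
proof -
  have "bounded ((\<lambda>w. - \<xi> w) ` space M)" if "bounded (\<xi> ` space M)" for \<xi> :: "'w \<Rightarrow> real^'d"
    using that by (simp add: bounded_iff)
  then show ?thesis
    using assms unfolding simple_jump_integrand_def step_diff_def by (fastforce split: prod.splits)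
qed

lemma step_integral_adapted:
  assumes hs: "simple_jump_integrand M F \<nu> (hs :: ('w, 'u, 'd::finite) simple_jump_integrand)" and t: "0 \<le> t"
  shows "step_integral R hs t \<in> borel_measurable (F t)"
proof -
  have "(\<lambda>w. (R A (min b t) w - R A (min a t) w) *\<^sub>R \<xi> w) \<in> borel_measurable (F t)"
    if h: "(a, b, A, \<xi>) \<in> set hs" for a b A \<xi>
  proof (cases "a \<le> t")
    case True
    note h = simple_jump_integrandD[OF hs h]
    have "R A (min b t) \<in> borel_measurable (F t)" "R A (min a t) \<in> borel_measurable (F t)"
      using h t by (auto intro!: measurable_F_mono[OF R_adapted])
    moreover have "\<xi> \<in> borel_measurable (F t)" using measurable_F_mono[OF h(4) True] .
    ultimately show ?thesis by measurable
  next
    case False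
    then have "min b t = t" "min a t = t" using simple_jump_integrandD[OF hs h] by auto
    then show ?thesis by simp
  qed
  then show ?thesis unfolding step_integral_def[abs_def]
    by (intro borel_measurable_sum_list) (auto split: prod.splits)
qed

lemma step_integral_measurable:
  assumes "simple_jump_integrand M F \<nu> (hs :: ('w, 'u, 'd::finite) simple_jump_integrand)" "0 \<le> t"
  shows "step_integral R hs t \<in> borel_measurable M"
  using step_integral_adapted[OF assms] measurable_F_M by blast

lemma simple_value_measurable:
  assumes hs: "simple_jump_integrand M F \<nu> (hs :: ('w, 'u, 'd::finite) simple_jump_integrand)"
  shows "(\<lambda>(r, u, w). simple_jump_value hs r u w) \<in> borel_measurable (borel \<Otimes>\<^sub>M \<nu> \<Otimes>\<^sub>M M)"
proof -
  have "(\<lambda>(r, u, w). (indicator {a<..b} r * indicator A u) *\<^sub>R \<xi> w) \<in> borel_measurable (borel \<Otimes>\<^sub>M \<nu> \<Otimes>\<^sub>M M)"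
    if "(a, b, A, \<xi>) \<in> set hs" for a b A and \<xi> :: "'w \<Rightarrow> real^'d"
  proof -
    have [measurable]: "\<xi> \<in> borel_measurable M" "A \<in> sets \<nu>"
      using simple_jump_integrandD[OF hs that] measurable_F_M by (auto simp: fmeasurable_def)
    show ?thesis by measurable
  qed
  then have "(\<lambda>p. (\<Sum>h\<leftarrow>hs. case h of (a, b, A, \<xi>) \<Rightarrow> case p of (r, u, w) \<Rightarrow> (indicator {a<..b} r * indicator A u) *\<^sub>R \<xi> w))
      \<in> borel_measurable (borel \<Otimes>\<^sub>M \<nu> \<Otimes>\<^sub>M M)"
    by (intro borel_measurable_sum_list) (auto split: prod.splits)
  then show ?thesis unfolding simple_jump_value_def case_prod_unfold .
qed

text \<open>Both sides are expanded into the same double sum over pairs of entries, so overlapping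
  entries need not be made disjoint. For a pair, \<open>\<xi> i \<bullet> \<xi> j\<close> is
  measurable at the later of the two starting times, as \<open>R_cov_intervals\<close> demands, and
  the overlap of the two rectangles factors into time and marks.\<close>

lemma step_total_isometry:
  assumes hs: "simple_jump_integrand M F \<nu> (hs :: ('w, 'u, 'd::finite) simple_jump_integrand)"
  shows "integrable M (\<lambda>w. (norm (step_total R hs w))\<^sup>2)"
    and "sq_norm M (\<lambda>w. step_total R hs w) =
      (\<integral>\<^sup>+r. (\<integral>\<^sup>+w. sq_norm \<nu> (\<lambda>u. simple_jump_value hs r u w) \<partial>M) \<partial>lborel)"
proof -
  define I where "I = {..<length hs}"
  define a where "a i = fst (hs ! i)" for i
  define b where "b i = fst (snd (hs ! i))" for i
  define A where "A i = fst (snd (snd (hs ! i)))" for i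
  define \<xi> where "\<xi> i = snd (snd (snd (hs ! i)))" for i
  have mem: "(a i, b i, A i, \<xi> i) \<in> set hs" if "i \<in> I" for i
    using that by (auto simp: I_def a_def b_def A_def \<xi>_def)
  note D = simple_jump_integrandD[OF hs mem]
  have sl: "(\<Sum>h\<leftarrow>hs. f h) = (\<Sum>i\<in>I. f (a i, b i, A i, \<xi> i))" for f :: "_ \<Rightarrow> real^'d"
    by (simp add: sum_list_sum_nth I_def a_def b_def A_def \<xi>_def atLeast0LessThan)
  obtain C where C: "\<And>i w. i \<in> I \<Longrightarrow> w \<in> space M \<Longrightarrow> norm (\<xi> i w) \<le> C i"
    using D(5) unfolding bounded_iff by (metis imageI)
  define e where "e i j w = \<xi> i w \<bullet> \<xi> j w" for i j w
  have em: "e i j \<in> borel_measurable (F (max (a i) (a j)))" if "i \<in> I" "j \<in> I" for i j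
    unfolding e_def using measurable_F_mono[OF D(4)[OF that(1)], of "max (a i) (a j)"]
      measurable_F_mono[OF D(4)[OF that(2)], of "max (a i) (a j)"] by (auto intro!: borel_measurable_inner)
  have eb: "\<bar>e i j w\<bar> \<le> C i * C j" if "i \<in> I" "j \<in> I" "w \<in> space M" for i j w
    unfolding e_def by (rule order_trans[OF Cauchy_Schwarz_ineq2]) (use C that in \<open>auto intro!: mult_mono order_trans[OF norm_ge_zero C]\<close>)
  have ei: "integrable M (e i j)" if "i \<in> I" "j \<in> I" for i j
    using eb[OF that] measurable_F_M[OF em[OF that]] by (intro integrable_const_bound[where B="C i * C j"]) (auto intro!: AE_I2)
  define c where "c i w = R (A i) (b i) w - R (A i) (a i) w" for i w
  define L where "L i j = measure lborel ({a i<..b i} \<inter> {a j<..b j})" for i j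
  define K where "K i j = measure \<nu> (A i \<inter> A j)" for i j
  have cov: "integrable M (\<lambda>w. e i j w * (c i w * c j w))"
    "expectation (\<lambda>w. e i j w * (c i w * c j w)) = expectation (e i j) * (L i j * K i j)" if "i \<in> I" "j \<in> I" for i j
    unfolding c_def L_def K_def using R_cov_intervals[OF D(3)[OF that(1)] D(3)[OF that(2)] D(1,2)[OF that(1)] D(1,2)[OF that(2)] em[OF that] eb[OF that]] by auto
  have tot: "(norm (step_total R hs w))\<^sup>2 = (\<Sum>i\<in>I. \<Sum>j\<in>I. e i j w * (c i w * c j w))" for w
    unfolding step_total_def sl prod.case c_def[symmetric] norm_sum_scaleR_sq e_def by (simp add: mult_ac)
  show itot: "integrable M (\<lambda>w. (norm (step_total R hs w))\<^sup>2)"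
    unfolding tot using cov(1) by (intro Bochner_Integration.integrable_sum)
  have Etot: "expectation (\<lambda>w. (norm (step_total R hs w))\<^sup>2) = (\<Sum>i\<in>I. \<Sum>j\<in>I. expectation (e i j) * (L i j * K i j))"
    unfolding tot using cov by (simp add: Bochner_Integration.integral_sum)
  have val: "(norm (simple_jump_value hs r u w))\<^sup>2 =
      (\<Sum>i\<in>I. \<Sum>j\<in>I. (indicator ({a i<..b i} \<inter> {a j<..b j}) r * e i j w) * indicator (A i \<inter> A j) u)" for r u w
    unfolding simple_jump_value_def sl prod.case norm_sum_scaleR_sq e_def indicator_inter_arith by (simp add: mult_ac)
  define f1 where "f1 r w = (\<Sum>i\<in>I. \<Sum>j\<in>I. (indicator ({a i<..b i} \<inter> {a j<..b j}) r * e i j w) * K i j)" for r w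
  define f2 where "f2 r = (\<Sum>i\<in>I. \<Sum>j\<in>I. indicator ({a i<..b i} \<inter> {a j<..b j}) r * (expectation (e i j) * K i j))" for r
  have fm: "A i \<inter> A j \<in> fmeasurable \<nu>" if "i \<in> I" "j \<in> I" for i j using D(3) that by (auto intro: fmeasurable.Int)
  have i1: "integrable \<nu> (\<lambda>u. (norm (simple_jump_value hs r u w))\<^sup>2)" for r w
    unfolding val using fm by (intro Bochner_Integration.integrable_sum integrable_mult_right integrable_real_indicator) (auto simp: fmeasurable_def)
  have e1: "(\<integral>u. (norm (simple_jump_value hs r u w))\<^sup>2 \<partial>\<nu>) = f1 r w" for r w
  proof -
    have "integrable \<nu> (\<lambda>u. indicat_real ({a i<..b i} \<inter> {a j<..b j}) r * e i j w * indicat_real (A i \<inter> A j) u)" if "i \<in> I" "j \<in> I" for i j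
      using fm[OF that] by (intro integrable_mult_right integrable_real_indicator) (auto simp: fmeasurable_def)
    moreover have "A i \<inter> A j \<inter> space \<nu> = A i \<inter> A j" if "i \<in> I" "j \<in> I" for i j
      using fm[OF that] sets.sets_into_space by (auto simp: fmeasurable_def)
    ultimately show ?thesis unfolding val f1_def K_def
      by (simp add: Bochner_Integration.integral_sum Bochner_Integration.integrable_sum)
  qed
  have n1: "sq_norm \<nu> (\<lambda>u. simple_jump_value hs r u w) = ennreal (f1 r w)" for r w
    using nn_integral_eq_integral[OF i1] by (simp add: e1)
  have f1p: "0 \<le> f1 r w" for r w unfolding e1[symmetric] by simp
  have i2: "integrable M (f1 r)" for r
    unfolding f1_def using ei by (intro Bochner_Integration.integrable_sum integrable_mult_left integrable_mult_right)
  have e2: "expectation (f1 r) = f2 r" for r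
    unfolding f1_def f2_def using ei by (simp add: Bochner_Integration.integral_sum Bochner_Integration.integrable_sum mult_ac)
  have n2: "(\<integral>\<^sup>+w. ennreal (f1 r w) \<partial>M) = ennreal (f2 r)" for r
    using nn_integral_eq_integral[OF i2] f1p by (simp add: e2)
  have f2p: "0 \<le> f2 r" for r unfolding e2[symmetric] using f1p by (simp add: Bochner_Integration.integral_nonneg)
  have ind: "integrable lborel (indicat_real ({a i<..b i} \<inter> {a j<..b j}))" for i j
  proof -
    have "{a i<..b i} \<inter> {a j<..b j} = {max (a i) (a j)<..min (b i) (b j)}" by auto
    then show ?thesis by (simp del: Int_greaterThanAtMost)
  qed
  have i3: "integrable lborel f2"
    unfolding f2_def by (intro Bochner_Integration.integrable_sum integrable_mult_left ind)
  have e3: "(\<integral>r. f2 r \<partial>lborel) = (\<Sum>i\<in>I. \<Sum>j\<in>I. expectation (e i j) * (L i j * K i j))"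
    unfolding f2_def L_def using ind by (simp add: Bochner_Integration.integral_sum Bochner_Integration.integrable_sum mult_ac)
  have n3: "(\<integral>\<^sup>+r. ennreal (f2 r) \<partial>lborel) = ennreal (\<Sum>i\<in>I. \<Sum>j\<in>I. expectation (e i j) * (L i j * K i j))"
    using nn_integral_eq_integral[OF i3] f2p by (simp add: e3)
  show "sq_norm M (\<lambda>w. step_total R hs w) =
      (\<integral>\<^sup>+r. (\<integral>\<^sup>+w. sq_norm \<nu> (\<lambda>u. simple_jump_value hs r u w) \<partial>M) \<partial>lborel)"
    unfolding nn_of_sq_integrable[OF itot] Etot n1 n2 n3 ..
qed

lemma step_integral_isometry:
  assumes hs: "simple_jump_integrand M F \<nu> (hs :: ('w, 'u, 'd::finite) simple_jump_integrand)" and st: "0 \<le> s" "s \<le> t"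
  shows "integrable M (\<lambda>w. (norm (step_integral R hs t w - step_integral R hs s w))\<^sup>2)"
    and "sq_norm M (\<lambda>w. step_integral R hs t w - step_integral R hs s w) = energy M \<nu> s t (simple_jump_value hs)"
proof -
  have le: "\<forall>(a, b, A, \<xi>)\<in>set hs. a \<le> b" using simple_jump_integrandD[OF hs] by auto
  note T = step_total_isometry[OF simple_clip[OF hs st]]
  show "integrable M (\<lambda>w. (norm (step_integral R hs t w - step_integral R hs s w))\<^sup>2)"
    using T(1) by (simp add: step_total_clip[OF st(2) le])
  have "(\<integral>\<^sup>+r. (\<integral>\<^sup>+w. sq_norm \<nu> (\<lambda>u. simple_jump_value (clip s t hs) r u w) \<partial>M) \<partial>lborel) = energy M \<nu> s t (simple_jump_value hs)"
    unfolding energy_def by (rule nn_integral_cong) (auto simp: simple_value_clip[OF st(2)] indicator_def)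
  then show "sq_norm M (\<lambda>w. step_integral R hs t w - step_integral R hs s w) = energy M \<nu> s t (simple_jump_value hs)"
    using T(2) by (simp add: step_total_clip[OF st(2) le])
qed

lemma step_integral_0:
  assumes "simple_jump_integrand M F \<nu> (hs :: ('w, 'u, 'd::finite) simple_jump_integrand)"
  shows "step_integral R hs 0 w = 0"
proof -
  have "(case h of (a, b, A, \<xi>) \<Rightarrow> (R A (min b 0) w - R A (min a 0) w) *\<^sub>R \<xi> w) = (0 :: real^'d)" if "h \<in> set hs" for h
  proof -
    obtain a b A \<xi> where h: "h = (a, b, A, \<xi>)" by (cases h)
    then have "0 \<le> a" "a \<le> b" using simple_jump_integrandD[OF assms] that by auto
    then show ?thesis by (simp add: h)
  qed
  then show ?thesis unfolding step_integral_def by (simp add: sum_list_0 cong: map_cong)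
qed

text \<open>After clipping, every entry starts at or after \<open>s\<close>, so
  \<open>\<zeta> \<bullet> \<xi>\<close> is measurable at the start of the entry and
  \<open>R_mean_L2\<close> applies to each entry separately. Boundedness of \<open>\<xi>\<close>
  keeps this product square integrable.\<close>

lemma step_integral_orthogonal:
  assumes hs: "simple_jump_integrand M F \<nu> (hs :: ('w, 'u, 'd::finite) simple_jump_integrand)" and st: "0 \<le> s" "s \<le> t"
    and \<zeta>: "\<zeta> \<in> borel_measurable (F s)" and sq: "integrable M (\<lambda>w. (norm (\<zeta> w))\<^sup>2)"
  shows "expectation (\<lambda>w. \<zeta> w \<bullet> (step_integral R hs t w - step_integral R hs s w)) = 0"
proof -
  have le: "\<forall>(a, b, A, \<xi>)\<in>set hs. a \<le> b" using simple_jump_integrandD[OF hs] by auto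
  define hs' where "hs' = clip s t hs"
  have hs': "simple_jump_integrand M F \<nu> hs'" using simple_clip[OF hs st] by (simp add: hs'_def)
  have as: "s \<le> a" if "(a, b, A, \<xi>) \<in> set hs'" for a b A \<xi>
    using that by (auto simp: hs'_def clip_def)
  have single: "integrable M (\<lambda>w. \<zeta> w \<bullet> ((R A b w - R A a w) *\<^sub>R \<xi> w)) \<and>
      expectation (\<lambda>w. \<zeta> w \<bullet> ((R A b w - R A a w) *\<^sub>R \<xi> w)) = 0"
    if h: "(a, b, A, \<xi>) \<in> set hs'" for a b A \<xi>
  proof -
    note D = simple_jump_integrandD[OF hs' h]
    obtain C where C: "\<And>w. w \<in> space M \<Longrightarrow> norm (\<xi> w) \<le> C" using D(5) unfolding bounded_iff by (metis imageI)
    have \<zeta>a: "\<zeta> \<in> borel_measurable (F a)" using measurable_F_mono[OF \<zeta> as[OF h]] .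
    have m: "(\<lambda>w. \<zeta> w \<bullet> \<xi> w) \<in> borel_measurable (F a)" using \<zeta>a D(4) by measurable
    have mM[measurable]: "(\<lambda>w. \<zeta> w \<bullet> \<xi> w) \<in> borel_measurable M" using measurable_F_M[OF m] .
    have sqm: "integrable M (\<lambda>w. (\<zeta> w \<bullet> \<xi> w)\<^sup>2)"
    proof (rule Bochner_Integration.integrable_bound)
      show "integrable M (\<lambda>w. C\<^sup>2 * (norm (\<zeta> w))\<^sup>2)" using sq by simp
      show "AE w in M. norm ((\<zeta> w \<bullet> \<xi> w)\<^sup>2) \<le> norm (C\<^sup>2 * (norm (\<zeta> w))\<^sup>2)"
      proof (rule AE_I2)
        fix w assume "w \<in> space M"
        then have "\<bar>\<zeta> w \<bullet> \<xi> w\<bar> \<le> norm (\<zeta> w) * C"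
          by (intro order_trans[OF Cauchy_Schwarz_ineq2] mult_left_mono C) auto
        then have "\<bar>\<zeta> w \<bullet> \<xi> w\<bar>\<^sup>2 \<le> (norm (\<zeta> w) * C)\<^sup>2" by (intro power_mono) auto
        then show "norm ((\<zeta> w \<bullet> \<xi> w)\<^sup>2) \<le> norm (C\<^sup>2 * (norm (\<zeta> w))\<^sup>2)"
          by (simp add: power_mult_distrib mult.commute)
      qed
    qed measurable
    have eq: "\<zeta> w \<bullet> ((R A b w - R A a w) *\<^sub>R \<xi> w) = (\<zeta> w \<bullet> \<xi> w) * (R A b w - R A a w)" for w by (simp add: mult.commute)
    have "integrable M (\<lambda>w. (\<zeta> w \<bullet> \<xi> w) * (R A b w - R A a w))"
      using sqm R_sq[OF D(3,1,2)] R_measurable[OF D(3)] D(1,2) by (intro sq_integrable_mult) auto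
    then show ?thesis using R_mean_L2[OF D(3,1,2) m sqm] by (simp only: eq simp_thms)
  qed
  have "integrable M (\<lambda>w. \<zeta> w \<bullet> step_total R hs'' w) \<and> expectation (\<lambda>w. \<zeta> w \<bullet> step_total R hs'' w) = 0"
    if "set hs'' \<subseteq> set hs'" for hs''
    using that
  proof (induction hs'')
    case Nil then show ?case by (simp add: step_total_def)
  next
    case (Cons h hs'')
    obtain a b A \<xi> where h: "h = (a, b, A, \<xi>)" by (cases h)
    show ?case using Cons single[of a b A \<xi>] by (simp add: step_total_def h inner_add_right)
  qed
  from this[of hs'] show ?thesis by (simp add: hs'_def step_total_clip[OF st(2) le, of R])
qed

lemma energy_measurable:
  fixes G :: "real \<Rightarrow> 'u \<Rightarrow> 'w \<Rightarrow> 'b::euclidean_space"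
  assumes [measurable]: "(\<lambda>(r, u, w). G r u w) \<in> borel_measurable (borel \<Otimes>\<^sub>M \<nu> \<Otimes>\<^sub>M M)"
  shows "(\<lambda>(r, w). sq_norm \<nu> (\<lambda>u. G r u w)) \<in> borel_measurable (borel \<Otimes>\<^sub>M M)"
    "(\<lambda>r. \<integral>\<^sup>+w. sq_norm \<nu> (\<lambda>u. G r u w) \<partial>M) \<in> borel_measurable borel"
    "(\<lambda>w. sq_norm \<nu> (\<lambda>u. G r u w)) \<in> borel_measurable M"
    "w \<in> space M \<Longrightarrow> (\<lambda>u. G r u w) \<in> borel_measurable \<nu>"
proof -
  have "(\<lambda>p. G (fst (fst p)) (snd p) (snd (fst p))) \<in> borel_measurable ((borel \<Otimes>\<^sub>M M) \<Otimes>\<^sub>M \<nu>)"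
    using measurable_compose[OF _ assms, of "\<lambda>p. (fst (fst p), snd p, snd (fst p))"] by simp
  then have "(\<lambda>p. ennreal ((norm (G (fst (fst p)) (snd p) (snd (fst p))))\<^sup>2)) \<in> borel_measurable ((borel \<Otimes>\<^sub>M M) \<Otimes>\<^sub>M \<nu>)"
    by measurable
  then show 1: "(\<lambda>(r, w). sq_norm \<nu> (\<lambda>u. G r u w)) \<in> borel_measurable (borel \<Otimes>\<^sub>M M)"
    using N.borel_measurable_nn_integral[of "\<lambda>p u. ennreal ((norm (G (fst p) u (snd p)))\<^sup>2)" "borel \<Otimes>\<^sub>M M"]
    by (simp add: case_prod_beta)
  show "(\<lambda>r. \<integral>\<^sup>+w. sq_norm \<nu> (\<lambda>u. G r u w) \<partial>M) \<in> borel_measurable borel"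
    using borel_measurable_nn_integral[OF 1] .
  show "(\<lambda>w. sq_norm \<nu> (\<lambda>u. G r u w)) \<in> borel_measurable M"
    using measurable_compose[OF _ 1, of "\<lambda>w. (r, w)" M] by simp
  show "(\<lambda>u. G r u w) \<in> borel_measurable \<nu>" if "w \<in> space M"
    using measurable_compose[OF _ assms, of "\<lambda>u. (r, u, w)" \<nu>] that by simp
qed

lemma energy_add_le:
  fixes G H :: "real \<Rightarrow> 'u \<Rightarrow> 'w \<Rightarrow> 'b::euclidean_space"
  assumes G[measurable]: "(\<lambda>(r, u, w). G r u w) \<in> borel_measurable (borel \<Otimes>\<^sub>M \<nu> \<Otimes>\<^sub>M M)"
    and H[measurable]: "(\<lambda>(r, u, w). H r u w) \<in> borel_measurable (borel \<Otimes>\<^sub>M \<nu> \<Otimes>\<^sub>M M)" and \<delta>: "\<delta> > 0"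
  shows "energy M \<nu> s t (\<lambda>r u w. G r u w + H r u w) \<le>
    ennreal (1 + \<delta>) * energy M \<nu> s t G + ennreal (1 + 1 / \<delta>) * energy M \<nu> s t H"
proof -
  note mm[measurable] = energy_measurable(1-3)[OF G] energy_measurable(1-3)[OF H]
  have 1: "sq_norm \<nu> (\<lambda>u. G r u w + H r u w) \<le> ennreal (1 + \<delta>) * sq_norm \<nu> (\<lambda>u. G r u w)
      + ennreal (1 + 1 / \<delta>) * sq_norm \<nu> (\<lambda>u. H r u w)" if "w \<in> space M" for r w
    using that by (intro nn_norm_add_sq_le \<delta> energy_measurable(4) G H)
  have 2: "(\<integral>\<^sup>+w. sq_norm \<nu> (\<lambda>u. G r u w + H r u w) \<partial>M) \<le>
      ennreal (1 + \<delta>) * (\<integral>\<^sup>+w. sq_norm \<nu> (\<lambda>u. G r u w) \<partial>M)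
      + ennreal (1 + 1 / \<delta>) * (\<integral>\<^sup>+w. sq_norm \<nu> (\<lambda>u. H r u w) \<partial>M)" for r
    by (rule order_trans[OF nn_integral_mono[OF 1]])
      (simp_all add: nn_integral_add nn_integral_cmult energy_measurable(3)[OF G] energy_measurable(3)[OF H])
  have "energy M \<nu> s t (\<lambda>r u w. G r u w + H r u w) \<le>
     (\<integral>\<^sup>+r. ennreal (1 + \<delta>) * ((\<integral>\<^sup>+w. sq_norm \<nu> (\<lambda>u. G r u w) \<partial>M) * indicator {s<..t} r)
      + ennreal (1 + 1 / \<delta>) * ((\<integral>\<^sup>+w. sq_norm \<nu> (\<lambda>u. H r u w) \<partial>M) * indicator {s<..t} r) \<partial>lborel)"
    unfolding energy_def by (rule nn_integral_mono) (use 2 in \<open>auto simp: indicator_def\<close>)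
  then show ?thesis unfolding energy_def using energy_measurable(2)[OF G] energy_measurable(2)[OF H]
    by (simp add: nn_integral_add nn_integral_cmult)
qed

lemma energy_diff_le2:
  fixes G H :: "real \<Rightarrow> 'u \<Rightarrow> 'w \<Rightarrow> 'b::euclidean_space"
  assumes "(\<lambda>(r, u, w). G r u w) \<in> borel_measurable (borel \<Otimes>\<^sub>M \<nu> \<Otimes>\<^sub>M M)"
    and "(\<lambda>(r, u, w). H r u w) \<in> borel_measurable (borel \<Otimes>\<^sub>M \<nu> \<Otimes>\<^sub>M M)"
  shows "energy M \<nu> s t (\<lambda>r u w. G r u w - H r u w) \<le> 2 * energy M \<nu> s t G + 2 * energy M \<nu> s t H"
  using energy_add_le[of G "\<lambda>r u w. - H r u w" 1 s t] assms(1) borel_measurable_uminus[OF assms(2)]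
  by (simp add: energy_def case_prod_beta)

lemma energy_mono_interval: "s' \<le> s \<Longrightarrow> t \<le> t' \<Longrightarrow> energy M \<nu> s t G \<le> energy M \<nu> s' t' G"
  unfolding energy_def by (intro nn_integral_mono mult_left_mono) (auto simp: indicator_def)

lemma energy_le:
  assumes "\<And>r w. s < r \<Longrightarrow> r \<le> t \<Longrightarrow> w \<in> space M \<Longrightarrow> (sq_norm \<nu> (\<lambda>u. G r u w)) \<le> ennreal c"
    and "s \<le> t" "0 \<le> c"
  shows "energy M \<nu> s t G \<le> ennreal (c * (t - s))"
proof -
  have "energy M \<nu> s t G \<le> (\<integral>\<^sup>+r. ennreal c * indicator {s<..t} r \<partial>lborel)"
    unfolding energy_def
  proof (intro nn_integral_mono)
    fix r
    have "(\<integral>\<^sup>+w. sq_norm \<nu> (\<lambda>u. G r u w) \<partial>M) \<le> (\<integral>\<^sup>+w. ennreal c \<partial>M)" if "s < r" "r \<le> t"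
      using assms(1)[OF that] by (intro nn_integral_mono)
    then show "(\<integral>\<^sup>+w. sq_norm \<nu> (\<lambda>u. G r u w) \<partial>M) * indicator {s<..t} r \<le> ennreal c * indicator {s<..t} r"
      by (auto simp: indicator_def emeasure_space_1)
  qed
  also have "\<dots> = ennreal (c * (t - s))" using assms by (simp add: nn_integral_cmult ennreal_mult')
  finally show ?thesis .
qed

end

text \<open>The common core of the two stochastic integrals: integrands and integrals converge in
  \<open>L^2\<close> along one sequence of simple integrands. Adaptedness and path regularity are
  added separately, since the latter differs for the two drivers.\<close>

definition noise_integral :: "'w measure \<Rightarrow> (real \<Rightarrow> 'w measure) \<Rightarrow> 'u measure \<Rightarrow> ('u set \<Rightarrow> real \<Rightarrow> 'w \<Rightarrow> real) \<Rightarrow>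
    (real \<Rightarrow> 'u \<Rightarrow> 'w \<Rightarrow> real^'d) \<Rightarrow> (real \<Rightarrow> 'w \<Rightarrow> real^'d) \<Rightarrow> bool" where
  "noise_integral M F \<nu> R G I \<longleftrightarrow> (\<forall>t\<ge>0. I t \<in> borel_measurable M) \<and>
     (\<exists>hs. (\<forall>n::nat. simple_jump_integrand M F \<nu> (hs n)) \<and>
        (\<forall>T\<ge>0. (\<lambda>n. energy M \<nu> 0 T (\<lambda>r u w. simple_jump_value (hs n) r u w - G r u w)) \<longlonglongrightarrow> 0 \<and>
           (\<lambda>n. sq_norm M (\<lambda>w. step_integral R (hs n) T w - I T w)) \<longlonglongrightarrow> 0))"

lemma ennreal_le_times_epsilon:
  fixes x y :: ennreal
  assumes "\<And>\<delta>::real. \<delta> > 0 \<Longrightarrow> x \<le> ennreal (1 + \<delta>) * (ennreal (1 + \<delta>) * y)"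
  shows "x \<le> y"
proof (cases "y = \<infinity>")
  case False
  have "(\<lambda>k. ennreal (1 + 1 / real (Suc k))) \<longlonglongrightarrow> ennreal (1 + 0)"
    by (intro tendsto_ennrealI tendsto_intros LIMSEQ_Suc lim_1_over_n)
  then have "(\<lambda>k. ennreal (1 + 1 / real (Suc k)) * (ennreal (1 + 1 / real (Suc k)) * y)) \<longlonglongrightarrow> ennreal (1 + 0) * (ennreal (1 + 0) * y)"
    using False by (intro tendsto_mult_ennreal tendsto_const) auto
  then have "x \<le> ennreal (1 + 0) * (ennreal (1 + 0) * y)"
    by (rule LIMSEQ_le_const) (intro exI[of _ 0] allI impI assms, simp)
  then show ?thesis by simp
qed simp

context noise
begin

lemma noise_integral_measurable: "noise_integral M F \<nu> R G I \<Longrightarrow> 0 \<le> t \<Longrightarrow> I t \<in> borel_measurable M"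
  by (simp add: noise_integral_def)

text \<open>The isometry passes to the limit with constant 1. A plain triangle inequality would
  leave a factor such as 2 or 4, which the monotonicity condition could not absorb; two weighted
  ones, for the integrals and for the integrands, leave only \<open>(1 + \<delta>)^2\<close>, and
  \<open>\<delta>\<close> is arbitrary.\<close>

lemma noise_integral_bound:
  fixes I :: "real \<Rightarrow> 'w \<Rightarrow> real^'d::finite"
  assumes NI: "noise_integral M F \<nu> R G I"
    and G: "(\<lambda>(r, u, w). G r u w) \<in> borel_measurable (borel \<Otimes>\<^sub>M \<nu> \<Otimes>\<^sub>M M)" and st: "0 \<le> s" "s \<le> t"
  shows "sq_norm M (\<lambda>w. I t w - I s w) \<le> energy M \<nu> s t G"
proof (rule ennreal_le_times_epsilon)
  fix \<delta> :: real assume \<delta>: "\<delta> > 0"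
  obtain hs where hs: "\<And>n. simple_jump_integrand M F \<nu> (hs n)"
    and e: "\<And>T. 0 \<le> T \<Longrightarrow> (\<lambda>n. energy M \<nu> 0 T (\<lambda>r u w. simple_jump_value (hs n) r u w - G r u w)) \<longlonglongrightarrow> 0"
    and c: "\<And>T. 0 \<le> T \<Longrightarrow> (\<lambda>n. sq_norm M (\<lambda>w. step_integral R (hs n) T w - I T w)) \<longlonglongrightarrow> 0"
    using NI unfolding noise_integral_def by blast
  have t: "0 \<le> t" using st by simp
  note [measurable] = noise_integral_measurable[OF NI st(1)] noise_integral_measurable[OF NI t]
    step_integral_measurable[OF hs st(1)] step_integral_measurable[OF hs t]
  define c1 c2 where "c1 = ennreal (1 + \<delta>)" and "c2 = ennreal (1 + 1 / \<delta>)"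
  define en where "en n = energy M \<nu> 0 t (\<lambda>r u w. simple_jump_value (hs n) r u w - G r u w)" for n
  define x where "x T n = sq_norm M (\<lambda>w. step_integral R (hs n) T w - I T w)" for T n
  have le: "sq_norm M (\<lambda>w. I t w - I s w) \<le> c1 * (c1 * energy M \<nu> s t G + c2 * en n) + c2 * (2 * x s n + 2 * x t n)" for n
  proof -
    have vG: "(\<lambda>(r, u, w). simple_jump_value (hs n) r u w - G r u w) \<in> borel_measurable (borel \<Otimes>\<^sub>M \<nu> \<Otimes>\<^sub>M M)"
      using borel_measurable_diff[OF simple_value_measurable[OF hs[of n]] G] by (simp add: case_prod_unfold)
    have "sq_norm M (\<lambda>w. I t w - I s w) =
       sq_norm M (\<lambda>w. (step_integral R (hs n) t w - step_integral R (hs n) s w) +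
          ((step_integral R (hs n) s w - I s w) + - (step_integral R (hs n) t w - I t w)))"
      by (simp add: algebra_simps)
    also have "\<dots> \<le> c1 * sq_norm M (\<lambda>w. step_integral R (hs n) t w - step_integral R (hs n) s w)
       + c2 * sq_norm M (\<lambda>w. (step_integral R (hs n) s w - I s w) + - (step_integral R (hs n) t w - I t w))"
      unfolding c1_def c2_def by (rule nn_norm_add_sq_le) (use \<delta> in measurable)
    also have "sq_norm M (\<lambda>w. (step_integral R (hs n) s w - I s w) + - (step_integral R (hs n) t w - I t w))
       \<le> ennreal (1 + 1) * x s n + ennreal (1 + 1 / 1) * sq_norm M (\<lambda>w. - (step_integral R (hs n) t w - I t w))"
      unfolding x_def by (rule nn_norm_add_sq_le) measurable
    also have "\<dots> = 2 * x s n + 2 * x t n" unfolding norm_minus_cancel x_def by simp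
    also have "sq_norm M (\<lambda>w. step_integral R (hs n) t w - step_integral R (hs n) s w)
        = energy M \<nu> s t (\<lambda>r u w. G r u w + (simple_jump_value (hs n) r u w - G r u w))"
      using step_integral_isometry(2)[OF hs st] by (simp add: energy_def)
    also have "\<dots> \<le> c1 * energy M \<nu> s t G + c2 * energy M \<nu> s t (\<lambda>r u w. simple_jump_value (hs n) r u w - G r u w)"
      unfolding c1_def c2_def by (rule energy_add_le[OF G vG \<delta>])
    also have "energy M \<nu> s t (\<lambda>r u w. simple_jump_value (hs n) r u w - G r u w) \<le> en n"
      unfolding en_def by (rule energy_mono_interval) (use st in auto)
    finally show ?thesis by (simp add: add_mono mult_left_mono)
  qed
  have "(\<lambda>n. c1 * (c1 * energy M \<nu> s t G + c2 * en n) + c2 * (2 * x s n + 2 * x t n)) \<longlonglongrightarrow>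
      c1 * (c1 * energy M \<nu> s t G + c2 * 0) + c2 * (2 * 0 + 2 * 0)"
    using e[OF t] c[OF st(1)] c[OF t] unfolding en_def x_def c1_def c2_def
    by (intro tendsto_add tendsto_const ennreal_tendsto_cmult) auto
  then have "sq_norm M (\<lambda>w. I t w - I s w) \<le> c1 * (c1 * energy M \<nu> s t G + c2 * 0) + c2 * (2 * 0 + 2 * 0)"
    by (rule LIMSEQ_le_const) (use le in auto)
  then show "sq_norm M (\<lambda>w. I t w - I s w) \<le> ennreal (1 + \<delta>) * (ennreal (1 + \<delta>) * energy M \<nu> s t G)"
    by (simp add: c1_def)
qed

lemma noise_integral_0:
  fixes I :: "real \<Rightarrow> 'w \<Rightarrow> real^'d::finite"
  assumes NI: "noise_integral M F \<nu> R G I"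
  shows "AE w in M. I 0 w = 0"
proof -
  obtain hs where hs: "\<And>n. simple_jump_integrand M F \<nu> (hs n)"
    and c: "\<And>T. 0 \<le> T \<Longrightarrow> (\<lambda>n. sq_norm M (\<lambda>w. step_integral R (hs n) T w - I T w)) \<longlonglongrightarrow> 0"
    using NI unfolding noise_integral_def by blast
  have "sq_norm M (\<lambda>w. I 0 w) = 0"
    using c[of 0] by (simp add: step_integral_0[OF hs] LIMSEQ_const_iff)
  then have "AE w in M. ennreal ((norm (I 0 w))\<^sup>2) = 0"
    using noise_integral_measurable[OF NI] by (subst (asm) nn_integral_0_iff_AE) auto
  then show ?thesis by eventually_elim simp
qed

text \<open>The inequality \<open>2 |a \<bullet> b| <= \<delta> |a|^2 + |b|^2 / \<delta>\<close>
  bounds the error of replacing the increment by that of an elementary integral; \<open>n\<close>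
  tends to infinity at fixed \<open>\<delta>\<close>, and only then \<open>\<delta>\<close> tends to
  0.\<close>

lemma noise_integral_orthogonal:
  fixes I :: "real \<Rightarrow> 'w \<Rightarrow> real^'d::finite"
  assumes NI: "noise_integral M F \<nu> R G I" and st: "0 \<le> s" "s \<le> t"
    and fin: "integrable M (\<lambda>w. (norm (I t w - I s w))\<^sup>2)"
    and \<zeta>: "\<zeta> \<in> borel_measurable (F s)" and sq: "integrable M (\<lambda>w. (norm (\<zeta> w))\<^sup>2)"
  shows "expectation (\<lambda>w. \<zeta> w \<bullet> (I t w - I s w)) = 0"
proof -
  obtain hs where hs: "\<And>n. simple_jump_integrand M F \<nu> (hs n)"
    and c: "\<And>T. 0 \<le> T \<Longrightarrow> (\<lambda>n. sq_norm M (\<lambda>w. step_integral R (hs n) T w - I T w)) \<longlonglongrightarrow> 0"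
    using NI unfolding noise_integral_def by blast
  have t: "0 \<le> t" using st by simp
  note [measurable] = noise_integral_measurable[OF NI st(1)] noise_integral_measurable[OF NI t]
    step_integral_measurable[OF hs st(1)] step_integral_measurable[OF hs t] measurable_F_M[OF \<zeta>]
  define \<Delta> where "\<Delta> w = I t w - I s w" for w
  define S where "S n w = step_integral R (hs n) t w - step_integral R (hs n) s w" for n w
  have [measurable]: "\<Delta> \<in> borel_measurable M" "S n \<in> borel_measurable M" for n
    unfolding \<Delta>_def[abs_def] S_def[abs_def] by measurable
  have iS: "integrable M (\<lambda>w. (norm (S n w))\<^sup>2)" for n unfolding S_def by (rule step_integral_isometry(1)[OF hs st])
  have i\<Delta>: "integrable M (\<lambda>w. (norm (\<Delta> w))\<^sup>2)" using fin by (simp add: \<Delta>_def)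
  have id: "integrable M (\<lambda>w. (norm (\<Delta> w - S n w))\<^sup>2)" for n using i\<Delta> iS by (intro sq_integrable_diff) auto
  define q where "q n = expectation (\<lambda>w. (norm (\<Delta> w - S n w))\<^sup>2)" for n
  have "(\<lambda>n. ennreal (q n)) \<longlonglongrightarrow> 0"
  proof (rule tendsto_sandwich[OF _ _ tendsto_const])
    show "\<forall>\<^sub>F n in sequentially. ennreal (q n) \<le> ennreal (1 + 1) * sq_norm M (\<lambda>w. step_integral R (hs n) s w - I s w)
      + ennreal (1 + 1 / 1) * sq_norm M (\<lambda>w. step_integral R (hs n) t w - I t w)"
    proof (intro always_eventually allI)
      fix n
      have "ennreal (q n) = sq_norm M (\<lambda>w. (step_integral R (hs n) s w - I s w) + - (step_integral R (hs n) t w - I t w))"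
        unfolding q_def nn_of_sq_integrable[OF id, symmetric] by (simp add: \<Delta>_def S_def algebra_simps)
      also have "\<dots> \<le> ennreal (1 + 1) * sq_norm M (\<lambda>w. step_integral R (hs n) s w - I s w)
        + ennreal (1 + 1 / 1) * sq_norm M (\<lambda>w. - (step_integral R (hs n) t w - I t w))"
        by (rule nn_norm_add_sq_le) measurable
      finally show "ennreal (q n) \<le> ennreal (1 + 1) * sq_norm M (\<lambda>w. step_integral R (hs n) s w - I s w)
        + ennreal (1 + 1 / 1) * sq_norm M (\<lambda>w. step_integral R (hs n) t w - I t w)"
        unfolding norm_minus_cancel .
    qed
    have "(\<lambda>n. ennreal (1 + 1) * sq_norm M (\<lambda>w. step_integral R (hs n) s w - I s w)
      + ennreal (1 + 1 / 1) * sq_norm M (\<lambda>w. step_integral R (hs n) t w - I t w)) \<longlonglongrightarrow> ennreal (1 + 1) * 0 + ennreal (1 + 1 / 1) * 0"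
      using c[OF st(1)] c[OF t] by (intro tendsto_add ennreal_tendsto_cmult) auto
    then show "(\<lambda>n. ennreal (1 + 1) * sq_norm M (\<lambda>w. step_integral R (hs n) s w - I s w)
      + ennreal (1 + 1 / 1) * sq_norm M (\<lambda>w. step_integral R (hs n) t w - I t w)) \<longlonglongrightarrow> 0" by simp
  qed simp
  moreover have q0: "0 \<le> q n" for n by (simp add: q_def)
  ultimately have q: "q \<longlonglongrightarrow> 0" using tendsto_ennreal_iff[of q sequentially 0] by simp
  define z where "z = expectation (\<lambda>w. (norm (\<zeta> w))\<^sup>2)"
  have le: "2 * \<bar>expectation (\<lambda>w. \<zeta> w \<bullet> \<Delta> w)\<bar> \<le> \<delta> * z + q n / \<delta>" if \<delta>: "\<delta> > 0" for \<delta> n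
  proof -
    have i1: "integrable M (\<lambda>w. \<zeta> w \<bullet> \<Delta> w)" "integrable M (\<lambda>w. \<zeta> w \<bullet> S n w)" "integrable M (\<lambda>w. \<zeta> w \<bullet> (\<Delta> w - S n w))"
      using sq i\<Delta> iS id by (auto intro!: sq_integrable_inner)
    have "expectation (\<lambda>w. \<zeta> w \<bullet> S n w) = 0"
      unfolding S_def by (rule step_integral_orthogonal[OF hs st \<zeta> sq])
    then have "expectation (\<lambda>w. \<zeta> w \<bullet> \<Delta> w) = expectation (\<lambda>w. \<zeta> w \<bullet> (\<Delta> w - S n w))"
      using i1 by (simp add: inner_diff_right)
    then have "\<bar>expectation (\<lambda>w. \<zeta> w \<bullet> \<Delta> w)\<bar> \<le> expectation (\<lambda>w. \<bar>\<zeta> w \<bullet> (\<Delta> w - S n w)\<bar>)" by simp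
    also have "\<dots> \<le> expectation (\<lambda>w. (\<delta> * (norm (\<zeta> w))\<^sup>2 + (norm (\<Delta> w - S n w))\<^sup>2 / \<delta>) / 2)"
    proof (rule integral_mono)
      fix w show "\<bar>\<zeta> w \<bullet> (\<Delta> w - S n w)\<bar> \<le> (\<delta> * (norm (\<zeta> w))\<^sup>2 + (norm (\<Delta> w - S n w))\<^sup>2 / \<delta>) / 2"
        using two_inner_le[OF \<delta>, of "\<zeta> w" "\<Delta> w - S n w"] by simp
    qed (use i1(3) sq id in auto)
    also have "\<dots> = (\<delta> * z + q n / \<delta>) / 2" using sq id by (simp add: z_def q_def)
    finally show ?thesis by simp
  qed
  have le2: "2 * \<bar>expectation (\<lambda>w. \<zeta> w \<bullet> \<Delta> w)\<bar> \<le> \<delta> * z" if \<delta>: "\<delta> > 0" for \<delta>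
  proof -
    have "(\<lambda>n. \<delta> * z + q n / \<delta>) \<longlonglongrightarrow> \<delta> * z + 0 / \<delta>" using \<delta> by (intro tendsto_intros q) auto
    then have "2 * \<bar>expectation (\<lambda>w. \<zeta> w \<bullet> \<Delta> w)\<bar> \<le> \<delta> * z + 0 / \<delta>"
      by (rule LIMSEQ_le_const) (use le[OF \<delta>] in auto)
    then show ?thesis by simp
  qed
  have "(\<lambda>n. (1 / real (Suc n)) * z) \<longlonglongrightarrow> 0 * z" by (intro tendsto_intros LIMSEQ_Suc lim_1_over_n)
  then have "2 * \<bar>expectation (\<lambda>w. \<zeta> w \<bullet> \<Delta> w)\<bar> \<le> 0 * z"
    by (rule LIMSEQ_le_const) (intro exI[of _ 0] allI impI le2, simp)
  then show ?thesis by (simp add: \<Delta>_def)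
qed

lemma noise_integral_diff:
  fixes I I' :: "real \<Rightarrow> 'w \<Rightarrow> real^'d::finite"
  assumes NI: "noise_integral M F \<nu> R G I" and NI': "noise_integral M F \<nu> R G' I'"
    and G: "(\<lambda>(r, u, w). G r u w) \<in> borel_measurable (borel \<Otimes>\<^sub>M \<nu> \<Otimes>\<^sub>M M)"
    and G': "(\<lambda>(r, u, w). G' r u w) \<in> borel_measurable (borel \<Otimes>\<^sub>M \<nu> \<Otimes>\<^sub>M M)"
  shows "noise_integral M F \<nu> R (\<lambda>r u w. G r u w - G' r u w) (\<lambda>t w. I t w - I' t w)"
proof -
  obtain hs where hs: "\<And>n. simple_jump_integrand M F \<nu> (hs n)"
    and e: "\<And>T. 0 \<le> T \<Longrightarrow> (\<lambda>n. energy M \<nu> 0 T (\<lambda>r u w. simple_jump_value (hs n) r u w - G r u w)) \<longlonglongrightarrow> 0"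
    and c: "\<And>T. 0 \<le> T \<Longrightarrow> (\<lambda>n. sq_norm M (\<lambda>w. step_integral R (hs n) T w - I T w)) \<longlonglongrightarrow> 0"
    using NI unfolding noise_integral_def by blast
  obtain hs' where hs': "\<And>n. simple_jump_integrand M F \<nu> (hs' n)"
    and e': "\<And>T. 0 \<le> T \<Longrightarrow> (\<lambda>n. energy M \<nu> 0 T (\<lambda>r u w. simple_jump_value (hs' n) r u w - G' r u w)) \<longlonglongrightarrow> 0"
    and c': "\<And>T. 0 \<le> T \<Longrightarrow> (\<lambda>n. sq_norm M (\<lambda>w. step_integral R (hs' n) T w - I' T w)) \<longlonglongrightarrow> 0"
    using NI' unfolding noise_integral_def by blast
  have lim: "(\<lambda>n. 2 * f n + 2 * g n) \<longlonglongrightarrow> 0" if "f \<longlonglongrightarrow> 0" "g \<longlonglongrightarrow> 0" for f g :: "nat \<Rightarrow> ennreal"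
  proof -
    have "(\<lambda>n. 2 * f n + 2 * g n) \<longlonglongrightarrow> 2 * 0 + 2 * 0" using that by (intro tendsto_add ennreal_tendsto_cmult) auto
    then show ?thesis by simp
  qed
  show ?thesis unfolding noise_integral_def
  proof (intro conjI allI impI exI[of _ "\<lambda>n. step_diff (hs n) (hs' n)"])
    show "(\<lambda>w. I t w - I' t w) \<in> borel_measurable M" if "0 \<le> t" for t
      using noise_integral_measurable[OF NI that] noise_integral_measurable[OF NI' that] by simp
    show "simple_jump_integrand M F \<nu> (step_diff (hs n) (hs' n))" for n by (rule simple_step_diff[OF hs hs'])
    fix T :: real assume T: "0 \<le> T"
    show "(\<lambda>n. energy M \<nu> 0 T (\<lambda>r u w. simple_jump_value (step_diff (hs n) (hs' n)) r u w - (G r u w - G' r u w))) \<longlonglongrightarrow> 0"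
    proof (rule tendsto_sandwich[OF _ _ tendsto_const lim[OF e[OF T] e'[OF T]]])
      have m: "(\<lambda>(r, u, w). simple_jump_value (hs n) r u w - G r u w) \<in> borel_measurable (borel \<Otimes>\<^sub>M \<nu> \<Otimes>\<^sub>M M)"
        "(\<lambda>(r, u, w). simple_jump_value (hs' n) r u w - G' r u w) \<in> borel_measurable (borel \<Otimes>\<^sub>M \<nu> \<Otimes>\<^sub>M M)" for n
        using borel_measurable_diff[OF simple_value_measurable[OF hs[of n]] G]
          borel_measurable_diff[OF simple_value_measurable[OF hs'[of n]] G'] by (simp_all add: case_prod_unfold)
      show "\<forall>\<^sub>F n in sequentially. energy M \<nu> 0 T (\<lambda>r u w. simple_jump_value (step_diff (hs n) (hs' n)) r u w - (G r u w - G' r u w))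
          \<le> 2 * energy M \<nu> 0 T (\<lambda>r u w. simple_jump_value (hs n) r u w - G r u w)
            + 2 * energy M \<nu> 0 T (\<lambda>r u w. simple_jump_value (hs' n) r u w - G' r u w)"
        using energy_diff_le2[OF m] by (intro always_eventually allI) (simp add: step_value_diff algebra_simps)
    qed simp
    show "(\<lambda>n. sq_norm M (\<lambda>w. step_integral R (step_diff (hs n) (hs' n)) T w - (I T w - I' T w))) \<longlonglongrightarrow> 0"
    proof (rule tendsto_sandwich[OF _ _ tendsto_const lim[OF c[OF T] c'[OF T]]])
      have "sq_norm M (\<lambda>w. (step_integral R (hs n) T w - I T w) + - (step_integral R (hs' n) T w - I' T w))
         \<le> ennreal (1 + 1) * sq_norm M (\<lambda>w. step_integral R (hs n) T w - I T w)
            + ennreal (1 + 1 / 1) * sq_norm M (\<lambda>w. - (step_integral R (hs' n) T w - I' T w))" for n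
        using noise_integral_measurable[OF NI T] noise_integral_measurable[OF NI' T]
          step_integral_measurable[OF hs T] step_integral_measurable[OF hs' T] by (intro nn_norm_add_sq_le) auto
      then show "\<forall>\<^sub>F n in sequentially. sq_norm M (\<lambda>w. step_integral R (step_diff (hs n) (hs' n)) T w - (I T w - I' T w))
         \<le> 2 * sq_norm M (\<lambda>w. step_integral R (hs n) T w - I T w)
            + 2 * sq_norm M (\<lambda>w. step_integral R (hs' n) T w - I' T w)"
        unfolding norm_minus_cancel by (intro always_eventually allI) (simp add: step_integral_diff algebra_simps)
    qed simp
  qed
qed

lemma noise_integral_step:
  assumes "simple_jump_integrand M F \<nu> (hs :: ('w, 'u, 'd::finite) simple_jump_integrand)"
  shows "noise_integral M F \<nu> R (simple_jump_value hs) (step_integral R hs)"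
  unfolding noise_integral_def using assms step_integral_measurable[OF assms]
  by (intro conjI allI impI exI[of _ "\<lambda>_. hs"]) (auto simp: energy_def)

end

section \<open>Path regularity of the integrals\<close>

lemma cadlagI:
  assumes "\<And>t. 0 \<le> t \<Longrightarrow> (f \<longlongrightarrow> f t) (at_right t)" "\<And>t. 0 < t \<Longrightarrow> (f \<longlongrightarrow> l t) (at_left t)"
  shows "cadlag f"
  using assms by (auto simp: cadlag_def)

lemma cadlag_const: "cadlag (\<lambda>_. c)"
  by (rule cadlagI) (rule tendsto_const)+

lemma cadlag_add:
  fixes f g :: "real \<Rightarrow> 'b::real_normed_vector"
  assumes "cadlag f" "cadlag g"
  shows "cadlag (\<lambda>t. f t + g t)"
  by (rule cadlagI[where l="\<lambda>t. left_limit f t + left_limit g t"]) (auto intro!: tendsto_add simp: cadlag_right cadlag_left assms)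

lemma cadlag_diff:
  fixes f g :: "real \<Rightarrow> 'b::real_normed_vector"
  assumes "cadlag f" "cadlag g"
  shows "cadlag (\<lambda>t. f t - g t)"
  by (rule cadlagI[where l="\<lambda>t. left_limit f t - left_limit g t"]) (auto intro!: tendsto_diff simp: cadlag_right cadlag_left assms)

lemma cadlag_scaleR_left:
  fixes c :: "'b::real_normed_vector"
  assumes "cadlag f" shows "cadlag (\<lambda>t. f t *\<^sub>R c)"
  by (rule cadlagI[where l="\<lambda>t. left_limit f t *\<^sub>R c"]) (auto intro!: tendsto_scaleR simp: cadlag_right cadlag_left assms)

lemma continuous_imp_cadlag:
  fixes f :: "real \<Rightarrow> 'b::metric_space"
  assumes f: "continuous_on {0..} f"
  shows "cadlag f"
  unfolding cadlag_def
proof (intro conjI allI impI)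
  fix t :: real assume t: "0 \<le> t"
  have "(f \<longlongrightarrow> f t) (at t within {0..})" using f t by (simp add: continuous_on_def)
  then show "(f \<longlongrightarrow> f t) (at_right t)" by (rule tendsto_within_subset) (use t in auto)
next
  fix t :: real assume t: "0 < t"
  have "(f \<longlongrightarrow> f t) (at t within {0..})" using f t by (simp add: continuous_on_def)
  then have "(f \<longlongrightarrow> f t) (at t within {0..<t})" by (rule tendsto_within_subset) auto
  moreover have "at_left t = at t within {0..<t}"
    using t by (intro at_within_nhd[of t "{0<..}"]) auto
  ultimately show "\<exists>l. (f \<longlongrightarrow> l) (at_left t)" by auto
qed

lemma cadlag_stopped:
  fixes f :: "real \<Rightarrow> 'b::metric_space"
  assumes f: "cadlag f" and a: "0 \<le> a"
  shows "cadlag (\<lambda>t. f (min a t))"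
proof (rule cadlagI[where l="\<lambda>t. if t \<le> a then left_limit f t else f a"])
  fix t :: real assume t: "0 \<le> t"
  show "((\<lambda>t. f (min a t)) \<longlongrightarrow> f (min a t)) (at_right t)"
  proof (cases "t < a")
    case True
    have "eventually (\<lambda>s. f s = f (min a s)) (at_right t)"
      using eventually_at_right_real[OF True] by eventually_elim simp
    moreover have "f (min a t) = f t" using True by simp
    ultimately show ?thesis using Lim_transform_eventually[OF cadlag_right[OF f t]] by simp
  next
    case False
    have "t < t + 1" by simp
    from eventually_at_right_real[OF this] have "eventually (\<lambda>s. f (min a s) = f (min a t)) (at_right t)"
    proof eventually_elim
      case (elim s)
      then have "min a s = a" "min a t = a" using False by auto
      then show ?case by simp
    qed
    then show ?thesis by (rule tendsto_eventually)
  qed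
next
  fix t :: real assume t: "0 < t"
  show "((\<lambda>t. f (min a t)) \<longlongrightarrow> (if t \<le> a then left_limit f t else f a)) (at_left t)"
  proof (cases "t \<le> a")
    case True
    have "t - 1 < t" by simp
    from eventually_at_left_real[OF this] have "eventually (\<lambda>s. f s = f (min a s)) (at_left t)"
      by eventually_elim (use True in simp)
    then show ?thesis using Lim_transform_eventually[OF cadlag_left[OF f t]] True by simp
  next
    case False
    then have "a < t" by simp
    from eventually_at_left_real[OF this] have "eventually (\<lambda>s. f (min a s) = f a) (at_left t)"
      by eventually_elim simp
    then show ?thesis using False by (simp add: tendsto_eventually)
  qed
qed

text \<open>A uniform bound on the distance of \<open>f n\<close> and \<open>f m\<close> passes to
  their left limits at \<open>t\<close>, which therefore form a Cauchy sequence; its limit is the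
  left limit of \<open>l\<close>. Completeness of the range is used here.\<close>

lemma cadlag_uniform_limit:
  fixes f :: "nat \<Rightarrow> real \<Rightarrow> 'b::{complete_space, metric_space}"
  assumes f: "\<And>n. cadlag (f n)" and u: "\<And>T. 0 \<le> T \<Longrightarrow> uniform_limit {0..T} f l sequentially"
  shows "cadlag l"
  unfolding cadlag_def
proof (intro conjI allI impI)
  fix t :: real assume t: "0 \<le> t"
  have "t < t + 1" by simp
  from eventually_at_right_real[OF this] have ev: "\<forall>\<^sub>F s in at_right t. s \<in> {0..t + 1}"
    by eventually_elim (use t in auto)
  show "(l \<longlongrightarrow> l t) (at_right t)"
  proof (rule tendstoI)
    fix e :: real assume e: "0 < e"
    have "\<forall>\<^sub>F n in sequentially. \<forall>s\<in>{0..t + 1}. dist (f n s) (l s) < e / 3"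
      using uniform_limitD[OF u[of "t + 1"], of "e / 3"] t e by simp
    then obtain n where n: "\<And>s. s \<in> {0..t + 1} \<Longrightarrow> dist (f n s) (l s) < e / 3"
      unfolding eventually_sequentially by blast
    have "\<forall>\<^sub>F s in at_right t. dist (f n s) (f n t) < e / 3"
      using cadlag_right[OF f t] e by (intro tendstoD) auto
    with ev show "\<forall>\<^sub>F s in at_right t. dist (l s) (l t) < e"
    proof eventually_elim
      case (elim s)
      then show ?case using n[of s] n[of t] t dist_triangle[of "l s" "l t" "f n s"]
          dist_triangle[of "f n s" "l t" "f n t"] by (simp add: dist_commute)
    qed
  qed
next
  fix t :: real assume t: "0 < t"
  have ev: "\<forall>\<^sub>F s in at_left t. s \<in> {0..t}"
    using eventually_at_left_real[OF t] by eventually_elim auto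
  define L where "L n = left_limit (f n) t" for n
  have L: "(f n \<longlongrightarrow> L n) (at_left t)" for n unfolding L_def by (rule cadlag_left[OF f t])
  have LL: "dist (L n) (L m) \<le> e" if "\<And>s. s \<in> {0..t} \<Longrightarrow> dist (f n s) (f m s) \<le> e" for n m e
  proof (rule tendsto_upperbound[OF tendsto_dist[OF L L]])
    show "\<forall>\<^sub>F s in at_left t. dist (f n s) (f m s) \<le> e" using ev by eventually_elim (rule that)
  qed auto
  have near: "\<exists>N. \<forall>n\<ge>N. \<forall>s\<in>{0..t}. dist (f n s) (l s) < e" if "e > 0" for e
    using uniform_limitD[OF u[of t] that] t by (auto simp: eventually_sequentially)
  have "Cauchy L"
  proof (rule metric_CauchyI)
    fix e :: real assume e: "0 < e"
    then have "0 < e / 4" by simp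
    from near[OF this] obtain N where N: "\<And>n s. n \<ge> N \<Longrightarrow> s \<in> {0..t} \<Longrightarrow> dist (f n s) (l s) < e / 4" by blast
    have "dist (L n) (L m) \<le> e / 2" if nm: "n \<ge> N" "m \<ge> N" for n m
    proof (rule LL)
      fix s assume "s \<in> {0..t}"
      then show "dist (f n s) (f m s) \<le> e / 2"
        using N[OF nm(1), of s] N[OF nm(2), of s] dist_triangle2[of "f n s" "f m s" "l s"] by linarith
    qed
    then show "\<exists>M. \<forall>m\<ge>M. \<forall>n\<ge>M. dist (L m) (L n) < e" using e by (intro exI[of _ N]) force
  qed
  then obtain y where y: "L \<longlonglongrightarrow> y" using Cauchy_convergent_iff convergent_def by blast
  have "(l \<longlongrightarrow> y) (at_left t)"
  proof (rule tendstoI)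
    fix e :: real assume e: "0 < e"
    have e3: "0 < e / 3" using e by simp
    from near[OF this] obtain N where N: "\<And>n s. n \<ge> N \<Longrightarrow> s \<in> {0..t} \<Longrightarrow> dist (f n s) (l s) < e / 3" by blast
    obtain N' where N': "\<And>n. n \<ge> N' \<Longrightarrow> dist (L n) y < e / 3"
      using tendstoD[OF y e3] unfolding eventually_sequentially by blast
    define n where "n = max N N'"
    have "\<forall>\<^sub>F s in at_left t. dist (f n s) (L n) < e / 3" using L e by (intro tendstoD) auto
    with ev show "\<forall>\<^sub>F s in at_left t. dist (l s) y < e"
    proof eventually_elim
      case (elim s)
      then show ?case using N[of n s] N'[of n] dist_triangle[of "l s" y "f n s"]
          dist_triangle[of "f n s" y "L n"] by (simp add: dist_commute n_def)
    qed
  qed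
  then show "\<exists>y. (l \<longlongrightarrow> y) (at_left t)" by blast
qed

context filtered_prob
begin

text \<open>The induction carries the sharper bound with \<open>indicator (E k)\<close> on the
  right. On \<open>E k\<close>, which is an event of time \<open>t k\<close>, passing from
  \<open>S k\<close> to \<open>S (Suc k)\<close> can only increase the second moment, since the
  cross term vanishes by \<open>orth\<close> with \<open>\<zeta>\<close> the restriction of
  \<open>S k\<close> to \<open>E k\<close>; on the newly added event the bound holds by the
  definition of that event. No first passage time has to be introduced.\<close>

lemma kolmogorov_maximal:
  fixes S :: "nat \<Rightarrow> 'w \<Rightarrow> 'b::euclidean_space" and t :: "nat \<Rightarrow> real"
  assumes t: "mono t" and ad: "\<And>k. S k \<in> borel_measurable (F (t k))"
    and sq: "\<And>k. integrable M (\<lambda>w. (norm (S k w))\<^sup>2)"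
    and orth: "\<And>k \<zeta>. \<zeta> \<in> borel_measurable (F (t k)) \<Longrightarrow> integrable M (\<lambda>w. (norm (\<zeta> w))\<^sup>2) \<Longrightarrow>
       expectation (\<lambda>w. \<zeta> w \<bullet> (S (Suc k) w - S k w)) = 0"
    and \<kappa>: "0 \<le> \<kappa>"
  shows "\<kappa>\<^sup>2 * prob {w\<in>space M. \<exists>j\<le>k. \<kappa> < norm (S j w)} \<le> expectation (\<lambda>w. (norm (S k w))\<^sup>2)"
proof -
  define E where "E k = {w\<in>space M. \<exists>j\<le>k. \<kappa> < norm (S j w)}" for k
  have EF: "E k \<in> sets (F (t k))" for k
  proof -
    have m: "S j \<in> borel_measurable (F (t k))" if "j \<le> k" for j
      using measurable_F_mono[OF ad[of j]] monoD[OF t that] by blast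
    have "E k = (\<Union>j\<in>{..k}. {w\<in>space (F (t k)). \<kappa> < norm (S j w)})" by (auto simp: E_def)
    moreover have "{w\<in>space (F (t k)). \<kappa> < norm (S j w)} \<in> sets (F (t k))" if "j \<le> k" for j
      using m[OF that] by measurable
    ultimately show ?thesis by auto
  qed
  have EM[measurable]: "E k \<in> sets M" for k using EF subalgebra_F[of "t k"] by (auto simp: subalgebra_def)
  have SM[measurable]: "S k \<in> borel_measurable M" for k using measurable_F_M[OF ad] .
  have ind: "integrable M (\<lambda>w. indicator (E k) w * (norm (S j w))\<^sup>2)" for k j
    using integrable_mult_indicator[OF EM sq] by simp
  have iI: "integrable M (indicat_real A)" if "A \<in> sets M" for A
    by (rule integrable_real_indicator[OF that]) (simp add: less_top[symmetric])
  have "\<kappa>\<^sup>2 * prob (E k) \<le> expectation (\<lambda>w. indicator (E k) w * (norm (S k w))\<^sup>2)"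
  proof (induction k)
    case 0
    have "\<kappa>\<^sup>2 * prob (E 0) = expectation (\<lambda>w. \<kappa>\<^sup>2 * indicator (E 0) w)" by simp
    also have "\<dots> \<le> expectation (\<lambda>w. indicator (E 0) w * (norm (S 0 w))\<^sup>2)"
    proof (intro integral_mono ind)
      fix w show "\<kappa>\<^sup>2 * indicator (E 0) w \<le> indicator (E 0) w * (norm (S 0 w))\<^sup>2"
        using \<kappa> by (auto simp: indicator_def E_def intro!: power_mono)
    qed (simp add: iI)
    finally show ?case .
  next
    case (Suc k)
    define B where "B = E (Suc k) - E k"
    have [measurable]: "B \<in> sets M" by (simp add: B_def)
    have sub: "E k \<subseteq> E (Suc k)" unfolding E_def using le_SucI by blast
    have iE: "indicator (E (Suc k)) w = (indicator (E k) w + indicator B w :: real)" for w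
      using sub by (auto simp: B_def indicator_def)
    have iB: "integrable M (\<lambda>w. indicator B w * (norm (S (Suc k) w))\<^sup>2)"
      using integrable_mult_indicator[of B M, OF _ sq] by simp
    have "prob (E (Suc k)) = prob (E k) + prob B"
      using finite_measure_Diff[OF EM EM sub] by (simp add: B_def)
    moreover have "\<kappa>\<^sup>2 * prob B \<le> expectation (\<lambda>w. indicator B w * (norm (S (Suc k) w))\<^sup>2)"
    proof -
      have "\<kappa>\<^sup>2 * prob B = expectation (\<lambda>w. \<kappa>\<^sup>2 * indicator B w)" by simp
      also have "\<dots> \<le> expectation (\<lambda>w. indicator B w * (norm (S (Suc k) w))\<^sup>2)"
      proof (intro integral_mono iB)
        fix w
        have "\<kappa> < norm (S (Suc k) w)" if "w \<in> B" using that by (auto simp: B_def E_def le_Suc_eq)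
        then show "\<kappa>\<^sup>2 * indicator B w \<le> indicator B w * (norm (S (Suc k) w))\<^sup>2"
          using \<kappa> by (auto simp: indicator_def intro!: power_mono)
      qed (simp add: iI)
      finally show ?thesis .
    qed
    moreover have "expectation (\<lambda>w. indicator (E k) w * (norm (S k w))\<^sup>2) \<le> expectation (\<lambda>w. indicator (E k) w * (norm (S (Suc k) w))\<^sup>2)"
    proof -
      define \<zeta> where "\<zeta> w = indicator (E k) w *\<^sub>R S k w" for w
      have \<zeta>: "\<zeta> \<in> borel_measurable (F (t k))" unfolding \<zeta>_def[abs_def] using EF ad by measurable
      have [measurable]: "\<zeta> \<in> borel_measurable M" using measurable_F_M[OF \<zeta>] .
      have i\<zeta>: "integrable M (\<lambda>w. (norm (\<zeta> w))\<^sup>2)"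
        using ind[of k k] by (rule Bochner_Integration.integrable_bound) (auto simp: \<zeta>_def indicator_def)
      have iz: "integrable M (\<lambda>w. \<zeta> w \<bullet> (S (Suc k) w - S k w))"
        by (intro sq_integrable_inner i\<zeta> sq_integrable_diff sq) auto
      have "expectation (\<lambda>w. indicator (E k) w * (norm (S k w))\<^sup>2) =
          expectation (\<lambda>w. indicator (E k) w * (norm (S k w))\<^sup>2 + 2 * (\<zeta> w \<bullet> (S (Suc k) w - S k w)))"
        using orth[OF \<zeta> i\<zeta>] ind[of k k] iz by simp
      also have "\<dots> \<le> expectation (\<lambda>w. indicator (E k) w * (norm (S (Suc k) w))\<^sup>2)"
      proof (rule integral_mono)
        fix w
        have "(norm (S (Suc k) w))\<^sup>2 = (norm (S k w))\<^sup>2 + 2 * (S k w \<bullet> (S (Suc k) w - S k w)) + (norm (S (Suc k) w - S k w))\<^sup>2"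
          by (simp add: power2_norm_eq_inner inner_diff_left inner_diff_right inner_commute)
        then show "indicator (E k) w * (norm (S k w))\<^sup>2 + 2 * (\<zeta> w \<bullet> (S (Suc k) w - S k w)) \<le> indicator (E k) w * (norm (S (Suc k) w))\<^sup>2"
          by (auto simp: \<zeta>_def indicator_def)
      qed (use ind iz in auto)
      finally show ?thesis .
    qed
    ultimately show ?case using Suc ind[of k "Suc k"] iB by (simp add: iE distrib_right distrib_left)
  qed
  also have "\<dots> \<le> expectation (\<lambda>w. (norm (S k w))\<^sup>2)"
    by (intro integral_mono ind sq) (auto simp: indicator_def)
  finally show ?thesis by (simp add: E_def)
qed

end

context noise
begin

lemma step_integral_cadlag:
  assumes hs: "simple_jump_integrand M F \<nu> (hs :: ('w, 'u, 'd::finite) simple_jump_integrand)"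
  shows "AE w in M. cadlag (\<lambda>t. step_integral R hs t w)"
proof -
  have "AE w in M. \<forall>h\<in>set hs. cadlag (\<lambda>t. R (fst (snd (snd h))) t w)"
  proof (subst AE_ball_countable)
    show "\<forall>h\<in>set hs. AE w in M. cadlag (\<lambda>t. R (fst (snd (snd h))) t w)"
      using simple_jump_integrandD(3)[OF hs] by (auto intro!: R_cadlag)
  qed (simp add: countable_finite)
  then show ?thesis
  proof eventually_elim
    case (elim w)
    have "cadlag (\<lambda>t. step_integral R hs' t w)" if "set hs' \<subseteq> set hs" for hs'
      using that
    proof (induction hs')
      case Nil then show ?case by (simp add: step_integral_def cadlag_const)
    next
      case (Cons h hs')
      obtain a b A \<xi> where h: "h = (a, b, A, \<xi>)" by (cases h)
      then have m: "(a, b, A, \<xi>) \<in> set hs" using Cons by auto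
      have c: "cadlag (\<lambda>t. R A t w)" using elim m by force
      have "cadlag (\<lambda>t. (R A (min b t) w - R A (min a t) w) *\<^sub>R \<xi> w)"
        using simple_jump_integrandD(1,2)[OF hs m] by (intro cadlag_scaleR_left cadlag_diff cadlag_stopped[OF c]) auto
      then have "cadlag (\<lambda>t. (R A (min b t) w - R A (min a t) w) *\<^sub>R \<xi> w + step_integral R hs' t w)"
        using Cons by (intro cadlag_add) auto
      then show ?case by (simp add: step_integral_def h)
    qed
    then show ?case by simp
  qed
qed

lemma step_integral_sq_integrable:
  assumes hs: "simple_jump_integrand M F \<nu> (hs :: ('w, 'u, 'd::finite) simple_jump_integrand)" and "0 \<le> t"
  shows "integrable M (\<lambda>w. (norm (step_integral R hs t w))\<^sup>2)"
  using step_integral_isometry(1)[OF hs order_refl assms(2)] by (simp add: step_integral_0[OF hs])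

text \<open>The maximal inequality on dyadic grids of \<open>[0, T]\<close> extends to all times by
  right-continuity: since \<open>E n\<close> is defined by a strict inequality, an exceedance at
  \<open>t\<close> persists at dyadic points just above \<open>t\<close>. The grids are nested, so
  the events increase and their union \<open>B\<close> inherits the bound.\<close>

lemma step_integral_maximal:
  assumes hs: "simple_jump_integrand M F \<nu> (hs :: ('w, 'u, 'd::finite) simple_jump_integrand)" and T: "0 \<le> T" and \<kappa>: "0 < \<kappa>"
    and c: "expectation (\<lambda>w. (norm (step_integral R hs T w))\<^sup>2) \<le> c"
  obtains B where "B \<in> sets M" "prob B \<le> c / \<kappa>\<^sup>2"
    "AE w in M. w \<notin> B \<longrightarrow> (\<forall>t\<in>{0..T}. norm (step_integral R hs t w) \<le> \<kappa>)"
proof -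
  define S where "S = step_integral R hs"
  define E where "E n = {w\<in>space M. \<exists>j\<le>2 ^ n. \<kappa> < norm (S (real j * T / 2 ^ n) w)}" for n
  have t0: "0 \<le> real j * T / 2 ^ n" for j n using T by simp
  have SM[measurable]: "S (real j * T / 2 ^ n) \<in> borel_measurable M" for j n
    unfolding S_def by (rule step_integral_measurable[OF hs t0])
  have EM[measurable]: "E n \<in> sets M" for n unfolding E_def by measurable
  have pE: "prob (E n) \<le> c / \<kappa>\<^sup>2" for n
  proof -
    have "\<kappa>\<^sup>2 * prob {w\<in>space M. \<exists>j\<le>2 ^ n. \<kappa> < norm (S (real j * T / 2 ^ n) w)}
       \<le> expectation (\<lambda>w. (norm (S (real (2 ^ n :: nat) * T / 2 ^ n) w))\<^sup>2)"
    proof (rule kolmogorov_maximal[where t="\<lambda>j. real j * T / 2 ^ n"])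
      show "mono (\<lambda>j. real j * T / 2 ^ n)" using T by (intro monoI divide_right_mono mult_right_mono) auto
      show "S (real k * T / 2 ^ n) \<in> borel_measurable (F (real k * T / 2 ^ n))" for k
        unfolding S_def by (rule step_integral_adapted[OF hs t0])
      show "integrable M (\<lambda>w. (norm (S (real k * T / 2 ^ n) w))\<^sup>2)" for k
        unfolding S_def by (rule step_integral_sq_integrable[OF hs t0])
      fix k and \<zeta> :: "'w \<Rightarrow> real^'d"
      assume "\<zeta> \<in> borel_measurable (F (real k * T / 2 ^ n))" "integrable M (\<lambda>w. (norm (\<zeta> w))\<^sup>2)"
      then show "expectation (\<lambda>w. \<zeta> w \<bullet> (S (real (Suc k) * T / 2 ^ n) w - S (real k * T / 2 ^ n) w)) = 0"
        unfolding S_def using T by (intro step_integral_orthogonal[OF hs t0]) (auto intro!: divide_right_mono mult_right_mono)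
    qed (use \<kappa> in simp)
    then have "\<kappa>\<^sup>2 * prob (E n) \<le> c" using c by (simp add: E_def S_def)
    then show ?thesis using \<kappa> by (simp add: pos_le_divide_eq mult.commute)
  qed
  have "incseq E"
  proof (rule incseq_SucI)
    fix n show "E n \<le> E (Suc n)"
    proof
      fix w assume "w \<in> E n"
      then obtain j where j: "j \<le> 2 ^ n" "\<kappa> < norm (S (real j * T / 2 ^ n) w)" "w \<in> space M" by (auto simp: E_def)
      have "real (2 * j) * T / 2 ^ Suc n = real j * T / 2 ^ n" by simp
      with j show "w \<in> E (Suc n)" unfolding E_def by (auto intro!: exI[of _ "2 * j"])
    qed
  qed
  define B where "B = (\<Union>n. E n)"
  have "(\<lambda>n. prob (E n)) \<longlonglongrightarrow> prob B"
    unfolding B_def using \<open>incseq E\<close> by (intro finite_Lim_measure_incseq) auto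
  then have "prob B \<le> c / \<kappa>\<^sup>2" by (rule LIMSEQ_le_const2) (use pE in auto)
  moreover have "B \<in> sets M" by (auto simp: B_def)
  moreover have "AE w in M. w \<notin> B \<longrightarrow> (\<forall>t\<in>{0..T}. norm (step_integral R hs t w) \<le> \<kappa>)"
    using step_integral_cadlag[OF hs] AE_space
  proof eventually_elim
    case (elim w)
    note cad = elim(1)[folded S_def]
    show ?case
    proof (intro impI ballI, rule ccontr)
      fix t assume nB: "w \<notin> B" and t: "t \<in> {0..T}" and "\<not> norm (step_integral R hs t w) \<le> \<kappa>"
      then have big: "\<kappa> < norm (S t w)" by (simp add: S_def)
      show False
      \<comment> \<open>No grid point lies above \<open>T\<close>, so this endpoint is taken as the
        node \<open>j = 1\<close> of the coarsest grid.\<close>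
      proof (cases "t = T")
        case True
        then have "w \<in> E 0" using big elim by (auto simp: E_def intro!: exI[of _ 1])
        then show False using nB by (auto simp: B_def)
      next
        case False
        then have tT: "t < T" "0 \<le> t" "0 < T" using t by auto
        define d where "d n = dyadic_above n (t / T) * T" for n
        have lim: "filterlim d (at_right t) sequentially"
        proof -
          have "(\<lambda>n. dyadic_above n (t / T)) \<longlonglongrightarrow> t / T" using dyadic_above(3)[of "t / T"] by (simp add: filterlim_at)
          then have "d \<longlonglongrightarrow> t / T * T" unfolding d_def by (intro tendsto_intros)
          moreover have "t < d n" for n using dyadic_above(1)[of "t / T" n] tT by (simp add: d_def field_simps)
          ultimately show ?thesis using tT by (auto simp: filterlim_at intro!: always_eventually less_imp_neq[THEN not_sym])
        qed
        have "(\<lambda>n. norm (S (d n) w)) \<longlonglongrightarrow> norm (S t w)"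
          by (rule tendsto_norm[OF filterlim_compose[OF cadlag_right[OF cad tT(2)] lim]])
        then have "eventually (\<lambda>n. \<kappa> < norm (S (d n) w)) sequentially" using big by (rule order_tendstoD)
        then obtain n where n: "\<kappa> < norm (S (d n) w)" by (auto simp: eventually_sequentially)
        define j where "j = nat (\<lfloor>t / T * 2 ^ n\<rfloor> + 1)"
        have fl: "0 \<le> \<lfloor>t / T * 2 ^ n\<rfloor>" using tT by simp
        have "t / T < 1" using tT by simp
        then have "t / T * 2 ^ n < 1 * 2 ^ n" by (rule mult_strict_right_mono) simp
        then have "\<lfloor>t / T * 2 ^ n\<rfloor> < 2 ^ n" by (simp add: floor_less_iff)
        then have "j \<le> 2 ^ n" using fl by (simp add: j_def nat_le_iff)
        moreover have "d n = real j * T / 2 ^ n" using fl by (simp add: d_def dyadic_above_def j_def)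
        ultimately have "w \<in> E n" using n elim by (auto simp: E_def)
        then show False using nB by (auto simp: B_def)
      qed
    qed
  qed
  ultimately show ?thesis using that by blast
qed

text \<open>\<open>4 * (3/4) ^ n\<close> is the tail of the geometric series from \<open>n\<close>
  on, so the difference on the right is the sum of the steps between \<open>n\<close> and
  \<open>n + j\<close>.\<close>

lemma geometric_chain:
  fixes x :: "nat \<Rightarrow> 'b::real_normed_vector"
  assumes "\<And>n. n \<ge> N \<Longrightarrow> norm (x n - x (Suc n)) \<le> (3/4) ^ n" "n \<ge> N"
  shows "norm (x n - x (n + j)) \<le> 4 * (3/4) ^ n - 4 * (3/4) ^ (n + j)"
proof (induction j)
  case (Suc j)
  have "norm (x n - x (n + Suc j)) \<le> norm (x n - x (n + j)) + norm (x (n + j) - x (Suc (n + j)))"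
    using norm_triangle_ineq[of "x n - x (n + j)" "x (n + j) - x (Suc (n + j))"] by simp
  also have "\<dots> \<le> 4 * (3/4) ^ n - 4 * (3/4) ^ (n + j) + (3/4) ^ (n + j)"
    using Suc assms(1)[of "n + j"] assms(2) by (intro add_mono) auto
  finally show ?case by simp
qed simp

text \<open>A mean-square rate \<open>(1/2) ^ n\<close> against the threshold
  \<open>(3/4) ^ n\<close> gives exceptional events of probability at most
  \<open>C * (8/9) ^ n\<close>, since \<open>(1/2) / (3/4)^2 = 8/9\<close>. Borel-Cantelli on each
  interval \<open>[0, k]\<close> then makes almost all paths uniformly Cauchy on bounded intervals.
  The estimate is assumed for \<open>n >= T\<close> only, in accordance with a scheme that runs up
  to time \<open>n\<close>.\<close>

lemma step_integrals_converge:
  fixes hs :: "nat \<Rightarrow> ('w, 'u, 'd::finite) simple_jump_integrand"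
  assumes hs: "\<And>n. simple_jump_integrand M F \<nu> (hs n)"
    and cau: "\<And>T. 0 \<le> T \<Longrightarrow> \<exists>C\<ge>0. \<forall>n m. T \<le> real n \<longrightarrow> n \<le> m \<longrightarrow>
      sq_norm M (\<lambda>w. step_integral R (hs n) T w - step_integral R (hs m) T w) \<le> ennreal (C * (1 / 2) ^ n)"
  obtains I where "\<And>t. 0 \<le> t \<Longrightarrow> I t \<in> borel_measurable (F t)"
    "AE w in M. \<forall>T\<ge>0. uniform_limit {0..T} (\<lambda>n t. step_integral R (hs n) t w) (\<lambda>t. I t w) sequentially"
    "\<And>T. 0 \<le> T \<Longrightarrow> (\<lambda>n. sq_norm M (\<lambda>w. step_integral R (hs n) T w - I T w)) \<longlonglongrightarrow> 0"
proof -
  define S where "S n t w = step_integral R (hs n) t w" for n t w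
  \<comment> \<open>\<open>lim\<close> is total, so \<open>I t\<close> is
    \<open>F t\<close>-measurable as it stands, including the null set where the sequence may
    diverge.\<close>
  define I where "I t w = lim (\<lambda>n. S n t w)" for t w
  have SF: "S n t \<in> borel_measurable (F t)" if "0 \<le> t" for n t
    unfolding S_def[abs_def] using step_integral_adapted[OF hs that] by simp
  have ad: "I t \<in> borel_measurable (F t)" if "0 \<le> t" for t
    unfolding I_def[abs_def] using SF[OF that] by (intro borel_measurable_lim_metric)
  have ev: "AE w in M. \<exists>N. \<forall>n\<ge>N. \<forall>t\<in>{0..real k}. norm (S n t w - S (Suc n) t w) \<le> (3/4) ^ n" for k :: nat
  proof -
    obtain C where C: "0 \<le> C" "\<And>n m. real k \<le> real n \<Longrightarrow> n \<le> m \<Longrightarrow>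
      sq_norm M (\<lambda>w. step_integral R (hs n) (real k) w - step_integral R (hs m) (real k) w) \<le> ennreal (C * (1 / 2) ^ n)"
      using cau[of "real k"] by auto
    have sd: "simple_jump_integrand M F \<nu> (step_diff (hs n) (hs (Suc n)))" for n by (rule simple_step_diff[OF hs hs])
    have ex: "\<exists>B. B \<in> sets M \<and> (k \<le> n \<longrightarrow> prob B \<le> C * (8/9) ^ n) \<and>
       (AE w in M. k \<le> n \<longrightarrow> w \<notin> B \<longrightarrow> (\<forall>t\<in>{0..real k}. norm (S n t w - S (Suc n) t w) \<le> (3/4) ^ n))" for n
    proof (cases "k \<le> n")
      case True
      have m: "step_integral R (step_diff (hs n) (hs (Suc n))) (real k) \<in> borel_measurable M"
        by (rule step_integral_measurable[OF sd]) simp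
      have "expectation (\<lambda>w. (norm (step_integral R (step_diff (hs n) (hs (Suc n))) (real k) w))\<^sup>2) \<le> C * (1 / 2) ^ n"
        using C True by (intro sq_integrable_of_nn(2)[OF m]) (auto simp: step_integral_diff)
      then obtain B where B: "B \<in> sets M" "prob B \<le> C * (1 / 2) ^ n / ((3/4) ^ n)\<^sup>2"
        "AE w in M. w \<notin> B \<longrightarrow> (\<forall>t\<in>{0..real k}. norm (step_integral R (step_diff (hs n) (hs (Suc n))) t w) \<le> (3/4) ^ n)"
        using step_integral_maximal[OF sd, of "real k" "(3/4) ^ n"] by auto
      have "((1 / 2) ^ n / ((3/4) ^ n)\<^sup>2 :: real) = (8/9) ^ n"
      proof -
        have "((3/4) ^ n)\<^sup>2 = (9/16 :: real) ^ n" by (simp add: power2_eq_square flip: power_mult_distrib)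
        then show ?thesis by (simp flip: power_divide)
      qed
      then have "prob B \<le> C * (8/9) ^ n" using B(2) by (metis times_divide_eq_right)
      then show ?thesis using B by (intro exI[of _ B]) (auto simp: S_def step_integral_diff)
    qed auto
    from choice[OF allI[OF ex]] obtain B where B0: "\<forall>n. B n \<in> sets M \<and> (k \<le> n \<longrightarrow> prob (B n) \<le> C * (8/9) ^ n) \<and>
       (AE w in M. k \<le> n \<longrightarrow> w \<notin> B n \<longrightarrow> (\<forall>t\<in>{0..real k}. norm (S n t w - S (Suc n) t w) \<le> (3/4) ^ n))" ..
    have B: "\<And>n. B n \<in> sets M" "\<And>n. k \<le> n \<Longrightarrow> prob (B n) \<le> C * (8/9) ^ n"
       "\<And>n. AE w in M. k \<le> n \<longrightarrow> w \<notin> B n \<longrightarrow> (\<forall>t\<in>{0..real k}. norm (S n t w - S (Suc n) t w) \<le> (3/4) ^ n)"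
      by (fact conjunct1[OF spec[OF B0]] mp[OF conjunct1[OF conjunct2[OF spec[OF B0]]]] conjunct2[OF conjunct2[OF spec[OF B0]]])+
    have "AE w in M. eventually (\<lambda>n. w \<in> space M - B n) sequentially"
    proof (rule borel_cantelli_AE1)
      show "summable (\<lambda>n. measure M (B n))"
        by (rule summable_comparison_test'[where N=k and g="\<lambda>n. C * (8/9) ^ n"]) (auto simp: B(2) intro!: summable_mult summable_geometric)
    qed (auto simp: B(1) emeasure_eq_measure)
    moreover have "AE w in M. \<forall>n. k \<le> n \<longrightarrow> w \<notin> B n \<longrightarrow> (\<forall>t\<in>{0..real k}. norm (S n t w - S (Suc n) t w) \<le> (3/4) ^ n)"
      using B(3) by (subst AE_all_countable) simp
    ultimately show ?thesis
    proof eventually_elim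
      case (elim w)
      from elim(1) obtain N where "\<forall>n\<ge>N. w \<in> space M - B n" unfolding eventually_sequentially by blast
      then have "\<forall>n\<ge>max N k. \<forall>t\<in>{0..real k}. norm (S n t w - S (Suc n) t w) \<le> (3/4) ^ n" using elim(2) by simp
      then show ?case by (rule exI)
    qed
  qed
  have unif: "AE w in M. \<forall>T\<ge>0. uniform_limit {0..T} (\<lambda>n t. S n t w) (\<lambda>t. I t w) sequentially"
  proof -
    have "AE w in M. \<forall>k::nat. \<exists>N. \<forall>n\<ge>N. \<forall>t\<in>{0..real k}. norm (S n t w - S (Suc n) t w) \<le> (3/4) ^ n"
      using ev by (subst AE_all_countable) simp
    then show ?thesis
    proof eventually_elim
      case (elim w)
      show ?case
      proof (intro allI impI)
        fix T :: real assume "0 \<le> T"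
        obtain k :: nat where k: "T \<le> real k" using real_arch_simple by blast
        obtain N where N: "\<And>n t. n \<ge> N \<Longrightarrow> t \<in> {0..real k} \<Longrightarrow> norm (S n t w - S (Suc n) t w) \<le> (3/4) ^ n"
          using elim by blast
        have ch: "norm (S n t w - S (n + j) t w) \<le> 4 * (3/4) ^ n" if "n \<ge> N" "t \<in> {0..T}" for n j t
        proof -
          have "norm (S n t w - S (n + j) t w) \<le> 4 * (3/4) ^ n - 4 * (3/4) ^ (n + j)"
            by (rule geometric_chain[of N "\<lambda>n. S n t w"]) (use N that k in auto)
          also have "\<dots> \<le> 4 * (3/4) ^ n" by simp
          finally show ?thesis .
        qed
        have g0: "(\<lambda>n. 4 * (3/4) ^ n :: real) \<longlonglongrightarrow> 4 * 0" by (intro tendsto_intros LIMSEQ_realpow_zero) auto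
        have conv: "(\<lambda>n. S n t w) \<longlonglongrightarrow> I t w" if t: "t \<in> {0..T}" for t
        proof -
          have "Cauchy (\<lambda>n. S n t w)"
          proof (rule CauchyI')
            fix e :: real assume "0 < e"
            then obtain N' where N': "\<And>n. n \<ge> N' \<Longrightarrow> 4 * (3/4) ^ n < e"
              using order_tendstoD(2)[OF g0] by (auto simp: eventually_sequentially)
            show "\<exists>M. \<forall>m\<ge>M. \<forall>n>m. dist (S m t w) (S n t w) < e"
            proof (intro exI[of _ "max N N'"] allI impI)
              fix m n assume "max N N' \<le> m" "m < n"
              then show "dist (S m t w) (S n t w) < e"
                using ch[of m t "n - m"] N'[of m] t by (simp add: dist_norm)
            qed
          qed
          then show ?thesis unfolding I_def by (simp add: Cauchy_convergent_iff convergent_LIMSEQ_iff)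
        qed
        have near: "norm (S n t w - I t w) \<le> 4 * (3/4) ^ n" if n: "n \<ge> N" and t: "t \<in> {0..T}" for n t
        proof (rule LIMSEQ_le_const2)
          show "(\<lambda>j. norm (S n t w - S j t w)) \<longlonglongrightarrow> norm (S n t w - I t w)" by (intro tendsto_intros conv t)
          show "\<exists>N. \<forall>j\<ge>N. norm (S n t w - S j t w) \<le> 4 * (3/4) ^ n"
            using ch[OF n t] by (intro exI[of _ n]) (metis le_add_diff_inverse)
        qed
        show "uniform_limit {0..T} (\<lambda>n t. S n t w) (\<lambda>t. I t w) sequentially"
        proof (rule uniform_limitI)
          fix e :: real assume "0 < e"
          then have "eventually (\<lambda>n. 4 * (3/4) ^ n < e) sequentially" using order_tendstoD(2)[OF g0] by simp
          then show "\<forall>\<^sub>F n in sequentially. \<forall>t\<in>{0..T}. dist (S n t w) (I t w) < e"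
            using eventually_ge_at_top[of N]
          proof eventually_elim
            case (elim n) then show ?case using near[of n] by (force simp: dist_norm)
          qed
        qed
      qed
    qed
  qed
  have l2: "(\<lambda>n. sq_norm M (\<lambda>w. S n T w - I T w)) \<longlonglongrightarrow> 0" if T: "0 \<le> T" for T
  proof -
    have [measurable]: "S n T \<in> borel_measurable M" "I T \<in> borel_measurable M" for n
      using measurable_F_M[OF SF[OF T]] measurable_F_M[OF ad[OF T]] by auto
    obtain C where C: "0 \<le> C" "\<And>n m. T \<le> real n \<Longrightarrow> n \<le> m \<Longrightarrow>
      sq_norm M (\<lambda>w. S n T w - S m T w) \<le> ennreal (C * (1 / 2) ^ n)"
      using cau[OF T] unfolding S_def by blast
    have le: "sq_norm M (\<lambda>w. S n T w - I T w) \<le> ennreal (C * (1 / 2) ^ n)" if n: "T \<le> real n" for n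
    proof -
      \<comment> \<open>Fatou in \<open>m\<close>: the Cauchy bound at fixed \<open>n\<close> passes
        to the limit, which the almost sure convergence identifies.\<close>
      have "sq_norm M (\<lambda>w. S n T w - I T w) = (\<integral>\<^sup>+w. liminf (\<lambda>m. ennreal ((norm (S n T w - S m T w))\<^sup>2)) \<partial>M)"
      proof (rule nn_integral_cong_AE)
        show "AE w in M. ennreal ((norm (S n T w - I T w))\<^sup>2) = liminf (\<lambda>m. ennreal ((norm (S n T w - S m T w))\<^sup>2))"
          using unif
        proof eventually_elim
          case (elim w)
          then have u: "uniform_limit {0..T} (\<lambda>n t. S n t w) (\<lambda>t. I t w) sequentially" using T by blast
          have "(\<lambda>m. S m T w) \<longlonglongrightarrow> I T w" using tendsto_uniform_limitI[OF u, of T] T by simp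
          then have "(\<lambda>m. ennreal ((norm (S n T w - S m T w))\<^sup>2)) \<longlonglongrightarrow> ennreal ((norm (S n T w - I T w))\<^sup>2)"
            by (intro tendsto_ennrealI tendsto_intros)
          then show ?case by (rule lim_imp_Liminf[OF trivial_limit_sequentially, symmetric])
        qed
      qed
      also have "\<dots> \<le> liminf (\<lambda>m. sq_norm M (\<lambda>w. S n T w - S m T w))"
        by (rule nn_integral_liminf) measurable
      also have "\<dots> \<le> liminf (\<lambda>m. ennreal (C * (1 / 2) ^ n))"
        by (intro Liminf_mono) (use C(2)[OF n] in \<open>auto simp: eventually_sequentially\<close>)
      also have "\<dots> = ennreal (C * (1 / 2) ^ n)" by (simp add: Liminf_const)
      finally show ?thesis .
    qed
    have lim: "(\<lambda>n. ennreal (C * (1 / 2) ^ n)) \<longlonglongrightarrow> 0"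
    proof -
      have "(\<lambda>n. ennreal (C * (1 / 2) ^ n)) \<longlonglongrightarrow> ennreal (C * 0)" by (intro tendsto_ennrealI tendsto_intros LIMSEQ_realpow_zero) auto
      then show ?thesis by simp
    qed
    show ?thesis
    proof (rule tendsto_sandwich[OF _ _ tendsto_const lim])
      obtain k :: nat where k: "T \<le> real k" using real_arch_simple by blast
      show "\<forall>\<^sub>F n in sequentially. sq_norm M (\<lambda>w. S n T w - I T w) \<le> ennreal (C * (1 / 2) ^ n)"
        using eventually_ge_at_top[of k] by eventually_elim (use le k in auto)
    qed simp
  qed
  show ?thesis
    using that[of I] ad unif l2 unfolding S_def by blast
qed

end

section \<open>Uniqueness\<close>

context noise
begin

text \<open>Under a uniform bound on the inner square norm all extended integrals are finite and
  agree with Bochner integrals. The energy estimate needs this form, because it integrates the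
  square norms together with a pairing of arbitrary sign.\<close>

lemma integral_sq_eq:
  fixes G :: "real \<Rightarrow> 'u \<Rightarrow> 'w \<Rightarrow> 'b::euclidean_space"
  assumes G: "(\<lambda>(r, u, w). G r u w) \<in> borel_measurable (borel \<Otimes>\<^sub>M \<nu> \<Otimes>\<^sub>M M)"
    and bd: "\<And>r. \<forall>w\<in>space M. sq_norm \<nu> (\<lambda>u. G r u w) \<le> ennreal c" and c: "0 \<le> c"
  shows "(\<lambda>(r, w). \<integral>u. (norm (G r u w))\<^sup>2 \<partial>\<nu>) \<in> borel_measurable (borel \<Otimes>\<^sub>M M)"
    and "\<And>r w. w \<in> space M \<Longrightarrow> integrable \<nu> (\<lambda>u. (norm (G r u w))\<^sup>2)"
    and "\<And>r w. w \<in> space M \<Longrightarrow> (\<integral>u. (norm (G r u w))\<^sup>2 \<partial>\<nu>) \<le> c"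
    and "\<And>r. (\<integral>\<^sup>+w. sq_norm \<nu> (\<lambda>u. G r u w) \<partial>M) = ennreal (expectation (\<lambda>w. \<integral>u. (norm (G r u w))\<^sup>2 \<partial>\<nu>))"
    and "s \<le> t \<Longrightarrow> energy M \<nu> s t G = ennreal (LINT r:{s<..t}|lborel. expectation (\<lambda>w. \<integral>u. (norm (G r u w))\<^sup>2 \<partial>\<nu>))"
proof -
  have eq: "(\<integral>u. (norm (G r u w))\<^sup>2 \<partial>\<nu>) = enn2real (sq_norm \<nu> (\<lambda>u. G r u w))" if "w \<in> space M" for r w
    using energy_measurable(4)[OF G that] by (intro integral_eq_nn_integral) auto
  have "(\<lambda>p. enn2real (case p of (r, w) \<Rightarrow> sq_norm \<nu> (\<lambda>u. G r u w))) \<in> borel_measurable (borel \<Otimes>\<^sub>M M)"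
    using energy_measurable(1)[OF G] by measurable
  also have "?this \<longleftrightarrow> (\<lambda>(r, w). \<integral>u. (norm (G r u w))\<^sup>2 \<partial>\<nu>) \<in> borel_measurable (borel \<Otimes>\<^sub>M M)"
    by (intro measurable_cong) (auto simp: space_pair_measure eq)
  finally show m: "(\<lambda>(r, w). \<integral>u. (norm (G r u w))\<^sup>2 \<partial>\<nu>) \<in> borel_measurable (borel \<Otimes>\<^sub>M M)" .
  show i: "integrable \<nu> (\<lambda>u. (norm (G r u w))\<^sup>2)" if "w \<in> space M" for r w
    using sq_integrable_of_nn(1)[OF energy_measurable(4)[OF G that] bd[rule_format, OF that]] .
  show le: "(\<integral>u. (norm (G r u w))\<^sup>2 \<partial>\<nu>) \<le> c" if "w \<in> space M" for r w
    using sq_integrable_of_nn(2)[OF energy_measurable(4)[OF G that] bd[rule_format, OF that] c] .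
  have [measurable]: "(\<lambda>w. \<integral>u. (norm (G r u w))\<^sup>2 \<partial>\<nu>) \<in> borel_measurable M" for r
    using measurable_compose[OF _ m, of "\<lambda>w. (r, w)" M] by simp
  have ia: "integrable M (\<lambda>w. \<integral>u. (norm (G r u w))\<^sup>2 \<partial>\<nu>)" for r
    by (rule integrable_const_bound[where B=c]) (use le in \<open>auto intro!: AE_I2\<close>)
  show 1: "(\<integral>\<^sup>+w. sq_norm \<nu> (\<lambda>u. G r u w) \<partial>M) = ennreal (expectation (\<lambda>w. \<integral>u. (norm (G r u w))\<^sup>2 \<partial>\<nu>))" for r
  proof -
    have "(\<integral>\<^sup>+w. sq_norm \<nu> (\<lambda>u. G r u w) \<partial>M) = (\<integral>\<^sup>+w. ennreal (\<integral>u. (norm (G r u w))\<^sup>2 \<partial>\<nu>) \<partial>M)"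
      by (intro nn_integral_cong nn_of_sq_integrable i)
    also have "\<dots> = ennreal (expectation (\<lambda>w. \<integral>u. (norm (G r u w))\<^sup>2 \<partial>\<nu>))"
      by (intro nn_integral_eq_integral ia) auto
    finally show ?thesis .
  qed
  assume st: "s \<le> t"
  have e0: "0 \<le> expectation (\<lambda>w. \<integral>u. (norm (G r u w))\<^sup>2 \<partial>\<nu>)" for r by (intro Bochner_Integration.integral_nonneg) simp
  have ec: "expectation (\<lambda>w. \<integral>u. (norm (G r u w))\<^sup>2 \<partial>\<nu>) \<le> c" for r
    using integral_mono[OF ia, of "\<lambda>_. c"] le by (simp add: prob_space)
  have mE[measurable]: "(\<lambda>r. expectation (\<lambda>w. \<integral>u. (norm (G r u w))\<^sup>2 \<partial>\<nu>)) \<in> borel_measurable borel"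
    using borel_measurable_lebesgue_integral[OF m] .
  have "set_integrable lborel {s<..t} (\<lambda>r. expectation (\<lambda>w. \<integral>u. (norm (G r u w))\<^sup>2 \<partial>\<nu>))"
    by (rule set_integrable_bounded_interval[where C=c]) (use e0 ec st in auto)
  then have "(\<integral>\<^sup>+r. ennreal (indicator {s<..t} r *\<^sub>R expectation (\<lambda>w. \<integral>u. (norm (G r u w))\<^sup>2 \<partial>\<nu>)) \<partial>lborel)
     = ennreal (LINT r:{s<..t}|lborel. expectation (\<lambda>w. \<integral>u. (norm (G r u w))\<^sup>2 \<partial>\<nu>))"
    unfolding set_integrable_def set_lebesgue_integral_def using e0 by (intro nn_integral_eq_integral) (auto intro!: mult_nonneg_nonneg)
  note that = this
  show "energy M \<nu> s t G = ennreal (LINT r:{s<..t}|lborel. expectation (\<lambda>w. \<integral>u. (norm (G r u w))\<^sup>2 \<partial>\<nu>))"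
  proof -
    have "energy M \<nu> s t G = (\<integral>\<^sup>+r. ennreal (indicator {s<..t} r *\<^sub>R expectation (\<lambda>w. \<integral>u. (norm (G r u w))\<^sup>2 \<partial>\<nu>)) \<partial>lborel)"
      unfolding energy_def 1 by (rule nn_integral_cong) (auto split: split_indicator)
    then show ?thesis using that by simp
  qed
qed

lemma noise_integral_increment:
  fixes I :: "real \<Rightarrow> 'w \<Rightarrow> real^'d::finite"
  assumes NI: "noise_integral M F \<nu> R G I" and G: "(\<lambda>(r, u, w). G r u w) \<in> borel_measurable (borel \<Otimes>\<^sub>M \<nu> \<Otimes>\<^sub>M M)"
    and bd: "\<And>r. \<forall>w\<in>space M. sq_norm \<nu> (\<lambda>u. G r u w) \<le> ennreal c" and c: "0 \<le> c"
    and st: "0 \<le> s" "s \<le> t"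
  shows "integrable M (\<lambda>w. (norm (I t w - I s w))\<^sup>2)"
    and "expectation (\<lambda>w. (norm (I t w - I s w))\<^sup>2) \<le> (LINT r:{s<..t}|lborel. expectation (\<lambda>w. \<integral>u. (norm (G r u w))\<^sup>2 \<partial>\<nu>))"
    and "expectation (\<lambda>w. (norm (I t w - I s w))\<^sup>2) \<le> c * (t - s)"
proof -
  have t: "0 \<le> t" using st by simp
  have m: "(\<lambda>w. I t w - I s w) \<in> borel_measurable M"
    using noise_integral_measurable[OF NI st(1)] noise_integral_measurable[OF NI t] by simp
  note b = noise_integral_bound[OF NI G st]
  note e = b[unfolded integral_sq_eq(5)[OF G bd c st(2)]]
  show "integrable M (\<lambda>w. (norm (I t w - I s w))\<^sup>2)" by (rule sq_integrable_of_nn(1)[OF m e])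
  show "expectation (\<lambda>w. (norm (I t w - I s w))\<^sup>2) \<le> (LINT r:{s<..t}|lborel. expectation (\<lambda>w. \<integral>u. (norm (G r u w))\<^sup>2 \<partial>\<nu>))"
    by (rule sq_integrable_of_nn(2)[OF m e]) (simp add: set_lebesgue_integral_def Bochner_Integration.integral_nonneg)
  have "energy M \<nu> s t G \<le> ennreal (c * (t - s))" by (rule energy_le) (use bd st c in auto)
  then show "expectation (\<lambda>w. (norm (I t w - I s w))\<^sup>2) \<le> c * (t - s)"
    using order_trans[OF b] c st by (intro sq_integrable_of_nn(2)[OF m]) auto
qed

end

locale two_noises = N1: noise M F \<nu>1 R1 + N2: noise M F \<nu>2 R2
  for M :: "'w measure" and F and \<nu>1 :: "'u1 measure" and R1 and \<nu>2 :: "'u2 measure" and R2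
begin

lemma ito_process_sq_integrable:
  fixes Z I J :: "real \<Rightarrow> 'w \<Rightarrow> real^'d::finite"
  assumes Zm: "Z t \<in> borel_measurable M" and t: "0 \<le> t"
    and Zeq: "AE w in M. Z t w = (LINT r:{0<..t}|lborel. \<beta> r w) + I t w + J t w"
    and \<beta>m[measurable]: "(\<lambda>(r, w). \<beta> r w) \<in> borel_measurable (borel \<Otimes>\<^sub>M M)"
    and \<beta>b: "\<And>r. \<forall>w\<in>space M. norm (\<beta> r w) \<le> C"
    and NI1: "noise_integral M F \<nu>1 R1 G1 I" and G1: "(\<lambda>(r, u, w). G1 r u w) \<in> borel_measurable (borel \<Otimes>\<^sub>M \<nu>1 \<Otimes>\<^sub>M M)"
    and bd1: "\<And>r. \<forall>w\<in>space M. sq_norm \<nu>1 (\<lambda>u. G1 r u w) \<le> ennreal c"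
    and NI2: "noise_integral M F \<nu>2 R2 G2 J" and G2: "(\<lambda>(r, u, w). G2 r u w) \<in> borel_measurable (borel \<Otimes>\<^sub>M \<nu>2 \<Otimes>\<^sub>M M)"
    and bd2: "\<And>r. \<forall>w\<in>space M. sq_norm \<nu>2 (\<lambda>u. G2 r u w) \<le> ennreal c" and c: "0 \<le> c"
  shows "integrable M (\<lambda>w. (norm (Z t w))\<^sup>2)"
    and "N1.expectation (\<lambda>w. (norm (Z t w))\<^sup>2) \<le> 2 * (C * t)\<^sup>2 + 8 * c * t"
proof -
  have inc1: "integrable M (\<lambda>w. (norm (I t w))\<^sup>2) \<and> N1.expectation (\<lambda>w. (norm (I t w))\<^sup>2) \<le> c * t"
  proof -
    have e: "AE w in M. (norm (I t w - I 0 w))\<^sup>2 = (norm (I t w))\<^sup>2"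
      using N1.noise_integral_0[OF NI1] by eventually_elim simp
    have [measurable]: "I t \<in> borel_measurable M" "I 0 \<in> borel_measurable M" using N1.noise_integral_measurable[OF NI1] t by auto
    show ?thesis using N1.noise_integral_increment(1,3)[OF NI1 G1 bd1 c order_refl t]
        integrable_cong_AE[OF _ _ e] integral_cong_AE[OF _ _ e] by simp
  qed
  have inc2: "integrable M (\<lambda>w. (norm (J t w))\<^sup>2) \<and> N1.expectation (\<lambda>w. (norm (J t w))\<^sup>2) \<le> c * t"
  proof -
    have e: "AE w in M. (norm (J t w - J 0 w))\<^sup>2 = (norm (J t w))\<^sup>2"
      using N2.noise_integral_0[OF NI2] by eventually_elim simp
    have [measurable]: "J t \<in> borel_measurable M" "J 0 \<in> borel_measurable M" using N2.noise_integral_measurable[OF NI2] t by auto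
    show ?thesis using N2.noise_integral_increment(1,3)[OF NI2 G2 bd2 c order_refl t]
        integrable_cong_AE[OF _ _ e] integral_cong_AE[OF _ _ e] by simp
  qed
  define B where "B w = (LINT r:{0<..t}|lborel. \<beta> r w)" for w
  have Bb: "norm (B w) \<le> C * t" if "w \<in> space M" for w
    unfolding B_def using set_integrable_bounded_interval(2)[of "\<lambda>r. \<beta> r w" 0 t C] that \<beta>b t by simp
  have [measurable]: "I t \<in> borel_measurable M" "J t \<in> borel_measurable M" "Z t \<in> borel_measurable M"
    using N1.noise_integral_measurable[OF NI1] N2.noise_integral_measurable[OF NI2] t Zm by auto
  have dom: "AE w in M. (norm (Z t w))\<^sup>2 \<le> 2 * (C * t)\<^sup>2 + 4 * (norm (I t w))\<^sup>2 + 4 * (norm (J t w))\<^sup>2"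
    using Zeq AE_space
  proof eventually_elim
    case (elim w)
    have "(norm (B w))\<^sup>2 \<le> (C * t)\<^sup>2" using Bb[OF elim(2)] by (intro power_mono) auto
    then show ?case using norm_add_sq_le2[of "B w" "I t w + J t w"] norm_add_sq_le2[of "I t w" "J t w"] elim(1)
      by (simp add: B_def add.assoc)
  qed
  have id: "integrable M (\<lambda>w. 2 * (C * t)\<^sup>2 + 4 * (norm (I t w))\<^sup>2 + 4 * (norm (J t w))\<^sup>2)" using inc1 inc2 by simp
  show i: "integrable M (\<lambda>w. (norm (Z t w))\<^sup>2)"
    by (rule Bochner_Integration.integrable_bound[OF id]) (use dom in auto)
  have "N1.expectation (\<lambda>w. (norm (Z t w))\<^sup>2) \<le> N1.expectation (\<lambda>w. 2 * (C * t)\<^sup>2 + 4 * (norm (I t w))\<^sup>2 + 4 * (norm (J t w))\<^sup>2)"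
    by (rule integral_mono_AE[OF i id dom])
  also have "\<dots> = 2 * (C * t)\<^sup>2 + 4 * N1.expectation (\<lambda>w. (norm (I t w))\<^sup>2) + 4 * N1.expectation (\<lambda>w. (norm (J t w))\<^sup>2)"
    using inc1 inc2 by (simp add: N1.prob_space)
  also have "\<dots> \<le> 2 * (C * t)\<^sup>2 + 8 * c * t" using inc1 inc2 by simp
  finally show "N1.expectation (\<lambda>w. (norm (Z t w))\<^sup>2) \<le> 2 * (C * t)\<^sup>2 + 8 * c * t" .
qed

text \<open>
  No relation between the two noises is used: the cross term of the two martingale parts is absorbed
  by \<open>|a + b|\<^sup>2 \<le> 2 |a|\<^sup>2 + 2 |b|\<^sup>2\<close>, which explains the factors \<open>2\<close> in the assumption \<open>main\<close>.
\<close>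

lemma ito_process_energy:
  fixes Z I J :: "real \<Rightarrow> 'w \<Rightarrow> real^'d::finite"
  assumes T: "0 \<le> T" and nn: "0 \<le> k" "0 \<le> \<epsilon>" "0 \<le> C" "0 \<le> c"
    and Zad: "\<And>t. 0 \<le> t \<Longrightarrow> Z t \<in> borel_measurable (F t)"
    and Zeq: "\<And>t. 0 \<le> t \<Longrightarrow> t \<le> T \<Longrightarrow> AE w in M. Z t w = (LINT r:{0<..t}|lborel. \<beta> r w) + I t w + J t w"
    and \<beta>m[measurable]: "(\<lambda>(r, w). \<beta> r w) \<in> borel_measurable (borel \<Otimes>\<^sub>M M)"
    and \<beta>b: "\<And>r. \<forall>w\<in>space M. norm (\<beta> r w) \<le> C"
    and NI1: "noise_integral M F \<nu>1 R1 G1 I" and G1: "(\<lambda>(r, u, w). G1 r u w) \<in> borel_measurable (borel \<Otimes>\<^sub>M \<nu>1 \<Otimes>\<^sub>M M)"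
    and bd1: "\<And>r. \<forall>w\<in>space M. sq_norm \<nu>1 (\<lambda>u. G1 r u w) \<le> ennreal c"
    and NI2: "noise_integral M F \<nu>2 R2 G2 J" and G2: "(\<lambda>(r, u, w). G2 r u w) \<in> borel_measurable (borel \<Otimes>\<^sub>M \<nu>2 \<Otimes>\<^sub>M M)"
    and bd2: "\<And>r. \<forall>w\<in>space M. sq_norm \<nu>2 (\<lambda>u. G2 r u w) \<le> ennreal c"
    and main: "\<And>r. 0 < r \<Longrightarrow> r \<le> T \<Longrightarrow> N1.expectation (\<lambda>w. 2 * (Z r w \<bullet> \<beta> r w) +
        (2 * (\<integral>u. (norm (G1 r u w))\<^sup>2 \<partial>\<nu>1) + 2 * (\<integral>u. (norm (G2 r u w))\<^sup>2 \<partial>\<nu>2)))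
      \<le> k * N1.expectation (\<lambda>w. (norm (Z r w))\<^sup>2) + \<epsilon>"
  shows "N1.expectation (\<lambda>w. (norm (Z T w))\<^sup>2) \<le> \<epsilon> * T * exp (k * T)"
proof -
  define a1 where "a1 r w = (\<integral>u. (norm (G1 r u w))\<^sup>2 \<partial>\<nu>1)" for r w
  define a2 where "a2 r w = (\<integral>u. (norm (G2 r u w))\<^sup>2 \<partial>\<nu>2)" for r w
  note A1 = N1.integral_sq_eq[OF G1 bd1 nn(4), folded a1_def] and A2 = N2.integral_sq_eq[OF G2 bd2 nn(4), folded a2_def]
  note [measurable] = A1(1) A2(1)
  have a1p: "0 \<le> a1 r w" "0 \<le> a2 r w" for r w by (simp_all add: a1_def a2_def)
  have ia: "integrable M (a1 r)" "integrable M (a2 r)" for r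
    by (rule N1.integrable_const_bound[where B=c]; use A1(3) A2(3) a1p in \<open>auto intro!: AE_I2\<close>)+
  have Zm: "Z t \<in> borel_measurable M" if "0 \<le> t" for t using N1.measurable_F_M[OF Zad[OF that]] .
  have Zsq: "integrable M (\<lambda>w. (norm (Z r w))\<^sup>2)" "N1.expectation (\<lambda>w. (norm (Z r w))\<^sup>2) \<le> 2 * (C * r)\<^sup>2 + 8 * c * r"
    if "0 \<le> r" "r \<le> T" for r
    using ito_process_sq_integrable[where Z=Z and t=r, OF Zm[OF that(1)] that(1) Zeq[OF that] \<beta>m \<beta>b NI1 G1 bd1 NI2 G2 bd2 nn(4)] by auto
  define m where "m s t w = (I t w - I s w) + (J t w - J s w)" for s t w
  have Im: "I t \<in> borel_measurable M" "J t \<in> borel_measurable M" if "0 \<le> t" for t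
    using N1.noise_integral_measurable[OF NI1 that] N2.noise_integral_measurable[OF NI2 that] by auto
  note i1 = N1.noise_integral_increment[OF NI1 G1 bd1 nn(4)] and i2 = N2.noise_integral_increment[OF NI2 G2 bd2 nn(4)]
  show ?thesis
  \<comment> \<open>\<open>A = 4 * c\<close> bounds \<open>2 * a1 + 2 * a2\<close>, and
    \<open>Q\<close> is the second moment bound of \<open>ito_process_sq_integrable\<close> at the
    final time.\<close>
  proof (rule N1.energy_estimate[where Z=Z and \<beta>=\<beta> and \<alpha>="\<lambda>r w. 2 * a1 r w + 2 * a2 r w" and m=m and C=C and A="4 * c"
        and Q="2 * (C * T)\<^sup>2 + 8 * c * T"])
    show "N1.expectation (\<lambda>w. (norm (Z r w))\<^sup>2) \<le> 2 * (C * T)\<^sup>2 + 8 * c * T" if r: "0 \<le> r" "r \<le> T" for r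
    proof -
      have "(C * r)\<^sup>2 \<le> (C * T)\<^sup>2" using r nn by (intro power_mono mult_left_mono) auto
      moreover have "c * r \<le> c * T" using r nn by (intro mult_left_mono) auto
      ultimately show ?thesis using Zsq(2)[OF r] by simp
    qed
    show "integrable M (\<lambda>w. (norm (Z r w))\<^sup>2)" if r: "0 \<le> r" "r \<le> T" for r using Zsq(1)[OF r] .
    show "Z r \<in> borel_measurable M" if "0 \<le> r" for r using Zm that .
    show "(\<lambda>(r, w). 2 * a1 r w + 2 * a2 r w) \<in> borel_measurable (borel \<Otimes>\<^sub>M M)" by measurable
    show "0 \<le> 2 * a1 r w + 2 * a2 r w \<and> 2 * a1 r w + 2 * a2 r w \<le> 4 * c" if "w \<in> space M" for r w
      using a1p[of r w] A1(3)[OF that, of r] A2(3)[OF that, of r] by simp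
    fix s t :: real assume st: "0 \<le> s" "s \<le> t" "t \<le> T"
    have t0: "0 \<le> t" and sT: "s \<le> T" using st by auto
    note [measurable] = Im[OF st(1)] Im[OF t0] Zm[OF st(1)]
    show mm: "m s t \<in> borel_measurable M" unfolding m_def[abs_def] by measurable
    show mi: "integrable M (\<lambda>w. (norm (m s t w))\<^sup>2)" unfolding m_def
      by (rule sq_integrable_add) (use i1(1)[OF st(1,2)] i2(1)[OF st(1,2)] in auto)
    show "N1.expectation (\<lambda>w. (norm (m s t w))\<^sup>2) \<le> (LINT r:{s<..t}|lborel. N1.expectation (\<lambda>w. 2 * a1 r w + 2 * a2 r w))"
    proof -
      have "N1.expectation (\<lambda>w. (norm (m s t w))\<^sup>2) \<le> N1.expectation (\<lambda>w. 2 * (norm (I t w - I s w))\<^sup>2 + 2 * (norm (J t w - J s w))\<^sup>2)"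
        unfolding m_def using i1(1)[OF st(1,2)] i2(1)[OF st(1,2)] mi[unfolded m_def]
        by (intro integral_mono norm_add_sq_le2) auto
      also have "\<dots> = 2 * N1.expectation (\<lambda>w. (norm (I t w - I s w))\<^sup>2) + 2 * N1.expectation (\<lambda>w. (norm (J t w - J s w))\<^sup>2)"
        using i1(1)[OF st(1,2)] i2(1)[OF st(1,2)] by simp
      also have "\<dots> \<le> 2 * (LINT r:{s<..t}|lborel. N1.expectation (a1 r)) + 2 * (LINT r:{s<..t}|lborel. N1.expectation (a2 r))"
        using i1(2)[OF st(1,2)] i2(2)[OF st(1,2)] unfolding a1_def[abs_def] a2_def[abs_def]
        by (intro add_mono mult_left_mono) auto
      also have "\<dots> = (LINT r:{s<..t}|lborel. 2 * N1.expectation (a1 r) + 2 * N1.expectation (a2 r))"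
      proof -
        have mE[measurable]: "(\<lambda>r. N1.expectation (a1 r)) \<in> borel_measurable borel" "(\<lambda>r. N1.expectation (a2 r)) \<in> borel_measurable borel"
          using N1.borel_measurable_lebesgue_integral[OF A1(1)] N1.borel_measurable_lebesgue_integral[OF A2(1)] by simp_all
        have e: "\<bar>N1.expectation (a1 r)\<bar> \<le> c" "\<bar>N1.expectation (a2 r)\<bar> \<le> c" for r
          using integral_mono[OF ia(1), of "\<lambda>_. c" r] integral_mono[OF ia(2), of "\<lambda>_. c" r] A1(3) A2(3) a1p
          by (simp_all add: N1.prob_space abs_of_nonneg Bochner_Integration.integral_nonneg)
        have "set_integrable lborel {s<..t} (\<lambda>r. N1.expectation (a1 r))" "set_integrable lborel {s<..t} (\<lambda>r. N1.expectation (a2 r))"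
          using e st by (auto intro!: set_integrable_bounded_interval[where C=c])
        then show ?thesis by (simp add: set_integral_add)
      qed
      also have "\<dots> = (LINT r:{s<..t}|lborel. N1.expectation (\<lambda>w. 2 * a1 r w + 2 * a2 r w))" using ia by simp
      finally show ?thesis .
    qed
    show "AE w in M. Z t w = Z s w + (LINT r:{s<..t}|lborel. \<beta> r w) + m s t w"
      using Zeq[OF t0 st(3)] Zeq[OF st(1) sT] AE_space
    proof eventually_elim
      case (elim w)
      have [measurable]: "(\<lambda>r. \<beta> r w) \<in> borel_measurable borel" using elim(3) by measurable
      have "set_integrable lborel {0<..s} (\<lambda>r. \<beta> r w)" "set_integrable lborel {s<..t} (\<lambda>r. \<beta> r w)"
        using \<beta>b[rule_format, OF elim(3)] st by (auto intro!: set_integrable_bounded_interval[where C=C])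
      then have "(LINT r:{0<..s} \<union> {s<..t}|lborel. \<beta> r w) = (LINT r:{0<..s}|lborel. \<beta> r w) + (LINT r:{s<..t}|lborel. \<beta> r w)"
        by (intro set_integral_Un) auto
      moreover have "{0<..s} \<union> {s<..t} = {0<..t}" using st by auto
      ultimately show ?case using elim by (simp add: m_def algebra_simps)
    qed
    show "N1.expectation (\<lambda>w. Z s w \<bullet> m s t w) = 0"
    proof -
      note iZ = Zsq(1)[OF st(1) sT]
      have "integrable M (\<lambda>w. Z s w \<bullet> (I t w - I s w))" "integrable M (\<lambda>w. Z s w \<bullet> (J t w - J s w))"
        using iZ i1(1)[OF st(1,2)] i2(1)[OF st(1,2)] by (auto intro!: sq_integrable_inner)
      moreover have "N1.expectation (\<lambda>w. Z s w \<bullet> (I t w - I s w)) = 0"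
        by (rule N1.noise_integral_orthogonal[OF NI1 st(1,2) i1(1)[OF st(1,2)] Zad[OF st(1)] iZ])
      moreover have "N1.expectation (\<lambda>w. Z s w \<bullet> (J t w - J s w)) = 0"
        by (rule N2.noise_integral_orthogonal[OF NI2 st(1,2) i2(1)[OF st(1,2)] Zad[OF st(1)] iZ])
      ultimately show ?thesis by (simp add: m_def inner_add_right)
    qed
  next
    fix r assume "0 < r" "r \<le> T"
    then show "N1.expectation (\<lambda>w. 2 * (Z r w \<bullet> \<beta> r w) + (2 * a1 r w + 2 * a2 r w)) \<le> k * N1.expectation (\<lambda>w. (norm (Z r w))\<^sup>2) + \<epsilon>"
      using main by (simp add: a1_def a2_def)
  next
    have "AE w in M. Z 0 w = 0"
      using Zeq[OF order_refl T] N1.noise_integral_0[OF NI1] N2.noise_integral_0[OF NI2]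
      by eventually_elim (simp add: set_lebesgue_integral_def)
    then have "AE w in M. (norm (Z 0 w))\<^sup>2 = 0" by eventually_elim simp
    then show "N1.expectation (\<lambda>w. (norm (Z 0 w))\<^sup>2) = 0" by (rule integral_eq_zero_AE)
  qed (use T nn \<beta>m \<beta>b in auto)
qed

end

lemma nn_diff_sq_le:
  fixes X Y :: "'a \<Rightarrow> 'b::euclidean_space"
  assumes "X \<in> borel_measurable M" "Y \<in> borel_measurable M"
    and "sq_norm M X \<le> ennreal c" "sq_norm M Y \<le> ennreal d" "0 \<le> c" "0 \<le> d"
  shows "sq_norm M (\<lambda>w. X w - Y w) \<le> ennreal (2 * c + 2 * d)"
proof -
  have "sq_norm M (\<lambda>w. X w + - Y w) \<le>
    ennreal (1 + 1) * sq_norm M X + ennreal (1 + 1 / 1) * sq_norm M (\<lambda>w. - Y w)"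
    by (rule nn_norm_add_sq_le) (use assms in auto)
  also have "\<dots> \<le> ennreal 2 * ennreal c + ennreal 2 * ennreal d"
    using assms(3,4) by (intro add_mono mult_mono) auto
  also have "\<dots> = ennreal (2 * c + 2 * d)" using assms(5,6) by (simp add: ennreal_mult)
  finally show ?thesis by simp
qed

text \<open>Diffusion and jumps are both kernels on a mark space and obey the same assumptions; for
  the diffusion the marks are the coordinates and \<open>g1 y j\<close> is a column of the matrix.
  \<open>L\<close> bounds each squared coefficient separately.\<close>

locale sde = two_noises M F \<nu>1 R1 \<nu>2 R2
  for M :: "'w measure" and F and \<nu>1 :: "'u1 measure" and R1 and \<nu>2 :: "'u2 measure" and R2 +
  fixes b :: "real^'d::finite \<Rightarrow> real^'d" and g1 :: "real^'d \<Rightarrow> 'u1 \<Rightarrow> real^'d" and g2 :: "real^'d \<Rightarrow> 'u2 \<Rightarrow> real^'d"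
    and K L :: real
  assumes b_continuous: "continuous_on UNIV b"
    and g1_measurable: "(\<lambda>(y, u). g1 y u) \<in> borel_measurable (borel \<Otimes>\<^sub>M \<nu>1)"
    and g2_measurable: "(\<lambda>(y, u). g2 y u) \<in> borel_measurable (borel \<Otimes>\<^sub>M \<nu>2)"
    and K_pos: "0 < K" and L_pos: "0 < L"
    and monotone: "\<And>x y. (b x - b y) \<bullet> (x - y) + (\<integral>u. (norm (g1 x u - g1 y u))\<^sup>2 \<partial>\<nu>1)
       + (\<integral>u. (norm (g2 x u - g2 y u))\<^sup>2 \<partial>\<nu>2) \<le> K * (norm (x - y))\<^sup>2"
    and b_bound: "\<And>x. (norm (b x))\<^sup>2 \<le> L"
    and g1_bound: "\<And>x. sq_norm \<nu>1 (\<lambda>u. g1 x u) \<le> ennreal L"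
    and g2_bound: "\<And>x. sq_norm \<nu>2 (\<lambda>u. g2 x u) \<le> ennreal L"
begin

lemma b_measurable [measurable]: "b \<in> borel_measurable borel"
  using b_continuous by (rule borel_measurable_continuous_onI)

lemma b_norm: "norm (b x) \<le> sqrt L"
  using b_bound real_le_rsqrt by blast

lemma g_section: "g1 y \<in> borel_measurable \<nu>1" "g2 y \<in> borel_measurable \<nu>2"
  using measurable_compose[OF _ g1_measurable, of "\<lambda>u. (y, u)" \<nu>1] measurable_compose[OF _ g2_measurable, of "\<lambda>u. (y, u)" \<nu>2] by simp_all

lemma b_diff_norm: "norm (b x - b y) \<le> 2 * sqrt L"
  using norm_triangle_ineq4[of "b x" "b y"] b_norm[of x] b_norm[of y] by linarith

lemma g_compose_measurable:
  fixes Y :: "real \<Rightarrow> 'w \<Rightarrow> real^'d"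
  assumes Y: "(\<lambda>(r, w). Y r w) \<in> borel_measurable (borel \<Otimes>\<^sub>M M)"
  shows "(\<lambda>(r, u, w). g1 (Y r w) u) \<in> borel_measurable (borel \<Otimes>\<^sub>M \<nu>1 \<Otimes>\<^sub>M M)"
    "(\<lambda>(r, u, w). g2 (Y r w) u) \<in> borel_measurable (borel \<Otimes>\<^sub>M \<nu>2 \<Otimes>\<^sub>M M)"
proof -
  have "(\<lambda>p. (fst p, snd (snd p))) \<in> borel \<Otimes>\<^sub>M \<nu>1 \<Otimes>\<^sub>M M \<rightarrow>\<^sub>M (borel :: real measure) \<Otimes>\<^sub>M M" by measurable
  from measurable_compose[OF this Y] have "(\<lambda>p. Y (fst p) (snd (snd p))) \<in> borel_measurable (borel \<Otimes>\<^sub>M \<nu>1 \<Otimes>\<^sub>M M)" by simp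
  then have "(\<lambda>p. (Y (fst p) (snd (snd p)), fst (snd p))) \<in> borel \<Otimes>\<^sub>M \<nu>1 \<Otimes>\<^sub>M M \<rightarrow>\<^sub>M borel \<Otimes>\<^sub>M \<nu>1" by measurable
  from measurable_compose[OF this g1_measurable]
  show "(\<lambda>(r, u, w). g1 (Y r w) u) \<in> borel_measurable (borel \<Otimes>\<^sub>M \<nu>1 \<Otimes>\<^sub>M M)" by (simp add: case_prod_unfold)
  have "(\<lambda>p. (fst p, snd (snd p))) \<in> borel \<Otimes>\<^sub>M \<nu>2 \<Otimes>\<^sub>M M \<rightarrow>\<^sub>M (borel :: real measure) \<Otimes>\<^sub>M M" by measurable
  from measurable_compose[OF this Y] have "(\<lambda>p. Y (fst p) (snd (snd p))) \<in> borel_measurable (borel \<Otimes>\<^sub>M \<nu>2 \<Otimes>\<^sub>M M)" by simp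
  then have "(\<lambda>p. (Y (fst p) (snd (snd p)), fst (snd p))) \<in> borel \<Otimes>\<^sub>M \<nu>2 \<Otimes>\<^sub>M M \<rightarrow>\<^sub>M borel \<Otimes>\<^sub>M \<nu>2" by measurable
  from measurable_compose[OF this g2_measurable]
  show "(\<lambda>(r, u, w). g2 (Y r w) u) \<in> borel_measurable (borel \<Otimes>\<^sub>M \<nu>2 \<Otimes>\<^sub>M M)" by (simp add: case_prod_unfold)
qed

lemma g_diff_bound:
  "sq_norm \<nu>1 (\<lambda>u. g1 x u - g1 y u) \<le> ennreal (4 * L)"
  "sq_norm \<nu>2 (\<lambda>u. g2 x u - g2 y u) \<le> ennreal (4 * L)"
  using nn_diff_sq_le[OF g_section(1,1) g1_bound g1_bound, of x y] nn_diff_sq_le[OF g_section(2,2) g2_bound g2_bound, of x y] L_pos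
  by simp_all

text \<open>All coefficients are evaluated along \<open>right_version X\<close>, which is jointly
  measurable without completion and equals \<open>X\<close> on cadlag paths. In the jump term it
  stands for the left limit: along a cadlag path the two differ at countably many times only, so the
  class of the integrand in \<open>L^2\<close> is the same.\<close>

definition strong_sol :: "real^'d \<Rightarrow> (real \<Rightarrow> 'w \<Rightarrow> real^'d) \<Rightarrow> (real \<Rightarrow> 'w \<Rightarrow> real^'d) \<Rightarrow> (real \<Rightarrow> 'w \<Rightarrow> real^'d) \<Rightarrow> bool" where
  "strong_sol x X I J \<longleftrightarrow> adapted_process F X \<and> (AE w in M. cadlag (\<lambda>t. X t w)) \<and>
     noise_integral M F \<nu>1 R1 (\<lambda>r u w. g1 (right_version X r w) u) I \<and>
     noise_integral M F \<nu>2 R2 (\<lambda>r u w. g2 (right_version X r w) u) J \<and>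
     (AE w in M. \<forall>t\<ge>0. X t w = x + (LINT r:{0<..t}|lborel. b (right_version X r w)) + I t w + J t w)"

lemma adapted_right_version_measurable:
  assumes "adapted_process F X"
  shows "(\<lambda>(r, w). right_version (X :: real \<Rightarrow> 'w \<Rightarrow> real^'d) r w) \<in> borel_measurable (borel \<Otimes>\<^sub>M M)"
  using assms N1.measurable_F_M by (intro borel_measurable_versions) (auto simp: adapted_process_def)

text \<open>The energy estimate with \<open>\<epsilon> = 0\<close> and rate \<open>2 * K\<close>
  gives \<open>X t = Y t\<close> almost surely for each single \<open>t\<close>. The exceptional set
  depends on \<open>t\<close>; countably many times and right-continuity of both paths remove this
  dependence.\<close>

theorem strong_sol_unique:
  assumes X: "strong_sol x X I J" and Y: "strong_sol x Y I' J'"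
  shows "indistinguishable M X Y"
proof -
  define X' Y' where "X' = right_version X" and "Y' = right_version Y"
  have mX[measurable]: "(\<lambda>(r, w). X' r w) \<in> borel_measurable (borel \<Otimes>\<^sub>M M)" and mY[measurable]: "(\<lambda>(r, w). Y' r w) \<in> borel_measurable (borel \<Otimes>\<^sub>M M)"
    using X Y by (auto simp: X'_def Y'_def strong_sol_def intro!: adapted_right_version_measurable)
  define Z where "Z t w = X t w - Y t w" for t w
  define \<beta> where "\<beta> r w = b (X' r w) - b (Y' r w)" for r w
  have cad: "AE w in M. cadlag (\<lambda>t. X t w)" "AE w in M. cadlag (\<lambda>t. Y t w)" using X Y by (auto simp: strong_sol_def)
  have Zad: "Z t \<in> borel_measurable (F t)" if "0 \<le> t" for t
    using X Y that unfolding Z_def[abs_def] strong_sol_def adapted_process_def by (intro borel_measurable_diff) auto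
  have \<beta>m: "(\<lambda>(r, w). \<beta> r w) \<in> borel_measurable (borel \<Otimes>\<^sub>M M)" unfolding \<beta>_def by measurable
  have \<beta>b: "\<forall>w\<in>space M. norm (\<beta> r w) \<le> 2 * sqrt L" for r
    using b_diff_norm by (simp add: \<beta>_def)
  note gX = g_compose_measurable[OF mX] and gY = g_compose_measurable[OF mY]
  have NI1: "noise_integral M F \<nu>1 R1 (\<lambda>r u w. g1 (X' r w) u - g1 (Y' r w) u) (\<lambda>t w. I t w - I' t w)"
    using X Y by (intro N1.noise_integral_diff gX gY) (auto simp: strong_sol_def X'_def Y'_def)
  have NI2: "noise_integral M F \<nu>2 R2 (\<lambda>r u w. g2 (X' r w) u - g2 (Y' r w) u) (\<lambda>t w. J t w - J' t w)"
    using X Y by (intro N2.noise_integral_diff gX gY) (auto simp: strong_sol_def X'_def Y'_def)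
  have G1: "(\<lambda>(r, u, w). g1 (X' r w) u - g1 (Y' r w) u) \<in> borel_measurable (borel \<Otimes>\<^sub>M \<nu>1 \<Otimes>\<^sub>M M)"
    and G2: "(\<lambda>(r, u, w). g2 (X' r w) u - g2 (Y' r w) u) \<in> borel_measurable (borel \<Otimes>\<^sub>M \<nu>2 \<Otimes>\<^sub>M M)"
    using borel_measurable_diff[OF gX(1) gY(1)] borel_measurable_diff[OF gX(2) gY(2)] by (simp_all add: case_prod_unfold)
  have bsec: "set_integrable lborel {0<..t} (\<lambda>r. b (X' r w))" "set_integrable lborel {0<..t} (\<lambda>r. b (Y' r w))" if "0 \<le> t" "w \<in> space M" for t w
  proof -
    have [measurable]: "(\<lambda>r. X' r w) \<in> borel_measurable borel" "(\<lambda>r. Y' r w) \<in> borel_measurable borel"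
      using that(2) by measurable
    show "set_integrable lborel {0<..t} (\<lambda>r. b (X' r w))" "set_integrable lborel {0<..t} (\<lambda>r. b (Y' r w))"
      using b_norm that by (auto intro!: set_integrable_bounded_interval[where C="sqrt L"])
  qed
  have Zeq: "AE w in M. Z t w = (LINT r:{0<..t}|lborel. \<beta> r w) + (I t w - I' t w) + (J t w - J' t w)" if t: "0 \<le> t" for t
  proof -
    have "AE w in M. \<forall>t\<ge>0. X t w = x + (LINT r:{0<..t}|lborel. b (X' r w)) + I t w + J t w"
      "AE w in M. \<forall>t\<ge>0. Y t w = x + (LINT r:{0<..t}|lborel. b (Y' r w)) + I' t w + J' t w"
      using X Y by (auto simp: strong_sol_def X'_def Y'_def)
    then show ?thesis using AE_space
    proof eventually_elim
      case (elim w)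
      then show ?case using t set_integral_diff(2)[OF bsec[OF t elim(3)]] by (simp add: Z_def \<beta>_def algebra_simps)
    qed
  qed
  have Zm: "Z t \<in> borel_measurable M" if "0 \<le> t" for t using N1.measurable_F_M[OF Zad[OF that]] .
  have bds: "\<forall>w\<in>space M. sq_norm \<nu>1 (\<lambda>u. g1 (X' r w) u - g1 (Y' r w) u) \<le> ennreal (4 * L)"
      "\<forall>w\<in>space M. sq_norm \<nu>2 (\<lambda>u. g2 (X' r w) u - g2 (Y' r w) u) \<le> ennreal (4 * L)" for r
    using g_diff_bound by auto
  have L4: "0 \<le> 4 * L" using L_pos by simp
  have iZ: "integrable M (\<lambda>w. (norm (Z t w))\<^sup>2)" if t: "0 \<le> t" for t
    by (rule ito_process_sq_integrable(1)[where Z=Z and t=t, OF Zm[OF t] t Zeq[OF t] \<beta>m \<beta>b NI1 G1 bds(1) NI2 G2 bds(2) L4])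
  have E0: "N1.expectation (\<lambda>w. (norm (Z T w))\<^sup>2) \<le> 0 * T * exp (2 * K * T)" if T: "0 \<le> T" for T
  proof (rule ito_process_energy[OF T _ _ _ L4 Zad Zeq \<beta>m \<beta>b NI1 G1 bds(1) NI2 G2 bds(2)])
    fix r assume r: "0 < r" "r \<le> T"
    have ae: "AE w in M. 2 * (Z r w \<bullet> \<beta> r w) + (2 * (\<integral>u. (norm (g1 (X' r w) u - g1 (Y' r w) u))\<^sup>2 \<partial>\<nu>1)
        + 2 * (\<integral>u. (norm (g2 (X' r w) u - g2 (Y' r w) u))\<^sup>2 \<partial>\<nu>2)) \<le> 2 * K * (norm (Z r w))\<^sup>2"
      using cad
    proof eventually_elim
      case (elim w)
      then have "X' r w = X r w" "Y' r w = Y r w" using r by (auto simp: X'_def Y'_def intro!: right_version_eq)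
      then show ?case using monotone[of "X r w" "Y r w"] by (simp add: Z_def \<beta>_def inner_commute)
    qed
    have "N1.expectation (\<lambda>w. 2 * (Z r w \<bullet> \<beta> r w) + (2 * (\<integral>u. (norm (g1 (X' r w) u - g1 (Y' r w) u))\<^sup>2 \<partial>\<nu>1)
        + 2 * (\<integral>u. (norm (g2 (X' r w) u - g2 (Y' r w) u))\<^sup>2 \<partial>\<nu>2))) \<le> N1.expectation (\<lambda>w. 2 * K * (norm (Z r w))\<^sup>2)"
    \<comment> \<open>The rule asks for a nonnegative integrable majorant; a left side that fails to
      be integrable would have the integral 0.\<close>
    proof (rule integral_mono_AE'[OF _ ae])
      show "integrable M (\<lambda>w. 2 * K * (norm (Z r w))\<^sup>2)" using iZ r by simp
      show "AE w in M. 0 \<le> 2 * K * (norm (Z r w))\<^sup>2" using K_pos by simp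
    qed
    then show "N1.expectation (\<lambda>w. 2 * (Z r w \<bullet> \<beta> r w) + (2 * (\<integral>u. (norm (g1 (X' r w) u - g1 (Y' r w) u))\<^sup>2 \<partial>\<nu>1)
        + 2 * (\<integral>u. (norm (g2 (X' r w) u - g2 (Y' r w) u))\<^sup>2 \<partial>\<nu>2))) \<le> 2 * K * N1.expectation (\<lambda>w. (norm (Z r w))\<^sup>2) + 0" by simp
  qed (use K_pos L_pos in auto)
  have Z0: "AE w in M. Z t w = 0" if t: "0 \<le> t" for t
  proof -
    have "N1.expectation (\<lambda>w. (norm (Z t w))\<^sup>2) = 0"
      by (rule order_antisym) (use E0[OF t] in simp_all)
    then have "AE w in M. (norm (Z t w))\<^sup>2 = 0"
      using integral_nonneg_eq_0_iff_AE[OF iZ[OF t]] by simp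
    then show ?thesis by eventually_elim simp
  qed
  \<comment> \<open>Exactly the times at which \<open>right_version\<close> samples a path, indexed
    by dyadic level and numerator.\<close>
  have "AE w in M. \<forall>n i. Z (max 0 ((real_of_int i + 1) / 2 ^ n)) w = 0"
    using Z0 by (simp add: AE_all_countable)
  with cad show ?thesis unfolding indistinguishable_def
  proof eventually_elim
    case (elim w)
    show ?case
    proof (intro allI impI)
      fix t :: real assume t: "0 \<le> t"
      have "right_version X t w = right_version Y t w"
        using elim(3) unfolding right_version_def dyadic_above_def by (simp add: Z_def)
      then show "X t w = Y t w" using right_version_eq[of X w, OF elim(1) t] right_version_eq[of Y w, OF elim(2) t] by simp
    qed
  qed
qed

end

section \<open>The Euler scheme\<close>

lemma simple_L2_approximation:
  fixes f :: "'u \<Rightarrow> 'b::euclidean_space"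
  assumes [measurable]: "f \<in> borel_measurable \<nu>" and fin: "sq_norm \<nu> f \<le> ennreal L" and L: "0 \<le> L" and \<delta>: "0 < \<delta>"
  obtains As where "\<And>A v. (A, v) \<in> set As \<Longrightarrow> A \<in> fmeasurable \<nu>"
    "sq_norm \<nu> (\<lambda>u. (\<Sum>(A, v)\<leftarrow>As. indicator A u *\<^sub>R v) - f u) \<le> ennreal \<delta>"
    "sq_norm \<nu> (\<lambda>u. \<Sum>(A, v)\<leftarrow>As. indicator A u *\<^sub>R v) \<le> ennreal (4 * L)"
proof -
  obtain s where s: "\<And>i. simple_function \<nu> (s i)" "\<And>u. u \<in> space \<nu> \<Longrightarrow> (\<lambda>i. s i u) \<longlonglongrightarrow> f u"
    "\<And>i u. u \<in> space \<nu> \<Longrightarrow> dist (s i u) 0 \<le> 2 * dist (f u) 0"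
    using borel_measurable_implies_sequence_metric[OF assms(1), of 0] by blast
  have [measurable]: "s i \<in> borel_measurable \<nu>" for i using s(1) by (rule borel_measurable_simple_function)
  \<comment> \<open>The factor 4 comes from \<open>norm (s i u) <= 2 * norm (f u)\<close>. The bound
    does not depend on \<open>i\<close>, and it yields the uniform bound on the kernels of the
    scheme.\<close>
  have fin4: "sq_norm \<nu> (\<lambda>u. s i u) \<le> ennreal (4 * L)" for i
  proof -
    have "sq_norm \<nu> (\<lambda>u. s i u) \<le> (\<integral>\<^sup>+u. ennreal 4 * ennreal ((norm (f u))\<^sup>2) \<partial>\<nu>)"
    proof (rule nn_integral_mono)
      fix u assume "u \<in> space \<nu>"
      then have "(norm (s i u))\<^sup>2 \<le> (2 * norm (f u))\<^sup>2" using s(3)[of u i] by (intro power_mono) auto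
      then show "ennreal ((norm (s i u))\<^sup>2) \<le> ennreal 4 * ennreal ((norm (f u))\<^sup>2)"
        by (subst ennreal_mult'[symmetric]) (auto simp: power_mult_distrib intro!: ennreal_leI)
    qed
    also have "\<dots> = ennreal 4 * sq_norm \<nu> f" by (rule nn_integral_cmult) simp
    also have "\<dots> \<le> ennreal 4 * ennreal L" using fin by (intro mult_left_mono) auto
    finally show ?thesis using L by (simp add: ennreal_mult)
  qed
  have "(\<lambda>i. sq_norm \<nu> (\<lambda>u. s i u - f u)) \<longlonglongrightarrow> (\<integral>\<^sup>+u. 0 \<partial>\<nu>)"
  proof (rule nn_integral_dominated_convergence[where w="\<lambda>u. ennreal 9 * ennreal ((norm (f u))\<^sup>2)"])
    show "AE u in \<nu>. ennreal ((norm (s i u - f u))\<^sup>2) \<le> ennreal 9 * ennreal ((norm (f u))\<^sup>2)" for i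
    proof (rule AE_I2)
      fix u assume "u \<in> space \<nu>"
      then have "norm (s i u - f u) \<le> 3 * norm (f u)" using s(3)[of u i] norm_triangle_ineq4[of "s i u" "f u"] by simp
      then have "(norm (s i u - f u))\<^sup>2 \<le> (3 * norm (f u))\<^sup>2" by (intro power_mono) auto
      then show "ennreal ((norm (s i u - f u))\<^sup>2) \<le> ennreal 9 * ennreal ((norm (f u))\<^sup>2)"
        by (subst ennreal_mult'[symmetric]) (auto simp: power_mult_distrib intro!: ennreal_leI)
    qed
    show "(\<integral>\<^sup>+u. ennreal 9 * ennreal ((norm (f u))\<^sup>2) \<partial>\<nu>) < \<infinity>"
      using fin by (simp add: nn_integral_cmult ennreal_mult_less_top le_less_trans)
    have "(\<lambda>i. ennreal ((norm (s i u - f u))\<^sup>2)) \<longlonglongrightarrow> ennreal ((norm (f u - f u))\<^sup>2)" if "u \<in> space \<nu>" for u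
      by (intro tendsto_ennrealI tendsto_intros s(2) that)
    then show "AE u in \<nu>. (\<lambda>i. ennreal ((norm (s i u - f u))\<^sup>2)) \<longlonglongrightarrow> 0" by (intro AE_I2) simp
  qed auto
  then have "eventually (\<lambda>i. sq_norm \<nu> (\<lambda>u. s i u - f u) < ennreal \<delta>) sequentially"
    using \<delta> by (intro order_tendstoD(2)[where y=0]) auto
  then obtain i where i: "sq_norm \<nu> (\<lambda>u. s i u - f u) < ennreal \<delta>" by (auto simp: eventually_sequentially)
  \<comment> \<open>Zero is left out of the values, since only nonzero values are sure to have level
    sets of finite measure.\<close>
  define V where "V = s i ` space \<nu> - {0}"
  have "finite V" using s(1)[of i] by (simp add: V_def simple_function_def)
  then obtain vs where vs: "set vs = V" "distinct vs" using finite_distinct_list by blast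
  define As where "As = map (\<lambda>v. (s i -` {v} \<inter> space \<nu>, v)) vs"
  have val: "(\<Sum>(A, v)\<leftarrow>As. indicator A u *\<^sub>R v) = s i u" if u: "u \<in> space \<nu>" for u
  proof -
    have "(\<Sum>(A, v)\<leftarrow>As. indicator A u *\<^sub>R v) = (\<Sum>v\<in>V. indicator (s i -` {v} \<inter> space \<nu>) u *\<^sub>R v)"
      using sum_list_distinct_conv_sum_set[OF vs(2), of "\<lambda>v. indicator (s i -` {v} \<inter> space \<nu>) u *\<^sub>R v"]
      by (simp add: As_def o_def vs(1))
    also have "\<dots> = (\<Sum>v\<in>V. if v = s i u then v else 0)"
      by (intro sum.cong) (use u in \<open>auto simp: indicator_def\<close>)
    also have "\<dots> = s i u" using \<open>finite V\<close> u by (auto simp: V_def)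
    finally show ?thesis .
  qed
  show ?thesis
  proof (rule that[of As])
    fix A v assume "(A, v) \<in> set As"
    then have A: "A = s i -` {v} \<inter> space \<nu>" "v \<noteq> 0" using vs(1) by (auto simp: As_def V_def)
    have Am[measurable]: "A \<in> sets \<nu>" unfolding A(1) by measurable
    have "ennreal ((norm v)\<^sup>2) * emeasure \<nu> A = (\<integral>\<^sup>+u. ennreal ((norm v)\<^sup>2) * indicator A u \<partial>\<nu>)"
      using Am by (rule nn_integral_cmult_indicator[symmetric])
    also have "\<dots> \<le> sq_norm \<nu> (\<lambda>u. s i u)"
      by (intro nn_integral_mono) (auto simp: A(1) indicator_def)
    also have "\<dots> < \<infinity>" using fin4[of i] by (simp add: le_less_trans)
    finally show "A \<in> fmeasurable \<nu>" using A(2) Am by (auto simp: fmeasurable_def ennreal_mult_less_top)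
  next
    show "sq_norm \<nu> (\<lambda>u. (\<Sum>(A, v)\<leftarrow>As. indicator A u *\<^sub>R v) - f u) \<le> ennreal \<delta>"
      using i by (simp add: val cong: nn_integral_cong)
    show "sq_norm \<nu> (\<lambda>u. \<Sum>(A, v)\<leftarrow>As. indicator A u *\<^sub>R v) \<le> ennreal (4 * L)"
      using fin4[of i] by (simp add: val cong: nn_integral_cong)
  qed
qed

text \<open>
  The list entry \<open>(A, c)\<close> stands for the kernel \<open>c(y) \<cdot> 1\<^bsub>A\<^esub>(u)\<close>, which makes each Euler step a simple integrand.
\<close>

definition kernel_value :: "('u set \<times> ('b \<Rightarrow> 'b::real_vector)) list \<Rightarrow> 'b \<Rightarrow> 'u \<Rightarrow> 'b" where
  "kernel_value As y u = (\<Sum>(A, c)\<leftarrow>As. indicator A u *\<^sub>R c y)"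

definition simple_kernel :: "'u measure \<Rightarrow> ('u set \<times> ('b::euclidean_space \<Rightarrow> 'b)) list \<Rightarrow> bool" where
  "simple_kernel \<nu> As \<longleftrightarrow> (\<forall>(A, c)\<in>set As. A \<in> fmeasurable \<nu> \<and> c \<in> borel_measurable borel \<and> bounded (range c))"

lemma kernel_value_measurable:
  assumes "simple_kernel \<nu> As"
  shows "kernel_value As y \<in> borel_measurable \<nu>"
  unfolding kernel_value_def[abs_def]
proof (rule borel_measurable_sum_list)
  fix h assume h: "h \<in> set As"
  obtain A c where [simp]: "h = (A, c)" by (cases h)
  have "A \<in> sets \<nu>" using assms h by (auto simp: simple_kernel_def)
  then show "(\<lambda>u. case h of (A, c) \<Rightarrow> indicat_real A u *\<^sub>R c y) \<in> borel_measurable \<nu>" by simp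
qed

text \<open>Induction over the centres of the balls. On the part \<open>C\<close> of a new ball that
  is not yet covered, the kernel is the simple approximation \<open>s\<close> of \<open>g q\<close>,
  the same for all \<open>y\<close> in \<open>C\<close>; that the old kernel vanishes off the old
  balls is carried along so that the sum equals \<open>s\<close> there. An error
  \<open>\<delta> / 4\<close> for \<open>s\<close> and another for the modulus add up to
  \<open>\<delta>\<close> after the doubling in \<open>nn_diff_sq_le\<close>.\<close>

lemma kernel_approximation_cover:
  fixes g :: "'b::euclidean_space \<Rightarrow> 'u \<Rightarrow> 'b"
  assumes g: "\<And>y. g y \<in> borel_measurable \<nu>" and fin: "\<And>y. sq_norm \<nu> (\<lambda>u. g y u) \<le> ennreal L" and L: "0 \<le> L" and \<delta>: "0 < \<delta>"
    and mod: "\<And>x y. dist x y < \<rho> \<longrightarrow> (sq_norm \<nu> (\<lambda>u. g x u - g y u)) \<le> ennreal (\<delta> / 4)"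
  shows "\<exists>As. simple_kernel \<nu> As \<and> (\<forall>y. sq_norm \<nu> (\<lambda>u. kernel_value As y u) \<le> ennreal (4 * L)) \<and>
    (\<forall>y\<in>(\<Union>q\<in>set qs. ball q \<rho>). sq_norm \<nu> (\<lambda>u. kernel_value As y u - g y u) \<le> ennreal \<delta>) \<and>
    (\<forall>y. y \<notin> (\<Union>q\<in>set qs. ball q \<rho>) \<longrightarrow> kernel_value As y = (\<lambda>_. 0))"
proof (induction qs)
  case Nil
  show ?case by (intro exI[of _ "[]"]) (auto simp: kernel_value_def simple_kernel_def fun_eq_iff)
next
  case (Cons q qs)
  define U where "U = (\<Union>q\<in>set qs. ball q \<rho>)"
  have [measurable]: "U \<in> sets borel" unfolding U_def by (intro borel_open open_UN) auto
  obtain As where As: "simple_kernel \<nu> As" "\<And>y. sq_norm \<nu> (\<lambda>u. kernel_value As y u) \<le> ennreal (4 * L)"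
    "\<And>y. y \<in> U \<Longrightarrow> (sq_norm \<nu> (\<lambda>u. kernel_value As y u - g y u)) \<le> ennreal \<delta>"
    "\<And>y. y \<notin> U \<Longrightarrow> kernel_value As y = (\<lambda>_. 0)"
    using Cons unfolding U_def by blast
  have "0 < \<delta> / 4" using \<delta> by simp
  from simple_L2_approximation[OF g[of q] fin[of q] L this]
  obtain Bs where Bs: "\<And>A v. (A, v) \<in> set Bs \<Longrightarrow> A \<in> fmeasurable \<nu>"
    "sq_norm \<nu> (\<lambda>u. (\<Sum>(A, v)\<leftarrow>Bs. indicator A u *\<^sub>R v) - g q u) \<le> ennreal (\<delta> / 4)"
    "sq_norm \<nu> (\<lambda>u. \<Sum>(A, v)\<leftarrow>Bs. indicator A u *\<^sub>R v) \<le> ennreal (4 * L)" by blast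
  define s where "s u = (\<Sum>(A, v)\<leftarrow>Bs. indicator A u *\<^sub>R v)" for u
  have sm[measurable]: "s \<in> borel_measurable \<nu>" unfolding s_def[abs_def]
    using fmeasurableD[OF Bs(1)]
    by (intro borel_measurable_sum_list) (auto intro!: borel_measurable_scaleR borel_measurable_indicator)
  define C where "C = ball q \<rho> - U"
  have [measurable]: "C \<in> sets borel" by (auto simp: C_def)
  define As' where "As' = As @ map (\<lambda>(A, v). (A, \<lambda>y. indicator C y *\<^sub>R v)) Bs"
  have kv: "kernel_value As' y u = kernel_value As y u + indicator C y *\<^sub>R s u" for y u
  proof -
    have "(\<Sum>(A, c)\<leftarrow>map (\<lambda>(A, v). (A, \<lambda>y. indicator C y *\<^sub>R v)) Bs'. indicator A u *\<^sub>R c y)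
        = indicator C y *\<^sub>R (\<Sum>(A, v)\<leftarrow>Bs'. indicator A u *\<^sub>R v)" for Bs' :: "('u set \<times> 'b) list"
      by (induction Bs') (auto simp: scaleR_right_distrib mult.commute)
    then show ?thesis by (simp add: kernel_value_def As'_def s_def)
  qed
  have kv1: "kernel_value As' y = kernel_value As y" if "y \<notin> C" for y using that by (auto simp: kv fun_eq_iff)
  have kv2: "kernel_value As' y = s" if "y \<in> C" for y using that As(4)[of y] by (auto simp: kv fun_eq_iff C_def)
  have "simple_kernel \<nu> As'"
  proof -
    have "bounded (range (\<lambda>y. indicat_real C y *\<^sub>R v))" for v :: 'b
      by (rule boundedI[of _ "norm v"]) (auto simp: indicator_def)
    then show ?thesis using As(1) Bs(1) by (auto simp: simple_kernel_def As'_def)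
  qed
  moreover have "sq_norm \<nu> (\<lambda>u. kernel_value As' y u) \<le> ennreal (4 * L)" for y
    using As(2)[of y] Bs(3) kv1[of y] kv2[of y] by (cases "y \<in> C") (auto simp: s_def)
  moreover have "sq_norm \<nu> (\<lambda>u. kernel_value As' y u - g y u) \<le> ennreal \<delta>" if "y \<in> (\<Union>q\<in>set (q # qs). ball q \<rho>)" for y
  proof (cases "y \<in> C")
    case True
    then have d: "dist y q < \<rho>" by (simp add: C_def dist_commute)
    have "sq_norm \<nu> (\<lambda>u. (s u - g q u) - (g y u - g q u)) \<le> ennreal (2 * (\<delta> / 4) + 2 * (\<delta> / 4))"
      using Bs(2) mod[rule_format, OF d] \<delta> g[of y] g[of q] by (intro nn_diff_sq_le) (auto simp: s_def[symmetric])
    then show ?thesis by (simp add: kv2[OF True])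
  next
    case False
    then have "y \<in> U" using that by (auto simp: C_def U_def)
    then show ?thesis using As(3) kv1[OF False] by simp
  qed
  moreover have "kernel_value As' y = (\<lambda>_. 0)" if "y \<notin> (\<Union>q\<in>set (q # qs). ball q \<rho>)" for y
    using that As(4)[of y] kv1[of y] by (auto simp: C_def U_def)
  ultimately show ?case by blast
qed

text \<open>A finite net gives uniform accuracy on a bounded set only, here the ball of radius
  \<open>4 ^ n\<close>. Outside it the trivial error \<open>10 * L\<close> is at most
  \<open>10 * L * (norm y)^2 * (1/16) ^ n\<close>, because \<open>(norm y)^2 >= 16 ^ n\<close>. An
  error with this quadratic weight suffices, since the scheme has bounded second moments on bounded
  time intervals.\<close>

lemma kernel_approximation:
  fixes g :: "'b::euclidean_space \<Rightarrow> 'u \<Rightarrow> 'b"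
  assumes g: "\<And>y. g y \<in> borel_measurable \<nu>" and fin: "\<And>y. sq_norm \<nu> (\<lambda>u. g y u) \<le> ennreal L" and L: "0 \<le> L"
    and K: "0 \<le> K" "0 \<le> B"
    and mod: "\<And>x y. sq_norm \<nu> (\<lambda>u. g x u - g y u) \<le> ennreal (K * (norm (x - y))\<^sup>2 + B * norm (x - y))"
  shows "\<exists>As. simple_kernel \<nu> As \<and> (\<forall>y. sq_norm \<nu> (\<lambda>u. kernel_value As y u) \<le> ennreal (4 * L)) \<and>
    (\<forall>y. sq_norm \<nu> (\<lambda>u. kernel_value As y u - g y u) \<le> ennreal ((1 + 10 * L * (norm y)\<^sup>2) * (1 / 16) ^ n))"
proof -
  define \<delta> where "\<delta> = (1 / 16 :: real) ^ n"
  have \<delta>: "0 < \<delta>" by (simp add: \<delta>_def)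
  \<comment> \<open>\<open>\<rho> <= 1\<close> lets the linear term dominate the quadratic one in
    the modulus, and the second bound makes \<open>(K + B) * \<rho>\<close> at most
    \<open>\<delta> / 4\<close>.\<close>
  define \<rho> where "\<rho> = min 1 (\<delta> / (4 * (K + B + 1)))"
  have \<rho>: "0 < \<rho>" "\<rho> \<le> 1" using \<delta> K by (auto simp: \<rho>_def)
  have mod': "dist x y < \<rho> \<longrightarrow> (sq_norm \<nu> (\<lambda>u. g x u - g y u)) \<le> ennreal (\<delta> / 4)" for x y
  proof
    assume d: "dist x y < \<rho>"
    have n: "norm (x - y) \<le> 1" "norm (x - y) \<le> \<delta> / (4 * (K + B + 1))" using d by (auto simp: \<rho>_def dist_norm)
    have "K * (norm (x - y))\<^sup>2 + B * norm (x - y) \<le> K * norm (x - y) + B * norm (x - y)"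
    proof -
      have "(norm (x - y))\<^sup>2 \<le> norm (x - y)" using n(1) by (simp add: power2_eq_square mult_left_le)
      then show ?thesis using K(1) by (intro add_right_mono mult_left_mono)
    qed
    also have "\<dots> \<le> (K + B + 1) * norm (x - y)" by (simp add: algebra_simps)
    also have "\<dots> \<le> (K + B + 1) * (\<delta> / (4 * (K + B + 1)))" using n K by (intro mult_left_mono) auto
    also have "\<dots> = \<delta> / 4" using K by (simp add: field_simps)
    finally show "sq_norm \<nu> (\<lambda>u. g x u - g y u) \<le> ennreal (\<delta> / 4)"
      by (intro order_trans[OF mod] ennreal_leI)
  qed
  have "\<forall>e>0. \<exists>k. finite k \<and> k \<subseteq> cball (0::'b) (4 ^ n) \<and> cball 0 (4 ^ n) \<subseteq> (\<Union>q\<in>k. ball q e)"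
    by (intro seq_compact_imp_totally_bounded compact_imp_seq_compact compact_cball)
  from this[rule_format, OF \<rho>(1)] obtain k :: "'b set" where k: "finite k" "cball 0 (4 ^ n) \<subseteq> (\<Union>q\<in>k. ball q \<rho>)"
    by (elim exE conjE)
  obtain qs where qs: "set qs = k" using finite_list[OF k(1)] by blast
  from kernel_approximation_cover[where qs=qs, OF g fin L \<delta> mod']
  obtain As where As0: "simple_kernel \<nu> As" "\<forall>y. sq_norm \<nu> (\<lambda>u. kernel_value As y u) \<le> ennreal (4 * L)"
    "\<forall>y\<in>(\<Union>q\<in>set qs. ball q \<rho>). sq_norm \<nu> (\<lambda>u. kernel_value As y u - g y u) \<le> ennreal \<delta>"
    by (elim exE conjE)
  note As = As0(1) As0(2)[rule_format] As0(3)[rule_format]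
  have kvm: "kernel_value As y \<in> borel_measurable \<nu>" for y
    by (rule kernel_value_measurable[OF As(1)])
  have "sq_norm \<nu> (\<lambda>u. kernel_value As y u - g y u) \<le> ennreal ((1 + 10 * L * (norm y)\<^sup>2) * (1 / 16) ^ n)" for y
  proof (cases "norm y \<le> 4 ^ n")
    case True
    then have "y \<in> cball 0 (4 ^ n)" by simp
    then have "y \<in> (\<Union>q\<in>set qs. ball q \<rho>)" using k(2) unfolding qs by (rule subsetD[rotated])
    then have "sq_norm \<nu> (\<lambda>u. kernel_value As y u - g y u) \<le> ennreal \<delta>" by (rule As(3))
    also have "\<dots> \<le> ennreal ((1 + 10 * L * (norm y)\<^sup>2) * (1 / 16) ^ n)"
      using L by (intro ennreal_leI) (simp add: \<delta>_def)
    finally show ?thesis .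
  next
    case False
    then have "4 ^ n \<le> norm y" by simp
    then have "(4 ^ n)\<^sup>2 \<le> (norm y)\<^sup>2" by (intro power_mono) auto
    then have "16 ^ n \<le> (norm y)\<^sup>2" by (simp add: power2_eq_square flip: power_mult_distrib)
    then have one: "1 \<le> (norm y)\<^sup>2 * (1 / 16) ^ n" by (simp add: power_one_over field_simps)
    have "sq_norm \<nu> (\<lambda>u. kernel_value As y u - g y u) \<le> ennreal (2 * (4 * L) + 2 * L)"
      using L by (intro nn_diff_sq_le kvm g As(2) fin) auto
    also have "\<dots> \<le> ennreal ((1 + 10 * L * (norm y)\<^sup>2) * (1 / 16) ^ n)"
    proof (rule ennreal_leI)
      have "10 * L * 1 \<le> 10 * L * ((norm y)\<^sup>2 * (1 / 16) ^ n)" using L by (intro mult_left_mono one) auto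
      moreover have "0 \<le> (1 / 16 :: real) ^ n" by simp
      moreover have "(1 + 10 * L * (norm y)\<^sup>2) * (1 / 16) ^ n = (1 / 16) ^ n + 10 * L * ((norm y)\<^sup>2 * (1 / 16) ^ n)"
        by (simp add: distrib_right)
      ultimately show "2 * (4 * L) + 2 * L \<le> (1 + 10 * L * (norm y)\<^sup>2) * (1 / 16) ^ n" by linarith
    qed
    finally show ?thesis .
  qed
  then show ?thesis using As by blast
qed

context sde
begin

text \<open>
  The term \<open>2 sqrt L |x - y|\<close> bounds the drift, of which no modulus of continuity is available.
\<close>

lemma g_modulus:
  "(\<integral>u. (norm (g1 x u - g1 y u))\<^sup>2 \<partial>\<nu>1) + (\<integral>u. (norm (g2 x u - g2 y u))\<^sup>2 \<partial>\<nu>2) \<le> K * (norm (x - y))\<^sup>2 + 2 * sqrt L * norm (x - y)"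
proof -
  have "- ((b x - b y) \<bullet> (x - y)) \<le> norm (b x - b y) * norm (x - y)"
    using Cauchy_Schwarz_ineq2[of "b x - b y" "x - y"] by linarith
  also have "\<dots> \<le> 2 * sqrt L * norm (x - y)" by (intro mult_right_mono b_diff_norm) auto
  finally show ?thesis using monotone[of x y] by linarith
qed

lemma g_diff_integrable:
  "integrable \<nu>1 (\<lambda>u. (norm (g1 x u - g1 y u))\<^sup>2)" "integrable \<nu>2 (\<lambda>u. (norm (g2 x u - g2 y u))\<^sup>2)"
  using g_diff_bound g_section by (auto intro!: sq_integrable_of_nn(1)[where c="4 * L"])

lemma g_modulus_nn:
  "sq_norm \<nu>1 (\<lambda>u. g1 x u - g1 y u) \<le> ennreal (K * (norm (x - y))\<^sup>2 + 2 * sqrt L * norm (x - y))"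
  "sq_norm \<nu>2 (\<lambda>u. g2 x u - g2 y u) \<le> ennreal (K * (norm (x - y))\<^sup>2 + 2 * sqrt L * norm (x - y))"
proof -
  have "0 \<le> (\<integral>u. (norm (g1 x u - g1 y u))\<^sup>2 \<partial>\<nu>1)" "0 \<le> (\<integral>u. (norm (g2 x u - g2 y u))\<^sup>2 \<partial>\<nu>2)" by simp_all
  then show "sq_norm \<nu>1 (\<lambda>u. g1 x u - g1 y u) \<le> ennreal (K * (norm (x - y))\<^sup>2 + 2 * sqrt L * norm (x - y))"
   "sq_norm \<nu>2 (\<lambda>u. g2 x u - g2 y u) \<le> ennreal (K * (norm (x - y))\<^sup>2 + 2 * sqrt L * norm (x - y))"
    unfolding nn_of_sq_integrable[OF g_diff_integrable(1)] nn_of_sq_integrable[OF g_diff_integrable(2)]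
    using g_modulus[of x y] by (intro ennreal_leI, linarith)+
qed

end

text \<open>The kernels \<open>A1 n\<close> and \<open>A2 n\<close> discretise the dependence on
  mark and state with the same rate \<open>16^-n\<close> as the time mesh. Each step then uses
  finitely many noise increments with bounded coefficients, so the stochastic part of the scheme is
  an elementary integral.\<close>

locale euler_scheme = sde M F \<nu>1 R1 \<nu>2 R2 b g1 g2 K L
  for M :: "'w measure" and F and \<nu>1 :: "'u1 measure" and R1 and \<nu>2 :: "'u2 measure" and R2
    and b :: "real^'d::finite \<Rightarrow> real^'d" and g1 g2 and K L :: real +
  fixes x0 :: "real^'d" and A1 :: "nat \<Rightarrow> ('u1 set \<times> (real^'d \<Rightarrow> real^'d)) list"
    and A2 :: "nat \<Rightarrow> ('u2 set \<times> (real^'d \<Rightarrow> real^'d)) list"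
  assumes A1: "\<And>n. simple_kernel \<nu>1 (A1 n)" and A2: "\<And>n. simple_kernel \<nu>2 (A2 n)"
    and A1_bound: "\<And>n y. sq_norm \<nu>1 (\<lambda>u. kernel_value (A1 n) y u) \<le> ennreal (4 * L)"
    and A2_bound: "\<And>n y. sq_norm \<nu>2 (\<lambda>u. kernel_value (A2 n) y u) \<le> ennreal (4 * L)"
    and A1_error: "\<And>n y. sq_norm \<nu>1 (\<lambda>u. kernel_value (A1 n) y u - g1 y u) \<le> ennreal ((1 + 10 * L * (norm y)\<^sup>2) * (1 / 16) ^ n)"
    and A2_error: "\<And>n y. sq_norm \<nu>2 (\<lambda>u. kernel_value (A2 n) y u - g2 y u) \<le> ennreal ((1 + 10 * L * (norm y)\<^sup>2) * (1 / 16) ^ n)"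
begin

definition node :: "nat \<Rightarrow> nat \<Rightarrow> real" where "node n i = real i / 16 ^ n"

primrec grid :: "nat \<Rightarrow> nat \<Rightarrow> 'w \<Rightarrow> real^'d" where
  "grid n 0 w = x0"
| "grid n (Suc i) w = grid n i w + (1 / 16 ^ n) *\<^sub>R b (grid n i w)
     + (\<Sum>(A, c)\<leftarrow>A1 n. (R1 A (node n (Suc i)) w - R1 A (node n i) w) *\<^sub>R c (grid n i w))
     + (\<Sum>(A, c)\<leftarrow>A2 n. (R2 A (node n (Suc i)) w - R2 A (node n i) w) *\<^sub>R c (grid n i w))"

text \<open>Enough steps of length \<open>1 / 16 ^ n\<close> to reach time \<open>n\<close>: mesh
  and horizon improve together, and every bounded interval is eventually covered.\<close>

definition steps :: "nat \<Rightarrow> nat" where "steps n = n * 16 ^ n"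

definition kernel_steps :: "nat \<Rightarrow> ('u set \<times> (real^'d \<Rightarrow> real^'d)) list \<Rightarrow> ('w, 'u, 'd) simple_jump_integrand" where
  "kernel_steps n As = concat (map (\<lambda>i. map (\<lambda>(A, c). (node n i, node n (Suc i), A, \<lambda>w. c (grid n i w))) As) [0..<steps n])"

abbreviation "hs1 n \<equiv> kernel_steps n (A1 n)"
abbreviation "hs2 n \<equiv> kernel_steps n (A2 n)"

definition drift :: "nat \<Rightarrow> real \<Rightarrow> 'w \<Rightarrow> real^'d" where
  "drift n r w = (\<Sum>i<steps n. indicator {node n i<..node n (Suc i)} r *\<^sub>R b (grid n i w))"

definition drift_integral :: "nat \<Rightarrow> real \<Rightarrow> 'w \<Rightarrow> real^'d" where
  "drift_integral n t w = (\<Sum>i<steps n. (min (node n (Suc i)) t - min (node n i) t) *\<^sub>R b (grid n i w))"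

text \<open>The scheme in continuous time: a Lipschitz drift part plus elementary integrals. It
  agrees with \<open>grid\<close> at the nodes up to time \<open>n\<close>, and its coefficients
  vanish afterwards.\<close>

definition euler :: "nat \<Rightarrow> real \<Rightarrow> 'w \<Rightarrow> real^'d" where
  "euler n t w = x0 + drift_integral n t w + step_integral R1 (hs1 n) t w + step_integral R2 (hs2 n) t w"

text \<open>
  The largest \<open>i\<close> with \<open>node n i < s\<close>; the inequality is strict because the integrands are left-continuous.
\<close>

definition last_node :: "nat \<Rightarrow> real \<Rightarrow> nat" where "last_node n s = nat (\<lceil>s * 16 ^ n\<rceil> - 1)"

definition euler_step :: "nat \<Rightarrow> real \<Rightarrow> 'w \<Rightarrow> real^'d" where
  "euler_step n s w = grid n (last_node n s) w"

lemma node_simps [simp]: "0 \<le> node n i" "node n 0 = 0" "node n i \<le> node n j \<longleftrightarrow> i \<le> j" "node n i < node n j \<longleftrightarrow> i < j"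
  by (auto simp: node_def divide_le_cancel divide_less_cancel)

lemma node_Suc: "node n (Suc i) = node n i + 1 / 16 ^ n"
  by (simp add: node_def field_simps)

lemma node_steps: "node n (steps n) = real n"
  by (simp add: node_def steps_def)

lemma in_step_iff:
  assumes "0 < s"
  shows "s \<in> {node n i<..node n (Suc i)} \<longleftrightarrow> i = last_node n s"
proof -
  have "0 < s * 16 ^ n" using assms by simp
  then have c: "1 \<le> \<lceil>s * 16 ^ n\<rceil>" by linarith
  have "s \<in> {node n i<..node n (Suc i)} \<longleftrightarrow> real i < s * 16 ^ n \<and> s * 16 ^ n \<le> real i + 1"
    by (auto simp: node_def field_simps)
  also have "\<dots> \<longleftrightarrow> \<lceil>s * 16 ^ n\<rceil> = int i + 1" by (simp add: ceiling_eq_iff)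
  also have "\<dots> \<longleftrightarrow> i = last_node n s" using c by (auto simp: last_node_def)
  finally show ?thesis .
qed

lemma last_node_bounds:
  assumes "0 < s"
  shows "node n (last_node n s) < s" "s \<le> node n (last_node n s) + 1 / 16 ^ n"
  using in_step_iff[OF assms, of n "last_node n s"] by (auto simp: node_Suc)

lemma last_node_less_steps:
  assumes "0 < s"
  shows "last_node n s < steps n \<longleftrightarrow> s \<le> real n"
proof
  assume "last_node n s < steps n"
  then have "node n (Suc (last_node n s)) \<le> node n (steps n)" by simp
  then show "s \<le> real n" using last_node_bounds[OF assms, of n] by (simp add: node_steps node_Suc)
next
  assume "s \<le> real n"
  then have "node n (last_node n s) < node n (steps n)" using last_node_bounds(1)[OF assms, of n] by (simp add: node_steps)
  then show "last_node n s < steps n" by simp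
qed

lemma sum_step:
  fixes v :: "nat \<Rightarrow> 'v::real_vector"
  assumes "0 < s"
  shows "(\<Sum>i<steps n. indicator {node n i<..node n (Suc i)} s *\<^sub>R v i) = (if s \<le> real n then v (last_node n s) else 0)"
proof -
  have "indicator {node n i<..node n (Suc i)} s = (if i = last_node n s then 1 else 0 :: real)" for i
    using in_step_iff[OF assms, of n i] by (simp only: indicator_def of_bool_def)
  then have "(\<Sum>i<steps n. indicator {node n i<..node n (Suc i)} s *\<^sub>R v i) = (\<Sum>i<steps n. if i = last_node n s then v i else 0)"
    by (intro sum.cong) simp_all
  then show ?thesis using last_node_less_steps[OF assms, of n] by simp
qed

lemma kernel_steps_sum:
  "(\<Sum>h\<leftarrow>kernel_steps n As. f h) = (\<Sum>i<steps n. \<Sum>(A, c)\<leftarrow>As. f (node n i, node n (Suc i), A, \<lambda>w. c (grid n i w)))"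
proof -
  have "(\<Sum>h\<leftarrow>concat (map G is). f h) = (\<Sum>i\<leftarrow>is. \<Sum>h\<leftarrow>G i. f h)" for G and "is" :: "nat list"
    by (induction "is") auto
  then show ?thesis
    by (simp add: kernel_steps_def o_def case_prod_unfold sum_set_upt_conv_sum_list_nat[symmetric] atLeast0LessThan)
qed

lemma kernel_steps_value:
  assumes "0 < s"
  shows "simple_jump_value (kernel_steps n As) s u w = (if s \<le> real n then kernel_value As (euler_step n s w) u else 0)"
proof -
  have e: "(\<Sum>(A, c)\<leftarrow>As. (a * indicat_real A u) *\<^sub>R c y) = a *\<^sub>R kernel_value As y u" for a y
    unfolding kernel_value_def by (induction As) (auto simp: scaleR_right_distrib)
  have "simple_jump_value (kernel_steps n As) s u w
     = (\<Sum>i<steps n. indicator {node n i<..node n (Suc i)} s *\<^sub>R kernel_value As (grid n i w) u)"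
    unfolding simple_jump_value_def kernel_steps_sum by (simp add: e)
  then show ?thesis using sum_step[OF assms, of n "\<lambda>i. kernel_value As (grid n i w) u"] by (simp add: euler_step_def)
qed

lemma kernel_steps_value_nonpos:
  assumes "s \<le> 0"
  shows "simple_jump_value (kernel_steps n As) s u w = 0"
proof -
  have "indicat_real {node n i<..node n (Suc i)} s = 0" for i
    using assms node_simps(1)[of n i] by (auto simp: indicator_def simp del: node_simps(1))
  then have "(\<Sum>(A, c)\<leftarrow>As. (indicator {node n i<..node n (Suc i)} s * indicator A u) *\<^sub>R c y) = 0" for i y
    by (induction As) auto
  then show ?thesis unfolding simple_jump_value_def kernel_steps_sum by simp
qed

lemma drift_eq: "0 < s \<Longrightarrow> drift n s w = (if s \<le> real n then b (euler_step n s w) else 0)"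
  unfolding drift_def euler_step_def by (rule sum_step)

lemma drift_norm: "norm (drift n s w) \<le> sqrt L"
proof (cases "0 < s")
  case True then show ?thesis using drift_eq[OF True] b_norm L_pos by simp
next
  case False
  then have "indicat_real {node n i<..node n (Suc i)} s = 0" for i
    using node_simps(1)[of n i] by (auto simp: indicator_def simp del: node_simps(1))
  then show ?thesis using L_pos by (simp add: drift_def)
qed

lemma drift_integral_eq:
  assumes "0 \<le> t"
  shows "drift_integral n t w = (LINT r:{0<..t}|lborel. drift n r w)"
proof -
  have e: "indicat_real {0<..t} r * indicator {node n i<..node n (Suc i)} r = indicator {min (node n i) t<..min (node n (Suc i)) t} r" for i r
    using node_simps(1)[of n i] by (auto simp: indicator_def simp del: node_simps(1))
  have l: "(\<integral>r. indicat_real {min (node n i) t<..min (node n (Suc i)) t} r \<partial>lborel) = min (node n (Suc i)) t - min (node n i) t" for i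
  proof -
    have "min (node n i) t \<le> min (node n (Suc i)) t" by (intro min.mono) simp_all
    then show ?thesis by simp
  qed
  have "(LINT r:{0<..t}|lborel. drift n r w) = (\<integral>r. (\<Sum>i<steps n. indicat_real {min (node n i) t<..min (node n (Suc i)) t} r *\<^sub>R b (grid n i w)) \<partial>lborel)"
    unfolding set_lebesgue_integral_def drift_def scaleR_sum_right scaleR_scaleR e ..
  also have "\<dots> = (\<Sum>i<steps n. \<integral>r. indicat_real {min (node n i) t<..min (node n (Suc i)) t} r *\<^sub>R b (grid n i w) \<partial>lborel)"
    by (intro Bochner_Integration.integral_sum integrable_scaleR_left integrable_indicator_Ioc)
  also have "\<dots> = drift_integral n t w"
    unfolding drift_integral_def by (intro sum.cong refl) (simp only: l integral_scaleR_left integrable_indicator_Ioc)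
  finally show ?thesis ..
qed

lemma grid_measurable: "grid n i \<in> borel_measurable (F (node n i))"
proof (induction i)
  case 0
  have "grid n 0 = (\<lambda>_. x0)" by (simp add: fun_eq_iff)
  then show ?case by simp
next
  case (Suc i)
  have le: "node n i \<le> node n (Suc i)" by simp
  have g: "grid n i \<in> borel_measurable (F (node n (Suc i)))" using N1.measurable_F_mono[OF Suc le] .
  have [measurable]: "b \<in> borel_measurable borel" by (rule b_measurable)
  have s1: "(\<lambda>w. \<Sum>(A, c)\<leftarrow>A1 n. (R1 A (node n (Suc i)) w - R1 A (node n i) w) *\<^sub>R c (grid n i w)) \<in> borel_measurable (F (node n (Suc i)))"
  proof (rule borel_measurable_sum_list)
    fix h assume h: "h \<in> set (A1 n)"
    obtain A c where [simp]: "h = (A, c)" by (cases h)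
    have A: "A \<in> fmeasurable \<nu>1" "c \<in> borel_measurable borel" using A1[of n] h by (auto simp: simple_kernel_def)
    have "R1 A (node n (Suc i)) \<in> borel_measurable (F (node n (Suc i)))" "R1 A (node n i) \<in> borel_measurable (F (node n (Suc i)))"
      using N1.R_adapted[OF A(1)] N1.measurable_F_mono[OF N1.R_adapted[OF A(1)] le] by auto
    moreover have "(\<lambda>w. c (grid n i w)) \<in> borel_measurable (F (node n (Suc i)))" by (rule measurable_compose[OF g A(2)])
    ultimately show "(\<lambda>w. case h of (A, c) \<Rightarrow> (R1 A (node n (Suc i)) w - R1 A (node n i) w) *\<^sub>R c (grid n i w)) \<in> borel_measurable (F (node n (Suc i)))"
      by simp
  qed
  have s2: "(\<lambda>w. \<Sum>(A, c)\<leftarrow>A2 n. (R2 A (node n (Suc i)) w - R2 A (node n i) w) *\<^sub>R c (grid n i w)) \<in> borel_measurable (F (node n (Suc i)))"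
  proof (rule borel_measurable_sum_list)
    fix h assume h: "h \<in> set (A2 n)"
    obtain A c where [simp]: "h = (A, c)" by (cases h)
    have A: "A \<in> fmeasurable \<nu>2" "c \<in> borel_measurable borel" using A2[of n] h by (auto simp: simple_kernel_def)
    have "R2 A (node n (Suc i)) \<in> borel_measurable (F (node n (Suc i)))" "R2 A (node n i) \<in> borel_measurable (F (node n (Suc i)))"
      using N2.R_adapted[OF A(1)] N1.measurable_F_mono[OF N2.R_adapted[OF A(1)] le] by auto
    moreover have "(\<lambda>w. c (grid n i w)) \<in> borel_measurable (F (node n (Suc i)))" by (rule measurable_compose[OF g A(2)])
    ultimately show "(\<lambda>w. case h of (A, c) \<Rightarrow> (R2 A (node n (Suc i)) w - R2 A (node n i) w) *\<^sub>R c (grid n i w)) \<in> borel_measurable (F (node n (Suc i)))"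
      by simp
  qed
  have "(\<lambda>w. grid n i w + (1 / 16 ^ n) *\<^sub>R b (grid n i w)
     + (\<Sum>(A, c)\<leftarrow>A1 n. (R1 A (node n (Suc i)) w - R1 A (node n i) w) *\<^sub>R c (grid n i w))
     + (\<Sum>(A, c)\<leftarrow>A2 n. (R2 A (node n (Suc i)) w - R2 A (node n i) w) *\<^sub>R c (grid n i w))) \<in> borel_measurable (F (node n (Suc i)))"
    using g s1 s2 measurable_compose[OF g b_measurable] by simp
  moreover have "grid n (Suc i) = (\<lambda>w. grid n i w + (1 / 16 ^ n) *\<^sub>R b (grid n i w)
     + (\<Sum>(A, c)\<leftarrow>A1 n. (R1 A (node n (Suc i)) w - R1 A (node n i) w) *\<^sub>R c (grid n i w))
     + (\<Sum>(A, c)\<leftarrow>A2 n. (R2 A (node n (Suc i)) w - R2 A (node n i) w) *\<^sub>R c (grid n i w)))" by (simp add: fun_eq_iff)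
  ultimately show ?case by simp
qed

lemma grid_measurable_M [measurable]: "grid n i \<in> borel_measurable M"
  using N1.measurable_F_M[OF grid_measurable] .

lemma simple_kernel_steps:
  assumes "simple_kernel \<nu> As"
  shows "simple_jump_integrand M F \<nu> (kernel_steps n As)"
  unfolding simple_jump_integrand_def
proof (intro ballI, clarify)
  fix a b' A \<xi> assume "(a, b', A, \<xi>) \<in> set (kernel_steps n As)"
  then obtain i c where h: "(A, c) \<in> set As" "a = node n i" "b' = node n (Suc i)" "\<xi> = (\<lambda>w. c (grid n i w))"
    by (auto simp: kernel_steps_def)
  have A: "A \<in> fmeasurable \<nu>" "c \<in> borel_measurable borel" "bounded (range c)" using assms h by (auto simp: simple_kernel_def)
  have "bounded (\<xi> ` space M)" by (rule bounded_subset[OF A(3)]) (auto simp: h)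
  then show "0 \<le> a \<and> a \<le> b' \<and> A \<in> sets \<nu> \<and> emeasure \<nu> A < \<infinity> \<and> \<xi> \<in> borel_measurable (F a) \<and> bounded (\<xi> ` space M)"
    using A measurable_compose[OF grid_measurable A(2), of n i] h by (auto simp: fmeasurable_def)
qed

lemmas simple1 = simple_kernel_steps[OF A1] and simple2 = simple_kernel_steps[OF A2]

text \<open>Steps from the node \<open>k\<close> on contribute nothing, because both minima equal
  \<open>node n k\<close>; what remains is the unrolled recursion of \<open>grid\<close>.\<close>

lemma euler_node:
  assumes "k \<le> steps n"
  shows "euler n (node n k) w = grid n k w"
proof -
  define f where "f i = (1 / 16 ^ n) *\<^sub>R b (grid n i w)
     + (\<Sum>(A, c)\<leftarrow>A1 n. (R1 A (node n (Suc i)) w - R1 A (node n i) w) *\<^sub>R c (grid n i w))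
     + (\<Sum>(A, c)\<leftarrow>A2 n. (R2 A (node n (Suc i)) w - R2 A (node n i) w) *\<^sub>R c (grid n i w))" for i
  have z1: "(\<Sum>(A, c)\<leftarrow>A1 n. 0 :: real^'d) = 0" by (induction "A1 n") (simp_all add: case_prod_unfold)
  have z2: "(\<Sum>(A, c)\<leftarrow>A2 n. 0 :: real^'d) = 0" by (induction "A2 n") (simp_all add: case_prod_unfold)
  have "euler n (node n k) w = x0 + (\<Sum>i<steps n. if i < k then f i else 0)"
  proof -
    have i: "(if i < k then f i else 0) = (min (node n (Suc i)) (node n k) - min (node n i) (node n k)) *\<^sub>R b (grid n i w)
       + (\<Sum>(A, c)\<leftarrow>A1 n. (R1 A (min (node n (Suc i)) (node n k)) w - R1 A (min (node n i) (node n k)) w) *\<^sub>R c (grid n i w))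
       + (\<Sum>(A, c)\<leftarrow>A2 n. (R2 A (min (node n (Suc i)) (node n k)) w - R2 A (min (node n i) (node n k)) w) *\<^sub>R c (grid n i w))" for i
    proof (cases "i < k")
      case True
      then have "min (node n (Suc i)) (node n k) = node n (Suc i)" "min (node n i) (node n k) = node n i" by (simp_all add: min_absorb1)
      then show ?thesis using True by (simp add: f_def node_Suc)
    next
      case False
      then have "min (node n (Suc i)) (node n k) = node n k" "min (node n i) (node n k) = node n k" by (simp_all add: min_absorb2)
      then show ?thesis using False by (simp add: z1 z2)
    qed
    show ?thesis unfolding euler_def drift_integral_def step_integral_def kernel_steps_sum i
      by (simp add: sum.distrib add.assoc)
  qed
  also have "(\<Sum>i<steps n. if i < k then f i else 0) = (\<Sum>i<k. f i)"
    using assms by (intro sum.mono_neutral_cong_right) auto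
  also have "x0 + (\<Sum>i<k. f i) = grid n k w"
    by (induction k) (auto simp: f_def add_ac)
  finally show ?thesis .
qed

lemma euler_step_eq:
  assumes "0 < s" "s \<le> real n"
  shows "euler_step n s w = euler n (node n (last_node n s)) w"
  using euler_node[of "last_node n s" n w] last_node_less_steps[OF assms(1), of n] assms(2) by (simp add: euler_step_def)

lemma euler_step_measurable [measurable]: "(\<lambda>(s, w). euler_step n s w) \<in> borel_measurable (borel \<Otimes>\<^sub>M M)"
proof -
  have "(\<lambda>p::real \<times> 'w. (\<lambda>i p. grid n (nat (i - 1)) (snd p)) \<lceil>fst p * 16 ^ n\<rceil> p) \<in> borel_measurable (borel \<Otimes>\<^sub>M M)"
    by (rule measurable_compose_countable, rule measurable_compose[OF measurable_snd]) simp_all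
  then show ?thesis by (simp add: euler_step_def last_node_def case_prod_beta)
qed

lemma drift_measurable [measurable]: "(\<lambda>(r, w). drift n r w) \<in> borel_measurable (borel \<Otimes>\<^sub>M M)"
proof -
  have [measurable]: "b \<in> borel_measurable borel" by (rule b_measurable)
  show ?thesis unfolding drift_def by measurable
qed

lemma drift_integral_adapted:
  assumes "0 \<le> t" shows "drift_integral n t \<in> borel_measurable (F t)"
proof -
  have "(\<lambda>w. (min (node n (Suc i)) t - min (node n i) t) *\<^sub>R b (grid n i w)) \<in> borel_measurable (F t)" for i
  proof (cases "node n i \<le> t")
    case True
    show ?thesis using measurable_compose[OF N1.measurable_F_mono[OF grid_measurable True] b_measurable] by simp
  next
    case False
    moreover have "node n i \<le> node n (Suc i)" by simp
    ultimately have "min (node n (Suc i)) t = t" "min (node n i) t = t" by linarith+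
    then show ?thesis by simp
  qed
  then show ?thesis unfolding drift_integral_def[abs_def] by (intro borel_measurable_sum)
qed

lemma euler_adapted:
  assumes "0 \<le> t" shows "euler n t \<in> borel_measurable (F t)"
  unfolding euler_def[abs_def]
  using drift_integral_adapted[OF assms] N1.step_integral_adapted[OF simple1 assms] N2.step_integral_adapted[OF simple2 assms]
  by (intro borel_measurable_add) auto

lemma euler_measurable: "0 \<le> t \<Longrightarrow> euler n t \<in> borel_measurable M"
  using N1.measurable_F_M[OF euler_adapted] .

lemma drift_integral_diff:
  assumes "0 \<le> s" "s \<le> t" "w \<in> space M"
  shows "norm (drift_integral n t w - drift_integral n s w) \<le> sqrt L * (t - s)"
proof -
  have [measurable]: "(\<lambda>r. drift n r w) \<in> borel_measurable borel" using assms(3) by measurable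
  have i: "set_integrable lborel {0<..s} (\<lambda>r. drift n r w)" "set_integrable lborel {s<..t} (\<lambda>r. drift n r w)"
    using drift_norm assms by (auto intro!: set_integrable_bounded_interval[where C="sqrt L"])
  have "{0<..t} = {0<..s} \<union> {s<..t}" using assms by auto
  then have "drift_integral n t w - drift_integral n s w = (LINT r:{s<..t}|lborel. drift n r w)"
    using assms set_integral_Un[OF _ i] by (simp add: drift_integral_eq)
  then show ?thesis using set_integrable_bounded_interval(2)[of "\<lambda>r. drift n r w" s t "sqrt L"] drift_norm assms by simp
qed

lemma drift_integral_continuous:
  assumes "w \<in> space M"
  shows "continuous_on {0..} (\<lambda>t. drift_integral n t w)"
  unfolding drift_integral_def by (intro continuous_intros)

lemma value_bound1: "\<forall>w\<in>space M. sq_norm \<nu>1 (\<lambda>u. simple_jump_value (hs1 n) r u w) \<le> ennreal (4 * L)"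
  using A1_bound by (cases "0 < r"; cases "r \<le> real n") (auto simp: kernel_steps_value kernel_steps_value_nonpos)

lemma value_bound2: "\<forall>w\<in>space M. sq_norm \<nu>2 (\<lambda>u. simple_jump_value (hs2 n) r u w) \<le> ennreal (4 * L)"
  using A2_bound by (cases "0 < r"; cases "r \<le> real n") (auto simp: kernel_steps_value kernel_steps_value_nonpos)

lemma L4: "0 \<le> 4 * L" using L_pos by simp

text \<open>The drift contributes \<open>2 * L * (t - s)^2\<close>; each of the two integrals has
  second moment at most \<open>4 * L * (t - s)\<close> by the kernel bounds and enters with the
  factor 4, which gives \<open>32 * L * (t - s)\<close>.\<close>

lemma euler_increment:
  assumes st: "0 \<le> s" "s \<le> t"
  shows "integrable M (\<lambda>w. (norm (euler n t w - euler n s w))\<^sup>2)"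
    and "N1.expectation (\<lambda>w. (norm (euler n t w - euler n s w))\<^sup>2) \<le> 2 * L * (t - s)\<^sup>2 + 32 * L * (t - s)"
proof -
  have t: "0 \<le> t" using st by simp
  define S1 where "S1 w = step_integral R1 (hs1 n) t w - step_integral R1 (hs1 n) s w" for w
  define S2 where "S2 w = step_integral R2 (hs2 n) t w - step_integral R2 (hs2 n) s w" for w
  note i1 = N1.noise_integral_increment[OF N1.noise_integral_step[OF simple1[of n]] N1.simple_value_measurable[OF simple1[of n]] value_bound1 L4 st, folded S1_def]
  note i2 = N2.noise_integral_increment[OF N2.noise_integral_step[OF simple2[of n]] N2.simple_value_measurable[OF simple2[of n]] value_bound2 L4 st, folded S2_def]
  have d: "(norm (euler n t w - euler n s w))\<^sup>2 \<le> 2 * L * (t - s)\<^sup>2 + 4 * (norm (S1 w))\<^sup>2 + 4 * (norm (S2 w))\<^sup>2" if "w \<in> space M" for w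
  proof -
    have "(norm (drift_integral n t w - drift_integral n s w))\<^sup>2 \<le> (sqrt L * (t - s))\<^sup>2"
      by (intro power_mono drift_integral_diff st that) auto
    also have "\<dots> = L * (t - s)\<^sup>2" using L_pos by (simp add: power_mult_distrib)
    finally show ?thesis
      using norm_add_sq_le2[of "drift_integral n t w - drift_integral n s w" "S1 w + S2 w"] norm_add_sq_le2[of "S1 w" "S2 w"]
      by (simp add: euler_def S1_def S2_def algebra_simps)
  qed
  have [measurable]: "euler n t \<in> borel_measurable M" "euler n s \<in> borel_measurable M" using euler_measurable st t by auto
  have iD: "integrable M (\<lambda>w. 2 * L * (t - s)\<^sup>2 + 4 * (norm (S1 w))\<^sup>2 + 4 * (norm (S2 w))\<^sup>2)" using i1(1) i2(1) by simp
  show i: "integrable M (\<lambda>w. (norm (euler n t w - euler n s w))\<^sup>2)"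
    by (rule Bochner_Integration.integrable_bound[OF iD]) (use d L_pos in \<open>auto intro!: AE_I2 intro: order_trans[OF d]\<close>)
  have "N1.expectation (\<lambda>w. (norm (euler n t w - euler n s w))\<^sup>2) \<le> N1.expectation (\<lambda>w. 2 * L * (t - s)\<^sup>2 + 4 * (norm (S1 w))\<^sup>2 + 4 * (norm (S2 w))\<^sup>2)"
    by (rule integral_mono[OF i iD d])
  also have "\<dots> = 2 * L * (t - s)\<^sup>2 + 4 * N1.expectation (\<lambda>w. (norm (S1 w))\<^sup>2) + 4 * N1.expectation (\<lambda>w. (norm (S2 w))\<^sup>2)"
    using i1(1) i2(1) by (simp add: N1.prob_space)
  also have "\<dots> \<le> 2 * L * (t - s)\<^sup>2 + 32 * L * (t - s)" using i1(3) i2(3) by simp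
  finally show "N1.expectation (\<lambda>w. (norm (euler n t w - euler n s w))\<^sup>2) \<le> 2 * L * (t - s)\<^sup>2 + 32 * L * (t - s)" .
qed

lemma euler_0: "euler n 0 w = x0"
  using euler_node[of 0 n w] by simp

text \<open>Twice the square of the starting point plus twice the bound of
  \<open>euler_increment\<close> from time 0 to \<open>T\<close>.\<close>

definition sq_bound :: "real \<Rightarrow> real" where "sq_bound T = 2 * (norm x0)\<^sup>2 + 4 * L * T\<^sup>2 + 64 * L * T"

lemma euler_sq:
  assumes t: "0 \<le> t" "t \<le> T"
  shows "integrable M (\<lambda>w. (norm (euler n t w))\<^sup>2)" "N1.expectation (\<lambda>w. (norm (euler n t w))\<^sup>2) \<le> sq_bound T"
proof -
  note i = euler_increment[OF order_refl t(1), of n, unfolded euler_0]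
  have [measurable]: "euler n t \<in> borel_measurable M" using euler_measurable t by auto
  have d: "(norm (euler n t w))\<^sup>2 \<le> 2 * (norm x0)\<^sup>2 + 2 * (norm (euler n t w - x0))\<^sup>2" for w
    using norm_add_sq_le2[of x0 "euler n t w - x0"] by simp
  have iD: "integrable M (\<lambda>w. 2 * (norm x0)\<^sup>2 + 2 * (norm (euler n t w - x0))\<^sup>2)" using i(1) by simp
  show j: "integrable M (\<lambda>w. (norm (euler n t w))\<^sup>2)"
    by (rule Bochner_Integration.integrable_bound[OF iD]) (use d in auto)
  have "N1.expectation (\<lambda>w. (norm (euler n t w))\<^sup>2) \<le> N1.expectation (\<lambda>w. 2 * (norm x0)\<^sup>2 + 2 * (norm (euler n t w - x0))\<^sup>2)"
    by (rule integral_mono[OF j iD d])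
  also have "\<dots> = 2 * (norm x0)\<^sup>2 + 2 * N1.expectation (\<lambda>w. (norm (euler n t w - x0))\<^sup>2)" using i(1) by (simp add: N1.prob_space)
  also have "\<dots> \<le> 2 * (norm x0)\<^sup>2 + 2 * (2 * L * t\<^sup>2 + 32 * L * t)" using i(2) by simp
  also have "\<dots> \<le> 2 * (norm x0)\<^sup>2 + 2 * (2 * L * T\<^sup>2 + 32 * L * T)" using t L_pos
    by (intro add_left_mono mult_left_mono add_mono power_mono) auto
  finally show "N1.expectation (\<lambda>w. (norm (euler n t w))\<^sup>2) \<le> sq_bound T" by (simp add: sq_bound_def)
qed

lemma euler_step_sq:
  assumes t: "0 < t" "t \<le> T" "T \<le> real n"
  shows "integrable M (\<lambda>w. (norm (euler_step n t w))\<^sup>2)" "N1.expectation (\<lambda>w. (norm (euler_step n t w))\<^sup>2) \<le> sq_bound T"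
    "integrable M (\<lambda>w. (norm (euler n t w - euler_step n t w))\<^sup>2)"
    "N1.expectation (\<lambda>w. (norm (euler n t w - euler_step n t w))\<^sup>2) \<le> 34 * L * (1 / 16) ^ n"
proof -
  define s where "s = node n (last_node n t)"
  have s: "0 \<le> s" "s \<le> t" "s \<le> T" "t - s \<le> 1 / 16 ^ n" using last_node_bounds[OF t(1), of n] t by (auto simp: s_def)
  have e: "euler_step n t = euler n s" using euler_step_eq[of t n] t by (simp add: s_def fun_eq_iff)
  show "integrable M (\<lambda>w. (norm (euler_step n t w))\<^sup>2)" "N1.expectation (\<lambda>w. (norm (euler_step n t w))\<^sup>2) \<le> sq_bound T"
    unfolding e using euler_sq[OF s(1,3)] by auto
  note i = euler_increment[OF s(1,2), of n]
  show "integrable M (\<lambda>w. (norm (euler n t w - euler_step n t w))\<^sup>2)" unfolding e by (rule i(1))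
  have h: "1 / 16 ^ n \<le> (1::real)" by (simp add: field_simps)
  then have ts: "t - s \<le> 1" using s(4) by linarith
  have "(t - s)\<^sup>2 \<le> (t - s) * 1" unfolding power2_eq_square using s(2) by (intro mult_left_mono ts) auto
  then have "2 * L * (t - s)\<^sup>2 + 32 * L * (t - s) \<le> 2 * L * (t - s) + 32 * L * (t - s)" using L_pos by (intro add_right_mono mult_left_mono) auto
  also have "\<dots> = 34 * L * (t - s)" by simp
  also have "\<dots> \<le> 34 * L * (1 / 16) ^ n" using s L_pos by (intro mult_left_mono) (auto simp: power_one_over)
  finally show "N1.expectation (\<lambda>w. (norm (euler n t w - euler_step n t w))\<^sup>2) \<le> 34 * L * (1 / 16) ^ n"
    unfolding e using i(2) by linarith
qed

end

section \<open>Rate of convergence of the schemes\<close>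

lemma kernel_difference:
  fixes X Y gX gY :: "'u \<Rightarrow> 'b::euclidean_space"
  assumes m: "X \<in> borel_measurable \<nu>" "Y \<in> borel_measurable \<nu>" "gX \<in> borel_measurable \<nu>" "gY \<in> borel_measurable \<nu>"
    and eX: "sq_norm \<nu> (\<lambda>u. X u - gX u) \<le> ennreal e" and eY: "sq_norm \<nu> (\<lambda>u. Y u - gY u) \<le> ennreal e'"
    and q: "sq_norm \<nu> (\<lambda>u. gX u - gY u) \<le> ennreal c" and nn: "0 \<le> e" "0 \<le> e'" "0 \<le> c" and \<delta>: "0 < \<delta>"
  shows "(\<integral>u. (norm (X u - Y u))\<^sup>2 \<partial>\<nu>) \<le> (\<integral>u. (norm (gX u - gY u))\<^sup>2 \<partial>\<nu>) + \<delta> * c + (1 + 1 / \<delta>) * (2 * e + 2 * e')"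
proof -
  define Q where "Q = (\<integral>u. (norm (gX u - gY u))\<^sup>2 \<partial>\<nu>)"
  have md: "(\<lambda>u. gX u - gY u) \<in> borel_measurable \<nu>" "(\<lambda>u. X u - Y u) \<in> borel_measurable \<nu>" using m by auto
  have Q: "sq_norm \<nu> (\<lambda>u. gX u - gY u) = ennreal Q" "Q \<le> c" "0 \<le> Q"
    using nn_of_sq_integrable[OF sq_integrable_of_nn(1)[OF md(1) q]] sq_integrable_of_nn(2)[OF md(1) q nn(3)] by (auto simp: Q_def)
  \<comment> \<open>The weighted split keeps the coefficient of \<open>Q\<close> at 1 up to
    \<open>\<delta>\<close>, as the monotonicity condition demands, and the excess
    \<open>\<delta> * Q\<close> is bounded by \<open>\<delta> * c\<close>.\<close>
  have "sq_norm \<nu> (\<lambda>u. X u - Y u) =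
      sq_norm \<nu> (\<lambda>u. (gX u - gY u) + ((X u - gX u) - (Y u - gY u)))" by (simp add: algebra_simps)
  also have "\<dots> \<le> ennreal (1 + \<delta>) * sq_norm \<nu> (\<lambda>u. gX u - gY u)
      + ennreal (1 + 1 / \<delta>) * sq_norm \<nu> (\<lambda>u. (X u - gX u) - (Y u - gY u))"
    by (rule nn_norm_add_sq_le) (use m \<delta> in auto)
  also have "\<dots> \<le> ennreal (1 + \<delta>) * ennreal Q + ennreal (1 + 1 / \<delta>) * ennreal (2 * e + 2 * e')"
    using nn_diff_sq_le[of "\<lambda>u. X u - gX u" \<nu> "\<lambda>u. Y u - gY u" e e'] m eX eY nn unfolding Q(1)
    by (intro add_mono mult_left_mono) auto
  also have "\<dots> = ennreal ((1 + \<delta>) * Q + (1 + 1 / \<delta>) * (2 * e + 2 * e'))"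
    using \<delta> nn Q by (subst ennreal_plus) (auto simp: ennreal_mult' intro!: mult_nonneg_nonneg)
  finally have "(\<integral>u. (norm (X u - Y u))\<^sup>2 \<partial>\<nu>) \<le> (1 + \<delta>) * Q + (1 + 1 / \<delta>) * (2 * e + 2 * e')"
    using \<delta> nn Q by (intro sq_integrable_of_nn(2)[OF md(2)]) (auto intro!: mult_nonneg_nonneg add_nonneg_nonneg)
  also have "\<dots> \<le> Q + \<delta> * c + (1 + 1 / \<delta>) * (2 * e + 2 * e')"
    using mult_left_mono[OF Q(2), of \<delta>] \<delta> by (simp add: algebra_simps)
  finally show ?thesis by (simp add: Q_def)
qed

context euler_scheme
begin

text \<open>Arises from \<open>kernel_difference\<close> with \<open>\<delta> = (1/4) ^ n\<close>
  and \<open>c = 4 * L\<close>: since \<open>(1 + 4 ^ n) * (1/16) ^ n <= 2 * (1/4) ^ n\<close>, the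
  two kernel errors contribute \<open>4 * (2 + 10 * L * (|y|^2 + |z|^2))\<close>. This
  \<open>\<delta>\<close> balances the excess against the errors, both of order
  \<open>(1/4) ^ n\<close>.\<close>

definition err_const :: "real^'d \<Rightarrow> real^'d \<Rightarrow> real" where
  "err_const y z = 4 * L + 8 + 40 * L * ((norm y)\<^sup>2 + (norm z)\<^sup>2)"

lemma err_const_bound:
  assumes "n \<le> m"
  shows "(1 / 4) ^ n * (4 * L) + (1 + 1 / (1 / 4) ^ n) * (2 * ((1 + 10 * L * (norm y)\<^sup>2) * (1 / 16) ^ n) + 2 * ((1 + 10 * L * (norm z)\<^sup>2) * (1 / 16) ^ m))
     \<le> (1 / 4) ^ n * err_const y z"
proof -
  define a c where "a = 1 + 10 * L * (norm y)\<^sup>2" and "c = 1 + 10 * L * (norm z)\<^sup>2"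
  have ac: "0 \<le> a" "0 \<le> c" using L_pos by (auto simp: a_def c_def)
  have m: "(1 / 16 :: real) ^ m \<le> (1 / 16) ^ n" by (rule power_decreasing) (use assms in auto)
  have k: "(1 + 1 / (1 / 4) ^ n) * (1 / 16 :: real) ^ n \<le> 2 * (1 / 4) ^ n"
  proof -
    have "(1 / 16 :: real) ^ n = (1 / 4) ^ n * (1 / 4) ^ n" by (simp flip: power_mult_distrib)
    moreover have "(1 / 4 :: real) ^ n \<le> 1" by (simp add: power_le_one)
    ultimately show ?thesis by (simp add: algebra_simps mult_left_le)
  qed
  have "(1 + 1 / (1 / 4) ^ n) * (2 * (a * (1 / 16) ^ n) + 2 * (c * (1 / 16) ^ m)) \<le> (1 + 1 / (1 / 4) ^ n) * (2 * (a * (1 / 16) ^ n) + 2 * (c * (1 / 16) ^ n))"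
    using ac m by (intro mult_left_mono add_left_mono) auto
  also have "\<dots> = (2 * a + 2 * c) * ((1 + 1 / (1 / 4) ^ n) * (1 / 16) ^ n)"
  proof -
    have "\<theta> * (2 * (a * h) + 2 * (c * h)) = (2 * a + 2 * c) * (\<theta> * h)" for \<theta> h by (simp add: algebra_simps)
    then show ?thesis .
  qed
  also have "\<dots> \<le> (2 * a + 2 * c) * (2 * (1 / 4) ^ n)" using ac k by (intro mult_left_mono) auto
  finally show ?thesis by (simp add: err_const_def a_def c_def algebra_simps)
qed

lemma kernel_diff:
  assumes "n \<le> m"
  shows "(\<integral>u. (norm (kernel_value (A1 n) y u - kernel_value (A1 m) z u))\<^sup>2 \<partial>\<nu>1) \<le> (\<integral>u. (norm (g1 y u - g1 z u))\<^sup>2 \<partial>\<nu>1) + (1 / 4) ^ n * err_const y z"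
    "(\<integral>u. (norm (kernel_value (A2 n) y u - kernel_value (A2 m) z u))\<^sup>2 \<partial>\<nu>2) \<le> (\<integral>u. (norm (g2 y u - g2 z u))\<^sup>2 \<partial>\<nu>2) + (1 / 4) ^ n * err_const y z"
proof -
  have nn: "0 \<le> (1 + 10 * L * (norm y)\<^sup>2) * (1 / 16) ^ n" "0 \<le> (1 + 10 * L * (norm z)\<^sup>2) * (1 / 16) ^ m" "0 < (1 / 4 :: real) ^ n"
    using L_pos by auto
  note km1 = kernel_value_measurable[OF A1] and km2 = kernel_value_measurable[OF A2]
  show "(\<integral>u. (norm (kernel_value (A1 n) y u - kernel_value (A1 m) z u))\<^sup>2 \<partial>\<nu>1) \<le> (\<integral>u. (norm (g1 y u - g1 z u))\<^sup>2 \<partial>\<nu>1) + (1 / 4) ^ n * err_const y z"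
    using kernel_difference[OF km1[of n y] km1[of m z] g_section(1,1) A1_error A1_error g_diff_bound(1) nn(1,2) L4 nn(3)]
      err_const_bound[OF assms, of y z] by linarith
  show "(\<integral>u. (norm (kernel_value (A2 n) y u - kernel_value (A2 m) z u))\<^sup>2 \<partial>\<nu>2) \<le> (\<integral>u. (norm (g2 y u - g2 z u))\<^sup>2 \<partial>\<nu>2) + (1 / 4) ^ n * err_const y z"
    using kernel_difference[OF km2[of n y] km2[of m z] g_section(2,2) A2_error A2_error g_diff_bound(2) nn(1,2) L4 nn(3)]
      err_const_bound[OF assms, of y z] by linarith
qed

definition rate_const :: "real \<Rightarrow> real" where
  "rate_const T = 544 * K * L + 4 * sqrt L * (1 + 34 * L) + 16 * L + 32 + 320 * L * sq_bound T"

lemma sq_bound_nonneg: "0 \<le> T \<Longrightarrow> 0 \<le> sq_bound T"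
  using L_pos by (simp add: sq_bound_def)

lemma rate_const_nonneg: "0 \<le> T \<Longrightarrow> 0 \<le> rate_const T"
  using L_pos K_pos sq_bound_nonneg by (simp add: rate_const_def)

text \<open>\<open>p\<close> and \<open>q\<close> are the gaps between running and frozen states of
  the two schemes; the finer scheme is estimated by the rate of the coarser one. In mean square the
  gaps are of order \<open>(1/16) ^ n\<close>, relaxed to \<open>(1/4) ^ n\<close>, the order of
  their first moments, so that all error terms share one scale.\<close>

lemma step_facts:
  assumes nm: "n \<le> m" and T: "T \<le> real n" and r: "0 < r" "r \<le> T"
  defines "y \<equiv> euler_step n r" and "z \<equiv> euler_step m r"
  defines "p \<equiv> \<lambda>w. euler n r w - y w" and "q \<equiv> \<lambda>w. euler m r w - z w"
  shows "y \<in> borel_measurable M" "z \<in> borel_measurable M" "p \<in> borel_measurable M" "q \<in> borel_measurable M"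
    "integrable M (\<lambda>w. (norm (y w))\<^sup>2)" "integrable M (\<lambda>w. (norm (z w))\<^sup>2)"
    "integrable M (\<lambda>w. (norm (p w))\<^sup>2)" "integrable M (\<lambda>w. (norm (q w))\<^sup>2)"
    "integrable M (\<lambda>w. norm (p w))" "integrable M (\<lambda>w. norm (q w))"
    "N1.expectation (\<lambda>w. (norm (y w))\<^sup>2) \<le> sq_bound T" "N1.expectation (\<lambda>w. (norm (z w))\<^sup>2) \<le> sq_bound T"
    "N1.expectation (\<lambda>w. (norm (p w))\<^sup>2) \<le> 34 * L * (1 / 4) ^ n" "N1.expectation (\<lambda>w. (norm (q w))\<^sup>2) \<le> 34 * L * (1 / 4) ^ n"
    "N1.expectation (\<lambda>w. norm (p w)) \<le> (1 + 34 * L) * (1 / 4) ^ n / 2" "N1.expectation (\<lambda>w. norm (q w)) \<le> (1 + 34 * L) * (1 / 4) ^ n / 2"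
proof -
  have Tm: "T \<le> real m" using T nm by simp
  have ys[measurable]: "euler_step k r \<in> borel_measurable M" for k by measurable
  have em[measurable]: "euler k r \<in> borel_measurable M" for k using euler_measurable r by simp
  show m: "y \<in> borel_measurable M" "z \<in> borel_measurable M" "p \<in> borel_measurable M" "q \<in> borel_measurable M"
    unfolding y_def z_def p_def q_def by measurable
  note fn = euler_step_sq[OF r T, folded y_def p_def] and fm = euler_step_sq[OF r Tm, folded z_def q_def]
  show i: "integrable M (\<lambda>w. (norm (y w))\<^sup>2)" "integrable M (\<lambda>w. (norm (z w))\<^sup>2)"
    "integrable M (\<lambda>w. (norm (p w))\<^sup>2)" "integrable M (\<lambda>w. (norm (q w))\<^sup>2)"
    "N1.expectation (\<lambda>w. (norm (y w))\<^sup>2) \<le> sq_bound T" "N1.expectation (\<lambda>w. (norm (z w))\<^sup>2) \<le> sq_bound T"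
    using fn fm by (auto simp: p_def q_def)
  show "integrable M (\<lambda>w. norm (p w))" "integrable M (\<lambda>w. norm (q w))"
    using m i by (auto intro!: N1.sq_integrable_norm)
  have c: "34 * L * (1 / 16) ^ n = 34 * L * ((1 / 4) ^ n)\<^sup>2" by (simp add: power2_eq_square flip: power_mult_distrib)
  have le: "34 * L * (1 / 16) ^ m \<le> 34 * L * (1 / 16) ^ n" using L_pos nm by (intro mult_left_mono power_decreasing) auto
  have le2: "34 * L * (1 / 16) ^ n \<le> 34 * L * (1 / 4) ^ n" using L_pos by (intro mult_left_mono power_mono) auto
  have pq: "N1.expectation (\<lambda>w. (norm (p w))\<^sup>2) \<le> 34 * L * (1 / 16) ^ n" "N1.expectation (\<lambda>w. (norm (q w))\<^sup>2) \<le> 34 * L * (1 / 16) ^ n"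
    using fn(4) fm(4) le by (auto simp: p_def q_def)
  then show "N1.expectation (\<lambda>w. (norm (p w))\<^sup>2) \<le> 34 * L * (1 / 4) ^ n" "N1.expectation (\<lambda>w. (norm (q w))\<^sup>2) \<le> 34 * L * (1 / 4) ^ n"
    using le2 by auto
  show "N1.expectation (\<lambda>w. norm (p w)) \<le> (1 + 34 * L) * (1 / 4) ^ n / 2" "N1.expectation (\<lambda>w. norm (q w)) \<le> (1 + 34 * L) * (1 / 4) ^ n / 2"
    using N1.expectation_norm_le[OF m(3) i(3) pq(1)[unfolded c]] N1.expectation_norm_le[OF m(4) i(4) pq(2)[unfolded c]] by simp_all
qed

lemma coefficient_difference:
  assumes nm: "n \<le> m" and r: "0 < r" "r \<le> real n"
  shows "(\<integral>u. (norm (simple_jump_value (hs1 n) r u w - simple_jump_value (hs1 m) r u w))\<^sup>2 \<partial>\<nu>1)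
      \<le> (\<integral>u. (norm (g1 (euler_step n r w) u - g1 (euler_step m r w) u))\<^sup>2 \<partial>\<nu>1) + (1 / 4) ^ n * err_const (euler_step n r w) (euler_step m r w)"
    "(\<integral>u. (norm (simple_jump_value (hs2 n) r u w - simple_jump_value (hs2 m) r u w))\<^sup>2 \<partial>\<nu>2)
      \<le> (\<integral>u. (norm (g2 (euler_step n r w) u - g2 (euler_step m r w) u))\<^sup>2 \<partial>\<nu>2) + (1 / 4) ^ n * err_const (euler_step n r w) (euler_step m r w)"
  using kernel_diff[OF nm, of "euler_step n r w" "euler_step m r w"] r nm by (simp_all add: kernel_steps_value)

lemma value_diff_measurable:
  "(\<lambda>(r, u, w). simple_jump_value (hs1 n) r u w - simple_jump_value (hs1 m) r u w) \<in> borel_measurable (borel \<Otimes>\<^sub>M \<nu>1 \<Otimes>\<^sub>M M)"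
  "(\<lambda>(r, u, w). simple_jump_value (hs2 n) r u w - simple_jump_value (hs2 m) r u w) \<in> borel_measurable (borel \<Otimes>\<^sub>M \<nu>2 \<Otimes>\<^sub>M M)"
  using borel_measurable_diff[OF N1.simple_value_measurable[OF simple1[of n]] N1.simple_value_measurable[OF simple1[of m]]]
    borel_measurable_diff[OF N2.simple_value_measurable[OF simple2[of n]] N2.simple_value_measurable[OF simple2[of m]]]
  by (simp_all add: case_prod_unfold)

lemma value_diff_bound:
  "\<forall>w\<in>space M. sq_norm \<nu>1 (\<lambda>u. simple_jump_value (hs1 n) r u w - simple_jump_value (hs1 m) r u w) \<le> ennreal (16 * L)"
  "\<forall>w\<in>space M. sq_norm \<nu>2 (\<lambda>u. simple_jump_value (hs2 n) r u w - simple_jump_value (hs2 m) r u w) \<le> ennreal (16 * L)"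
proof -
  have e: "2 * (4 * L) + 2 * (4 * L) = 16 * L" by simp
  show "\<forall>w\<in>space M. sq_norm \<nu>1 (\<lambda>u. simple_jump_value (hs1 n) r u w - simple_jump_value (hs1 m) r u w) \<le> ennreal (16 * L)"
    unfolding e[symmetric]
  proof
    fix w assume o: "w \<in> space M"
    show "sq_norm \<nu>1 (\<lambda>u. simple_jump_value (hs1 n) r u w - simple_jump_value (hs1 m) r u w) \<le> ennreal (2 * (4 * L) + 2 * (4 * L))"
      by (rule nn_diff_sq_le[OF N1.energy_measurable(4)[OF N1.simple_value_measurable[OF simple1] o] N1.energy_measurable(4)[OF N1.simple_value_measurable[OF simple1] o]
        value_bound1[rule_format, OF o] value_bound1[rule_format, OF o] L4 L4])
  qed
  show "\<forall>w\<in>space M. sq_norm \<nu>2 (\<lambda>u. simple_jump_value (hs2 n) r u w - simple_jump_value (hs2 m) r u w) \<le> ennreal (16 * L)"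
    unfolding e[symmetric]
  proof
    fix w assume o: "w \<in> space M"
    show "sq_norm \<nu>2 (\<lambda>u. simple_jump_value (hs2 n) r u w - simple_jump_value (hs2 m) r u w) \<le> ennreal (2 * (4 * L) + 2 * (4 * L))"
      by (rule nn_diff_sq_le[OF N2.energy_measurable(4)[OF N2.simple_value_measurable[OF simple2] o] N2.energy_measurable(4)[OF N2.simple_value_measurable[OF simple2] o]
        value_bound2[rule_format, OF o] value_bound2[rule_format, OF o] L4 L4])
  qed
qed

lemma euler_diff_sq:
  assumes nm: "n \<le> m" and T: "T \<le> real n" and t: "0 \<le> t" "t \<le> T"
  shows "N1.expectation (\<lambda>w. (norm (euler n t w - euler m t w))\<^sup>2) \<le> rate_const T * T * exp (4 * K * T) * (1 / 4) ^ n"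
proof -
  have T0: "0 \<le> T" using t by simp
  define Z where "Z t w = euler n t w - euler m t w" for t w
  define \<epsilon> where "\<epsilon> = rate_const T * (1 / 4) ^ n"
  have \<epsilon>: "0 \<le> \<epsilon>" using rate_const_nonneg[OF T0] by (simp add: \<epsilon>_def)
  have "N1.expectation (\<lambda>w. (norm (Z t w))\<^sup>2) \<le> \<epsilon> * t * exp (4 * K * t)"
  proof (rule ito_process_energy[where Z=Z and \<beta>="\<lambda>r w. drift n r w - drift m r w" and C="2 * sqrt L" and c="16 * L"
      and I="\<lambda>t w. step_integral R1 (hs1 n) t w - step_integral R1 (hs1 m) t w"
      and J="\<lambda>t w. step_integral R2 (hs2 n) t w - step_integral R2 (hs2 m) t w"
      and ?G1.0="\<lambda>r u w. simple_jump_value (hs1 n) r u w - simple_jump_value (hs1 m) r u w"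
      and ?G2.0="\<lambda>r u w. simple_jump_value (hs2 n) r u w - simple_jump_value (hs2 m) r u w"])
    show "0 \<le> t" "0 \<le> 4 * K" "0 \<le> \<epsilon>" "0 \<le> 2 * sqrt L" "0 \<le> 16 * L" using t K_pos L_pos \<epsilon> by auto
    show "Z t \<in> borel_measurable (F t)" if "0 \<le> t" for t
      unfolding Z_def[abs_def] by (intro borel_measurable_diff euler_adapted that)
    show "AE w in M. Z t' w = (LINT r:{0<..t'}|lborel. drift n r w - drift m r w)
      + (step_integral R1 (hs1 n) t' w - step_integral R1 (hs1 m) t' w) + (step_integral R2 (hs2 n) t' w - step_integral R2 (hs2 m) t' w)"
      if t': "0 \<le> t'" for t'
    proof (rule AE_I2)
      fix w assume o: "w \<in> space M"
      have i: "set_integrable lborel {0<..t'} (\<lambda>r. drift k r w)" for k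
        by (rule set_integrable_bounded_interval[where C="sqrt L"]) (use o t' drift_norm in measurable)
      show "Z t' w = (LINT r:{0<..t'}|lborel. drift n r w - drift m r w)
      + (step_integral R1 (hs1 n) t' w - step_integral R1 (hs1 m) t' w) + (step_integral R2 (hs2 n) t' w - step_integral R2 (hs2 m) t' w)"
        unfolding set_integral_diff(2)[OF i i] Z_def euler_def drift_integral_eq[OF t'] by (simp add: algebra_simps)
    qed
    show "(\<lambda>(r, w). drift n r w - drift m r w) \<in> borel_measurable (borel \<Otimes>\<^sub>M M)" by measurable
    show "\<forall>w\<in>space M. norm (drift n r w - drift m r w) \<le> 2 * sqrt L" for r
      using norm_triangle_ineq4[of "drift n r _" "drift m r _"] drift_norm[of n r] drift_norm[of m r] by (smt (verit))
    show "noise_integral M F \<nu>1 R1 (\<lambda>r u w. simple_jump_value (hs1 n) r u w - simple_jump_value (hs1 m) r u w) (\<lambda>t w. step_integral R1 (hs1 n) t w - step_integral R1 (hs1 m) t w)"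
      by (intro N1.noise_integral_diff N1.noise_integral_step N1.simple_value_measurable simple1)
    show "noise_integral M F \<nu>2 R2 (\<lambda>r u w. simple_jump_value (hs2 n) r u w - simple_jump_value (hs2 m) r u w) (\<lambda>t w. step_integral R2 (hs2 n) t w - step_integral R2 (hs2 m) t w)"
      by (intro N2.noise_integral_diff N2.noise_integral_step N2.simple_value_measurable simple2)
    fix r assume r: "0 < r" "r \<le> t"
    have rT: "r \<le> T" using r t by simp
    define y z where "y = euler_step n r" and "z = euler_step m r"
    define p q where "p w = euler n r w - y w" and "q w = euler m r w - z w" for w
    note S = step_facts[OF nm T r(1) rT, folded y_def z_def, folded p_def q_def]
    have pq: "(\<lambda>w. euler n r w - y w) = p" "(\<lambda>w. euler m r w - z w) = q" by (simp_all add: p_def q_def fun_eq_iff)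
    note S = S[unfolded pq]
    \<comment> \<open>The majorant of the energy density: the first two terms bound
      \<open>2 * K * |y - z|^2\<close>, the third the pairing of the gaps with the drift, and the
      last is four times the kernel error, one for each of the two kernels and doubled like the
      square norms.\<close>
    define H where "H w = 4 * K * (norm (Z r w))\<^sup>2 + 8 * K * ((norm (p w))\<^sup>2 + (norm (q w))\<^sup>2) + 4 * sqrt L * (norm (p w) + norm (q w))
       + (1 / 4) ^ n * (16 * L + 32 + 160 * L * ((norm (y w))\<^sup>2 + (norm (z w))\<^sup>2))" for w
    have iZ: "integrable M (\<lambda>w. (norm (Z r w))\<^sup>2)"
      unfolding Z_def using euler_sq(1)[of r T n] euler_sq(1)[of r T m] euler_measurable r rT by (intro sq_integrable_diff) auto
    have iH: "integrable M H" unfolding H_def using iZ S by simp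
    have pw: "2 * (Z r w \<bullet> (drift n r w - drift m r w)) +
        (2 * (\<integral>u. (norm (simple_jump_value (hs1 n) r u w - simple_jump_value (hs1 m) r u w))\<^sup>2 \<partial>\<nu>1) +
         2 * (\<integral>u. (norm (simple_jump_value (hs2 n) r u w - simple_jump_value (hs2 m) r u w))\<^sup>2 \<partial>\<nu>2)) \<le> H w" for w
    proof -
      have rn: "r \<le> real n" "r \<le> real m" using rT T nm by auto
      have d: "drift n r w - drift m r w = b (y w) - b (z w)" using r rn by (simp add: drift_eq y_def z_def)
      have Zd: "Z r w = (y w - z w) + (p w - q w)" by (simp add: Z_def p_def q_def)
      have "(p w - q w) \<bullet> (b (y w) - b (z w)) \<le> norm (p w - q w) * norm (b (y w) - b (z w))" by (rule norm_cauchy_schwarz)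
      also have "\<dots> \<le> (norm (p w) + norm (q w)) * (2 * sqrt L)"
        by (intro mult_mono norm_triangle_ineq4 b_diff_norm) auto
      finally have 1: "(p w - q w) \<bullet> (b (y w) - b (z w)) \<le> 2 * sqrt L * (norm (p w) + norm (q w))" by (simp add: mult.commute)
      have "(norm (y w - z w))\<^sup>2 \<le> 2 * (norm (Z r w))\<^sup>2 + 2 * (norm (p w - q w))\<^sup>2"
        using norm_diff_sq_le2[of "Z r w" "p w - q w"] by (simp add: Zd)
      also have "\<dots> \<le> 2 * (norm (Z r w))\<^sup>2 + 4 * ((norm (p w))\<^sup>2 + (norm (q w))\<^sup>2)"
        using norm_diff_sq_le2[of "p w" "q w"] by simp
      finally have "2 * K * (norm (y w - z w))\<^sup>2 \<le> 2 * K * (2 * (norm (Z r w))\<^sup>2 + 4 * ((norm (p w))\<^sup>2 + (norm (q w))\<^sup>2))"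
        using K_pos by (intro mult_left_mono) auto
      then have 2: "2 * K * (norm (y w - z w))\<^sup>2 \<le> 4 * K * (norm (Z r w))\<^sup>2 + 8 * K * ((norm (p w))\<^sup>2 + (norm (q w))\<^sup>2)"
        by (simp add: algebra_simps)
      have 3: "(y w - z w) \<bullet> (b (y w) - b (z w)) + (\<integral>u. (norm (g1 (y w) u - g1 (z w) u))\<^sup>2 \<partial>\<nu>1)
       + (\<integral>u. (norm (g2 (y w) u - g2 (z w) u))\<^sup>2 \<partial>\<nu>2) \<le> K * (norm (y w - z w))\<^sup>2"
        using monotone[of "y w" "z w"] by (simp add: inner_commute)
      have 4: "4 * ((1 / 4) ^ n * err_const (y w) (z w)) = (1 / 4) ^ n * (16 * L + 32 + 160 * L * ((norm (y w))\<^sup>2 + (norm (z w))\<^sup>2))"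
        by (simp add: err_const_def algebra_simps)
      have 5: "Z r w \<bullet> (b (y w) - b (z w)) = (y w - z w) \<bullet> (b (y w) - b (z w)) + (p w - q w) \<bullet> (b (y w) - b (z w))"
        unfolding Zd by (simp add: inner_add_left)
      define sp kz where "sp = sqrt L * (norm (p w) + norm (q w))" and "kz = K * (norm (y w - z w))\<^sup>2"
      define e X where "e = (1 / 4) ^ n * err_const (y w) (z w)"
        and "X = 4 * K * (norm (Z r w))\<^sup>2 + 8 * K * ((norm (p w))\<^sup>2 + (norm (q w))\<^sup>2)"
      have H: "H w = X + 4 * sp + 4 * e" unfolding H_def e_def 4 by (simp add: X_def sp_def mult.assoc)
      have 1: "(p w - q w) \<bullet> (b (y w) - b (z w)) \<le> 2 * sp" using 1 by (simp add: sp_def mult.assoc)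
      have 2: "2 * kz \<le> X" using 2 by (simp add: X_def kz_def mult.assoc)
      show ?thesis
        using coefficient_difference[OF nm r(1) rn(1), of w, folded y_def z_def, folded e_def] 1 2 3[folded kz_def]
        unfolding d 5 H by (simp only: distrib_left)
    qed
    have "N1.expectation (\<lambda>w. 2 * (Z r w \<bullet> (drift n r w - drift m r w)) +
        (2 * (\<integral>u. (norm (simple_jump_value (hs1 n) r u w - simple_jump_value (hs1 m) r u w))\<^sup>2 \<partial>\<nu>1) +
         2 * (\<integral>u. (norm (simple_jump_value (hs2 n) r u w - simple_jump_value (hs2 m) r u w))\<^sup>2 \<partial>\<nu>2))) \<le> N1.expectation H"
    proof (rule integral_mono_AE'[OF iH])
      show "AE w in M. 0 \<le> H w" using K_pos L_pos by (simp add: H_def)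
    qed (use pw in simp)
    also have "N1.expectation H = 4 * K * N1.expectation (\<lambda>w. (norm (Z r w))\<^sup>2)
       + 8 * K * (N1.expectation (\<lambda>w. (norm (p w))\<^sup>2) + N1.expectation (\<lambda>w. (norm (q w))\<^sup>2))
       + 4 * sqrt L * (N1.expectation (\<lambda>w. norm (p w)) + N1.expectation (\<lambda>w. norm (q w)))
       + (1 / 4) ^ n * (16 * L + 32 + 160 * L * (N1.expectation (\<lambda>w. (norm (y w))\<^sup>2) + N1.expectation (\<lambda>w. (norm (z w))\<^sup>2)))"
      unfolding H_def using iZ S by (simp add: N1.prob_space)
    also have "\<dots> \<le> 4 * K * N1.expectation (\<lambda>w. (norm (Z r w))\<^sup>2)
       + 8 * K * (34 * L * (1 / 4) ^ n + 34 * L * (1 / 4) ^ n)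
       + 4 * sqrt L * ((1 + 34 * L) * (1 / 4) ^ n / 2 + (1 + 34 * L) * (1 / 4) ^ n / 2)
       + (1 / 4) ^ n * (16 * L + 32 + 160 * L * (sq_bound T + sq_bound T))"
      using S K_pos L_pos by (intro add_mono mult_left_mono order_refl) auto
    also have "\<dots> = 4 * K * N1.expectation (\<lambda>w. (norm (Z r w))\<^sup>2) + \<epsilon>"
      by (simp add: \<epsilon>_def rate_const_def algebra_simps)
    finally show "N1.expectation (\<lambda>w. 2 * (Z r w \<bullet> (drift n r w - drift m r w)) +
        (2 * (\<integral>u. (norm (simple_jump_value (hs1 n) r u w - simple_jump_value (hs1 m) r u w))\<^sup>2 \<partial>\<nu>1) +
         2 * (\<integral>u. (norm (simple_jump_value (hs2 n) r u w - simple_jump_value (hs2 m) r u w))\<^sup>2 \<partial>\<nu>2)))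
       \<le> 4 * K * N1.expectation (\<lambda>w. (norm (Z r w))\<^sup>2) + \<epsilon>" .
  qed (use value_diff_measurable value_diff_bound in auto)
  also have "\<dots> \<le> \<epsilon> * T * exp (4 * K * T)"
    using t \<epsilon> K_pos by (intro mult_mono mult_left_mono) auto
  finally show ?thesis by (simp add: Z_def \<epsilon>_def mult_ac)
qed

text \<open>Factor of \<open>(1/4) ^ n\<close> in the mean-square distance of two frozen states:
  twice the estimate of \<open>euler_diff_sq\<close>, plus \<open>4 * 34 * L\<close> for each of the
  two gaps.\<close>

definition diff_const :: "real \<Rightarrow> real" where
  "diff_const T = 2 * (rate_const T * T * exp (4 * K * T)) + 272 * L"

definition coef_const :: "real \<Rightarrow> real" where
  "coef_const T = K * diff_const T + sqrt L * (1 + diff_const T) + 8 * L + 16 + 160 * L * sq_bound T"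

lemma diff_const_nonneg: "0 \<le> T \<Longrightarrow> 0 \<le> diff_const T"
  using rate_const_nonneg L_pos by (simp add: diff_const_def)

lemma coef_const_nonneg: "0 \<le> T \<Longrightarrow> 0 \<le> coef_const T"
  using diff_const_nonneg[of T] sq_bound_nonneg[of T] L_pos K_pos by (simp add: coef_const_def)

lemma coefficient_expectation:
  assumes nm: "n \<le> m" and T: "T \<le> real n" and r: "0 < r" "r \<le> T"
  shows "N1.expectation (\<lambda>w. \<integral>u. (norm (simple_jump_value (hs1 n) r u w - simple_jump_value (hs1 m) r u w))\<^sup>2 \<partial>\<nu>1) \<le> coef_const T * (1 / 2) ^ n"
    "N1.expectation (\<lambda>w. \<integral>u. (norm (simple_jump_value (hs2 n) r u w - simple_jump_value (hs2 m) r u w))\<^sup>2 \<partial>\<nu>2) \<le> coef_const T * (1 / 2) ^ n"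
proof -
  define y z where "y = euler_step n r" and "z = euler_step m r"
  define p q where "p w = euler n r w - y w" and "q w = euler m r w - z w" for w
  have pq: "(\<lambda>w. euler n r w - y w) = p" "(\<lambda>w. euler m r w - z w) = q" by (simp_all add: p_def q_def fun_eq_iff)
  note S = step_facts[OF nm T r, folded y_def z_def, folded p_def q_def, unfolded pq]
  have T0: "0 \<le> T" using r by simp
  define Z where "Z w = euler n r w - euler m r w" for w
  have iZ: "integrable M (\<lambda>w. (norm (Z w))\<^sup>2)"
    unfolding Z_def using euler_sq(1)[of r T n] euler_sq(1)[of r T m] euler_measurable r by (intro sq_integrable_diff) auto
  have r0: "0 \<le> r" using r by simp
  have EZ: "N1.expectation (\<lambda>w. (norm (Z w))\<^sup>2) \<le> rate_const T * T * exp (4 * K * T) * (1 / 4) ^ n"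
    unfolding Z_def by (rule euler_diff_sq[OF nm T r0 r(2)])
  have d: "(norm (y w - z w))\<^sup>2 \<le> 2 * (norm (Z w))\<^sup>2 + 4 * (norm (p w))\<^sup>2 + 4 * (norm (q w))\<^sup>2" for w
    using norm_diff_sq_le2[of "Z w" "p w - q w"] norm_diff_sq_le2[of "p w" "q w"] by (simp add: Z_def p_def q_def)
  have iyz: "integrable M (\<lambda>w. (norm (y w - z w))\<^sup>2)" using S by (intro sq_integrable_diff)
  have yzm: "(\<lambda>w. y w - z w) \<in> borel_measurable M" using S by simp
  have "N1.expectation (\<lambda>w. (norm (y w - z w))\<^sup>2) \<le> N1.expectation (\<lambda>w. 2 * (norm (Z w))\<^sup>2 + 4 * (norm (p w))\<^sup>2 + 4 * (norm (q w))\<^sup>2)"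
    by (rule integral_mono[OF iyz _ d]) (use iZ S in auto)
  also have "\<dots> = 2 * N1.expectation (\<lambda>w. (norm (Z w))\<^sup>2) + 4 * N1.expectation (\<lambda>w. (norm (p w))\<^sup>2) + 4 * N1.expectation (\<lambda>w. (norm (q w))\<^sup>2)"
    using iZ S by simp
  also have "\<dots> \<le> 2 * (rate_const T * T * exp (4 * K * T) * (1 / 4) ^ n) + 4 * (34 * L * (1 / 4) ^ n) + 4 * (34 * L * (1 / 4) ^ n)"
    using EZ S by (intro add_mono mult_left_mono) auto
  also have "\<dots> = diff_const T * (1 / 4) ^ n" by (simp add: diff_const_def algebra_simps)
  finally have E2: "N1.expectation (\<lambda>w. (norm (y w - z w))\<^sup>2) \<le> diff_const T * (1 / 4) ^ n" .
  also have "(1 / 4 :: real) ^ n = ((1 / 2) ^ n)\<^sup>2" by (simp add: power2_eq_square flip: power_mult_distrib)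
  finally have E1: "N1.expectation (\<lambda>w. norm (y w - z w)) \<le> (1 + diff_const T) * (1 / 2) ^ n / 2"
    by (intro N1.expectation_norm_le yzm iyz) auto
  have iyzn: "integrable M (\<lambda>w. norm (y w - z w))" by (rule N1.sq_integrable_norm[OF yzm iyz])
  define H where "H w = K * (norm (y w - z w))\<^sup>2 + 2 * sqrt L * norm (y w - z w)
     + (1 / 4) ^ n * (8 * L + 16 + 80 * L * ((norm (y w))\<^sup>2 + (norm (z w))\<^sup>2))" for w
  have iH: "integrable M H" unfolding H_def using iyz iyzn S by simp
  have H0: "AE w in M. 0 \<le> H w" using K_pos L_pos by (simp add: H_def)
  have two: "(1 / 4) ^ n * err_const (y w) (z w) + (1 / 4) ^ n * err_const (y w) (z w)
       = (1 / 4) ^ n * (8 * L + 16 + 80 * L * ((norm (y w))\<^sup>2 + (norm (z w))\<^sup>2))" for w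
    by (simp add: err_const_def algebra_simps)
  have rn: "r \<le> real n" using r T by simp
  have pw: "(\<integral>u. (norm (simple_jump_value (hs1 n) r u w - simple_jump_value (hs1 m) r u w))\<^sup>2 \<partial>\<nu>1)
     + (\<integral>u. (norm (simple_jump_value (hs2 n) r u w - simple_jump_value (hs2 m) r u w))\<^sup>2 \<partial>\<nu>2) \<le> H w" for w
    using coefficient_difference[OF nm r(1) rn, of w, folded y_def z_def] g_modulus[of "y w" "z w"] two[of w]
    unfolding H_def by linarith
  have p1: "(\<integral>u. (norm (simple_jump_value (hs1 n) r u w - simple_jump_value (hs1 m) r u w))\<^sup>2 \<partial>\<nu>1) \<le> H w"
    "(\<integral>u. (norm (simple_jump_value (hs2 n) r u w - simple_jump_value (hs2 m) r u w))\<^sup>2 \<partial>\<nu>2) \<le> H w" for w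
  proof -
    have "0 \<le> (\<integral>u. (norm (simple_jump_value (hs1 n) r u w - simple_jump_value (hs1 m) r u w))\<^sup>2 \<partial>\<nu>1)"
     "0 \<le> (\<integral>u. (norm (simple_jump_value (hs2 n) r u w - simple_jump_value (hs2 m) r u w))\<^sup>2 \<partial>\<nu>2)" by simp_all
    then show "(\<integral>u. (norm (simple_jump_value (hs1 n) r u w - simple_jump_value (hs1 m) r u w))\<^sup>2 \<partial>\<nu>1) \<le> H w"
      "(\<integral>u. (norm (simple_jump_value (hs2 n) r u w - simple_jump_value (hs2 m) r u w))\<^sup>2 \<partial>\<nu>2) \<le> H w"
      using pw[of w] by linarith+
  qed
  have h: "(1 / 4 :: real) ^ n \<le> (1 / 2) ^ n" by (intro power_mono) auto
  have "N1.expectation H = K * N1.expectation (\<lambda>w. (norm (y w - z w))\<^sup>2) + 2 * sqrt L * N1.expectation (\<lambda>w. norm (y w - z w))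
     + (1 / 4) ^ n * (8 * L + 16 + 80 * L * (N1.expectation (\<lambda>w. (norm (y w))\<^sup>2) + N1.expectation (\<lambda>w. (norm (z w))\<^sup>2)))"
    unfolding H_def using iyz iyzn S by (simp add: N1.prob_space)
  also have "\<dots> \<le> K * (diff_const T * (1 / 4) ^ n) + 2 * sqrt L * ((1 + diff_const T) * (1 / 2) ^ n / 2)
     + (1 / 4) ^ n * (8 * L + 16 + 80 * L * (sq_bound T + sq_bound T))"
    using S E1 E2 K_pos L_pos by (intro add_mono mult_left_mono order_refl) auto
  also have "\<dots> \<le> K * (diff_const T * (1 / 2) ^ n) + 2 * sqrt L * ((1 + diff_const T) * (1 / 2) ^ n / 2)
     + (1 / 2) ^ n * (8 * L + 16 + 80 * L * (sq_bound T + sq_bound T))"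
    using h K_pos L_pos diff_const_nonneg[OF T0] sq_bound_nonneg[OF T0]
    by (intro add_mono mult_left_mono mult_right_mono order_refl) auto
  also have "\<dots> = coef_const T * (1 / 2) ^ n" by (simp add: coef_const_def algebra_simps)
  finally have EH: "N1.expectation H \<le> coef_const T * (1 / 2) ^ n" .
  show "N1.expectation (\<lambda>w. \<integral>u. (norm (simple_jump_value (hs1 n) r u w - simple_jump_value (hs1 m) r u w))\<^sup>2 \<partial>\<nu>1) \<le> coef_const T * (1 / 2) ^ n"
    by (rule order_trans[OF integral_mono_AE'[OF iH _ H0] EH]) (use p1 in simp)
  show "N1.expectation (\<lambda>w. \<integral>u. (norm (simple_jump_value (hs2 n) r u w - simple_jump_value (hs2 m) r u w))\<^sup>2 \<partial>\<nu>2) \<le> coef_const T * (1 / 2) ^ n"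
    by (rule order_trans[OF integral_mono_AE'[OF iH _ H0] EH]) (use p1 in simp)
qed

text \<open>The isometry applied to the concatenated list \<open>step_diff\<close> turns the
  distance of two integrals into the distance of their integrands, which
  \<open>coefficient_expectation\<close> bounds at each time.\<close>

lemma step_integral_cauchy:
  assumes nm: "n \<le> m" and T: "0 \<le> T" "T \<le> real n"
  shows "sq_norm M (\<lambda>w. step_integral R1 (hs1 n) T w - step_integral R1 (hs1 m) T w) \<le> ennreal (coef_const T * T * (1 / 2) ^ n)"
    "sq_norm M (\<lambda>w. step_integral R2 (hs2 n) T w - step_integral R2 (hs2 m) T w) \<le> ennreal (coef_const T * T * (1 / 2) ^ n)"
proof -
  have L16: "0 \<le> 16 * L" using L_pos by simp
  have e: "(\<integral>\<^sup>+r. ennreal (coef_const T * (1 / 2) ^ n) * indicator {0<..T} r \<partial>lborel) = ennreal (coef_const T * T * (1 / 2) ^ n)"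
    using T coef_const_nonneg[OF T(1)] by (subst nn_integral_cmult_indicator) (simp_all add: mult_ac flip: ennreal_mult')
  have "sq_norm M (\<lambda>w. step_integral R1 (hs1 n) T w - step_integral R1 (hs1 m) T w)
      = energy M \<nu>1 0 T (simple_jump_value (step_diff (hs1 n) (hs1 m)))"
    using N1.step_integral_isometry(2)[OF N1.simple_step_diff[OF simple1[of n n] simple1[of m m]] order_refl T(1)]
    by (simp add: N1.step_integral_0[OF simple1] step_integral_diff)
  also have "\<dots> = energy M \<nu>1 0 T (\<lambda>r u w. simple_jump_value (hs1 n) r u w - simple_jump_value (hs1 m) r u w)"
    by (simp add: energy_def step_value_diff)
  also have "\<dots> \<le> (\<integral>\<^sup>+r. ennreal (coef_const T * (1 / 2) ^ n) * indicator {0<..T} r \<partial>lborel)"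
    unfolding energy_def N1.integral_sq_eq(4)[OF value_diff_measurable(1) value_diff_bound(1) L16]
    using coefficient_expectation(1)[OF nm T(2)] by (intro nn_integral_mono) (auto simp: indicator_def intro!: ennreal_leI)
  finally show "sq_norm M (\<lambda>w. step_integral R1 (hs1 n) T w - step_integral R1 (hs1 m) T w) \<le> ennreal (coef_const T * T * (1 / 2) ^ n)"
    unfolding e .
  have "sq_norm M (\<lambda>w. step_integral R2 (hs2 n) T w - step_integral R2 (hs2 m) T w)
      = energy M \<nu>2 0 T (simple_jump_value (step_diff (hs2 n) (hs2 m)))"
    using N2.step_integral_isometry(2)[OF N2.simple_step_diff[OF simple2[of n n] simple2[of m m]] order_refl T(1)]
    by (simp add: N2.step_integral_0[OF simple2] step_integral_diff)
  also have "\<dots> = energy M \<nu>2 0 T (\<lambda>r u w. simple_jump_value (hs2 n) r u w - simple_jump_value (hs2 m) r u w)"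
    by (simp add: energy_def step_value_diff)
  also have "\<dots> \<le> (\<integral>\<^sup>+r. ennreal (coef_const T * (1 / 2) ^ n) * indicator {0<..T} r \<partial>lborel)"
    unfolding energy_def N2.integral_sq_eq(4)[OF value_diff_measurable(2) value_diff_bound(2) L16]
    using coefficient_expectation(2)[OF nm T(2)] by (intro nn_integral_mono) (auto simp: indicator_def intro!: ennreal_leI)
  finally show "sq_norm M (\<lambda>w. step_integral R2 (hs2 n) T w - step_integral R2 (hs2 m) T w) \<le> ennreal (coef_const T * T * (1 / 2) ^ n)"
    unfolding e .
qed

end

section \<open>Existence\<close>

text \<open>First moments of successive differences are of order \<open>(1/2) ^ n\<close>, so the
  series of their norms has finite expectation and converges almost surely. The starting index
  \<open>N\<close> is there because the scheme is controlled at time \<open>t\<close> only for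
  \<open>n >= t\<close>.\<close>

lemma (in prob_space) AE_convergent_geometric:
  fixes x :: "nat \<Rightarrow> 'a \<Rightarrow> 'b::euclidean_space"
  assumes m[measurable]: "\<And>n. x n \<in> borel_measurable M"
    and i: "\<And>n. n \<ge> N \<Longrightarrow> integrable M (\<lambda>w. (norm (x n w - x (Suc n) w))\<^sup>2)"
    and le: "\<And>n. n \<ge> N \<Longrightarrow> expectation (\<lambda>w. (norm (x n w - x (Suc n) w))\<^sup>2) \<le> C * (1 / 4) ^ n"
  shows "AE w in M. convergent (\<lambda>n. x n w)"
proof -
  define y where "y k w = x (N + k) w" for k w
  have [measurable]: "y k \<in> borel_measurable M" for k unfolding y_def[abs_def] by measurable
  define c where "c k = max 0 ((1 + C) * (1 / 2) ^ (N + k) / 2)" for k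
  have nn: "(\<integral>\<^sup>+w. ennreal (norm (y k w - y (Suc k) w)) \<partial>M) \<le> ennreal (c k)" for k
  proof -
    have e: "(1 / 4 :: real) ^ (N + k) = ((1 / 2) ^ (N + k))\<^sup>2" by (simp add: power2_eq_square flip: power_mult_distrib)
    have j: "integrable M (\<lambda>w. (norm (y k w - y (Suc k) w))\<^sup>2)" using i[of "N + k"] by (simp add: y_def)
    have "expectation (\<lambda>w. norm (y k w - y (Suc k) w)) \<le> (1 + C) * (1 / 2) ^ (N + k) / 2"
      by (rule expectation_norm_le[OF _ j]) (use le[of "N + k"] in \<open>auto simp: y_def e\<close>)
    moreover have "(\<integral>\<^sup>+w. ennreal (norm (y k w - y (Suc k) w)) \<partial>M) = ennreal (expectation (\<lambda>w. norm (y k w - y (Suc k) w)))"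
      by (intro nn_integral_eq_integral sq_integrable_norm j) auto
    ultimately show ?thesis by (auto simp: c_def intro!: ennreal_leI)
  qed
  have sc: "summable c"
  proof (rule summable_comparison_test')
    show "summable (\<lambda>k. (1 + \<bar>C\<bar>) * (1 / 2) ^ N * (1 / 2) ^ k / 2 :: real)"
      by (intro summable_divide summable_mult summable_geometric) simp
    show "norm (c k) \<le> (1 + \<bar>C\<bar>) * (1 / 2) ^ N * (1 / 2) ^ k / 2" for k
    proof -
      have "(1 + C) * (1 / 2) ^ (N + k) / 2 \<le> (1 + \<bar>C\<bar>) * (1 / 2) ^ (N + k) / 2"
        by (intro divide_right_mono mult_right_mono) auto
      then have "c k \<le> (1 + \<bar>C\<bar>) * (1 / 2) ^ (N + k) / 2" unfolding c_def by (intro max.boundedI) auto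
      moreover have "0 \<le> c k" by (simp add: c_def)
      ultimately show ?thesis by (simp add: power_add mult.assoc)
    qed
  qed
  have "(\<integral>\<^sup>+w. (\<Sum>k. ennreal (norm (y k w - y (Suc k) w))) \<partial>M) = (\<Sum>k. \<integral>\<^sup>+w. ennreal (norm (y k w - y (Suc k) w)) \<partial>M)"
    by (intro nn_integral_suminf) measurable
  also have "\<dots> \<le> (\<Sum>k. ennreal (c k))" by (intro suminf_le nn) auto
  also have "\<dots> = ennreal (\<Sum>k. c k)" by (intro suminf_ennreal2 sc) (simp add: c_def)
  also have "\<dots> < \<infinity>" by simp
  finally have "AE w in M. (\<Sum>k. ennreal (norm (y k w - y (Suc k) w))) \<noteq> \<infinity>"
    by (intro nn_integral_noteq_infinite) auto
  then show ?thesis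
  proof eventually_elim
    case (elim w)
    then have "summable (\<lambda>k. norm (y k w - y (Suc k) w))" by (intro summable_suminf_not_top) auto
    then have "summable (\<lambda>k. norm (y (Suc k) w - y k w))" by (subst norm_minus_commute)
    then have "summable (\<lambda>k. y (Suc k) w - y k w)" by (rule summable_norm_cancel)
    then have "convergent (\<lambda>n. y n w - y 0 w)" by (simp add: summable_iff_convergent sum_lessThan_telescope[of "\<lambda>n. y n w"])
    then obtain l where "(\<lambda>n. y n w - y 0 w) \<longlonglongrightarrow> l" by (auto simp: convergent_def)
    then have "(\<lambda>n. (y n w - y 0 w) + y 0 w) \<longlonglongrightarrow> l + y 0 w" by (intro tendsto_intros)
    then have "(\<lambda>n. x (n + N) w) \<longlonglongrightarrow> l + y 0 w" by (simp add: y_def add.commute)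
    then show ?case using LIMSEQ_offset[of "\<lambda>n. x n w" N] by (auto simp: convergent_def)
  qed
qed

text \<open>Convergence is uniform over the finitely many nodes of level \<open>k\<close> in
  \<open>[0, T]\<close>, and the common Lipschitz constant extends it to all times: moving to the
  nearest node below costs less than \<open>e / 4\<close> for each function.\<close>

lemma equi_lipschitz_uniformly_convergent:
  fixes f :: "nat \<Rightarrow> real \<Rightarrow> 'b::{complete_space, real_normed_vector}"
  assumes B: "0 \<le> B" and lip: "\<And>n s t. 0 \<le> s \<Longrightarrow> s \<le> t \<Longrightarrow> norm (f n t - f n s) \<le> B * (t - s)"
    and conv: "\<And>i k. convergent (\<lambda>n. f n (real i / 2 ^ k))" and T: "0 \<le> T"
  shows "uniformly_convergent_on {0..T} f"
proof (rule Cauchy_uniformly_convergent, rule uniformly_Cauchy_onI)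
  fix e :: real assume e: "0 < e"
  have "0 < e / (4 * (B + 1))" using e B by simp
  then obtain k where k: "(1 / 2) ^ k < e / (4 * (B + 1))" using real_arch_pow_inv[of _ "1 / 2"] by auto
  then have "(1 / 2) ^ k * (B + 1) < e / 4" using B by (simp add: field_simps)
  moreover have "B * (1 / 2) ^ k \<le> (1 / 2) ^ k * (B + 1)" by (simp add: algebra_simps)
  ultimately have Bk: "B * (1 / 2) ^ k < e / 4" by linarith
  define J where "J = nat \<lfloor>T * 2 ^ k\<rfloor>"
  have "\<forall>\<^sub>F N in sequentially. \<forall>m\<ge>N. \<forall>n\<ge>N. dist (f m (real i / 2 ^ k)) (f n (real i / 2 ^ k)) < e / 2" for i
  proof -
    have "Cauchy (\<lambda>n. f n (real i / 2 ^ k))" using conv[of i k] by (rule convergent_Cauchy)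
    then obtain N where "\<forall>m\<ge>N. \<forall>n\<ge>N. dist (f m (real i / 2 ^ k)) (f n (real i / 2 ^ k)) < e / 2"
      using e unfolding Cauchy_def by (meson half_gt_zero)
    then show ?thesis by (auto simp: eventually_sequentially intro!: exI[of _ N])
  qed
  then have "\<forall>\<^sub>F N in sequentially. \<forall>i\<in>{..J}. \<forall>m\<ge>N. \<forall>n\<ge>N. dist (f m (real i / 2 ^ k)) (f n (real i / 2 ^ k)) < e / 2"
    by (intro eventually_ball_finite) auto
  then obtain N where N0: "\<forall>i\<in>{..J}. \<forall>m\<ge>N. \<forall>n\<ge>N. dist (f m (real i / 2 ^ k)) (f n (real i / 2 ^ k)) < e / 2"
    unfolding eventually_sequentially by blast
  have N: "dist (f m (real i / 2 ^ k)) (f n (real i / 2 ^ k)) < e / 2" if "i \<le> J" "m \<ge> N" "n \<ge> N" for i m n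
    using N0 that by (meson atMost_iff)
  show "\<exists>N. \<forall>t\<in>{0..T}. \<forall>m\<ge>N. \<forall>n\<ge>N. dist (f m t) (f n t) < e"
  proof (intro exI[of _ N] ballI allI impI)
    fix t m n assume t: "t \<in> {0..T}" and mn: "N \<le> m" "N \<le> n"
    define i where "i = nat \<lfloor>t * 2 ^ k\<rfloor>"
    define q where "q = real i / 2 ^ k"
    have fl: "0 \<le> \<lfloor>t * 2 ^ k\<rfloor>" using t by simp
    have "\<lfloor>t * 2 ^ k\<rfloor> \<le> \<lfloor>T * 2 ^ k\<rfloor>" using t by (intro floor_mono mult_right_mono) auto
    then have iJ: "i \<le> J" by (simp add: i_def J_def nat_mono)
    have "real i = real_of_int \<lfloor>t * 2 ^ k\<rfloor>" using fl by (simp add: i_def)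
    then have fi: "real i \<le> t * 2 ^ k" "t * 2 ^ k < real i + 1" using floor_correct[of "t * 2 ^ k"] by linarith+
    from fi(2) have "t < (real i + 1) / 2 ^ k" by (simp add: pos_less_divide_eq)
    then have q: "0 \<le> q" "q \<le> t" "t - q \<le> (1 / 2) ^ k"
      using fi(1) by (simp_all add: q_def pos_divide_le_eq add_divide_distrib power_one_over)
    have l: "norm (f n' t - f n' q) < e / 4" for n'
      using lip[OF q(1,2), of n'] mult_left_mono[OF q(3) B] Bk by linarith
    have "dist (f m t) (f n t) \<le> dist (f m t) (f m q) + dist (f m q) (f n q) + dist (f n t) (f n q)"
      using dist_triangle[of "f m t" "f n t" "f m q"] dist_triangle[of "f m q" "f n t" "f n q"] by (simp add: dist_commute)
    also have "\<dots> < e / 4 + e / 2 + e / 4"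
      using l[of m] l[of n] N[OF iJ mn] by (intro add_strict_mono) (auto simp: dist_norm q_def)
    finally show "dist (f m t) (f n t) < e" by simp
  qed
qed

text \<open>Along a cadlag path, left limit and value differ at countably many times only. Fubini
  exchanges the quantifiers: at almost every time the two versions agree almost surely. Joint
  measurability of the versions makes the exchange legitimate.\<close>

lemma (in prob_space) AE_left_version_eq:
  fixes X :: "real \<Rightarrow> 'a \<Rightarrow> real^'d::finite"
  assumes X: "\<And>t. 0 \<le> t \<Longrightarrow> X t \<in> borel_measurable M" and cad: "AE w in M. cadlag (\<lambda>t. X t w)"
  shows "AE r in lborel. AE w in M. 0 < r \<longrightarrow> left_version X r w = right_version X r w"
proof -
  interpret P: pair_sigma_finite M lborel ..
  have "(\<lambda>(r, w). right_version X r w) \<in> borel_measurable (borel \<Otimes>\<^sub>M M)" "(\<lambda>(r, w). left_version X r w) \<in> borel_measurable (borel \<Otimes>\<^sub>M M)"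
    using borel_measurable_versions[OF X] by auto
  note [measurable] = this
  have "AE w in M. AE r in lborel. 0 < r \<longrightarrow> left_version X r w = right_version X r w"
    using cad
  proof eventually_elim
    case (elim w)
    have "AE r in lborel. 0 < r \<longrightarrow> left_limit (\<lambda>t. X t w) r = X r w" by (rule cadlag_AE_left_limit[OF elim])
    then show ?case by eventually_elim (use elim in \<open>auto simp: left_version_eq right_version_eq\<close>)
  qed
  then show ?thesis by (subst (asm) P.AE_commute) measurable
qed

text \<open>Dominated convergence twice, in \<open>w\<close> with the constant \<open>c\<close> and
  in time with \<open>c\<close> on \<open>(0, T]\<close>. Convergence is asked for almost every time
  and then almost every \<open>w\<close>, which is the order in which
  \<open>AE_left_version_eq\<close> delivers it.\<close>

lemma (in noise) energy_tendsto_0: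
  fixes H :: "nat \<Rightarrow> real \<Rightarrow> 'u \<Rightarrow> 'w \<Rightarrow> 'b::euclidean_space"
  assumes H: "\<And>n. (\<lambda>(r, u, w). H n r u w) \<in> borel_measurable (borel \<Otimes>\<^sub>M \<nu> \<Otimes>\<^sub>M M)"
    and bd: "\<And>n r. \<forall>w\<in>space M. sq_norm \<nu> (\<lambda>u. H n r u w) \<le> ennreal c"
    and lim: "AE r in lborel. 0 < r \<longrightarrow> (AE w in M. (\<lambda>n. sq_norm \<nu> (\<lambda>u. H n r u w)) \<longlonglongrightarrow> 0)"
  shows "(\<lambda>n. energy M \<nu> 0 T (H n)) \<longlonglongrightarrow> 0"
proof -
  note [measurable] = energy_measurable(2,3)[OF H]
  have le: "(\<integral>\<^sup>+w. sq_norm \<nu> (\<lambda>u. H n r u w) \<partial>M) \<le> ennreal c" for n r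
  proof -
    have "(\<integral>\<^sup>+w. sq_norm \<nu> (\<lambda>u. H n r u w) \<partial>M) \<le> (\<integral>\<^sup>+w. ennreal c \<partial>M)"
      using bd by (intro nn_integral_mono) auto
    then show ?thesis by (simp add: emeasure_space_1)
  qed
  have "(\<lambda>n. \<integral>\<^sup>+r. (\<integral>\<^sup>+w. sq_norm \<nu> (\<lambda>u. H n r u w) \<partial>M) * indicator {0<..T} r \<partial>lborel) \<longlonglongrightarrow> (\<integral>\<^sup>+r. 0 \<partial>(lborel :: real measure))"
  proof (rule nn_integral_dominated_convergence[where w="\<lambda>r. ennreal c * indicator {0<..T} r"])
    show "AE r in lborel. (\<integral>\<^sup>+w. sq_norm \<nu> (\<lambda>u. H n r u w) \<partial>M) * indicator {0<..T} r \<le> ennreal c * indicator {0<..T} r" for n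
      using le by (intro AE_I2 mult_right_mono) auto
    show "(\<integral>\<^sup>+r. ennreal c * indicator {0<..T} r \<partial>lborel) < \<infinity>"
      by (cases "0 \<le> T") (simp_all add: nn_integral_cmult_indicator ennreal_mult_less_top)
    show "AE r in lborel. (\<lambda>n. (\<integral>\<^sup>+w. sq_norm \<nu> (\<lambda>u. H n r u w) \<partial>M) * indicator {0<..T} r) \<longlonglongrightarrow> 0"
      using lim
    proof eventually_elim
      case (elim r)
      show ?case
      proof (cases "r \<in> {0<..T}")
        case True
        then have ae: "AE w in M. (\<lambda>n. sq_norm \<nu> (\<lambda>u. H n r u w)) \<longlonglongrightarrow> 0" using elim by simp
        have "(\<lambda>n. \<integral>\<^sup>+w. sq_norm \<nu> (\<lambda>u. H n r u w) \<partial>M) \<longlonglongrightarrow> (\<integral>\<^sup>+w. 0 \<partial>M)"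
        proof (rule nn_integral_dominated_convergence[where w="\<lambda>_. ennreal c"])
          show "AE w in M. sq_norm \<nu> (\<lambda>u. H n r u w) \<le> ennreal c" for n
            using bd by (intro AE_I2) auto
        qed (use ae in \<open>auto simp: emeasure_space_1\<close>)
        then show ?thesis using True by simp
      qed simp
    qed
  qed auto
  then show ?thesis by (simp add: energy_def)
qed

context euler_scheme
begin

lemma limits_obtain:
  obtains I J where "\<And>t. 0 \<le> t \<Longrightarrow> I t \<in> borel_measurable (F t)" "\<And>t. 0 \<le> t \<Longrightarrow> J t \<in> borel_measurable (F t)"
    "AE w in M. \<forall>T\<ge>0. uniform_limit {0..T} (\<lambda>n t. step_integral R1 (hs1 n) t w) (\<lambda>t. I t w) sequentially"
    "AE w in M. \<forall>T\<ge>0. uniform_limit {0..T} (\<lambda>n t. step_integral R2 (hs2 n) t w) (\<lambda>t. J t w) sequentially"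
    "\<And>T. 0 \<le> T \<Longrightarrow> (\<lambda>n. sq_norm M (\<lambda>w. step_integral R1 (hs1 n) T w - I T w)) \<longlonglongrightarrow> 0"
    "\<And>T. 0 \<le> T \<Longrightarrow> (\<lambda>n. sq_norm M (\<lambda>w. step_integral R2 (hs2 n) T w - J T w)) \<longlonglongrightarrow> 0"
proof -
  have c1: "\<exists>C\<ge>0. \<forall>n m. T \<le> real n \<longrightarrow> n \<le> m \<longrightarrow>
      sq_norm M (\<lambda>w. step_integral R1 (hs1 n) T w - step_integral R1 (hs1 m) T w) \<le> ennreal (C * (1 / 2) ^ n)" if "0 \<le> T" for T
    using step_integral_cauchy(1)[OF _ that] coef_const_nonneg[OF that] that by (intro exI[of _ "coef_const T * T"]) auto
  have c2: "\<exists>C\<ge>0. \<forall>n m. T \<le> real n \<longrightarrow> n \<le> m \<longrightarrow>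
      sq_norm M (\<lambda>w. step_integral R2 (hs2 n) T w - step_integral R2 (hs2 m) T w) \<le> ennreal (C * (1 / 2) ^ n)" if "0 \<le> T" for T
    using step_integral_cauchy(2)[OF _ that] coef_const_nonneg[OF that] that by (intro exI[of _ "coef_const T * T"]) auto
  show ?thesis
  proof (rule N1.step_integrals_converge[where hs="\<lambda>n. hs1 n", OF simple1 c1])
    fix I assume I: "\<And>t. 0 \<le> t \<Longrightarrow> I t \<in> borel_measurable (F t)"
      "AE w in M. \<forall>T\<ge>0. uniform_limit {0..T} (\<lambda>n t. step_integral R1 (hs1 n) t w) (\<lambda>t. I t w) sequentially"
      "\<And>T. 0 \<le> T \<Longrightarrow> (\<lambda>n. sq_norm M (\<lambda>w. step_integral R1 (hs1 n) T w - I T w)) \<longlonglongrightarrow> 0"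
    show ?thesis
    proof (rule N2.step_integrals_converge[where hs="\<lambda>n. hs2 n", OF simple2 c2])
      fix J assume J: "\<And>t. 0 \<le> t \<Longrightarrow> J t \<in> borel_measurable (F t)"
        "AE w in M. \<forall>T\<ge>0. uniform_limit {0..T} (\<lambda>n t. step_integral R2 (hs2 n) t w) (\<lambda>t. J t w) sequentially"
        "\<And>T. 0 \<le> T \<Longrightarrow> (\<lambda>n. sq_norm M (\<lambda>w. step_integral R2 (hs2 n) T w - J T w)) \<longlonglongrightarrow> 0"
      show ?thesis by (rule that[OF I(1) J(1) I(2) J(2) I(3) J(3)])
    qed
  qed
qed

lemma euler_converges:
  assumes "0 \<le> t" shows "AE w in M. convergent (\<lambda>n. euler n t w)"
proof (rule N1.AE_convergent_geometric)
  show "euler n t \<in> borel_measurable M" for n using euler_measurable[OF assms] .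
  fix n assume "nat \<lceil>t\<rceil> \<le> n"
  then have n: "t \<le> real n" by linarith
  show "integrable M (\<lambda>w. (norm (euler n t w - euler (Suc n) t w))\<^sup>2)"
    using euler_measurable[OF assms] euler_sq(1)[OF assms order_refl] by (intro sq_integrable_diff)
  show "N1.expectation (\<lambda>w. (norm (euler n t w - euler (Suc n) t w))\<^sup>2) \<le> rate_const t * t * exp (4 * K * t) * (1 / 4) ^ n"
    by (rule euler_diff_sq) (use n assms in auto)
qed

text \<open>Defined for every \<open>w\<close> by the total function \<open>lim\<close>, hence
  adapted. The moment estimates give almost sure convergence at single times;
  \<open>euler_path_limit\<close> extends it to all times along almost every path.\<close>

definition limit :: "real \<Rightarrow> 'w \<Rightarrow> real^'d" where
  "limit t w = lim (\<lambda>n. euler n t w)"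

lemma limit_adapted: "0 \<le> t \<Longrightarrow> limit t \<in> borel_measurable (F t)"
  unfolding limit_def[abs_def] by (intro borel_measurable_lim_metric euler_adapted)

text \<open>The differences of the drift parts cannot be estimated directly, since \<open>b\<close>
  has no modulus. Their convergence at dyadic times is read off from that of the scheme and of the
  two integrals, and the common Lipschitz constant \<open>sqrt L\<close> makes it locally
  uniform.\<close>

lemma euler_path_limit:
  assumes o: "w \<in> space M"
    and I: "\<And>T. 0 \<le> T \<Longrightarrow> uniform_limit {0..T} (\<lambda>n t. step_integral R1 (hs1 n) t w) (\<lambda>t. I t) sequentially"
    and J: "\<And>T. 0 \<le> T \<Longrightarrow> uniform_limit {0..T} (\<lambda>n t. step_integral R2 (hs2 n) t w) (\<lambda>t. J t) sequentially"
    and c: "\<And>i k. convergent (\<lambda>n. euler n (real i / 2 ^ k) w)"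
  obtains D where "\<And>t. 0 \<le> t \<Longrightarrow> (\<lambda>n. drift_integral n t w) \<longlonglongrightarrow> D t"
    "\<And>t. 0 \<le> t \<Longrightarrow> limit t w = x0 + D t + I t + J t"
    "\<And>T. 0 \<le> T \<Longrightarrow> uniform_limit {0..T} (\<lambda>n t. euler n t w) (\<lambda>t. limit t w) sequentially"
proof -
  have pI: "(\<lambda>n. step_integral R1 (hs1 n) t w) \<longlonglongrightarrow> I t" "(\<lambda>n. step_integral R2 (hs2 n) t w) \<longlonglongrightarrow> J t" if "0 \<le> t" for t
    using tendsto_uniform_limitI[OF I[OF that], of t] tendsto_uniform_limitI[OF J[OF that], of t] that by auto
  have cD: "convergent (\<lambda>n. drift_integral n (real i / 2 ^ k) w)" for i k
  proof -
    obtain l where l: "(\<lambda>n. euler n (real i / 2 ^ k) w) \<longlonglongrightarrow> l" using c[of i k] by (auto simp: convergent_def)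
    have t: "0 \<le> real i / 2 ^ k" by simp
    have "(\<lambda>n. euler n (real i / 2 ^ k) w - x0 - step_integral R1 (hs1 n) (real i / 2 ^ k) w - step_integral R2 (hs2 n) (real i / 2 ^ k) w)
       \<longlonglongrightarrow> l - x0 - I (real i / 2 ^ k) - J (real i / 2 ^ k)" by (intro tendsto_intros l pI t)
    then show ?thesis by (auto simp: euler_def convergent_def)
  qed
  have "uniformly_convergent_on {0..T} (\<lambda>n t. drift_integral n t w)" if "0 \<le> T" for T
    by (rule equi_lipschitz_uniformly_convergent[where B="sqrt L" and f="\<lambda>n t. drift_integral n t w", OF _ _ cD that]) (use L_pos drift_integral_diff[OF _ _ o] in auto)
  then have uD: "uniform_limit {0..T} (\<lambda>n t. drift_integral n t w) (\<lambda>t. lim (\<lambda>n. drift_integral n t w)) sequentially" if "0 \<le> T" for T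
    using that by (simp add: uniformly_convergent_uniform_limit_iff)
  define D where "D t = lim (\<lambda>n. drift_integral n t w)" for t
  have pD: "(\<lambda>n. drift_integral n t w) \<longlonglongrightarrow> D t" if "0 \<le> t" for t
    using tendsto_uniform_limitI[OF uD[OF that], of t] that by (simp add: D_def)
  have X: "limit t w = x0 + D t + I t + J t" if "0 \<le> t" for t
    unfolding limit_def euler_def by (rule limI) (intro tendsto_intros pD pI that)
  have "uniform_limit {0..T} (\<lambda>n t. euler n t w) (\<lambda>t. limit t w) sequentially" if T: "0 \<le> T" for T
  proof -
    have "uniform_limit {0..T} (\<lambda>n t. euler n t w) (\<lambda>t. x0 + D t + I t + J t) sequentially"
      unfolding euler_def using uD[OF T] I[OF T] J[OF T] by (intro uniform_limit_intros) (auto simp: D_def)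
    then show ?thesis by (rule uniform_limit_cong'[THEN iffD1, rotated -1]) (simp_all add: X)
  qed
  then show ?thesis using that[of D] pD X by blast
qed

lemma euler_cadlag: "AE w in M. cadlag (\<lambda>t. euler n t w)"
  using N1.step_integral_cadlag[OF simple1[of n n]] N2.step_integral_cadlag[OF simple2[of n n]] AE_space
  unfolding euler_def by eventually_elim (auto intro!: cadlag_add cadlag_const continuous_imp_cadlag[OF drift_integral_continuous])

lemma euler_step_tendsto:
  assumes u: "\<And>T. 0 \<le> T \<Longrightarrow> uniform_limit {0..T} (\<lambda>n t. euler n t w) (\<lambda>t. limit t w) sequentially"
    and c: "cadlag (\<lambda>t. limit t w)" and r: "0 < r"
  shows "(\<lambda>n. euler_step n r w) \<longlonglongrightarrow> left_limit (\<lambda>t. limit t w) r"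
proof -
  define s where "s n = node n (last_node n r)" for n
  have s: "s n < r" "r - 1 / 16 ^ n \<le> s n" "0 \<le> s n" for n
    using last_node_bounds[OF r, of n] by (auto simp: s_def)
  have "(\<lambda>n. r - 1 / 16 ^ n) \<longlonglongrightarrow> r - 0" by (intro tendsto_intros LIMSEQ_divide_realpow_zero) auto
  then have lim: "(\<lambda>n. r - 1 / 16 ^ n) \<longlonglongrightarrow> r" by simp
  have ev: "\<forall>\<^sub>F n in sequentially. r - 1 / 16 ^ n \<le> s n" "\<forall>\<^sub>F n in sequentially. s n \<le> r"
    using s(2) less_imp_le[OF s(1)] by (simp_all add: always_eventually)
  have "s \<longlonglongrightarrow> r" by (rule tendsto_sandwich[OF ev lim tendsto_const])
  then have "filterlim s (at_left r) sequentially" using s(1) by (simp add: filterlim_at less_imp_neq)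
  then have 1: "(\<lambda>n. limit (s n) w) \<longlonglongrightarrow> left_limit (\<lambda>t. limit t w) r" by (rule filterlim_compose[OF cadlag_left[OF c r]])
  have 2: "(\<lambda>n. euler n (s n) w - limit (s n) w) \<longlonglongrightarrow> 0"
  proof (rule tendstoI)
    fix e :: real assume "0 < e"
    then have "\<forall>\<^sub>F n in sequentially. \<forall>t\<in>{0..r}. dist (euler n t w) (limit t w) < e" using uniform_limitD[OF u] r by simp
    then show "\<forall>\<^sub>F n in sequentially. dist (euler n (s n) w - limit (s n) w) 0 < e"
      by eventually_elim (use s in \<open>simp add: dist_norm less_imp_le\<close>)
  qed
  have 3: "(\<lambda>n. euler n (s n) w) \<longlonglongrightarrow> left_limit (\<lambda>t. limit t w) r"
    using tendsto_add[OF 2 1] by simp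
  have "\<forall>\<^sub>F n in sequentially. euler n (s n) w = euler_step n r w"
    using eventually_ge_at_top[of "nat \<lceil>r\<rceil>"]
  proof eventually_elim
    case (elim n)
    then have "r \<le> real n" by linarith
    then show ?case using euler_step_eq[OF r, of n] by (simp add: s_def)
  qed
  then show ?thesis by (rule Lim_transform_eventually[OF 3])
qed

text \<open>The kernel error at \<open>y n\<close> vanishes because a convergent sequence of states
  is bounded, and the modulus controls the passage from \<open>y n\<close> to
  \<open>x\<close>.\<close>

lemma integrand_limit:
  assumes r: "0 < r" and lim: "(\<lambda>n. euler_step n r w) \<longlonglongrightarrow> x"
  shows "(\<lambda>n. sq_norm \<nu>1 (\<lambda>u. simple_jump_value (hs1 n) r u w - g1 x u)) \<longlonglongrightarrow> 0"
    "(\<lambda>n. sq_norm \<nu>2 (\<lambda>u. simple_jump_value (hs2 n) r u w - g2 x u)) \<longlonglongrightarrow> 0"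
proof -
  define y where "y n = euler_step n r w" for n
  define e where "e n = 2 * ((1 + 10 * L * (norm (y n))\<^sup>2) * (1 / 16) ^ n) + 2 * (K * (norm (x - y n))\<^sup>2 + 2 * sqrt L * norm (x - y n))" for n
  have "e \<longlonglongrightarrow> 2 * ((1 + 10 * L * (norm x)\<^sup>2) * 0) + 2 * (K * (norm (x - x))\<^sup>2 + 2 * sqrt L * norm (x - x))"
    unfolding e_def using lim by (intro tendsto_intros LIMSEQ_realpow_zero) (auto simp: y_def)
  then have "(\<lambda>n. ennreal (e n)) \<longlonglongrightarrow> ennreal 0" by (intro tendsto_ennrealI) simp
  then have e0: "(\<lambda>n. ennreal (e n)) \<longlonglongrightarrow> 0" by simp
  have ev: "\<forall>\<^sub>F n in sequentially. r \<le> real n"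
    using eventually_ge_at_top[of "nat \<lceil>r\<rceil>"] by eventually_elim linarith
  have p1: "0 \<le> (1 + 10 * L * (norm (y n))\<^sup>2) * (1 / 16) ^ n" for n using L_pos by simp
  have p2: "0 \<le> K * (norm (x - y n))\<^sup>2 + 2 * sqrt L * norm (x - y n)" for n using L_pos K_pos by simp
  show "(\<lambda>n. sq_norm \<nu>1 (\<lambda>u. simple_jump_value (hs1 n) r u w - g1 x u)) \<longlonglongrightarrow> 0"
  proof (rule tendsto_sandwich[OF _ _ tendsto_const e0])
    show "\<forall>\<^sub>F n in sequentially. sq_norm \<nu>1 (\<lambda>u. simple_jump_value (hs1 n) r u w - g1 x u) \<le> ennreal (e n)"
      using ev
    proof eventually_elim
      case (elim n)
      have "sq_norm \<nu>1 (\<lambda>u. (kernel_value (A1 n) (y n) u - g1 (y n) u) - (g1 x u - g1 (y n) u)) \<le> ennreal (e n)"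
        unfolding e_def using kernel_value_measurable[OF A1] g_section(1)
        by (intro nn_diff_sq_le A1_error g_modulus_nn p1 p2) auto
      then show ?case using r elim by (simp add: kernel_steps_value y_def)
    qed
  qed simp
  show "(\<lambda>n. sq_norm \<nu>2 (\<lambda>u. simple_jump_value (hs2 n) r u w - g2 x u)) \<longlonglongrightarrow> 0"
  proof (rule tendsto_sandwich[OF _ _ tendsto_const e0])
    show "\<forall>\<^sub>F n in sequentially. sq_norm \<nu>2 (\<lambda>u. simple_jump_value (hs2 n) r u w - g2 x u) \<le> ennreal (e n)"
      using ev
    proof eventually_elim
      case (elim n)
      have "sq_norm \<nu>2 (\<lambda>u. (kernel_value (A2 n) (y n) u - g2 (y n) u) - (g2 x u - g2 (y n) u)) \<le> ennreal (e n)"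
        unfolding e_def using kernel_value_measurable[OF A2] g_section(2)
        by (intro nn_diff_sq_le A2_error g_modulus_nn p1 p2) auto
      then show ?case using r elim by (simp add: kernel_steps_value y_def)
    qed
  qed simp
qed

text \<open>Locally uniform convergence of the elementary integrals is kept in the conclusion: from
  it \<open>I\<close> is later seen to be continuous and \<open>J\<close> to be cadlag, each as a
  limit of paths of that kind.\<close>

theorem limit_solution:
  "\<exists>I J. strong_sol x0 limit I J \<and> adapted_process F I \<and> adapted_process F J \<and>
     (AE w in M. \<forall>T\<ge>0. uniform_limit {0..T} (\<lambda>n t. step_integral R1 (hs1 n) t w) (\<lambda>t. I t w) sequentially) \<and>
     (AE w in M. \<forall>T\<ge>0. uniform_limit {0..T} (\<lambda>n t. step_integral R2 (hs2 n) t w) (\<lambda>t. J t w) sequentially)"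
proof (rule limits_obtain)
  fix I J
  assume IJ: "\<And>t. 0 \<le> t \<Longrightarrow> I t \<in> borel_measurable (F t)" "\<And>t. 0 \<le> t \<Longrightarrow> J t \<in> borel_measurable (F t)"
    and uI: "AE w in M. \<forall>T\<ge>0. uniform_limit {0..T} (\<lambda>n t. step_integral R1 (hs1 n) t w) (\<lambda>t. I t w) sequentially"
    and uJ: "AE w in M. \<forall>T\<ge>0. uniform_limit {0..T} (\<lambda>n t. step_integral R2 (hs2 n) t w) (\<lambda>t. J t w) sequentially"
    and lI: "\<And>T. 0 \<le> T \<Longrightarrow> (\<lambda>n. sq_norm M (\<lambda>w. step_integral R1 (hs1 n) T w - I T w)) \<longlonglongrightarrow> 0"
    and lJ: "\<And>T. 0 \<le> T \<Longrightarrow> (\<lambda>n. sq_norm M (\<lambda>w. step_integral R2 (hs2 n) T w - J T w)) \<longlonglongrightarrow> 0"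
  \<comment> \<open>Dyadic times only, so that the exceptional sets of
    \<open>euler_converges\<close> unite to a null set.\<close>
  have cE: "AE w in M. \<forall>i k. convergent (\<lambda>n. euler n (real i / 2 ^ k) w)"
    using euler_converges by (simp add: AE_all_countable)
  have path: "AE w in M. w \<in> space M \<and> (\<exists>D. (\<forall>t\<ge>0. (\<lambda>n. drift_integral n t w) \<longlonglongrightarrow> D t) \<and> (\<forall>t\<ge>0. limit t w = x0 + D t + I t w + J t w))
      \<and> (\<forall>T\<ge>0. uniform_limit {0..T} (\<lambda>n t. euler n t w) (\<lambda>t. limit t w) sequentially)"
    using uI uJ cE AE_space
  proof eventually_elim
    case (elim w)
    show ?case
    proof (rule euler_path_limit[of w "\<lambda>t. I t w" "\<lambda>t. J t w"])
      show "w \<in> space M" by (rule elim(4))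
      show "uniform_limit {0..T} (\<lambda>n t. step_integral R1 (hs1 n) t w) (\<lambda>t. I t w) sequentially" if "0 \<le> T" for T
        using elim(1) that by blast
      show "uniform_limit {0..T} (\<lambda>n t. step_integral R2 (hs2 n) t w) (\<lambda>t. J t w) sequentially" if "0 \<le> T" for T
        using elim(2) that by blast
      show "convergent (\<lambda>n. euler n (real i / 2 ^ k) w)" for i k using elim(3) by blast
      fix D assume "\<And>t. 0 \<le> t \<Longrightarrow> (\<lambda>n. drift_integral n t w) \<longlonglongrightarrow> D t"
        "\<And>t. 0 \<le> t \<Longrightarrow> limit t w = x0 + D t + I t w + J t w"
        "\<And>T. 0 \<le> T \<Longrightarrow> uniform_limit {0..T} (\<lambda>n t. euler n t w) (\<lambda>t. limit t w) sequentially"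
      then have "(\<forall>t\<ge>0. (\<lambda>n. drift_integral n t w) \<longlonglongrightarrow> D t) \<and> (\<forall>t\<ge>0. limit t w = x0 + D t + I t w + J t w)"
        "\<forall>T\<ge>0. uniform_limit {0..T} (\<lambda>n t. euler n t w) (\<lambda>t. limit t w) sequentially" by auto
      then show ?case using elim(4) by blast
    qed
  qed
  have "AE w in M. \<forall>n. cadlag (\<lambda>t. euler n t w)" using euler_cadlag by (simp add: AE_all_countable)
  with path have cad: "AE w in M. cadlag (\<lambda>t. limit t w)"
  proof eventually_elim
    case (elim w)
    show ?case
    proof (rule cadlag_uniform_limit[where f="\<lambda>n t. euler n t w"])
      show "cadlag (\<lambda>t. euler n t w)" for n using elim(2) by (rule spec)
      show "uniform_limit {0..T} (\<lambda>n t. euler n t w) (\<lambda>t. limit t w) sequentially" if "0 \<le> T" for T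
        using elim(1) that by blast
    qed
  qed
  have lM: "limit t \<in> borel_measurable M" if "0 \<le> t" for t using N1.measurable_F_M[OF limit_adapted[OF that]] .
  define X where "X = right_version limit"
  have Xm: "(\<lambda>(r, w). X r w) \<in> borel_measurable (borel \<Otimes>\<^sub>M M)"
    unfolding X_def by (rule borel_measurable_versions(1)[OF lM])
  have eq: "AE w in M. \<forall>t\<ge>0. limit t w = x0 + (LINT r:{0<..t}|lborel. b (X r w)) + I t w + J t w"
    using path cad
  proof eventually_elim
    case (elim w)
    then obtain D where D: "\<And>t. 0 \<le> t \<Longrightarrow> (\<lambda>n. drift_integral n t w) \<longlonglongrightarrow> D t" "\<And>t. 0 \<le> t \<Longrightarrow> limit t w = x0 + D t + I t w + J t w"
      and u: "\<And>T. 0 \<le> T \<Longrightarrow> uniform_limit {0..T} (\<lambda>n t. euler n t w) (\<lambda>t. limit t w) sequentially" and o: "w \<in> space M" by blast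
    have Xsec[measurable]: "(\<lambda>r. X r w) \<in> borel_measurable borel" using measurable_compose[OF _ Xm, of "\<lambda>r. (r, w)"] o by simp
    have dsec[measurable]: "(\<lambda>r. drift n r w) \<in> borel_measurable borel" for n using measurable_compose[OF _ drift_measurable, of "\<lambda>r. (r, w)"] o by simp
    have "D t = (LINT r:{0<..t}|lborel. b (X r w))" if t: "0 \<le> t" for t
    proof -
      have "(\<lambda>n. LINT r:{0<..t}|lborel. drift n r w) \<longlonglongrightarrow> (LINT r:{0<..t}|lborel. b (X r w))"
        unfolding set_lebesgue_integral_def
      proof (rule integral_dominated_convergence[where w="\<lambda>r. indicator {0<..t} r * sqrt L"])
        show "AE r in lborel. (\<lambda>n. indicat_real {0<..t} r *\<^sub>R drift n r w) \<longlonglongrightarrow> indicat_real {0<..t} r *\<^sub>R b (X r w)"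
          using cadlag_AE_left_limit[OF elim(2)]
        proof eventually_elim
          case (elim r)
          show ?case
          proof (cases "0 < r")
            case True
            have "X r w = left_limit (\<lambda>t. limit t w) r"
              using right_version_eq[of limit w r] \<open>cadlag (\<lambda>t. limit t w)\<close> elim True by (simp add: X_def)
            then have "(\<lambda>n. euler_step n r w) \<longlonglongrightarrow> X r w" using euler_step_tendsto[OF u \<open>cadlag (\<lambda>t. limit t w)\<close> True] by simp
            then have bl: "(\<lambda>n. b (euler_step n r w)) \<longlonglongrightarrow> b (X r w)"
              by (rule continuous_on_tendsto_compose[OF b_continuous]) auto
            have "\<forall>\<^sub>F n in sequentially. b (euler_step n r w) = drift n r w"
              using eventually_ge_at_top[of "nat \<lceil>r\<rceil>"]
            proof eventually_elim
              case (elim n)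
              then have "r \<le> real n" by linarith
              then show ?case using drift_eq[OF True] by simp
            qed
            then have "(\<lambda>n. drift n r w) \<longlonglongrightarrow> b (X r w)" by (rule Lim_transform_eventually[OF bl])
            then show ?thesis by (intro tendsto_intros)
          qed simp
        qed
        show "AE r in lborel. norm (indicat_real {0<..t} r *\<^sub>R drift n r w) \<le> indicator {0<..t} r * sqrt L" for n
          using drift_norm[of n _ w] by (intro AE_I2) (auto simp: indicator_def)
      qed auto
      then have "(\<lambda>n. drift_integral n t w) \<longlonglongrightarrow> (LINT r:{0<..t}|lborel. b (X r w))" by (simp add: drift_integral_eq[OF t])
      then show ?thesis using D(1)[OF t] LIMSEQ_unique by blast
    qed
    then show ?case using D(2) by simp
  qed
  have stp: "AE w in M. \<forall>r>0. (\<lambda>n. euler_step n r w) \<longlonglongrightarrow> left_version limit r w"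
    using path cad
  proof eventually_elim
    case (elim w)
    then show ?case using euler_step_tendsto[of w] left_version_eq[of limit w] by simp
  qed
  have ver: "AE r in lborel. AE w in M. 0 < r \<longrightarrow> left_version limit r w = right_version limit r w"
    by (rule N1.AE_left_version_eq[OF _ cad]) (rule lM)
  have lim: "AE r in lborel. 0 < r \<longrightarrow> (AE w in M. (\<lambda>n. euler_step n r w) \<longlonglongrightarrow> X r w)"
    using ver
  proof eventually_elim
    case (elim r)
    show ?case
    proof
      assume r: "0 < r"
      show "AE w in M. (\<lambda>n. euler_step n r w) \<longlonglongrightarrow> X r w"
        using elim stp
      proof eventually_elim
        case (elim w)
        have "(\<lambda>n. euler_step n r w) \<longlonglongrightarrow> left_version limit r w" using elim(2) r by blast
        then show ?case using elim(1) r by (simp add: X_def)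
      qed
    qed
  qed
  note gX = g_compose_measurable[OF Xm]
  have L10: "2 * (4 * L) + 2 * L = 10 * L" by simp
  have NI1: "noise_integral M F \<nu>1 R1 (\<lambda>r u w. g1 (X r w) u) I"
    unfolding noise_integral_def
  proof (intro conjI allI impI exI[of _ "\<lambda>n. hs1 n"])
    show "I t \<in> borel_measurable M" if "0 \<le> t" for t using N1.measurable_F_M[OF IJ(1)[OF that]] .
    show "simple_jump_integrand M F \<nu>1 (hs1 n)" for n by (rule simple1)
    fix T :: real assume T: "0 \<le> T"
    show "(\<lambda>n. sq_norm M (\<lambda>w. step_integral R1 (hs1 n) T w - I T w)) \<longlonglongrightarrow> 0" by (rule lI[OF T])
    show "(\<lambda>n. energy M \<nu>1 0 T (\<lambda>r u w. simple_jump_value (hs1 n) r u w - g1 (X r w) u)) \<longlonglongrightarrow> 0"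
    proof (rule N1.energy_tendsto_0[where c="10 * L"])
      show "(\<lambda>(r, u, w). simple_jump_value (hs1 n) r u w - g1 (X r w) u) \<in> borel_measurable (borel \<Otimes>\<^sub>M \<nu>1 \<Otimes>\<^sub>M M)" for n
        using borel_measurable_diff[OF N1.simple_value_measurable[OF simple1[of n n]] gX(1)] by (simp add: case_prod_unfold)
      show "\<forall>w\<in>space M. sq_norm \<nu>1 (\<lambda>u. simple_jump_value (hs1 n) r u w - g1 (X r w) u) \<le> ennreal (10 * L)" for n r
        unfolding L10[symmetric]
        using value_bound1 N1.energy_measurable(4)[OF N1.simple_value_measurable[OF simple1]] g_section(1) g1_bound L_pos
        by (intro ballI nn_diff_sq_le) auto
      show "AE r in lborel. 0 < r \<longrightarrow> (AE w in M. (\<lambda>n. sq_norm \<nu>1 (\<lambda>u. simple_jump_value (hs1 n) r u w - g1 (X r w) u)) \<longlonglongrightarrow> 0)"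
        using lim
      proof eventually_elim
        case (elim r)
        show ?case
        proof
          assume r: "0 < r"
          with elim have "AE w in M. (\<lambda>n. euler_step n r w) \<longlonglongrightarrow> X r w" by simp
          then show "AE w in M. (\<lambda>n. sq_norm \<nu>1 (\<lambda>u. simple_jump_value (hs1 n) r u w - g1 (X r w) u)) \<longlonglongrightarrow> 0"
            by eventually_elim (rule integrand_limit(1)[OF r])
        qed
      qed
    qed
  qed
  have NI2: "noise_integral M F \<nu>2 R2 (\<lambda>r u w. g2 (X r w) u) J"
    unfolding noise_integral_def
  proof (intro conjI allI impI exI[of _ "\<lambda>n. hs2 n"])
    show "J t \<in> borel_measurable M" if "0 \<le> t" for t using N1.measurable_F_M[OF IJ(2)[OF that]] .
    show "simple_jump_integrand M F \<nu>2 (hs2 n)" for n by (rule simple2)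
    fix T :: real assume T: "0 \<le> T"
    show "(\<lambda>n. sq_norm M (\<lambda>w. step_integral R2 (hs2 n) T w - J T w)) \<longlonglongrightarrow> 0" by (rule lJ[OF T])
    show "(\<lambda>n. energy M \<nu>2 0 T (\<lambda>r u w. simple_jump_value (hs2 n) r u w - g2 (X r w) u)) \<longlonglongrightarrow> 0"
    proof (rule N2.energy_tendsto_0[where c="10 * L"])
      show "(\<lambda>(r, u, w). simple_jump_value (hs2 n) r u w - g2 (X r w) u) \<in> borel_measurable (borel \<Otimes>\<^sub>M \<nu>2 \<Otimes>\<^sub>M M)" for n
        using borel_measurable_diff[OF N2.simple_value_measurable[OF simple2[of n n]] gX(2)] by (simp add: case_prod_unfold)
      show "\<forall>w\<in>space M. sq_norm \<nu>2 (\<lambda>u. simple_jump_value (hs2 n) r u w - g2 (X r w) u) \<le> ennreal (10 * L)" for n r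
        unfolding L10[symmetric]
        using value_bound2 N2.energy_measurable(4)[OF N2.simple_value_measurable[OF simple2]] g_section(2) g2_bound L_pos
        by (intro ballI nn_diff_sq_le) auto
      show "AE r in lborel. 0 < r \<longrightarrow> (AE w in M. (\<lambda>n. sq_norm \<nu>2 (\<lambda>u. simple_jump_value (hs2 n) r u w - g2 (X r w) u)) \<longlonglongrightarrow> 0)"
        using lim
      proof eventually_elim
        case (elim r)
        show ?case
        proof
          assume r: "0 < r"
          with elim have "AE w in M. (\<lambda>n. euler_step n r w) \<longlonglongrightarrow> X r w" by simp
          then show "AE w in M. (\<lambda>n. sq_norm \<nu>2 (\<lambda>u. simple_jump_value (hs2 n) r u w - g2 (X r w) u)) \<longlonglongrightarrow> 0"
            by eventually_elim (rule integrand_limit(2)[OF r])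
        qed
      qed
    qed
  qed
  have "strong_sol x0 limit I J"
    unfolding strong_sol_def using limit_adapted cad NI1 NI2 eq by (auto simp: adapted_process_def X_def)
  moreover have "adapted_process F I" "adapted_process F J" using IJ by (simp_all add: adapted_process_def)
  ultimately show ?thesis using uI uJ by (intro exI[of _ I] exI[of _ J] conjI)
qed

end

context sde
begin

text \<open>\<open>kernel_approximation\<close>, fed with the modulus of the coefficients, supplies
  the kernels of a scheme for every \<open>n\<close>. The sequences \<open>hs1\<close> and
  \<open>hs2\<close> are handed on because the path regularity of \<open>I\<close> and
  \<open>J\<close> depends on the driver and is derived outside this locale.\<close>

theorem strong_sol_exists:
  "\<exists>X I J hs1 hs2. strong_sol x X I J \<and> adapted_process F I \<and> adapted_process F J \<and>
     (\<forall>n::nat. simple_jump_integrand M F \<nu>1 (hs1 n)) \<and> (\<forall>n::nat. simple_jump_integrand M F \<nu>2 (hs2 n)) \<and>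
     (AE w in M. \<forall>T\<ge>0. uniform_limit {0..T} (\<lambda>n t. step_integral R1 (hs1 n) t w) (\<lambda>t. I t w) sequentially) \<and>
     (AE w in M. \<forall>T\<ge>0. uniform_limit {0..T} (\<lambda>n t. step_integral R2 (hs2 n) t w) (\<lambda>t. J t w) sequentially)"
proof -
  have nn: "0 \<le> L" "0 \<le> K" "0 \<le> 2 * sqrt L" using L_pos K_pos by auto
  have "\<forall>n. \<exists>As. simple_kernel \<nu>1 As \<and> (\<forall>y. sq_norm \<nu>1 (\<lambda>u. kernel_value As y u) \<le> ennreal (4 * L)) \<and>
    (\<forall>y. sq_norm \<nu>1 (\<lambda>u. kernel_value As y u - g1 y u) \<le> ennreal ((1 + 10 * L * (norm y)\<^sup>2) * (1 / 16) ^ n))"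
    using kernel_approximation[OF g_section(1) g1_bound nn g_modulus_nn(1)] by blast
  from choice[OF this] obtain A1 where A1: "\<forall>n. simple_kernel \<nu>1 (A1 n) \<and> (\<forall>y. sq_norm \<nu>1 (\<lambda>u. kernel_value (A1 n) y u) \<le> ennreal (4 * L)) \<and>
    (\<forall>y. sq_norm \<nu>1 (\<lambda>u. kernel_value (A1 n) y u - g1 y u) \<le> ennreal ((1 + 10 * L * (norm y)\<^sup>2) * (1 / 16) ^ n))" ..
  have "\<forall>n. \<exists>As. simple_kernel \<nu>2 As \<and> (\<forall>y. sq_norm \<nu>2 (\<lambda>u. kernel_value As y u) \<le> ennreal (4 * L)) \<and>
    (\<forall>y. sq_norm \<nu>2 (\<lambda>u. kernel_value As y u - g2 y u) \<le> ennreal ((1 + 10 * L * (norm y)\<^sup>2) * (1 / 16) ^ n))"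
    using kernel_approximation[OF g_section(2) g2_bound nn g_modulus_nn(2)] by blast
  from choice[OF this] obtain A2 where A2: "\<forall>n. simple_kernel \<nu>2 (A2 n) \<and> (\<forall>y. sq_norm \<nu>2 (\<lambda>u. kernel_value (A2 n) y u) \<le> ennreal (4 * L)) \<and>
    (\<forall>y. sq_norm \<nu>2 (\<lambda>u. kernel_value (A2 n) y u - g2 y u) \<le> ennreal ((1 + 10 * L * (norm y)\<^sup>2) * (1 / 16) ^ n))" ..
  interpret E: euler_scheme M F \<nu>1 R1 \<nu>2 R2 b g1 g2 K L x A1 A2
    by unfold_locales (use A1 A2 in simp_all)
  from E.limit_solution obtain I J where "strong_sol x E.limit I J" "adapted_process F I" "adapted_process F J"
    "AE w in M. \<forall>T\<ge>0. uniform_limit {0..T} (\<lambda>n t. step_integral R1 (E.hs1 n) t w) (\<lambda>t. I t w) sequentially"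
    "AE w in M. \<forall>T\<ge>0. uniform_limit {0..T} (\<lambda>n t. step_integral R2 (E.hs2 n) t w) (\<lambda>t. J t w) sequentially"
    by (elim exE conjE)
  then show ?thesis
    by (intro exI[of _ E.limit] exI[of _ I] exI[of _ J] exI[of _ "\<lambda>n. E.hs1 n"] exI[of _ "\<lambda>n. E.hs2 n"] conjI allI E.simple1 E.simple2)
qed

end

section \<open>The Wiener process and the Poisson random measure as noises\<close>

lemma lborel_prod_integral:
  fixes f :: "'a::euclidean_space \<Rightarrow> real \<Rightarrow> real"
  assumes i: "\<And>b. b \<in> Basis \<Longrightarrow> integrable lborel (f b)"
  shows "integrable lborel (\<lambda>x::'a. \<Prod>b\<in>Basis. f b (x \<bullet> b))"
    and "(\<integral>x. (\<Prod>b\<in>Basis. f b (x \<bullet> b)) \<partial>(lborel :: 'a measure)) = (\<Prod>b\<in>Basis. \<integral>y. f b y \<partial>lborel)"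
proof -
  interpret product_sigma_finite "\<lambda>_::'a. lborel :: real measure" by unfold_locales
  have [measurable]: "f b \<in> borel_measurable borel" if "b \<in> Basis" for b using i[OF that] by simp
  have [measurable]: "(\<lambda>x::'a. \<Prod>b\<in>Basis. f b (x \<bullet> b)) \<in> borel_measurable borel" by measurable
  have [measurable]: "(\<lambda>g. \<Sum>b\<in>Basis. g b *\<^sub>R b) \<in> (\<Pi>\<^sub>M b\<in>(Basis :: 'a set). (lborel :: real measure)) \<rightarrow>\<^sub>M borel"
    by measurable
  have e: "(\<Prod>b\<in>Basis. f b ((\<Sum>b\<in>Basis. g b *\<^sub>R b :: 'a) \<bullet> b)) = (\<Prod>b\<in>Basis. f b (g b))" for g
    by (intro prod.cong) (simp_all add: inner_sum_left_Basis)
  show "integrable lborel (\<lambda>x::'a. \<Prod>b\<in>Basis. f b (x \<bullet> b))"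
    by (subst lborel_eq, subst integrable_distr_eq) (use i in \<open>auto simp: e intro!: product_integrable_prod\<close>)
  show "(\<integral>x. (\<Prod>b\<in>Basis. f b (x \<bullet> b)) \<partial>(lborel :: 'a measure)) = (\<Prod>b\<in>Basis. \<integral>y. f b y \<partial>lborel)"
    by (subst lborel_eq, subst integral_distr) (use i in \<open>auto simp: e intro!: product_integral_prod\<close>)
qed

lemma lborel_prod_integral_vec:
  fixes f :: "'n::finite \<Rightarrow> real \<Rightarrow> real"
  assumes i: "\<And>k. integrable lborel (f k)"
  shows "integrable lborel (\<lambda>x::real^'n. \<Prod>k\<in>UNIV. f k (x $ k))"
    and "(\<integral>x. (\<Prod>k\<in>UNIV. f k (x $ k)) \<partial>(lborel :: (real^'n) measure)) = (\<Prod>k\<in>UNIV. \<integral>y. f k y \<partial>lborel)"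
proof -
  have B: "Basis = range (\<lambda>k::'n. axis k (1::real))" by (auto simp: Basis_vec_def)
  have inj: "inj (\<lambda>k::'n. axis k (1::real))" by (auto simp: inj_on_def axis_eq_axis)
  \<comment> \<open>\<open>SOME k\<close> recovers the coordinate of a basis vector, so that factors
    indexed by coordinates become factors indexed by \<open>Basis\<close>.\<close>
  define h where "h = (\<lambda>b::real^'n. f (SOME k. b = axis k 1))"
  have h: "h (axis k 1) = f k" for k unfolding h_def by (simp add: axis_eq_axis)
  have e: "(\<Prod>b\<in>Basis. h b (x \<bullet> b)) = (\<Prod>k\<in>UNIV. f k (x $ k))" for x :: "real^'n"
    unfolding B by (subst prod.reindex[OF inj]) (simp add: h inner_axis)
  have e2: "(\<Prod>b\<in>Basis. \<integral>y. h b y \<partial>lborel) = (\<Prod>k\<in>UNIV. \<integral>y. f k y \<partial>lborel)"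
    unfolding B by (subst prod.reindex[OF inj]) (simp add: h)
  have ih: "integrable lborel (h b)" if "b \<in> Basis" for b using that i by (auto simp: B h)
  show "integrable lborel (\<lambda>x::real^'n. \<Prod>k\<in>UNIV. f k (x $ k))" using lborel_prod_integral(1)[of h] ih by (simp add: e)
  show "(\<integral>x. (\<Prod>k\<in>UNIV. f k (x $ k)) \<partial>(lborel :: (real^'n) measure)) = (\<Prod>k\<in>UNIV. \<integral>y. f k y \<partial>lborel)"
    using lborel_prod_integral(2)[of h] ih by (simp add: e e2)
qed

text \<open>Each moment is a product of one-dimensional integrals: \<open>f1\<close> and
  \<open>f2\<close> absorb the factors \<open>x $ i\<close> and \<open>x $ j\<close> into the
  densities of the coordinates concerned. If \<open>i\<close> and \<open>j\<close> differ, a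
  vanishing first moment appears as a factor.\<close>

lemma gaussian_vector_moments:
  fixes X :: "'a \<Rightarrow> real^'n::finite"
  assumes D: "distributed M lborel X (\<lambda>x. ennreal (\<Prod>k\<in>UNIV. normal_density 0 s (x $ k)))" and s: "0 < s"
  shows "integrable M (\<lambda>w. X w $ i)" "(\<integral>w. X w $ i \<partial>M) = 0"
    and "integrable M (\<lambda>w. X w $ i * X w $ j)" "(\<integral>w. X w $ i * X w $ j \<partial>M) = (if i = j then s\<^sup>2 else 0)"
proof -
  have nn: "0 \<le> (\<Prod>k\<in>UNIV. normal_density 0 s (x $ k))" for x :: "real^'n" by (intro prod_nonneg) simp
  have i0: "integrable lborel (\<lambda>y. normal_density 0 s y)" "(\<integral>y. normal_density 0 s y \<partial>lborel) = 1" using s by auto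
  have i1: "integrable lborel (\<lambda>y. normal_density 0 s y * y)" "(\<integral>y. normal_density 0 s y * y \<partial>lborel) = 0"
    using s integrable_normal_moment_nz_1[of s 0] integral_normal_moment_nz_1[of s 0] by auto
  have i2: "integrable lborel (\<lambda>y. normal_density 0 s y * y\<^sup>2)" "(\<integral>y. normal_density 0 s y * y\<^sup>2 \<partial>lborel) = s\<^sup>2"
    using s integrable_normal_moment[of s 0 2] integral_normal_moment_even[of s 0 1] by (auto simp: fact_numeral power2_eq_square)
  define f1 where "f1 k y = normal_density 0 s y * (if k = i then y else 1)" for k y
  have f1: "integrable lborel (f1 k)" "(\<integral>y. f1 k y \<partial>lborel) = (if k = i then 0 else 1)" for k
  proof -
    have "f1 k = (if k = i then (\<lambda>y. normal_density 0 s y * y) else normal_density 0 s)" by (auto simp: f1_def)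
    then show "integrable lborel (f1 k)" "(\<integral>y. f1 k y \<partial>lborel) = (if k = i then 0 else 1)" using i0 i1 by simp_all
  qed
  have e1: "(\<Prod>k\<in>UNIV. f1 k (x $ k)) = (\<Prod>k\<in>UNIV. normal_density 0 s (x $ k)) * x $ i" for x :: "real^'n"
    unfolding f1_def prod.distrib by (simp add: prod.delta)
  have F1: "integrable lborel (\<lambda>x::real^'n. (\<Prod>k\<in>UNIV. normal_density 0 s (x $ k)) * x $ i)"
    "(\<integral>x. (\<Prod>k\<in>UNIV. normal_density 0 s (x $ k)) * x $ i \<partial>(lborel :: (real^'n) measure)) = 0"
    using lborel_prod_integral_vec[of f1] f1 by (simp_all add: e1)
  show "integrable M (\<lambda>w. X w $ i)" using distributed_integrable[OF D, of "\<lambda>x. x $ i"] nn F1 by simp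
  show "(\<integral>w. X w $ i \<partial>M) = 0" using distributed_integral[OF D, of "\<lambda>x. x $ i"] nn F1 by simp
  define f2 where "f2 k y = normal_density 0 s y * ((if k = i then y else 1) * (if k = j then y else 1))" for k y
  have f2: "integrable lborel (f2 k)" "(\<integral>y. f2 k y \<partial>lborel) = (if k = i then if k = j then s\<^sup>2 else 0 else if k = j then 0 else 1)" for k
  proof -
    have "f2 k = (if k = i then if k = j then (\<lambda>y. normal_density 0 s y * y\<^sup>2) else (\<lambda>y. normal_density 0 s y * y)
        else if k = j then (\<lambda>y. normal_density 0 s y * y) else normal_density 0 s)"
      by (auto simp: f2_def power2_eq_square)
    then show "integrable lborel (f2 k)" "(\<integral>y. f2 k y \<partial>lborel) = (if k = i then if k = j then s\<^sup>2 else 0 else if k = j then 0 else 1)"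
      using i0 i1 i2 by simp_all
  qed
  have e2: "(\<Prod>k\<in>UNIV. f2 k (x $ k)) = (\<Prod>k\<in>UNIV. normal_density 0 s (x $ k)) * (x $ i * x $ j)" for x :: "real^'n"
    unfolding f2_def prod.distrib by (simp add: prod.delta)
  have p2: "(\<Prod>k\<in>UNIV. if k = i then if k = j then s\<^sup>2 else 0 else if k = j then 0 else 1) = (if i = j then s\<^sup>2 else 0)"
  proof (cases "i = j")
    case True
    then have "(\<Prod>k\<in>UNIV. if k = i then if k = j then s\<^sup>2 else 0 else if k = j then 0 else 1) = (\<Prod>k\<in>UNIV. if k = i then s\<^sup>2 else 1)"
      by (intro prod.cong) auto
    then show ?thesis using True by (simp add: prod.delta)
  next
    case False
    then show ?thesis by (auto intro!: prod_zero bexI[of _ i])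
  qed
  have F2: "integrable lborel (\<lambda>x::real^'n. (\<Prod>k\<in>UNIV. normal_density 0 s (x $ k)) * (x $ i * x $ j))"
    "(\<integral>x. (\<Prod>k\<in>UNIV. normal_density 0 s (x $ k)) * (x $ i * x $ j) \<partial>(lborel :: (real^'n) measure)) = (if i = j then s\<^sup>2 else 0)"
    using lborel_prod_integral_vec[of f2] f2 by (simp_all add: e2 p2)
  show "integrable M (\<lambda>w. X w $ i * X w $ j)" using distributed_integrable[OF D, of "\<lambda>x. x $ i * x $ j"] nn F2 by simp
  show "(\<integral>w. X w $ i * X w $ j \<partial>M) = (if i = j then s\<^sup>2 else 0)"
    using distributed_integral[OF D, of "\<lambda>x. x $ i * x $ j"] nn F2 by simp
qed

text \<open>The marks are the coordinates with counting measure; the covariance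
  \<open>(t - s) * card (A \<inter> B)\<close> says that distinct coordinates are uncorrelated and
  each has variance \<open>t - s\<close>.\<close>

definition wiener_noise :: "(real \<Rightarrow> 'w \<Rightarrow> real^'d) \<Rightarrow> 'd set \<Rightarrow> real \<Rightarrow> 'w \<Rightarrow> real" where
  "wiener_noise W A t w = (\<Sum>j\<in>A. W t w $ j)"

text \<open>The Gaussian law gives the moments of an increment, and independence of the past gives
  the factorisation against \<open>\<eta>\<close>. Both are available for \<open>s < t\<close>, so
  equal times, where the increments vanish, are treated apart.\<close>

lemma wiener_is_noise:
  fixes W :: "real \<Rightarrow> 'w \<Rightarrow> real^'d::finite"
  assumes F: "filtered_prob_space M F" and W: "wiener_process M F W"
  shows "noise M F (count_space UNIV) (wiener_noise W)"
proof -
  interpret prob_space M using F by (simp add: filtered_prob_space_def)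
  interpret P: filtered_prob M F by unfold_locales (rule F)
  have ad: "W t \<in> borel_measurable (F t)" if "0 \<le> t" for t using W that by (simp add: wiener_process_def adapted_process_def)
  have Wm: "W t \<in> borel_measurable M" if "0 \<le> t" for t using P.measurable_F_M[OF ad[OF that]] .
  have cont: "AE w in M. continuous_on {0..} (\<lambda>t. W t w)" using W by (simp add: wiener_process_def)
  define \<Delta> where "\<Delta> s t w = W t w - W s w" for s t w
  have \<Delta>m: "\<Delta> s t \<in> borel_measurable M" if "0 \<le> s" "s \<le> t" for s t
    unfolding \<Delta>_def[abs_def] using that by (intro borel_measurable_diff Wm) auto
  have dist: "distributed M lborel (\<Delta> s t) (\<lambda>x. ennreal (\<Prod>k\<in>UNIV. normal_density 0 (sqrt (t - s)) (x $ k)))"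
    and ind: "indep_set (sets (F s)) {\<Delta> s t -` B \<inter> space M | B. B \<in> sets borel}" if "0 \<le> s" "s < t" for s t
    using W that unfolding wiener_process_def \<Delta>_def[abs_def] by auto
  have mom: "integrable M (\<lambda>w. \<Delta> s t w $ i)" "expectation (\<lambda>w. \<Delta> s t w $ i) = 0"
    "integrable M (\<lambda>w. \<Delta> s t w $ i * \<Delta> s t w $ j)" "expectation (\<lambda>w. \<Delta> s t w $ i * \<Delta> s t w $ j) = (if i = j then t - s else 0)"
    if st: "0 \<le> s" "s \<le> t" for s t i j
  proof -
    have "integrable M (\<lambda>w. \<Delta> s t w $ i) \<and> expectation (\<lambda>w. \<Delta> s t w $ i) = 0 \<and>
      integrable M (\<lambda>w. \<Delta> s t w $ i * \<Delta> s t w $ j) \<and> expectation (\<lambda>w. \<Delta> s t w $ i * \<Delta> s t w $ j) = (if i = j then t - s else 0)"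
    proof (cases "s = t")
      case True then show ?thesis by (simp add: \<Delta>_def)
    next
      case False
      then have "s < t" "0 < sqrt (t - s)" using st by auto
      then show ?thesis using gaussian_vector_moments[OF dist[OF st(1)]] st by auto
    qed
    then show "integrable M (\<lambda>w. \<Delta> s t w $ i)" "expectation (\<lambda>w. \<Delta> s t w $ i) = 0"
    "integrable M (\<lambda>w. \<Delta> s t w $ i * \<Delta> s t w $ j)" "expectation (\<lambda>w. \<Delta> s t w $ i * \<Delta> s t w $ j) = (if i = j then t - s else 0)"
      by auto
  qed
  have inc: "wiener_noise W A t w - wiener_noise W A s w = (\<Sum>j\<in>A. \<Delta> s t w $ j)" for A s t w
    by (simp add: wiener_noise_def \<Delta>_def sum_subtractf)
  have prod2: "(\<Sum>i\<in>A. \<Delta> s t w $ i) * (\<Sum>j\<in>B. \<Delta> s t w $ j) = (\<Sum>i\<in>A. \<Sum>j\<in>B. \<Delta> s t w $ i * \<Delta> s t w $ j)" for A B s t w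
    by (rule sum_product)
  have indep_mult: "integrable M (\<lambda>w. \<eta> w * f (\<Delta> s t w)) \<and> expectation (\<lambda>w. \<eta> w * f (\<Delta> s t w)) = expectation \<eta> * expectation (\<lambda>w. f (\<Delta> s t w))"
    if st: "0 \<le> s" "s < t" and \<eta>: "\<eta> \<in> borel_measurable (F s)" and C: "\<And>w. w \<in> space M \<Longrightarrow> \<bar>\<eta> w\<bar> \<le> C"
      and f: "f \<in> borel_measurable borel" and i: "integrable M (\<lambda>w. f (\<Delta> s t w))" for s t \<eta> C and f :: "real^'d \<Rightarrow> real"
  proof -
    \<comment> \<open>The sets of this sigma-algebra are exactly the family whose independence of
      \<open>F s\<close> is assumed.\<close>
    define G where "G = vimage_algebra (space M) (\<Delta> s t) borel"
    have sG: "sets G = {\<Delta> s t -` B \<inter> space M | B. B \<in> sets borel}" unfolding G_def by (rule sets_vimage_algebra2) simp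
    have sub: "subalgebra M G"
      using \<Delta>m[of s t] st by (auto simp: subalgebra_def sG) (simp_all add: G_def)
    have "\<Delta> s t \<in> G \<rightarrow>\<^sub>M borel" unfolding G_def by (rule measurable_vimage_algebra1) simp
    then have fG: "(\<lambda>w. f (\<Delta> s t w)) \<in> borel_measurable G" using f by (rule measurable_compose)
    have i\<eta>: "integrable M \<eta>"
      by (rule integrable_const_bound[where B=C]) (use C P.measurable_F_M[OF \<eta>] in \<open>auto intro!: AE_I2\<close>)
    show ?thesis
      using indep_set_integral_mult[OF ind[OF st, folded sG] P.subalgebra_F sub \<eta> fG i\<eta> i] by simp
  qed
  show ?thesis
  proof unfold_locales
    fix A :: "'d set" and t :: real assume "0 \<le> t"
    then show "wiener_noise W A t \<in> borel_measurable (F t)"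
      unfolding wiener_noise_def[abs_def] by (intro borel_measurable_sum measurable_compose[OF ad borel_measurable_nth])
  next
    fix A :: "'d set" and s t :: real assume st: "0 \<le> s" "s \<le> t"
    show "integrable M (\<lambda>w. (wiener_noise W A t w - wiener_noise W A s w)\<^sup>2)"
      unfolding inc power2_eq_square prod2 by (intro Bochner_Integration.integrable_sum mom st)
  next
    fix A :: "'d set" and s t C :: real and \<eta> :: "'w \<Rightarrow> real"
    assume st: "0 \<le> s" "s \<le> t" and \<eta>: "\<eta> \<in> borel_measurable (F s)" and C: "\<And>w. w \<in> space M \<Longrightarrow> \<bar>\<eta> w\<bar> \<le> C"
    show "expectation (\<lambda>w. \<eta> w * (wiener_noise W A t w - wiener_noise W A s w)) = 0"
    proof (cases "s = t")
      case False
      have i: "integrable M (\<lambda>w. \<Sum>j\<in>A. \<Delta> s t w $ j)" by (intro Bochner_Integration.integrable_sum mom st)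
      have "expectation (\<lambda>w. \<eta> w * (\<Sum>j\<in>A. \<Delta> s t w $ j)) = expectation \<eta> * expectation (\<lambda>w. \<Sum>j\<in>A. \<Delta> s t w $ j)"
        by (rule conjunct2[OF indep_mult[of s t \<eta> C "\<lambda>x. \<Sum>j\<in>A. x $ j"]]) (use st False \<eta> C i in auto)
      also have "expectation (\<lambda>w. \<Sum>j\<in>A. \<Delta> s t w $ j) = 0"
        using mom(1,2)[OF st] by (simp add: Bochner_Integration.integral_sum)
      finally show ?thesis by (simp add: inc)
    qed simp
  next
    fix A B :: "'d set" and s t C :: real and \<eta> :: "'w \<Rightarrow> real"
    assume st: "0 \<le> s" "s \<le> t" and \<eta>: "\<eta> \<in> borel_measurable (F s)" and C: "\<And>w. w \<in> space M \<Longrightarrow> \<bar>\<eta> w\<bar> \<le> C"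
    show "expectation (\<lambda>w. \<eta> w * ((wiener_noise W A t w - wiener_noise W A s w) * (wiener_noise W B t w - wiener_noise W B s w)))
        = expectation \<eta> * ((t - s) * measure (count_space UNIV) (A \<inter> B))"
    proof (cases "s = t")
      case False
      have i: "integrable M (\<lambda>w. \<Sum>i\<in>A. \<Sum>j\<in>B. \<Delta> s t w $ i * \<Delta> s t w $ j)"
        by (intro Bochner_Integration.integrable_sum mom st)
      have "expectation (\<lambda>w. \<eta> w * (\<Sum>i\<in>A. \<Sum>j\<in>B. \<Delta> s t w $ i * \<Delta> s t w $ j))
          = expectation \<eta> * expectation (\<lambda>w. \<Sum>i\<in>A. \<Sum>j\<in>B. \<Delta> s t w $ i * \<Delta> s t w $ j)"
        by (rule conjunct2[OF indep_mult[of s t \<eta> C "\<lambda>x. \<Sum>i\<in>A. \<Sum>j\<in>B. x $ i * x $ j"]]) (use st False \<eta> C i in auto)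
      also have "expectation (\<lambda>w. \<Sum>i\<in>A. \<Sum>j\<in>B. \<Delta> s t w $ i * \<Delta> s t w $ j) = (\<Sum>i\<in>A. \<Sum>j\<in>B. if i = j then t - s else 0)"
        using mom(3,4)[OF st] by (simp add: Bochner_Integration.integral_sum Bochner_Integration.integrable_sum)
      also have "\<dots> = (\<Sum>i\<in>A. if i \<in> B then t - s else 0)" by (intro sum.cong) (simp_all add: sum.delta)
      also have "\<dots> = (\<Sum>i\<in>A \<inter> B. t - s)" by (simp add: sum.inter_restrict[symmetric])
      also have "\<dots> = (t - s) * measure (count_space UNIV) (A \<inter> B)" by (simp add: measure_count_space)
      finally show ?thesis by (simp add: inc prod2)
    qed simp
  next
    fix A :: "'d set"
    show "AE w in M. cadlag (\<lambda>t. wiener_noise W A t w)"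
      using cont
    proof eventually_elim
      case (elim w)
      then show ?case unfolding wiener_noise_def by (intro continuous_imp_cadlag continuous_intros)
    qed
  qed (auto simp: sigma_finite_measure_count_space_finite)
qed

section \<open>Poisson moments and the compensated random measure\<close>

lemma poisson_sums:
  fixes m :: real
  shows "(\<lambda>k. m ^ k / fact k * exp (- m)) sums 1"
    and "(\<lambda>k. real k * (m ^ k / fact k * exp (- m))) sums m"
    and "(\<lambda>k. (real k)\<^sup>2 * (m ^ k / fact k * exp (- m))) sums (m\<^sup>2 + m)"
proof -
  define p where "p k = m ^ k / fact k * exp (- m)" for k
  have "(\<lambda>k. m ^ k / fact k) sums exp m" using exp_converges[of m] by (simp add: divide_inverse mult.commute)
  from sums_mult2[OF this, of "exp (- m)"] have 0: "p sums 1" by (simp add: p_def[abs_def] exp_minus)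
  \<comment> \<open>This recursion reduces each moment to the preceding ones, after a shift of the
    index that drops the vanishing term at 0.\<close>
  have Suc: "real (Suc k) * p (Suc k) = m * p k" for k
    by (simp add: p_def field_simps del: of_nat_Suc)
  have "(\<lambda>k. real (Suc k) * p (Suc k)) sums m" unfolding Suc using sums_mult[OF 0, of m] by simp
  then have 1: "(\<lambda>k. real k * p k) sums m" using sums_Suc_iff[of "\<lambda>k. real k * p k" m] by simp
  have "(real (Suc k))\<^sup>2 * p (Suc k) = m * (real k * p k) + m * p k" for k
  proof -
    have "(real (Suc k))\<^sup>2 * p (Suc k) = real (Suc k) * (m * p k)" unfolding Suc[symmetric] by (simp add: power2_eq_square)
    then show ?thesis by (simp add: algebra_simps)
  qed
  then have "(\<lambda>k. (real (Suc k))\<^sup>2 * p (Suc k)) sums (m * m + m)"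
    using sums_add[OF sums_mult[OF 1, of m] sums_mult[OF 0, of m]] by simp
  then have 2: "(\<lambda>k. (real k)\<^sup>2 * p k) sums (m\<^sup>2 + m)"
    using sums_Suc_iff[of "\<lambda>k. (real k)\<^sup>2 * p k" "m * m + m"] by (simp add: power2_eq_square)
  show "(\<lambda>k. m ^ k / fact k * exp (- m)) sums 1" "(\<lambda>k. real k * (m ^ k / fact k * exp (- m))) sums m"
    "(\<lambda>k. (real k)\<^sup>2 * (m ^ k / fact k * exp (- m))) sums (m\<^sup>2 + m)"
    using 0 1 2 by (simp_all add: p_def[abs_def])
qed

text \<open>The prescribed point masses already sum to 1, so \<open>Y\<close> almost surely takes
  values in the natural numbers; this yields finiteness, and the moments follow by summing
  \<open>f k * prob (A k)\<close>.\<close>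

lemma (in prob_space) poisson_moments:
  fixes Y :: "'a \<Rightarrow> ennreal"
  assumes Y[measurable]: "Y \<in> borel_measurable M"
    and p: "\<And>k::nat. prob {w\<in>space M. Y w = of_nat k} = m ^ k / fact k * exp (- m)"
  shows "AE w in M. Y w \<noteq> \<infinity>"
    and "integrable M (\<lambda>w. enn2real (Y w))" "expectation (\<lambda>w. enn2real (Y w)) = m"
    and "integrable M (\<lambda>w. (enn2real (Y w))\<^sup>2)" "expectation (\<lambda>w. (enn2real (Y w))\<^sup>2) = m\<^sup>2 + m"
proof -
  define A where "A k = {w\<in>space M. Y w = of_nat k}" for k :: nat
  have A[measurable]: "A k \<in> sets M" for k unfolding A_def by measurable
  have disj: "disjoint_family A" by (auto simp: disjoint_family_on_def A_def)
  have pA: "prob (A k) = m ^ k / fact k * exp (- m)" for k using p by (simp add: A_def)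
  have "(\<lambda>k. prob (A k)) sums prob (\<Union>k. A k)" using disj by (intro finite_measure_UNION) auto
  then have "prob (\<Union>k. A k) = 1" unfolding pA using poisson_sums(1)[of m] sums_unique2 by blast
  from AE_prob_1[OF this] have ae: "AE w in M. \<exists>k. w \<in> A k" by simp
  have *: "integrable M (\<lambda>w. f (enn2real (Y w))) \<and> expectation (\<lambda>w. f (enn2real (Y w))) = S"
    if f[measurable]: "f \<in> borel_measurable borel" and f0: "\<And>x. 0 \<le> f x" and S: "(\<lambda>k. f (real k) * prob (A k)) sums S" for f S
  proof -
    have "(\<integral>\<^sup>+w. ennreal (f (enn2real (Y w))) \<partial>M) = (\<integral>\<^sup>+w. (\<Sum>k. ennreal (f (real k)) * indicator (A k) w) \<partial>M)"
    proof (rule nn_integral_cong_AE, use ae in eventually_elim)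
      case (elim w)
      then obtain k where k: "w \<in> A k" by blast
      have "(\<Sum>j. ennreal (f (real j)) * indicator (A j) w) = (\<Sum>j\<in>{k}. ennreal (f (real j)) * indicator (A j) w)"
        using disj k by (intro suminf_finite) (auto simp: disjoint_family_on_def indicator_def)
      moreover have "enn2real (Y w) = real k" using k by (simp add: A_def ennreal_of_nat_eq_real_of_nat)
      ultimately show ?case using k by simp
    qed
    also have "\<dots> = (\<Sum>k. \<integral>\<^sup>+w. ennreal (f (real k)) * indicator (A k) w \<partial>M)" by (rule nn_integral_suminf) simp
    also have "\<dots> = (\<Sum>k. ennreal (f (real k) * prob (A k)))"
      by (simp add: nn_integral_cmult_indicator emeasure_eq_measure ennreal_mult f0)
    also have "\<dots> = ennreal S"
    proof (rule sums_unique[symmetric])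
      have "0 \<le> S" using S f0 by (intro sums_le[OF _ sums_zero S]) auto
      then show "(\<lambda>k. ennreal (f (real k) * prob (A k))) sums ennreal S" using S f0 by (subst sums_ennreal) auto
    qed
    finally have e: "(\<integral>\<^sup>+w. ennreal (f (enn2real (Y w))) \<partial>M) = ennreal S" .
    have S0: "0 \<le> S" using S f0 by (intro sums_le[OF _ sums_zero S]) auto
    have "integrable M (\<lambda>w. f (enn2real (Y w)))" by (rule integrableI_nn_integral_finite[OF _ _ e]) (use f0 in auto)
    moreover have "expectation (\<lambda>w. f (enn2real (Y w))) = S"
      using e f0 S0 by (subst integral_eq_nn_integral) auto
    ultimately show ?thesis ..
  qed
  show "AE w in M. Y w \<noteq> \<infinity>" using ae by eventually_elim (auto simp: A_def)
  have "(\<lambda>k. \<bar>real k\<bar> * prob (A k)) sums m" using poisson_sums(2)[of m] by (simp add: pA)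
  from *[OF _ _ this] show "integrable M (\<lambda>w. enn2real (Y w))" "expectation (\<lambda>w. enn2real (Y w)) = m" by simp_all
  have "(\<lambda>k. (real k)\<^sup>2 * prob (A k)) sums (m\<^sup>2 + m)" using poisson_sums(3)[of m] by (simp add: pA)
  from *[OF _ _ this] show "integrable M (\<lambda>w. (enn2real (Y w))\<^sup>2)" "expectation (\<lambda>w. (enn2real (Y w))\<^sup>2) = m\<^sup>2 + m" by simp_all
qed

lemma box_jump_intensity:
  assumes "sigma_finite_measure \<nu>" "A \<in> fmeasurable \<nu>" "0 \<le> s"
  shows "{s<..t} \<times> A \<in> fmeasurable (jump_intensity \<nu>)"
    and "s \<le> t \<Longrightarrow> measure (jump_intensity \<nu>) ({s<..t} \<times> A) = (t - s) * measure \<nu> A"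
    and "{s<..<t} \<times> A \<in> sets (jump_intensity \<nu>)"
proof -
  interpret sigma_finite_measure \<nu> by fact
  have A: "A \<in> sets \<nu>" "emeasure \<nu> A = ennreal (measure \<nu> A)"
    using assms(2) by (auto simp: fmeasurable_def emeasure_eq_ennreal_measure)
  have S: "{s<..t} \<in> sets (restrict_space lborel {0..})" "{s<..<t} \<in> sets (restrict_space lborel {0..})"
    using assms(3) by (auto simp: sets_restrict_space_iff)
  have "emeasure (restrict_space lborel {0..}) {s<..t} = emeasure lborel {s<..t}"
    using assms(3) by (intro emeasure_restrict_space) auto
  then have e: "emeasure (jump_intensity \<nu>) ({s<..t} \<times> A) = emeasure lborel {s<..t} * ennreal (measure \<nu> A)"
    unfolding jump_intensity_def using emeasure_pair_measure_Times[OF S(1) A(1)] A(2) by simp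
  show "{s<..t} \<times> A \<in> fmeasurable (jump_intensity \<nu>)"
  proof (rule fmeasurableI)
    show "{s<..t} \<times> A \<in> sets (jump_intensity \<nu>)" unfolding jump_intensity_def using S A by auto
    show "emeasure (jump_intensity \<nu>) ({s<..t} \<times> A) < \<infinity>" unfolding e
      by (cases "s \<le> t") (auto simp: ennreal_mult_less_top)
  qed
  show "{s<..<t} \<times> A \<in> sets (jump_intensity \<nu>)" unfolding jump_intensity_def using S A by auto
  assume "s \<le> t"
  then show "measure (jump_intensity \<nu>) ({s<..t} \<times> A) = (t - s) * measure \<nu> A"
    unfolding measure_def[of "jump_intensity \<nu>"] e by (simp add: enn2real_mult)
qed

text \<open>Continuity of the measure from above gives right-continuity, and continuity from below
  gives the left limit, which is the mass of the box open at \<open>t\<close>. Finiteness at integer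
  horizons bounds every box.\<close>

lemma measure_box_cadlag:
  assumes \<nu>: "sigma_finite_measure \<nu>" and A: "A \<in> fmeasurable \<nu>" and Q: "sets Q = sets (jump_intensity \<nu>)"
    and fin: "\<And>n::nat. emeasure Q ({0<..real n} \<times> A) \<noteq> \<infinity>"
  shows "cadlag (\<lambda>t. measure Q ({0<..t} \<times> A))"
proof (rule cadlagI[where l="\<lambda>t. measure Q ({0<..<t} \<times> A)"])
  have sQ: "{0<..t} \<times> A \<in> sets Q" "{0<..<t} \<times> A \<in> sets Q" for t
    using box_jump_intensity(1,3)[OF \<nu> A order_refl, of t] unfolding Q by (auto simp: fmeasurable_def)
  have fin': "emeasure Q B \<noteq> \<infinity>" if "B \<subseteq> {0<..t} \<times> A" for B t
  proof -
    have "emeasure Q B \<le> emeasure Q ({0<..real (nat \<lceil>t\<rceil>)} \<times> A)"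
    proof (rule emeasure_mono)
      have "t \<le> real (nat \<lceil>t\<rceil>)" by linarith
      then have "{0<..t} \<times> A \<subseteq> {0<..real (nat \<lceil>t\<rceil>)} \<times> A" by (intro Sigma_mono) (auto intro: order_trans[OF _ le_of_int_ceiling])
      then show "B \<subseteq> {0<..real (nat \<lceil>t\<rceil>)} \<times> A" using that by (rule order_trans[rotated])
    qed (rule sQ)
    then show ?thesis using fin[of "nat \<lceil>t\<rceil>"] by (auto simp: top_unique)
  qed
  fix t :: real
  {
    assume t: "0 \<le> t"
    show "((\<lambda>t. measure Q ({0<..t} \<times> A)) \<longlongrightarrow> measure Q ({0<..t} \<times> A)) (at_right t)"
    proof (rule tendsto_at_right_sequentially[where b="t + 1"])
      fix S assume S: "\<And>n. t < S n" "decseq S" "S \<longlonglongrightarrow> t"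
      have "(\<lambda>n. measure Q ({0<..S n} \<times> A)) \<longlonglongrightarrow> measure Q (\<Inter>n. {0<..S n} \<times> A)"
      proof (rule Lim_measure_decseq)
        show "decseq (\<lambda>n. {0<..S n} \<times> A)" using S(2) by (fastforce simp: decseq_def intro: order_trans)
        show "emeasure Q ({0<..S n} \<times> A) \<noteq> \<infinity>" for n by (rule fin'[OF order_refl])
      qed (use sQ in auto)
      moreover have "(\<Inter>n. {0<..S n} \<times> A) = {0<..t} \<times> A"
      proof -
        have "r \<le> t" if "\<forall>n. r \<le> S n" for r using that S(3) LIMSEQ_le_const by blast
        moreover have "r \<le> S n" if "r \<le> t" for r n using that S(1)[of n] by linarith
        ultimately show ?thesis by fastforce
      qed
      ultimately show "(\<lambda>n. measure Q ({0<..S n} \<times> A)) \<longlonglongrightarrow> measure Q ({0<..t} \<times> A)" by simp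
    qed simp
  next
    assume t: "0 < t"
    show "((\<lambda>t. measure Q ({0<..t} \<times> A)) \<longlongrightarrow> measure Q ({0<..<t} \<times> A)) (at_left t)"
    proof (rule tendsto_at_left_sequentially[where b="t - 1"])
      fix S assume S: "\<And>n. S n < t" "incseq S" "S \<longlonglongrightarrow> t"
      have U: "(\<Union>n. {0<..S n} \<times> A) = {0<..<t} \<times> A"
      proof -
        have "\<exists>n. r \<le> S n" if "r < t" for r
          using order_tendstoD(1)[OF S(3) that] by (meson eventually_sequentially less_imp_le order_refl)
        moreover have "r < t" if "r \<le> S n" for r n using that S(1)[of n] by linarith
        ultimately show ?thesis by fastforce
      qed
      have "(\<lambda>n. measure Q ({0<..S n} \<times> A)) \<longlonglongrightarrow> measure Q (\<Union>n. {0<..S n} \<times> A)"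
      proof (rule Lim_measure_incseq)
        show "incseq (\<lambda>n. {0<..S n} \<times> A)" using S(2) by (force simp: incseq_def intro: order_trans)
        show "emeasure Q (\<Union>n. {0<..S n} \<times> A) \<noteq> \<infinity>" unfolding U by (rule fin'[of _ t]) auto
      qed (use sQ in auto)
      then show "(\<lambda>n. measure Q ({0<..S n} \<times> A)) \<longlonglongrightarrow> measure Q ({0<..<t} \<times> A)" unfolding U .
    qed simp
  }
qed

definition poisson_noise :: "'u measure \<Rightarrow> ('w \<Rightarrow> (real \<times> 'u) measure) \<Rightarrow> 'u set \<Rightarrow> real \<Rightarrow> 'w \<Rightarrow> real" where
  "poisson_noise \<nu> N A t w = compensated \<nu> N w ({0<..t} \<times> A)"

locale poisson_measure = filtered_prob M F for M :: "'w measure" and F +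
  fixes \<nu> :: "'u measure" and N :: "'w \<Rightarrow> (real \<times> 'u) measure"
  assumes sigma_finite_intensity: "sigma_finite_measure \<nu>"
    and random_measure: "adapted_poisson_random_measure M F \<nu> N"
begin

abbreviation \<mu> where "\<mu> \<equiv> jump_intensity \<nu>"

lemma poisson_random_measure: "poisson_random_measure M \<mu> N"
  using random_measure by (simp add: adapted_poisson_random_measure_def)

lemma sets_N: "w \<in> space M \<Longrightarrow> sets (N w) = sets \<mu>"
  using poisson_random_measure by (simp add: poisson_random_measure_def)

lemma emeasure_N_measurable: "B \<in> sets \<mu> \<Longrightarrow> (\<lambda>w. emeasure (N w) B) \<in> borel_measurable M"
  using poisson_random_measure by (simp add: poisson_random_measure_def)

lemma compensated_eq: "compensated \<nu> N w B = enn2real (emeasure (N w) B) - measure \<mu> B"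
  by (simp add: compensated_def measure_def)

lemma compensated_moments:
  assumes B: "B \<in> fmeasurable \<mu>"
  shows "AE w in M. emeasure (N w) B \<noteq> \<infinity>"
    and "integrable M (\<lambda>w. compensated \<nu> N w B)" "expectation (\<lambda>w. compensated \<nu> N w B) = 0"
    and "integrable M (\<lambda>w. (compensated \<nu> N w B)\<^sup>2)" "expectation (\<lambda>w. (compensated \<nu> N w B)\<^sup>2) = measure \<mu> B"
proof -
  have B': "B \<in> sets \<mu>" "emeasure \<mu> B < \<infinity>" using B by (auto simp: fmeasurable_def)
  define m where "m = measure \<mu> B"
  have "prob {w\<in>space M. emeasure (N w) B = of_nat k} = m ^ k / fact k * exp (- m)" for k :: nat
    using poisson_random_measure B' by (simp add: poisson_random_measure_def m_def)
  note P = poisson_moments[OF emeasure_N_measurable[OF B'(1)] this]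
  show "AE w in M. emeasure (N w) B \<noteq> \<infinity>" by (rule P(1))
  show "integrable M (\<lambda>w. compensated \<nu> N w B)" unfolding compensated_eq using P(2) by simp
  show "expectation (\<lambda>w. compensated \<nu> N w B) = 0" unfolding compensated_eq using P(2,3) by (simp add: prob_space m_def)
  have e: "(compensated \<nu> N w B)\<^sup>2 = (enn2real (emeasure (N w) B))\<^sup>2 - 2 * m * enn2real (emeasure (N w) B) + m\<^sup>2" for w
    by (simp add: compensated_eq m_def power2_eq_square algebra_simps)
  show "integrable M (\<lambda>w. (compensated \<nu> N w B)\<^sup>2)" unfolding e using P(2,4) by simp
  show "expectation (\<lambda>w. (compensated \<nu> N w B)\<^sup>2) = measure \<mu> B"
    unfolding e using P(2-5) by (simp add: prob_space m_def power2_eq_square)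
qed

text \<open>Independence of the random measure on disjoint sets is stated for finite indexed
  families, so \<open>P\<close> and \<open>Q\<close> receive the indices 0 and 1; compensation then
  makes both factors centred.\<close>

lemma compensated_disjoint:
  assumes P: "P \<in> fmeasurable \<mu>" and Q: "Q \<in> fmeasurable \<mu>" and disj: "P \<inter> Q = {}"
  shows "integrable M (\<lambda>w. compensated \<nu> N w P * compensated \<nu> N w Q)"
    and "expectation (\<lambda>w. compensated \<nu> N w P * compensated \<nu> N w Q) = 0"
proof -
  define A where "A i = (if i = 0 then P else Q)" for i :: nat
  have "indep_vars (\<lambda>_. borel) (\<lambda>i w. emeasure (N w) (A i)) {..<2::nat}"
  proof -
    have "A ` {..<2} \<subseteq> sets \<mu>" using P Q by (auto simp: A_def fmeasurable_def)
    moreover have "disjoint_family_on A {..<2}" using disj by (auto simp: disjoint_family_on_def A_def)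
    ultimately show ?thesis using poisson_random_measure unfolding poisson_random_measure_def by blast
  qed
  then have "indep_vars (\<lambda>_. borel) (\<lambda>i w. enn2real (emeasure (N w) (A i)) - measure \<mu> (A i)) {..<2}"
    by (rule indep_vars_compose2[where Y="\<lambda>i y. enn2real y - measure \<mu> (A i)"]) simp
  then have ind: "indep_vars (\<lambda>_. borel) (\<lambda>i w. compensated \<nu> N w (A i)) {..<2}" by (simp add: compensated_eq)
  have i: "integrable M (\<lambda>w. compensated \<nu> N w (A i))" for i
    using compensated_moments(2) P Q by (simp add: A_def)
  have pr: "(\<Prod>i\<in>{..<2::nat}. f i) = f 0 * f 1" for f :: "nat \<Rightarrow> real" by (simp add: numeral_2_eq_2)
  show "integrable M (\<lambda>w. compensated \<nu> N w P * compensated \<nu> N w Q)"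
    using indep_vars_integrable[OF _ ind i] by (simp add: pr A_def)
  show "expectation (\<lambda>w. compensated \<nu> N w P * compensated \<nu> N w Q) = 0"
    using indep_vars_lebesgue_integral[OF _ ind i] compensated_moments(3)[OF P] by (simp add: pr A_def)
qed

lemma compensated_union:
  assumes P: "P \<in> fmeasurable \<mu>" and Q: "Q \<in> fmeasurable \<mu>" and disj: "P \<inter> Q = {}" and w: "w \<in> space M"
    and fin: "emeasure (N w) P \<noteq> \<infinity>" "emeasure (N w) Q \<noteq> \<infinity>"
  shows "compensated \<nu> N w (P \<union> Q) = compensated \<nu> N w P + compensated \<nu> N w Q"
proof -
  have "measure (N w) (P \<union> Q) = measure (N w) P + measure (N w) Q"
    using P Q disj fin sets_N[OF w] by (intro measure_Union) (auto simp: fmeasurable_def)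
  moreover have "measure \<mu> (P \<union> Q) = measure \<mu> P + measure \<mu> Q"
    using P Q disj by (intro measure_Union) (auto simp: fmeasurable_def)
  ultimately show ?thesis by (simp add: compensated_def)
qed

text \<open>Splitting \<open>P\<close> and \<open>Q\<close> along \<open>P \<inter> Q\<close> leaves
  the variance of the common part and products over disjoint sets, whose expectations vanish. The
  splitting holds almost surely, namely where the random measure is finite on the parts.\<close>

lemma compensated_covariance:
  assumes P: "P \<in> fmeasurable \<mu>" and Q: "Q \<in> fmeasurable \<mu>"
  shows "integrable M (\<lambda>w. compensated \<nu> N w P * compensated \<nu> N w Q)"
    and "expectation (\<lambda>w. compensated \<nu> N w P * compensated \<nu> N w Q) = measure \<mu> (P \<inter> Q)"
proof -
  define c where "c B w = compensated \<nu> N w B" for B w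
  have I: "P \<inter> Q \<in> fmeasurable \<mu>" and PD: "P - Q \<in> fmeasurable \<mu>" and QD: "Q - P \<in> fmeasurable \<mu>"
    using P Q by (auto intro: fmeasurable_Int_fmeasurable fmeasurable_Diff simp: fmeasurableD)
  have d: "(P \<inter> Q) \<inter> (P - Q) = {}" "(P \<inter> Q) \<inter> (Q - P) = {}" "(P - Q) \<inter> (Q - P) = {}" by auto
  have ae: "AE w in M. c P w * c Q w
      = (c (P \<inter> Q) w)\<^sup>2 + c (P \<inter> Q) w * c (Q - P) w + c (P \<inter> Q) w * c (P - Q) w + c (P - Q) w * c (Q - P) w"
    using compensated_moments(1)[OF I] compensated_moments(1)[OF PD] compensated_moments(1)[OF QD] AE_space
  proof eventually_elim
    case (elim w)
    have "P = (P \<inter> Q) \<union> (P - Q)" "Q = (P \<inter> Q) \<union> (Q - P)" by auto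
    then have "c P w = c (P \<inter> Q) w + c (P - Q) w" "c Q w = c (P \<inter> Q) w + c (Q - P) w"
      using compensated_union[OF I PD d(1) elim(4) elim(1,2)] compensated_union[OF I QD d(2) elim(4) elim(1,3)]
      by (simp_all add: c_def)
    then show ?case by (simp add: power2_eq_square algebra_simps)
  qed
  note i = compensated_moments(4)[OF I] compensated_disjoint(1)[OF I PD d(1)] compensated_disjoint(1)[OF I QD d(2)]
     compensated_disjoint(1)[OF PD QD d(3)]
  note e = compensated_moments(5)[OF I] compensated_disjoint(2)[OF I PD d(1)] compensated_disjoint(2)[OF I QD d(2)]
     compensated_disjoint(2)[OF PD QD d(3)]
  have m[measurable]: "c B \<in> borel_measurable M" if "B \<in> fmeasurable \<mu>" for B
    using compensated_moments(2)[OF that] by (simp add: c_def[abs_def])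
  note [measurable] = m[OF P] m[OF Q] m[OF I] m[OF PD] m[OF QD]
  show "integrable M (\<lambda>w. compensated \<nu> N w P * compensated \<nu> N w Q)"
    using integrable_cong_AE[OF _ _ ae] i by (simp add: c_def[symmetric])
  show "expectation (\<lambda>w. compensated \<nu> N w P * compensated \<nu> N w Q) = measure \<mu> (P \<inter> Q)"
    using integral_cong_AE[OF _ _ ae] i e by (simp add: c_def[symmetric])
qed

lemma compensated_measurable_events:
  assumes "B \<in> sets \<mu>" "B \<subseteq> E" and G: "random_measure_events M \<mu> N E \<subseteq> sets G" "space G = space M"
  shows "(\<lambda>w. compensated \<nu> N w B) \<in> borel_measurable G"
proof -
  have "(\<lambda>w. emeasure (N w) B) \<in> borel_measurable G"
  proof (rule measurableI)
    fix S :: "ennreal set" assume "S \<in> sets borel"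
    then have "(\<lambda>w. emeasure (N w) B) -` S \<inter> space M \<in> random_measure_events M \<mu> N E"
      unfolding random_measure_events_def using assms(1,2) by (intro sigma_sets.Basic) blast
    then show "(\<lambda>w. emeasure (N w) B) -` S \<inter> space G \<in> sets G" using G by auto
  qed simp
  then show ?thesis unfolding compensated_eq by measurable
qed

text \<open>\<open>measure\<close> takes the value 0 on sets of infinite mass, so additivity in time
  may fail on a null set of paths. This condition selects the good paths once for all times; integer
  horizons keep the number of requirements countable.\<close>

definition finite_boxes :: "'u set \<Rightarrow> 'w \<Rightarrow> bool" where
  "finite_boxes A w \<longleftrightarrow> w \<in> space M \<and> (\<forall>n::nat. emeasure (N w) ({0<..real n} \<times> A) \<noteq> \<infinity>)"

lemmas box = box_jump_intensity[OF sigma_finite_intensity]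

lemma AE_finite_boxes: "A \<in> fmeasurable \<nu> \<Longrightarrow> AE w in M. finite_boxes A w"
  unfolding finite_boxes_def using compensated_moments(1)[OF box(1)[of A 0]] by (auto simp: AE_all_countable)

lemma poisson_noise_increment:
  assumes A: "A \<in> fmeasurable \<nu>" and st: "0 \<le> s" "s \<le> t" and w: "finite_boxes A w"
  shows "poisson_noise \<nu> N A t w - poisson_noise \<nu> N A s w = compensated \<nu> N w ({s<..t} \<times> A)"
proof -
  have w': "w \<in> space M" using w by (simp add: finite_boxes_def)
  have fin: "emeasure (N w) B \<noteq> \<infinity>" if "B \<subseteq> {0<..t} \<times> A" for B
  proof -
    have "emeasure (N w) B \<le> emeasure (N w) ({0<..real (nat \<lceil>t\<rceil>)} \<times> A)"
    proof (rule emeasure_mono)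
      have "t \<le> real (nat \<lceil>t\<rceil>)" by linarith
      then have "{0<..t} \<times> A \<subseteq> {0<..real (nat \<lceil>t\<rceil>)} \<times> A" by (intro Sigma_mono) (auto intro: order_trans[OF _ le_of_int_ceiling])
      then show "B \<subseteq> {0<..real (nat \<lceil>t\<rceil>)} \<times> A" using that by (rule order_trans[rotated])
      show "{0<..real (nat \<lceil>t\<rceil>)} \<times> A \<in> sets (N w)" using box(1)[OF A] sets_N[OF w'] by (auto simp: fmeasurable_def)
    qed
    then show ?thesis using w by (auto simp: finite_boxes_def top_unique)
  qed
  have u: "{0<..t} \<times> A = {0<..s} \<times> A \<union> {s<..t} \<times> A" using st by auto
  have "compensated \<nu> N w ({0<..s} \<times> A \<union> {s<..t} \<times> A)
      = compensated \<nu> N w ({0<..s} \<times> A) + compensated \<nu> N w ({s<..t} \<times> A)"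
  proof (rule compensated_union[OF box(1)[OF A] box(1)[OF A] _ w'])
    show "emeasure (N w) ({0<..s} \<times> A) \<noteq> \<infinity>" "emeasure (N w) ({s<..t} \<times> A) \<noteq> \<infinity>"
      using st by (auto intro!: fin simp del: infinity_ennreal_def)
  qed (use st in auto)
  then show ?thesis unfolding poisson_noise_def u by simp
qed

text \<open>An increment over \<open>(s, t]\<close> is the compensated mass of a box beyond time
  \<open>s\<close>, hence measurable for the sigma-algebra of the random measure after
  \<open>s\<close>, which is independent of \<open>F s\<close>; mean and covariance therefore
  factor. The identity for the increment holds almost surely, so the expectations are compared by
  \<open>integral_cong_AE\<close>.\<close>

lemma poisson_is_noise: "noise M F \<nu> (poisson_noise \<nu> N)"
proof -
  have mult: "integrable M (\<lambda>w. \<eta> w * Z w) \<and> expectation (\<lambda>w. \<eta> w * Z w) = expectation \<eta> * expectation Z"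
    if s: "0 \<le> s" and \<eta>: "\<eta> \<in> borel_measurable (F s)" and C: "\<And>w. w \<in> space M \<Longrightarrow> \<bar>\<eta> w\<bar> \<le> C"
      and Z: "Z \<in> borel_measurable (sigma (space M) (random_measure_events M \<mu> N ({s<..} \<times> space \<nu>)))" and i: "integrable M Z"
    for s C and \<eta> Z :: "'w \<Rightarrow> real"
  proof -
    define G where "G = sigma (space M) (random_measure_events M \<mu> N ({s<..} \<times> space \<nu>))"
    define gen where "gen = {(\<lambda>w. emeasure (N w) A) -` B \<inter> space M | A B. A \<in> sets \<mu> \<and> A \<subseteq> {s<..} \<times> space \<nu> \<and> B \<in> sets borel}"
    have ev: "random_measure_events M \<mu> N ({s<..} \<times> space \<nu>) = sigma_sets (space M) gen"
      by (simp add: random_measure_events_def gen_def)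
    have gen: "gen \<subseteq> Pow (space M)" "gen \<subseteq> sets M"
      unfolding gen_def using measurable_sets[OF emeasure_N_measurable] by auto
    \<comment> \<open>\<open>random_measure_events\<close> is a sigma-algebra already; generating
      once more adds no sets.\<close>
    have "sigma_sets (space M) (sigma_sets (space M) gen) = sigma_sets (space M) gen" by (rule sigma_sets_sigma_sets_eq[OF gen(1)])
    then have sG: "sets G = random_measure_events M \<mu> N ({s<..} \<times> space \<nu>)"
      unfolding G_def ev using sigma_sets_into_sp[OF gen(1)] by (subst sets_measure_of) auto
    have sub: "subalgebra M G"
      unfolding subalgebra_def sG ev using sets.sigma_sets_subset[OF gen(2)] by (simp add: G_def space_measure_of_conv)
    have ind: "indep_set (sets (F s)) (sets G)" unfolding sG using random_measure s by (simp add: adapted_poisson_random_measure_def)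
    have i\<eta>: "integrable M \<eta>"
      by (rule integrable_const_bound[where B=C]) (use C measurable_F_M[OF \<eta>] in \<open>auto intro!: AE_I2\<close>)
    show ?thesis using indep_set_integral_mult[OF ind subalgebra_F sub \<eta> Z[folded G_def] i\<eta> i] by simp
  qed
  have cm: "(\<lambda>w. compensated \<nu> N w ({s<..t} \<times> A)) \<in> borel_measurable (sigma (space M) (random_measure_events M \<mu> N ({s<..} \<times> space \<nu>)))"
    if A: "A \<in> fmeasurable \<nu>" and s: "0 \<le> s" for A s t
  proof (rule compensated_measurable_events[where E="{s<..} \<times> space \<nu>"])
    have "A \<subseteq> space \<nu>" using A sets.sets_into_space by (auto simp: fmeasurable_def)
    then show "{s<..t} \<times> A \<subseteq> {s<..} \<times> space \<nu>" by auto
    show "{s<..t} \<times> A \<in> sets \<mu>" using box(1)[OF A s] by (auto simp: fmeasurable_def)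
    have "random_measure_events M \<mu> N ({s<..} \<times> space \<nu>) \<subseteq> Pow (space M)"
      unfolding random_measure_events_def using sigma_sets_into_sp[of _ "space M"] by (auto dest!: sigma_sets_into_sp[rotated])
    then show "random_measure_events M \<mu> N ({s<..} \<times> space \<nu>) \<subseteq> sets (sigma (space M) (random_measure_events M \<mu> N ({s<..} \<times> space \<nu>)))"
      by (subst sets_measure_of) auto
  qed (simp add: space_measure_of_conv)
  show ?thesis
  proof unfold_locales
    fix A and t :: real assume A: "A \<in> fmeasurable \<nu>" and t: "0 \<le> t"
    have "A \<subseteq> space \<nu>" using A sets.sets_into_space by (auto simp: fmeasurable_def)
    then show "poisson_noise \<nu> N A t \<in> borel_measurable (F t)"
      unfolding poisson_noise_def[abs_def] using random_measure t box(1)[OF A order_refl, of t]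
      by (intro compensated_measurable_events[where E="{0..t} \<times> space \<nu>"]) (auto simp: adapted_poisson_random_measure_def fmeasurable_def)
  next
    fix A assume A: "A \<in> fmeasurable \<nu>"
    show "AE w in M. cadlag (\<lambda>t. poisson_noise \<nu> N A t w)"
      using AE_finite_boxes[OF A]
    proof eventually_elim
      case (elim w)
      have "cadlag (\<lambda>t. measure (N w) ({0<..t} \<times> A))"
        using elim by (intro measure_box_cadlag[OF sigma_finite_intensity A]) (auto simp: finite_boxes_def sets_N)
      moreover have "cadlag (\<lambda>t. measure \<mu> ({0<..t} \<times> A))"
        using box(1)[OF A order_refl] by (intro measure_box_cadlag[OF sigma_finite_intensity A]) (auto simp: fmeasurable_def top.not_eq_extremum)
      ultimately show ?case unfolding poisson_noise_def compensated_def by (rule cadlag_diff)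
    qed
  next
    fix A and s t :: real assume A: "A \<in> fmeasurable \<nu>" and st: "0 \<le> s" "s \<le> t"
    have ae: "AE w in M. (poisson_noise \<nu> N A t w - poisson_noise \<nu> N A s w)\<^sup>2 = (compensated \<nu> N w ({s<..t} \<times> A))\<^sup>2"
      using AE_finite_boxes[OF A] by eventually_elim (simp add: poisson_noise_increment[OF A st])
    have [measurable]: "(\<lambda>w. compensated \<nu> N w ({r<..r'} \<times> A)) \<in> borel_measurable M" if "0 \<le> r" for r r'
      using compensated_moments(2)[OF box(1)[OF A that]] by simp
    show "integrable M (\<lambda>w. (poisson_noise \<nu> N A t w - poisson_noise \<nu> N A s w)\<^sup>2)"
      using integrable_cong_AE[OF _ _ ae] compensated_moments(4)[OF box(1)[OF A st(1)]] st by (simp add: poisson_noise_def)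
  next
    fix A and s t C :: real and \<eta> :: "'w \<Rightarrow> real"
    assume A: "A \<in> fmeasurable \<nu>" and st: "0 \<le> s" "s \<le> t" and \<eta>: "\<eta> \<in> borel_measurable (F s)"
      and C: "\<And>w. w \<in> space M \<Longrightarrow> \<bar>\<eta> w\<bar> \<le> C"
    have ae: "AE w in M. \<eta> w * (poisson_noise \<nu> N A t w - poisson_noise \<nu> N A s w) = \<eta> w * compensated \<nu> N w ({s<..t} \<times> A)"
      using AE_finite_boxes[OF A] by eventually_elim (simp add: poisson_noise_increment[OF A st])
    have [measurable]: "(\<lambda>w. compensated \<nu> N w ({r<..r'} \<times> A)) \<in> borel_measurable M" if "0 \<le> r" for r r'
      using compensated_moments(2)[OF box(1)[OF A that]] by simp
    have [measurable]: "\<eta> \<in> borel_measurable M" by (rule measurable_F_M[OF \<eta>])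
    note m = compensated_moments(2,3)[OF box(1)[OF A st(1)]]
    have "expectation (\<lambda>w. \<eta> w * compensated \<nu> N w ({s<..t} \<times> A)) = 0"
      using mult[OF st(1) \<eta> C cm[OF A st(1)] m(1)] m(2) by simp
    then show "expectation (\<lambda>w. \<eta> w * (poisson_noise \<nu> N A t w - poisson_noise \<nu> N A s w)) = 0"
      using integral_cong_AE[OF _ _ ae] st by (simp add: poisson_noise_def)
  next
    fix A B and s t C :: real and \<eta> :: "'w \<Rightarrow> real"
    assume A: "A \<in> fmeasurable \<nu>" and B: "B \<in> fmeasurable \<nu>" and st: "0 \<le> s" "s \<le> t" and \<eta>: "\<eta> \<in> borel_measurable (F s)"
      and C: "\<And>w. w \<in> space M \<Longrightarrow> \<bar>\<eta> w\<bar> \<le> C"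
    have ae: "AE w in M. \<eta> w * ((poisson_noise \<nu> N A t w - poisson_noise \<nu> N A s w) * (poisson_noise \<nu> N B t w - poisson_noise \<nu> N B s w))
        = \<eta> w * (compensated \<nu> N w ({s<..t} \<times> A) * compensated \<nu> N w ({s<..t} \<times> B))"
      using AE_finite_boxes[OF A] AE_finite_boxes[OF B]
      by eventually_elim (simp add: poisson_noise_increment[OF A st] poisson_noise_increment[OF B st])
    have [measurable]: "(\<lambda>w. compensated \<nu> N w ({r<..r'} \<times> D)) \<in> borel_measurable M" if "0 \<le> r" "D \<in> fmeasurable \<nu>" for r r' D
      using compensated_moments(2)[OF box(1)[OF that(2,1)]] by simp
    have [measurable]: "\<eta> \<in> borel_measurable M" by (rule measurable_F_M[OF \<eta>])
    note c = compensated_covariance[OF box(1)[OF A st(1), of t] box(1)[OF B st(1), of t]]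
    have AB: "A \<inter> B \<in> fmeasurable \<nu>" using A B by (intro fmeasurable_Int_fmeasurable) (auto simp: fmeasurableD)
    have "({s<..t} \<times> A) \<inter> ({s<..t} \<times> B) = {s<..t} \<times> (A \<inter> B)" by auto
    then have "expectation (\<lambda>w. compensated \<nu> N w ({s<..t} \<times> A) * compensated \<nu> N w ({s<..t} \<times> B)) = (t - s) * measure \<nu> (A \<inter> B)"
      unfolding c(2) using box(2)[OF AB st] by simp
    then have "expectation (\<lambda>w. \<eta> w * (compensated \<nu> N w ({s<..t} \<times> A) * compensated \<nu> N w ({s<..t} \<times> B)))
        = expectation \<eta> * ((t - s) * measure \<nu> (A \<inter> B))"
      using mult[OF st(1) \<eta> C borel_measurable_times[OF cm[OF A st(1)] cm[OF B st(1)]] c(1)] by simp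
    then show "expectation (\<lambda>w. \<eta> w * ((poisson_noise \<nu> N A t w - poisson_noise \<nu> N A s w) * (poisson_noise \<nu> N B t w - poisson_noise \<nu> N B s w)))
        = expectation \<eta> * ((t - s) * measure \<nu> (A \<inter> B))"
      using integral_cong_AE[OF _ _ ae] st A B by (simp add: poisson_noise_def)
  qed (rule sigma_finite_measure.sigma_finite_countable[OF sigma_finite_intensity])
qed

text \<open>One null set serves all times: only the finitely many mark sets of \<open>hs\<close>
  occur, and \<open>finite_boxes\<close> covers every horizon.\<close>

lemma AE_simple_jump_integral_eq:
  assumes hs: "simple_jump_integrand M F \<nu> (hs :: ('w, 'u, 'd::finite) simple_jump_integrand)"
  shows "AE w in M. \<forall>t\<ge>0. simple_jump_integral \<nu> N hs t w = step_integral (poisson_noise \<nu> N) hs t w"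
proof -
  have ok: "A \<in> fmeasurable \<nu> \<and> 0 \<le> a \<and> a \<le> b" if "(a, b, A, \<xi>) \<in> set hs" for a b A \<xi>
    using hs that by (auto simp: simple_jump_integrand_def fmeasurable_def)
  have "AE w in M. \<forall>h\<in>set hs. finite_boxes (fst (snd (snd h))) w"
  proof (subst AE_ball_countable)
    show "\<forall>h\<in>set hs. AE w in M. finite_boxes (fst (snd (snd h))) w"
      using ok by (auto intro!: AE_finite_boxes)
  qed (simp add: countable_finite)
  then show ?thesis
  proof eventually_elim
    case (elim w)
    show ?case
    proof (intro allI impI)
      fix t :: real assume t: "0 \<le> t"
      have "compensated \<nu> N w ({min a t<..min b t} \<times> A) = poisson_noise \<nu> N A (min b t) w - poisson_noise \<nu> N A (min a t) w"
        if "(a, b, A, \<xi>) \<in> set hs" for a b A \<xi>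
        using ok[OF that] elim that t by (intro poisson_noise_increment[symmetric]) (auto simp: min_def)
      then show "simple_jump_integral \<nu> N hs t w = step_integral (poisson_noise \<nu> N) hs t w"
        unfolding simple_jump_integral_def step_integral_def by (intro arg_cong[where f=sum_list] map_cong) auto
    qed
  qed
qed

end

section \<open>Strong solutions\<close>

lemma borel_measurable_completion_AE_eq:
  assumes g: "g \<in> borel_measurable M" and ae: "AE x in M. f x = g x"
  shows "f \<in> borel_measurable (completion M)"
proof (rule measurableI)
  fix S :: "'b set" assume S: "S \<in> sets borel"
  show "f -` S \<inter> space (completion M) \<in> sets (completion M)"
  proof (rule completion.in_sets_AE)
    show "AE x in completion M. (x \<in> g -` S \<inter> space M) = (x \<in> f -` S \<inter> space (completion M))"
      using AE_completion[OF ae] by eventually_elim auto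
    show "g -` S \<inter> space M \<in> sets (completion M)" using measurable_sets[OF g S] by simp
  qed auto
qed simp

lemma AE_snd:
  assumes Q: "sigma_finite_measure Q" and ae: "AE y in Q. P y"
  shows "AE p in A \<Otimes>\<^sub>M Q. P (snd p)"
proof -
  interpret sigma_finite_measure Q by fact
  obtain N where N: "N \<in> null_sets Q" "{y \<in> space Q. \<not> P y} \<subseteq> N" using ae unfolding eventually_ae_filter by auto
  have "emeasure (A \<Otimes>\<^sub>M Q) (space A \<times> N) = 0"
    using N by (subst emeasure_pair_measure_Times) auto
  then have "space A \<times> N \<in> null_sets (A \<Otimes>\<^sub>M Q)" using N by auto
  then show ?thesis by (rule AE_I') (use N(2) in \<open>auto simp: space_pair_measure\<close>)
qed

lemma measurable_time_interval_pair:
  assumes "f \<in> borel \<Otimes>\<^sub>M Q \<rightarrow>\<^sub>M N"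
  shows "f \<in> time_interval T \<Otimes>\<^sub>M Q \<rightarrow>\<^sub>M N"
proof -
  have "(\<lambda>x. x) \<in> time_interval T \<rightarrow>\<^sub>M borel" by (rule measurable_restrict_space1) simp
  then have "(\<lambda>p. (fst p, snd p)) \<in> time_interval T \<Otimes>\<^sub>M Q \<rightarrow>\<^sub>M borel \<Otimes>\<^sub>M Q"
    by (intro measurable_Pair measurable_compose[OF measurable_fst]) auto
  from measurable_compose[OF this assms] show ?thesis by simp
qed

lemma sigma_finite_time_interval: "sigma_finite_measure (time_interval T)"
  by (intro sigma_finite_measure_restrict_space) (auto intro: lborel.sigma_finite_measure_axioms)

text \<open>Tonelli, together with the remark that the closed interval \<open>{0..T}\<close> and the
  half-open one in \<open>energy\<close> differ by a single time, which is a null set.\<close>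

lemma nn_integral_time_interval:
  fixes f :: "real \<times> 'a \<Rightarrow> ennreal"
  assumes Q: "sigma_finite_measure Q" and f: "f \<in> borel_measurable (borel \<Otimes>\<^sub>M Q)"
  shows "(\<integral>\<^sup>+p. f p \<partial>(time_interval T \<Otimes>\<^sub>M Q)) = (\<integral>\<^sup>+r. (\<integral>\<^sup>+q. f (r, q) \<partial>Q) * indicator {0<..T} r \<partial>lborel)"
proof -
  interpret sigma_finite_measure Q by fact
  have "(\<integral>\<^sup>+p. f p \<partial>(time_interval T \<Otimes>\<^sub>M Q)) = (\<integral>\<^sup>+r. (\<integral>\<^sup>+q. f (r, q) \<partial>Q) \<partial>time_interval T)"
    by (rule nn_integral_fst[symmetric]) (rule measurable_time_interval_pair[OF f])
  also have "\<dots> = (\<integral>\<^sup>+r. (\<integral>\<^sup>+q. f (r, q) \<partial>Q) * indicator {0..T} r \<partial>lborel)"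
    by (rule nn_integral_restrict_space) simp
  also have "\<dots> = (\<integral>\<^sup>+r. (\<integral>\<^sup>+q. f (r, q) \<partial>Q) * indicator {0<..T} r \<partial>lborel)"
    by (rule nn_integral_cong_AE, use AE_lborel_singleton[of 0] in eventually_elim) (auto simp: indicator_def)
  finally show ?thesis .
qed

text \<open>Lifts a statement for almost every time and almost every \<open>w\<close> to the product
  that also carries the marks; time 0, where there is no left limit to speak of, is discarded as a
  null set.\<close>

lemma (in filtered_prob) AE_time_interval_marks:
  assumes \<nu>: "sigma_finite_measure \<nu>" and P[measurable]: "Measurable.pred (borel \<Otimes>\<^sub>M M) (\<lambda>(r, w). P r w)"
    and ae: "AE r in lborel. AE w in M. 0 < r \<longrightarrow> P r w"
  shows "AE (r, u, w) in time_interval T \<Otimes>\<^sub>M \<nu> \<Otimes>\<^sub>M M. 0 < r \<and> P r w"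
proof -
  interpret V: sigma_finite_measure \<nu> by fact
  interpret VM: pair_sigma_finite \<nu> M ..
  interpret T: sigma_finite_measure "time_interval T" by (rule sigma_finite_time_interval)
  interpret VM2: sigma_finite_measure "\<nu> \<Otimes>\<^sub>M M" by (rule VM.sigma_finite_measure_axioms)
  interpret Q: pair_sigma_finite "time_interval T" "\<nu> \<Otimes>\<^sub>M M" ..
  have "AE p in time_interval T \<Otimes>\<^sub>M \<nu> \<Otimes>\<^sub>M M. 0 < fst p \<and> P (fst p) (snd (snd p))"
  proof (rule Q.AE_pair_measure)
    have "(\<lambda>p. (fst p, snd (snd p))) \<in> (borel :: real measure) \<Otimes>\<^sub>M \<nu> \<Otimes>\<^sub>M M \<rightarrow>\<^sub>M borel \<Otimes>\<^sub>M M" by measurable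
    from measurable_compose[OF this P]
    have "Measurable.pred (borel \<Otimes>\<^sub>M \<nu> \<Otimes>\<^sub>M M) (\<lambda>p. P (fst p) (snd (snd p)))" by simp
    then have "Measurable.pred (borel \<Otimes>\<^sub>M \<nu> \<Otimes>\<^sub>M M) (\<lambda>p. 0 < fst p \<and> P (fst p) (snd (snd p)))" by measurable
    from measurable_time_interval_pair[OF this]
    show "{p \<in> space (time_interval T \<Otimes>\<^sub>M \<nu> \<Otimes>\<^sub>M M). 0 < fst p \<and> P (fst p) (snd (snd p))} \<in> sets (time_interval T \<Otimes>\<^sub>M \<nu> \<Otimes>\<^sub>M M)"
      by (rule predE)
    have "AE r in lborel. r \<in> {0..T} \<longrightarrow> (AE q in \<nu> \<Otimes>\<^sub>M M. 0 < fst (r, q) \<and> P (fst (r, q)) (snd (snd (r, q))))"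
      using ae AE_lborel_singleton[of 0]
    proof eventually_elim
      case (elim r)
      show ?case
      proof
        assume "r \<in> {0..T}"
        then have r: "0 < r" using elim(2) by simp
        then have "AE w in M. P r w" using elim(1) by simp
        from AE_snd[OF sigma_finite_measure_axioms this, of \<nu>]
        show "AE q in \<nu> \<Otimes>\<^sub>M M. 0 < fst (r, q) \<and> P (fst (r, q)) (snd (snd (r, q)))" using r by simp
      qed
    qed
    then show "AE r in time_interval T. AE q in \<nu> \<Otimes>\<^sub>M M. 0 < fst (r, q) \<and> P (fst (r, q)) (snd (snd (r, q)))"
      by (subst AE_restrict_space_iff) auto
  qed
  then show ?thesis by (simp add: case_prod_unfold)
qed

text \<open>Completion leaves the integral unchanged, the integrand may be altered on a null set,
  and exchanging marks and \<open>w\<close> brings the iterated integral into the order of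
  \<open>energy\<close>.\<close>

lemma (in noise) nn_integral_energy:
  fixes D V :: "real \<Rightarrow> 'u \<Rightarrow> 'w \<Rightarrow> 'b::euclidean_space"
  assumes D[measurable]: "(\<lambda>(r, u, w). D r u w) \<in> borel_measurable (borel \<Otimes>\<^sub>M \<nu> \<Otimes>\<^sub>M M)"
    and ae: "AE (r, u, w) in time_interval T \<Otimes>\<^sub>M \<nu> \<Otimes>\<^sub>M M. V r u w = D r u w"
  shows "(\<integral>\<^sup>+(r, u, w). ennreal ((norm (V r u w))\<^sup>2) \<partial>completion (time_interval T \<Otimes>\<^sub>M \<nu> \<Otimes>\<^sub>M M)) = energy M \<nu> 0 T D"
proof -
  interpret VM: pair_sigma_finite \<nu> M ..
  define f where "f p = ennreal ((norm (D (fst p) (fst (snd p)) (snd (snd p))))\<^sup>2)" for p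
  have D': "(\<lambda>p. D (fst p) (fst (snd p)) (snd (snd p))) \<in> borel_measurable (borel \<Otimes>\<^sub>M \<nu> \<Otimes>\<^sub>M M)"
    using D by (simp add: case_prod_unfold)
  then have f: "f \<in> borel_measurable (borel \<Otimes>\<^sub>M \<nu> \<Otimes>\<^sub>M M)" unfolding f_def by measurable
  have "(\<integral>\<^sup>+(r, u, w). ennreal ((norm (V r u w))\<^sup>2) \<partial>completion (time_interval T \<Otimes>\<^sub>M \<nu> \<Otimes>\<^sub>M M))
      = (\<integral>\<^sup>+p. f p \<partial>(time_interval T \<Otimes>\<^sub>M \<nu> \<Otimes>\<^sub>M M))"
    unfolding nn_integral_completion
    by (rule nn_integral_cong_AE, use ae in eventually_elim) (auto simp: f_def)
  also have "\<dots> = (\<integral>\<^sup>+r. (\<integral>\<^sup>+q. f (r, q) \<partial>(\<nu> \<Otimes>\<^sub>M M)) * indicator {0<..T} r \<partial>lborel)"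
    by (rule nn_integral_time_interval[OF VM.sigma_finite_measure_axioms f])
  also have "\<dots> = (\<integral>\<^sup>+r. (\<integral>\<^sup>+w. (\<integral>\<^sup>+u. f (r, u, w) \<partial>\<nu>) \<partial>M) * indicator {0<..T} r \<partial>lborel)"
  proof -
    have "(\<integral>\<^sup>+q. f (r, q) \<partial>(\<nu> \<Otimes>\<^sub>M M)) = (\<integral>\<^sup>+w. (\<integral>\<^sup>+u. f (r, u, w) \<partial>\<nu>) \<partial>M)" for r
      by (rule VM.nn_integral_snd[symmetric]) (rule measurable_compose[OF _ f], simp)
    then show ?thesis by simp
  qed
  finally show ?thesis by (simp add: energy_def f_def)
qed

text \<open>For each simple integrand the two distances occurring in one notion equal those in the
  other: the integrand changes on a null set, and the elementary integrals agree almost surely. Thus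
  the same approximating sequence serves in both directions.\<close>

lemma (in poisson_measure) compensated_poisson_integral_iff:
  fixes G H :: "real \<Rightarrow> 'u \<Rightarrow> 'w \<Rightarrow> real^'d::finite"
  assumes G: "(\<lambda>(r, u, w). G r u w) \<in> borel_measurable (borel \<Otimes>\<^sub>M \<nu> \<Otimes>\<^sub>M M)"
    and ae: "\<And>T. AE (r, u, w) in time_interval T \<Otimes>\<^sub>M \<nu> \<Otimes>\<^sub>M M. H r u w = G r u w"
  shows "is_compensated_poisson_integral M F \<nu> N H J \<longleftrightarrow>
    adapted_process F J \<and> (AE w in M. cadlag (\<lambda>t. J t w)) \<and> noise_integral M F \<nu> (poisson_noise \<nu> N) G J"
proof -
  interpret R: noise M F \<nu> "poisson_noise \<nu> N" by (rule poisson_is_noise)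
  have Hm: "(\<lambda>(r, u, w). H r u w) \<in> borel_measurable (completion (time_interval T \<Otimes>\<^sub>M \<nu> \<Otimes>\<^sub>M M))" for T
    by (rule borel_measurable_completion_AE_eq[OF measurable_time_interval_pair[OF G]], use ae[of T] in eventually_elim) auto
  have e: "(\<integral>\<^sup>+(s, u, w). ennreal ((norm (simple_jump_value hs s u w - H s u w))\<^sup>2) \<partial>completion (time_interval T \<Otimes>\<^sub>M \<nu> \<Otimes>\<^sub>M M))
      = energy M \<nu> 0 T (\<lambda>r u w. simple_jump_value hs r u w - G r u w)"
    if "simple_jump_integrand M F \<nu> hs" for hs and T
  proof (rule R.nn_integral_energy)
    show "(\<lambda>(r, u, w). simple_jump_value hs r u w - G r u w) \<in> borel_measurable (borel \<Otimes>\<^sub>M \<nu> \<Otimes>\<^sub>M M)"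
      using borel_measurable_diff[OF R.simple_value_measurable[OF that] G] by (simp add: case_prod_unfold)
    show "AE (r, u, w) in time_interval T \<Otimes>\<^sub>M \<nu> \<Otimes>\<^sub>M M. simple_jump_value hs r u w - H r u w = simple_jump_value hs r u w - G r u w"
      using ae[of T] by eventually_elim auto
  qed
  have i: "sq_norm M (\<lambda>w. simple_jump_integral \<nu> N hs T w - J T w)
      = sq_norm M (\<lambda>w. step_integral (poisson_noise \<nu> N) hs T w - J T w)"
    if "simple_jump_integrand M F \<nu> hs" "0 \<le> T" for hs T
    by (rule nn_integral_cong_AE, use AE_simple_jump_integral_eq[OF that(1)] in eventually_elim) (use that(2) in simp)
  have eq: "((\<forall>n::nat. simple_jump_integrand M F \<nu> (hs n)) \<and> (\<forall>T\<ge>0.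
      (\<lambda>n. \<integral>\<^sup>+(s, u, w). ennreal ((norm (simple_jump_value (hs n) s u w - H s u w))\<^sup>2) \<partial>completion (time_interval T \<Otimes>\<^sub>M \<nu> \<Otimes>\<^sub>M M)) \<longlonglongrightarrow> 0 \<and>
      (\<lambda>n. sq_norm M (\<lambda>w. simple_jump_integral \<nu> N (hs n) T w - J T w)) \<longlonglongrightarrow> 0)) =
    ((\<forall>n. simple_jump_integrand M F \<nu> (hs n)) \<and> (\<forall>T\<ge>0.
      (\<lambda>n. energy M \<nu> 0 T (\<lambda>r u w. simple_jump_value (hs n) r u w - G r u w)) \<longlonglongrightarrow> 0 \<and>
      (\<lambda>n. sq_norm M (\<lambda>w. step_integral (poisson_noise \<nu> N) (hs n) T w - J T w)) \<longlonglongrightarrow> 0))" for hs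
    by (intro conj_cong refl all_cong arg_cong[where f="\<lambda>f. f \<longlonglongrightarrow> 0"] ext e i) simp_all
  have J: "\<forall>t\<ge>0. J t \<in> borel_measurable M" if "adapted_process F J"
    using that measurable_F_M by (auto simp: adapted_process_def)
  show ?thesis unfolding is_compensated_poisson_integral_def noise_integral_def eq using Hm J by auto
qed

section \<open>Matrix integrands as kernels on the coordinates\<close>

lemma linear_column: "linear (\<lambda>A::real^'n^'m. column j A)"
  by (rule linearI) (simp_all add: column_def vec_eq_iff)

lemma column_simps:
  fixes A B :: "real^'n^'m"
  shows "column j (0 :: real^'n^'m) = 0" "column j (A + B) = column j A + column j B"
    "column j (A - B) = column j A - column j B" "column j (c *\<^sub>R A) = c *\<^sub>R column j A"
  using linear_0[OF linear_column] linear_add[OF linear_column] linear_diff[OF linear_column] linear_scale[OF linear_column] by metis+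

lemma hs_norm_sq_columns: "(hs_norm (A::real^'n::finite^'m::finite))\<^sup>2 = (\<Sum>j\<in>UNIV. (norm (column j A))\<^sup>2)"
proof -
  have "(norm (column j A))\<^sup>2 = (\<Sum>i\<in>UNIV. (A $ i $ j)\<^sup>2)" for j
    by (simp add: norm_vec_def L2_set_def column_def sum_nonneg)
  then show ?thesis unfolding hs_norm_def by (simp add: sum_nonneg) (rule sum.swap)
qed

text \<open>The outer product of \<open>v\<close> with the indicator vector of \<open>A\<close>;
  applied to an increment of \<open>W\<close> it gives \<open>v\<close> times the sum of the
  coordinates in \<open>A\<close>, that is, the noise of the mark set \<open>A\<close>.\<close>

definition columns_on :: "'n set \<Rightarrow> real^'m \<Rightarrow> real^'n^'m" where
  "columns_on A v = (\<chi> i j. if j \<in> A then v $ i else 0)"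

lemma linear_columns_on: "linear (columns_on A :: real^'m \<Rightarrow> real^'n^'m)"
  by (rule linearI) (simp_all add: columns_on_def vec_eq_iff)

lemma column_columns_on: "column j (columns_on A v) = indicator A j *\<^sub>R v"
  by (simp add: column_def columns_on_def vec_eq_iff)

lemma columns_on_mult: "columns_on A v *v \<theta> = (\<Sum>j\<in>A. \<theta> $ j) *\<^sub>R v"
  for v :: "real^'m" and \<theta> :: "real^'n::finite"
proof -
  have "(\<Sum>j\<in>UNIV. (if j \<in> A then v $ i else 0) * \<theta> $ j) = (\<Sum>j\<in>UNIV. if j \<in> A then v $ i * \<theta> $ j else 0)" for i
    by (intro sum.cong) auto
  then show ?thesis
    by (simp add: columns_on_def vec_eq_iff matrix_vector_mult_def sum.inter_restrict[symmetric] sum_distrib_left sum_distrib_right mult.commute)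
qed

text \<open>
  A matrix integrand against \<open>W\<close> corresponds to its columns, indexed by the marks \<open>j\<close>, integrated against
  the coordinates of \<open>W\<close>.
\<close>

definition to_marks :: "('w, 'd::finite) simple_integrand \<Rightarrow> ('w, 'd, 'd) simple_jump_integrand" where
  "to_marks hs = concat (map (\<lambda>(a, b, \<xi>). map (\<lambda>j. (a, b, {j}, \<lambda>w. column j (\<xi> w))) (SOME js. distinct js \<and> set js = UNIV)) hs)"

text \<open>Inverse to \<open>to_marks\<close> at the level of values and integrals, not of lists: a
  mark set with several coordinates becomes one matrix entry with several equal columns.\<close>

definition of_marks :: "('w, 'd, 'd::finite) simple_jump_integrand \<Rightarrow> ('w, 'd) simple_integrand" where
  "of_marks hs = map (\<lambda>(a, b, A, \<xi>). (a, b, \<lambda>w. columns_on A (\<xi> w))) hs"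

lemma enumeration: "distinct (SOME js. distinct js \<and> set js = (UNIV :: 'd::finite set))"
    "set (SOME js. distinct js \<and> set js = (UNIV :: 'd set)) = UNIV"
  using someI_ex[of "\<lambda>js. distinct js \<and> set js = (UNIV :: 'd set)"] finite_distinct_list[of "UNIV :: 'd set"] by auto

lemma sum_list_enumeration: "sum_list (map f (SOME js. distinct js \<and> set js = (UNIV :: 'd::finite set))) = (\<Sum>j\<in>UNIV. f j)"
  using sum_list_distinct_conv_sum_set[OF enumeration(1), of f] by (simp add: enumeration(2))

lemma simple_to_marks:
  assumes "simple_integrand M F (hs :: ('w, 'd::finite) simple_integrand)"
  shows "simple_jump_integrand M F (count_space UNIV) (to_marks hs)"
proof -
  have bl: "bounded_linear (\<lambda>A::real^'d^'d. column j A)" for j using linear_column by (simp add: linear_conv_bounded_linear)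
  have "(\<lambda>w. column j (\<xi> w)) \<in> borel_measurable (F a) \<and> bounded ((\<lambda>w. column j (\<xi> w)) ` space M)"
    if "\<xi> \<in> borel_measurable (F a)" "bounded (\<xi> ` space M)" for j a and \<xi> :: "'w \<Rightarrow> real^'d^'d"
    using measurable_compose[OF that(1) borel_measurable_continuous_onI[OF linear_continuous_on[OF bl]]]
      bounded_linear_image[OF that(2) bl, unfolded image_image] by blast
  then show ?thesis using assms by (fastforce simp: simple_integrand_def simple_jump_integrand_def to_marks_def)
qed

lemma simple_of_marks:
  assumes "simple_jump_integrand M F \<nu> (hs :: ('w, 'd, 'd::finite) simple_jump_integrand)"
  shows "simple_integrand M F (of_marks hs)"
proof -
  have bl: "bounded_linear (columns_on A :: real^'d \<Rightarrow> real^'d^'d)" for A using linear_columns_on by (simp add: linear_conv_bounded_linear)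
  have "(\<lambda>w. columns_on A (\<xi> w)) \<in> borel_measurable (F a) \<and> bounded ((\<lambda>w. columns_on A (\<xi> w) :: real^'d^'d) ` space M)"
    if "\<xi> \<in> borel_measurable (F a)" "bounded (\<xi> ` space M)" for A a and \<xi> :: "'w \<Rightarrow> real^'d"
    using measurable_compose[OF that(1) borel_measurable_continuous_onI[OF linear_continuous_on[OF bl]]]
      bounded_linear_image[OF that(2) bl, unfolded image_image] by blast
  then show ?thesis using assms by (fastforce simp: simple_integrand_def simple_jump_integrand_def of_marks_def)
qed

lemma to_marks_value: "simple_jump_value (to_marks hs) r j w = column j (simple_value hs r w)"
proof (induction hs)
  case Nil then show ?case by (simp add: column_simps to_marks_def simple_jump_value_def simple_value_def)
next
  case (Cons h hs)
  obtain a b \<xi> where h: "h = (a, b, \<xi>)" by (cases h)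
  have "(\<Sum>k\<in>UNIV. (indicator {a<..b} r * indicator {k} j) *\<^sub>R column k (\<xi> w)) = (\<Sum>k\<in>UNIV. if k = j then indicator {a<..b} r *\<^sub>R column k (\<xi> w) else 0)"
    by (intro sum.cong) (auto simp: indicator_def)
  also have "\<dots> = column j (indicator {a<..b} r *\<^sub>R \<xi> w)" by (simp add: column_simps)
  finally show ?case using Cons
    by (simp add: column_simps h to_marks_def simple_jump_value_def simple_value_def comp_def sum_list_enumeration)
qed

lemma to_marks_integral: "step_integral (wiener_noise W) (to_marks hs) t w = simple_ito_integral W hs t w"
proof (induction hs)
  case Nil then show ?case by (simp add: to_marks_def step_integral_def simple_ito_integral_def)
next
  case (Cons h hs)
  obtain a b \<xi> where h: "h = (a, b, \<xi>)" by (cases h)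
  show ?case using Cons
    by (simp add: h to_marks_def step_integral_def simple_ito_integral_def comp_def sum_list_enumeration wiener_noise_def
        matrix_mult_sum scalar_mult_eq_scaleR)
qed

lemma of_marks_value: "column j (simple_value (of_marks hs) r w) = simple_jump_value hs r j w"
proof (induction hs)
  case Nil then show ?case by (simp add: column_simps of_marks_def simple_jump_value_def simple_value_def)
next
  case (Cons h hs)
  obtain a b A \<xi> where h: "h = (a, b, A, \<xi>)" by (cases h)
  show ?case using Cons
    by (simp add: column_simps h of_marks_def simple_jump_value_def simple_value_def column_columns_on)
qed

lemma of_marks_integral: "simple_ito_integral W (of_marks hs) t w = step_integral (wiener_noise W) hs t w"
  by (induction hs) (auto simp: of_marks_def step_integral_def simple_ito_integral_def wiener_noise_def columns_on_mult sum_subtractf)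

lemma nn_integral_columns:
  "sq_norm (count_space UNIV) (\<lambda>j. column j A) = ennreal ((hs_norm (A::real^'n::finite^'m::finite))\<^sup>2)"
  by (simp add: nn_integral_count_space_finite hs_norm_sq_columns)

lemma borel_measurable_marks:
  fixes f :: "'n::finite \<Rightarrow> 'a \<Rightarrow> 'b \<Rightarrow> 'c::topological_space"
  assumes "\<And>j. (\<lambda>(x, y). f j x y) \<in> borel_measurable (A \<Otimes>\<^sub>M B)"
  shows "(\<lambda>(x, j, y). f j x y) \<in> borel_measurable (A \<Otimes>\<^sub>M count_space UNIV \<Otimes>\<^sub>M B)"
proof -
  have "(\<lambda>p. (\<lambda>j p. f j (fst p) (snd (snd p))) (fst (snd p)) p) \<in> borel_measurable (A \<Otimes>\<^sub>M count_space UNIV \<Otimes>\<^sub>M B)"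
  proof (rule measurable_compose_countable)
    show "(\<lambda>p. f j (fst p) (snd (snd p))) \<in> borel_measurable (A \<Otimes>\<^sub>M count_space UNIV \<Otimes>\<^sub>M B)" for j
    proof -
      have "(\<lambda>p. (fst p, snd (snd p))) \<in> A \<Otimes>\<^sub>M count_space UNIV \<Otimes>\<^sub>M B \<rightarrow>\<^sub>M A \<Otimes>\<^sub>M B" by measurable
      from measurable_compose[OF this assms[of j]] show ?thesis by simp
    qed
  qed simp
  then show ?thesis by (simp add: case_prod_unfold)
qed

text \<open>The squared Hilbert-Schmidt norm is the square norm of the columns over the coordinate
  marks, so the two distances of integrands coincide; \<open>to_marks\<close> and
  \<open>of_marks\<close> carry approximating sequences across in the two directions, with equal
  elementary integrals.\<close>

lemma ito_integral_iff:
  fixes W :: "real \<Rightarrow> 'w \<Rightarrow> real^'d::finite"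
  assumes F: "filtered_prob_space M F" and W: "wiener_process M F W"
    and G: "(\<lambda>(r, w). G r w) \<in> borel_measurable (borel \<Otimes>\<^sub>M M)"
    and ae: "\<And>T. AE (r, w) in time_interval T \<Otimes>\<^sub>M M. H r w = G r w"
  shows "is_ito_integral M F W H I \<longleftrightarrow> adapted_process F I \<and> (AE w in M. continuous_on {0..} (\<lambda>t. I t w)) \<and>
    noise_integral M F (count_space UNIV) (wiener_noise W) (\<lambda>r j w. column j (G r w)) I"
proof -
  interpret R: noise M F "count_space UNIV" "wiener_noise W" by (rule wiener_is_noise[OF F W])
  have Hm: "(\<lambda>(r, w). H r w) \<in> borel_measurable (completion (time_interval T \<Otimes>\<^sub>M M))" for T
    by (rule borel_measurable_completion_AE_eq[OF measurable_time_interval_pair[OF G]], use ae[of T] in eventually_elim) auto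
  have bl: "bounded_linear (\<lambda>A::real^'d^'d. column j A)" for j using linear_column by (simp add: linear_conv_bounded_linear)
  have "(\<lambda>(r, w). column j (G r w)) \<in> borel_measurable (borel \<Otimes>\<^sub>M M)" for j
    using measurable_compose[OF G borel_measurable_continuous_onI[OF linear_continuous_on[OF bl]]] by (simp add: case_prod_unfold)
  then have Gc: "(\<lambda>(r, j, w). column j (G r w)) \<in> borel_measurable (borel \<Otimes>\<^sub>M count_space UNIV \<Otimes>\<^sub>M M)"
    by (rule borel_measurable_marks)
  have e: "(\<integral>\<^sup>+(r, w). ennreal ((hs_norm (simple_value hs r w - H r w))\<^sup>2) \<partial>completion (time_interval T \<Otimes>\<^sub>M M))
      = energy M (count_space UNIV) 0 T (\<lambda>r j w. simple_jump_value hs' r j w - column j (G r w))"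
    if hs': "simple_jump_integrand M F (count_space UNIV) hs'"
      and v: "\<And>r j w. simple_jump_value hs' r j w = column j (simple_value hs r w)" for hs hs' T
  proof -
    define D where "D r j w = simple_jump_value hs' r j w - column j (G r w)" for r j w
    have D: "(\<lambda>(r, j, w). D r j w) \<in> borel_measurable (borel \<Otimes>\<^sub>M count_space UNIV \<Otimes>\<^sub>M M)"
      unfolding D_def using borel_measurable_diff[OF R.simple_value_measurable[OF hs'] Gc] by (simp add: case_prod_unfold)
    have hs: "sq_norm (count_space UNIV) (\<lambda>j. D r j w) = ennreal ((hs_norm (simple_value hs r w - G r w))\<^sup>2)" for r w
      unfolding D_def v column_simps(3)[symmetric] by (rule nn_integral_columns)
    have m: "(\<lambda>(r, w). ennreal ((hs_norm (simple_value hs r w - G r w))\<^sup>2)) \<in> borel_measurable (borel \<Otimes>\<^sub>M M)"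
      using R.energy_measurable(1)[OF D] by (simp add: hs)
    have "(\<integral>\<^sup>+(r, w). ennreal ((hs_norm (simple_value hs r w - H r w))\<^sup>2) \<partial>completion (time_interval T \<Otimes>\<^sub>M M))
      = (\<integral>\<^sup>+(r, w). ennreal ((hs_norm (simple_value hs r w - G r w))\<^sup>2) \<partial>(time_interval T \<Otimes>\<^sub>M M))"
      unfolding nn_integral_completion by (rule nn_integral_cong_AE, use ae[of T] in eventually_elim) auto
    also have "\<dots> = energy M (count_space UNIV) 0 T D"
      unfolding nn_integral_time_interval[OF R.sigma_finite_measure_axioms m] energy_def hs by simp
    finally show ?thesis unfolding D_def[abs_def] .
  qed
  have I: "\<forall>t\<ge>0. I t \<in> borel_measurable M" if "adapted_process F I"
    using that R.measurable_F_M by (auto simp: adapted_process_def)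
  show ?thesis
  proof (intro iffI conjI)
    assume ito: "is_ito_integral M F W H I"
    show ad: "adapted_process F I" and "AE w in M. continuous_on {0..} (\<lambda>t. I t w)"
      using ito by (auto simp: is_ito_integral_def)
    obtain hs where hs: "\<And>n::nat. simple_integrand M F (hs n)"
      "\<And>T. 0 \<le> T \<Longrightarrow> (\<lambda>n. \<integral>\<^sup>+(r, w). ennreal ((hs_norm (simple_value (hs n) r w - H r w))\<^sup>2) \<partial>completion (time_interval T \<Otimes>\<^sub>M M)) \<longlonglongrightarrow> 0"
      "\<And>T. 0 \<le> T \<Longrightarrow> (\<lambda>n. sq_norm M (\<lambda>w. simple_ito_integral W (hs n) T w - I T w)) \<longlonglongrightarrow> 0"
      using ito unfolding is_ito_integral_def by auto
    show "noise_integral M F (count_space UNIV) (wiener_noise W) (\<lambda>r j w. column j (G r w)) I"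
      unfolding noise_integral_def
      by (intro conjI I[OF ad] exI[of _ "\<lambda>n. to_marks (hs n)"] allI impI)
        (use simple_to_marks[OF hs(1)] hs(2,3) in \<open>simp_all add: to_marks_integral e[OF simple_to_marks[OF hs(1)] to_marks_value, symmetric]\<close>)
  next
    assume *: "adapted_process F I \<and> (AE w in M. continuous_on {0..} (\<lambda>t. I t w)) \<and>
      noise_integral M F (count_space UNIV) (wiener_noise W) (\<lambda>r j w. column j (G r w)) I"
    then obtain hs where hs: "\<And>n::nat. simple_jump_integrand M F (count_space UNIV) (hs n)"
      "\<And>T. 0 \<le> T \<Longrightarrow> (\<lambda>n. energy M (count_space UNIV) 0 T (\<lambda>r j w. simple_jump_value (hs n) r j w - column j (G r w))) \<longlonglongrightarrow> 0"
      "\<And>T. 0 \<le> T \<Longrightarrow> (\<lambda>n. sq_norm M (\<lambda>w. step_integral (wiener_noise W) (hs n) T w - I T w)) \<longlonglongrightarrow> 0"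
      unfolding noise_integral_def by auto
    have "(\<lambda>n. \<integral>\<^sup>+(r, w). ennreal ((hs_norm (simple_value (of_marks (hs n)) r w - H r w))\<^sup>2) \<partial>completion (time_interval T \<Otimes>\<^sub>M M)) \<longlonglongrightarrow> 0" if "0 \<le> T" for T
      using hs(2)[OF that] unfolding e[OF hs(1) of_marks_value[symmetric]] .
    then have "\<exists>hs. (\<forall>n::nat. simple_integrand M F (hs n)) \<and>
        (\<forall>T\<ge>0. (\<lambda>n. \<integral>\<^sup>+(s, w). ennreal ((hs_norm (simple_value (hs n) s w - H s w))\<^sup>2) \<partial>completion (time_interval T \<Otimes>\<^sub>M M)) \<longlonglongrightarrow> 0 \<and>
           (\<lambda>n. sq_norm M (\<lambda>w. simple_ito_integral W (hs n) T w - I T w)) \<longlonglongrightarrow> 0)"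
      using hs(3) by (intro exI[of _ "\<lambda>n. of_marks (hs n)"]) (auto simp: of_marks_integral intro: simple_of_marks[OF hs(1)])
    then show "is_ito_integral M F W H I" unfolding is_ito_integral_def using * Hm by blast
  qed
qed

lemma continuous_on_uniform_limit_atLeast:
  fixes f :: "nat \<Rightarrow> real \<Rightarrow> 'b::metric_space"
  assumes f: "\<And>n. continuous_on {0..} (f n)" and u: "\<And>T. 0 \<le> T \<Longrightarrow> uniform_limit {0..T} f l sequentially"
  shows "continuous_on {0..} l"
  unfolding continuous_on_def
proof
  fix t :: real assume "t \<in> {0..}"
  then have t: "0 \<le> t" by simp
  have "continuous_on {0..t + 1} l"
    by (rule uniform_limit_theorem[OF _ u]) (use t in \<open>auto intro!: always_eventually continuous_on_subset[OF f]\<close>)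
  then have "(l \<longlongrightarrow> l t) (at t within {0..t + 1})" using t by (simp add: continuous_on_def)
  moreover have "at t within {0..} = at t within {0..t + 1}"
    by (rule at_within_nhd[of t "{..<t + 1}"]) auto
  ultimately show "(l \<longlongrightarrow> l t) (at t within {0..})" by simp
qed

lemma continuous_step_integral_wiener:
  assumes W: "continuous_on {0..} (\<lambda>t. W t w)" and hs: "\<forall>(a, b, A, \<xi>)\<in>set hs. 0 \<le> a \<and> a \<le> b"
  shows "continuous_on {0..} (\<lambda>t. step_integral (wiener_noise W) hs t w)"
  using hs
proof (induction hs)
  case Nil then show ?case by (simp add: step_integral_def)
next
  case (Cons h hs)
  obtain a b A \<xi> where h: "h = (a, b, A, \<xi>)" by (cases h)
  have ab: "0 \<le> a" "0 \<le> b" using Cons.prems h by auto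
  have c: "continuous_on {0..} (\<lambda>t. wiener_noise W A (min c t) w)" if "0 \<le> c" for c
    unfolding wiener_noise_def using that
    by (intro continuous_intros continuous_on_compose2[OF W]) auto
  have "continuous_on {0..} (\<lambda>t. (wiener_noise W A (min b t) w - wiener_noise W A (min a t) w) *\<^sub>R \<xi> w + step_integral (wiener_noise W) hs t w)"
    using Cons c[OF ab(1)] c[OF ab(2)] by (intro continuous_intros) auto
  then show ?case by (simp add: h step_integral_def)
qed

context sde
begin

lemma drift_integral_cadlag:
  assumes ad: "adapted_process F X" and w: "w \<in> space M" and c: "cadlag (\<lambda>t. X t w)" and t: "0 \<le> t"
  shows "set_integrable lborel {0..t} (\<lambda>s. b (X s w))"
    and "(LINT s:{0..t}|lborel. b (X s w)) = (LINT s:{0<..t}|lborel. b (right_version X s w))"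
proof -
  define f where "f s = b (right_version X s w)" for s
  have "(\<lambda>s. right_version X s w) \<in> borel_measurable borel"
    using measurable_compose[OF _ adapted_right_version_measurable[OF ad], of "\<lambda>s. (s, w)" borel] w by simp
  then have f[measurable]: "f \<in> borel_measurable borel" unfolding f_def by measurable
  have e: "(\<lambda>s. indicator {0..t} s *\<^sub>R b (X s w)) = (\<lambda>s. indicator {0..t} s *\<^sub>R f s)"
    by (auto simp: fun_eq_iff indicator_def f_def right_version_eq[of X w, OF c])
  have ae: "AE s in lborel. indicator {0<..t} s *\<^sub>R f s = indicator {0..t} s *\<^sub>R f s"
    using AE_lborel_singleton[of 0] by eventually_elim (auto simp: indicator_def)
  have m: "(\<lambda>s. indicator {0<..t} s *\<^sub>R f s) \<in> borel_measurable lborel" "(\<lambda>s. indicator {0..t} s *\<^sub>R f s) \<in> borel_measurable lborel"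
    by measurable
  have i: "set_integrable lborel {0<..t} f"
    by (rule set_integrable_bounded_interval[where C="sqrt L"]) (use t in \<open>auto simp: f_def b_norm\<close>)
  show "set_integrable lborel {0..t} (\<lambda>s. b (X s w))"
    unfolding set_integrable_def e using i[unfolded set_integrable_def] integrable_cong_AE[OF m ae] by simp
  show "(LINT s:{0..t}|lborel. b (X s w)) = (LINT s:{0<..t}|lborel. b (right_version X s w))"
    unfolding set_lebesgue_integral_def e using integral_cong_AE[OF m ae] by (simp add: f_def)
qed

text \<open>Along cadlag paths the left limit at positive times is \<open>left_version\<close>, and
  \<open>AE_left_version_eq\<close> exchanges that for \<open>right_version\<close> at almost every
  time. This is where the predictable jump integrand and the jointly measurable one are
  identified.\<close>

lemma integrand_left_limit:
  assumes ad: "adapted_process F X" and cad: "AE w in M. cadlag (\<lambda>t. X t w)"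
  shows "AE (r, u, w) in time_interval T \<Otimes>\<^sub>M \<nu>2 \<Otimes>\<^sub>M M. g2 (left_limit (\<lambda>t. X t w) r) u = g2 (right_version X r w) u"
proof -
  interpret VM: pair_sigma_finite \<nu>2 M ..
  have X: "X t \<in> borel_measurable M" if "0 \<le> t" for t
    using ad N1.measurable_F_M that by (auto simp: adapted_process_def)
  note [measurable] = borel_measurable_versions[OF X]
  have m: "Measurable.pred (borel \<Otimes>\<^sub>M M) (\<lambda>(r, w). left_version X r w = right_version X r w)" by measurable
  have ae: "AE r in lborel. AE w in M. 0 < r \<longrightarrow> left_version X r w = right_version X r w"
    by (rule N1.AE_left_version_eq[OF _ cad]) (rule X)
  have "AE p in time_interval T \<Otimes>\<^sub>M \<nu>2 \<Otimes>\<^sub>M M. cadlag (\<lambda>t. X t (snd (snd p)))"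
    by (rule AE_snd[OF VM.sigma_finite_measure_axioms AE_snd[OF N1.sigma_finite_measure_axioms cad]])
  moreover note N1.AE_time_interval_marks[OF N2.sigma_finite_marks m ae, of T]
  ultimately show ?thesis
    by eventually_elim (auto simp: left_version_eq)
qed

end

theorem theorem1p5:
  fixes M :: "'w measure" and F :: "real \<Rightarrow> 'w measure" and \<nu> :: "'u measure"
    and W :: "real \<Rightarrow> 'w \<Rightarrow> real^'d" and N :: "'w \<Rightarrow> (real \<times> 'u) measure"
    and b :: "real^'d \<Rightarrow> real^'d" and \<sigma> :: "real^'d \<Rightarrow> real^'d^'d"
    and g :: "real^'d \<Rightarrow> 'u \<Rightarrow> real^'d"
    and K L :: real
  assumes "filtered_prob_space M F"
    and "sigma_finite_measure \<nu>"
    and "wiener_process M F W"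
    and "adapted_poisson_random_measure M F \<nu> N"
    and "wiener_poisson_independent M \<nu> W N"
    and "continuous_on UNIV b"
    and "\<sigma> \<in> borel_measurable borel"
    and "(\<lambda>(x, u). g x u) \<in> borel_measurable (borel \<Otimes>\<^sub>M \<nu>)"
    and "K > 0"
    and "\<And>x y. (b x - b y) \<bullet> (x - y) + (hs_norm (\<sigma> x - \<sigma> y))\<^sup>2
             + (\<integral>u. (norm (g x u - g y u))\<^sup>2 \<partial>\<nu>) \<le> K * (norm (x - y))\<^sup>2"
    and "L > 0"
    and "\<And>x. ennreal ((norm (b x))\<^sup>2 + (hs_norm (\<sigma> x))\<^sup>2)
             + (\<integral>\<^sup>+u. ennreal ((norm (g x u))\<^sup>2) \<partial>\<nu>) \<le> ennreal L"
  shows "\<forall>x. (\<exists>X. strong_solution M F \<nu> W N b \<sigma> g x X) \<and>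
             (\<forall>X Y. strong_solution M F \<nu> W N b \<sigma> g x X \<and> strong_solution M F \<nu> W N b \<sigma> g x Y
                \<longrightarrow> indistinguishable M X Y)"
proof -
  note F = assms(1) and \<nu> = assms(2) and W = assms(3) and \<sigma>[measurable] = assms(7) and g = assms(8)
    and mono = assms(10) and bound = assms(12)
  interpret P: poisson_measure M F \<nu> N
    by (intro poisson_measure.intro filtered_prob.intro filtered_prob_axioms.intro poisson_measure_axioms.intro assms)
      (use F in \<open>simp add: filtered_prob_space_def\<close>)
  have bl: "bounded_linear (\<lambda>A::real^'d^'d. column j A)" for j using linear_column by (simp add: linear_conv_bounded_linear)
  have "(\<lambda>y. column j (\<sigma> y)) \<in> borel_measurable borel" for j
    by (rule measurable_compose[OF \<sigma> borel_measurable_continuous_onI[OF linear_continuous_on[OF bl]]])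
  then have "(\<lambda>p. (\<lambda>j p. column j (\<sigma> (fst p))) (snd p) p) \<in> borel_measurable (borel \<Otimes>\<^sub>M count_space UNIV)"
    by (rule measurable_compose_countable[OF measurable_compose[OF measurable_fst] measurable_snd])
  then have g1: "(\<lambda>(y, j). column j (\<sigma> y)) \<in> borel_measurable (borel \<Otimes>\<^sub>M count_space UNIV)" by (simp add: case_prod_unfold)
  have hs: "(\<integral>j. (norm (column j A))\<^sup>2 \<partial>count_space UNIV) = (hs_norm A)\<^sup>2" for A :: "real^'d^'d"
    by (simp add: lebesgue_integral_count_space_finite hs_norm_sq_columns)
  have le: "a \<le> ennreal L" "b \<le> ennreal L" if "a + b \<le> ennreal L" for a b :: ennreal
    using order_trans[OF add_increasing2[of b a a] that] order_trans[OF add_increasing[of a b b] that] by simp_all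
  \<comment> \<open>The columns of \<open>\<sigma>\<close> form the first kernel, on the coordinates
    with counting measure; integrating their squared norms restores the Hilbert-Schmidt norm, so the
    monotonicity condition is the given one.\<close>
  interpret S: sde M F "count_space UNIV" "wiener_noise W" \<nu> "poisson_noise \<nu> N" b "\<lambda>y j. column j (\<sigma> y)" g K L
  proof (intro sde.intro two_noises.intro sde_axioms.intro wiener_is_noise P.poisson_is_noise F W)
    show "(b x - b y) \<bullet> (x - y) + (\<integral>j. (norm (column j (\<sigma> x) - column j (\<sigma> y)))\<^sup>2 \<partial>count_space UNIV)
       + (\<integral>u. (norm (g x u - g y u))\<^sup>2 \<partial>\<nu>) \<le> K * (norm (x - y))\<^sup>2" for x y
      using mono[of x y] by (simp add: column_simps(3)[symmetric] hs)
    show "(norm (b x))\<^sup>2 \<le> L" for x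
    proof -
      have "ennreal ((norm (b x))\<^sup>2) \<le> ennreal ((norm (b x))\<^sup>2 + (hs_norm (\<sigma> x))\<^sup>2)" by (intro ennreal_leI) simp
      also have "\<dots> \<le> ennreal L" by (rule le(1)[OF bound])
      finally show ?thesis using \<open>L > 0\<close> by (simp add: ennreal_le_iff)
    qed
    show "sq_norm (count_space UNIV) (\<lambda>j. column j (\<sigma> x)) \<le> ennreal L" for x
    proof -
      have "ennreal ((hs_norm (\<sigma> x))\<^sup>2) \<le> ennreal ((norm (b x))\<^sup>2 + (hs_norm (\<sigma> x))\<^sup>2)" by (intro ennreal_leI) simp
      also have "\<dots> \<le> ennreal L" by (rule le(1)[OF bound])
      finally show ?thesis by (simp add: nn_integral_columns)
    qed
    show "sq_norm \<nu> (\<lambda>u. g x u) \<le> ennreal L" for x by (rule le(2)[OF bound])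
  qed (use assms(6,9,11) g g1 in auto)
  \<comment> \<open>The given notion of solution coincides with the internal one once adaptedness
    and path regularity of the integrals are added. The integrands can be exchanged only for
    adapted, almost surely cadlag \<open>X\<close>; for any other \<open>X\<close> both sides are
    false, hence the case distinction.\<close>
  have sol: "strong_solution M F \<nu> W N b \<sigma> g x X \<longleftrightarrow>
      (\<exists>I J. S.strong_sol x X I J \<and> adapted_process F I \<and> adapted_process F J \<and>
        (AE w in M. continuous_on {0..} (\<lambda>t. I t w)) \<and> (AE w in M. cadlag (\<lambda>t. J t w)))" for x X
  proof (cases "adapted_process F X \<and> (AE w in M. cadlag (\<lambda>t. X t w))")
    case True
    then have ad: "adapted_process F X" and cad: "AE w in M. cadlag (\<lambda>t. X t w)" by auto
    note [measurable] = S.adapted_right_version_measurable[OF ad]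
    have "(\<lambda>p. \<sigma> (case p of (r, w) \<Rightarrow> right_version X r w)) \<in> borel_measurable (borel \<Otimes>\<^sub>M M)" by measurable
    then have G: "(\<lambda>(r, w). \<sigma> (right_version X r w)) \<in> borel_measurable (borel \<Otimes>\<^sub>M M)" by (simp add: case_prod_unfold)
    have ae: "AE (r, w) in time_interval T \<Otimes>\<^sub>M M. \<sigma> (X r w) = \<sigma> (right_version X r w)" for T
      using AE_snd[OF P.sigma_finite_measure_axioms cad, of "time_interval T"] AE_space
      by eventually_elim (auto simp: space_pair_measure right_version_eq)
    note ito = ito_integral_iff[OF F W G ae]
    note poi = P.compensated_poisson_integral_iff[OF S.g_compose_measurable(2)[OF S.adapted_right_version_measurable[OF ad]]
        S.integrand_left_limit[OF ad cad]]
    have eq: "(AE w in M. \<forall>t\<ge>0. set_integrable lborel {0..t} (\<lambda>s. b (X s w)) \<and>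
           X t w = x + (LINT s:{0..t}|lborel. b (X s w)) + I t w + J t w) \<longleftrightarrow>
        (AE w in M. \<forall>t\<ge>0. X t w = x + (LINT s:{0<..t}|lborel. b (right_version X s w)) + I t w + J t w)" for I J
    proof (rule eventually_subst, use cad AE_space in eventually_elim)
      case (elim w)
      then show ?case using S.drift_integral_cadlag[OF ad elim(2,1)] by auto
    qed
    show ?thesis unfolding strong_solution_def S.strong_sol_def eq ito poi using True by blast
  next
    case False
    then show ?thesis by (auto simp: strong_solution_def S.strong_sol_def)
  qed
  have exists: "\<exists>X. strong_solution M F \<nu> W N b \<sigma> g x X" for x
  proof -
    obtain X I J hs1 hs2 where *: "S.strong_sol x X I J" "adapted_process F I" "adapted_process F J"
      "\<forall>n::nat. simple_jump_integrand M F (count_space UNIV) (hs1 n)" "\<forall>n::nat. simple_jump_integrand M F \<nu> (hs2 n)"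
      "AE w in M. \<forall>T\<ge>0. uniform_limit {0..T} (\<lambda>n t. step_integral (wiener_noise W) (hs1 n) t w) (\<lambda>t. I t w) sequentially"
      "AE w in M. \<forall>T\<ge>0. uniform_limit {0..T} (\<lambda>n t. step_integral (poisson_noise \<nu> N) (hs2 n) t w) (\<lambda>t. J t w) sequentially"
      using S.strong_sol_exists[of x] by (elim exE conjE)
    \<comment> \<open>Path regularity is inherited from the elementary integrals: continuity from
      the paths of \<open>W\<close>, the cadlag property from those of the random measure.\<close>
    have "AE w in M. continuous_on {0..} (\<lambda>t. W t w)" using W by (simp add: wiener_process_def)
    then have I: "AE w in M. continuous_on {0..} (\<lambda>t. I t w)"
      using *(6)
    proof eventually_elim
      case (elim w)
      have "continuous_on {0..} (\<lambda>t. step_integral (wiener_noise W) (hs1 n) t w)" for n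
        by (rule continuous_step_integral_wiener[of W w, OF elim(1)]) (use *(4)[rule_format, of n] in \<open>auto simp: simple_jump_integrand_def\<close>)
      then show ?case by (rule continuous_on_uniform_limit_atLeast[where f="\<lambda>n t. step_integral (wiener_noise W) (hs1 n) t w"]) (use elim(2) in simp)
    qed
    have "AE w in M. \<forall>n. cadlag (\<lambda>t. step_integral (poisson_noise \<nu> N) (hs2 n) t w)"
      unfolding AE_all_countable using S.N2.step_integral_cadlag *(5) by auto
    then have J: "AE w in M. cadlag (\<lambda>t. J t w)"
      using *(7)
    proof eventually_elim
      case (elim w)
      show ?case by (rule cadlag_uniform_limit[where f="\<lambda>n t. step_integral (poisson_noise \<nu> N) (hs2 n) t w"]) (use elim in auto)
    qed
    show ?thesis unfolding sol by (intro exI[of _ X] exI[of _ I] exI[of _ J] conjI *(1-3) I J)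
  qed
  show ?thesis
  proof (intro allI conjI impI)
    fix x X Y assume "strong_solution M F \<nu> W N b \<sigma> g x X \<and> strong_solution M F \<nu> W N b \<sigma> g x Y"
    then obtain I J I' J' where "S.strong_sol x X I J" "S.strong_sol x Y I' J'" unfolding sol by auto
    then show "indistinguishable M X Y" by (rule S.strong_sol_unique)
  qed (rule exists)
qed

end
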